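(* Let $X(\mathbb{Z})$ be a reflexive rearrangement-invariant Banach sequence space with nontrivial Boyd indices $\alpha_X,\beta_X$ (that is, $0<\alpha_X$ and $\beta_X<1$) and let $w\in A_{1/\alpha_X}^{\rm sym}(\mathbb{Z})\cap A_{1/\beta_X}^{\rm sym}(\mathbb{Z})$. (a) If $a\in M_{X(\mathbb{Z},w)}$, then $a\in L^\infty(-\pi,\pi)$ and $\|a\|_{L^\infty(-\pi,\pi)}\le \|a\|_{M_{X(\mathbb{Z},w)}}$. (b) $M_{X(\mathbb{Z},w)}$ is a Banach algebra under pointwise multiplication and the norm $\|a\|_{M_{X(\mathbb{Z},w)}}=\|L(a)\|_{\mathcal{B}(X(\mathbb{Z},w))}$. (c) There is a constant $C_{X(\mathbb{Z},w)}\in(0,\infty)$ depending only on $X(\mathbb{Z})$ and $w$ such that \[ \|a\|_{M_{X(\mathbb{Z},w)}}\le C_{X(\mathbb{Z},w)}\left(\|a\|_{L^\infty(-\pi,\pi)}+V(a)\right) \] for all $a\in BV[-\pi,\pi]$. In particular, $BV[-\pi,\pi]\hookrightarrow M_{X(\mathbb{Z},w)}$ (continuous embedding).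
   Context: **Banach sequence spaces.** Let $\mathbb{S}\in\{\mathbb{N},\mathbb{Z}\}$ carry the counting measure $m$. Let $\ell^0(\mathbb{S})$ be the set of all sequences $f:\mathbb{S}\to\mathbb{C}$ and $\ell^0_+(\mathbb{S})$ its cone of nonnegative sequences. A Banach function norm is a map $\varrho:\ell^0_+(\mathbb{S})\to[0,\infty]$ such that for all $f,g,f^{(n)}\in\ell_+^0(\mathbb{S})$ ($n\in\mathbb{N}$), all finite $E\subset\mathbb{S}$ and all constants $\alpha\ge0$: (A1) $\varrho(f)=0\Leftrightarrow f=0$, $\varrho(\alpha f)=\alpha\varrho(f)$, $\varrho(f+g)\le\varrho(f)+\varrho(g)$; (A2) $0\le g\le f\Rightarrow\varrho(g)\le\varrho(f)$; (A3) $0\le f^{(n)}\uparrow f\Rightarrow\varrho(f^{(n)})\uparrow\varrho(f)$; (A4) $\varrho(\chi_E)<\infty$; (A5) $\sum_{k\in E}f_k\le C_E\varrho(f)$ with $C_E\in(0,\infty)$ independent of $f$. The Banach sequence space $X(\mathbb{S})$ generated by $\varrho$ is $\{f\in\ell^0(\mathbb{S}):\varrho(|f|)<\infty\}$ with norm $\|f\|_{X(\mathbb{S})}=\varrho(|f|)$. **Rearrangement-invariance.** For $f\in\ell^0(\mathbb{S})$ put $d_f(\lambda)=m\{k\in\mathbb{S}:|f_k|>\lambda\}$, $\lambda\ge0$, and $f^*(n)=\inf\{\lambda\ge0:d_f(\lambda)\le n-1\}$, $n\in\mathbb{N}$. $\varrho$ and $X(\mathbb{S})$ are rearrangement-invariant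 if $\varrho(f)=\varrho(g)$ whenever $f,g\in\ell^0_+(\mathbb{S})$ and $d_f=d_g$. **Boyd indices.** If $X(\mathbb{Z})$ is rearrangement-invariant, generated by $\varrho$, there is a unique rearrangement-invariant Banach function norm $\overline\varrho:\ell_+^0(\mathbb{N})\to[0,\infty]$ with $\varrho(f)=\overline\varrho(f^* )$ for $f\in\ell_+^0(\mathbb{Z})$ (Luxemburg representation); let $\overline X(\mathbb{N})$ be the space it generates (with $\overline\varrho(f)$ meaning $\overline\varrho(|f|)$ for $f\in\overline X(\mathbb{N})$). For $f:\mathbb{N}\to[0,\infty)$ and $j,k\in\mathbb{N}$ let $(E_jf)_k=f_{jk}$ and $(F_jf)_k=f_{\lfloor(k-1)/j\rfloor+1}$. Put $H(j,X)=\sup\{\overline\varrho(E_jf^* ):f\in\overline X(\mathbb{N}),\overline\varrho(f)\le1\}$ and $K(j,X)=\sup\{\overline\varrho(F_jf^* ):f\in\overline X(\mathbb{N}),\overline\varrho(f)\le1\}$. The lower and upper Boyd indices are the (existing) limits $\alpha_X=\lim_{j\to\infty}\frac{-\log H(j,X)}{\log j}$ and $\beta_X=\lim_{j\to\infty}\frac{\log K(j,X)}{\log j}$; they satisfy $0\le\alpha_X\le\beta_X\le1$. **Weights.** A weight on $\mathbb{Z}$ is a sequence $w=\{w_k\}_{k\in\mathbb{Z}}$ of positive numbers. For $1<p<\infty$, $1/p+1/q=1$, $w\in A_p(\mathbb{Z})$ means \[\sup_J\frac1{m(J)}\Big(\sum_{k\in J}w_k^p\Big)^{1/p}\Big(\sum_{k\in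 J}w_k^{-q}\Big)^{1/q}<\infty,\] the supremum over all intervals $J=\{l,\dots,n\}$, $l\le n$, of $\mathbb{Z}$. $A_p^{\rm sym}(\mathbb{Z})$ is the set of $w\in A_p(\mathbb{Z})$ with $w_{-k}=w_k$ for all $k$. The weighted space is $X(\mathbb{Z},w)=\{f:fw\in X(\mathbb{Z})\}$ with $\|f\|_{X(\mathbb{Z},w)}=\|fw\|_{X(\mathbb{Z})}$, where $fw=\{f_kw_k\}$; it is a Banach sequence space. **Multipliers.** $\mathcal{P}$ is the space of infinitely differentiable $2\pi$-periodic functions $\mathbb{R}\to\mathbb{C}$ with its usual Fréchet topology (seminorms $\sup|D^{k}u|$, $k\ge0$), and $\mathcal{P}'$ is the space of continuous linear functionals on $\mathcal{P}$ (periodic distributions). For $a\in\mathcal{P}'$, $\widehat a(n)=a(E_{-n})$, where $E_n(\theta)=e^{in\theta}$, $n\in\mathbb{Z}$. A $2\pi$-periodic function $a$ integrable on $(-\pi,\pi)$ is identified with the distribution $u\mapsto\frac1{2\pi}\int_{-\pi}^{\pi}a(\theta)u(\theta)\,d\theta$. Let $S_0(\mathbb{Z})$ be the set of finitely supported sequences. For $a\in\mathcal{P}'$, $\varphi\in S_0(\mathbb{Z})$, put $(a*\varphi)_j=\sum_{k\in\mathbb{Z}}\widehat a(j-k)\varphi_k$. For a Banach sequence space $Y(\mathbb{Z})$, $M_{Y(\mathbb{Z})}$ is the set of $a\in\mathcal{P}'$ with $a*\varphi\in Y(\mathbb{Z})$ for all $\varphi\in S_0(\mathbb{Z})$ and \[\|a\|_{M_{Y(\mathbb{Z})}}=\sup\{\|a*\varphi\|_{Y(\mathbb{Z})}/\|\varphi\|_{Y(\mathbb{Z})}:\varphi\in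 S_0(\mathbb{Z}),\varphi\ne0\}<\infty.\] If $Y(\mathbb{Z})$ is separable (in particular, reflexive), $S_0(\mathbb{Z})$ is dense in $Y(\mathbb{Z})$, and $L(a):Y(\mathbb{Z})\to Y(\mathbb{Z})$ denotes the bounded extension of $\varphi\mapsto a*\varphi$ (Laurent operator); this applies to $Y(\mathbb{Z})=X(\mathbb{Z},w)$ here. $\mathcal{B}(\mathcal{X})$ is the Banach algebra of bounded linear operators on $\mathcal{X}$ with the operator norm. **Function spaces.** $L^\infty(-\pi,\pi)$ is the space of essentially bounded measurable $2\pi$-periodic functions $\mathbb{R}\to\mathbb{C}$ with the essential supremum norm. $BV[-\pi,\pi]$ is the set of $2\pi$-periodic $a:\mathbb{R}\to\mathbb{C}$ with $V(a)=\sup\sum_{j=1}^n|a(\theta_{j+1})-a(\theta_j)|<\infty$, the supremum over all partitions $-\pi\le\theta_1<\dots<\theta_{n+1}=\pi$, normed by $\|a\|_{L^\infty(-\pi,\pi)}+V(a)$. *)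

theory Defs
  imports "HOL-Probability.Essential_Supremum"
begin

section \<open>Normed spaces of complex-valued functions\<close>

text \<open>
  All normed spaces below (sequence spaces, their duals and biduals, spaces of distributions, BV)
  consist of complex-valued functions on some index type, with pointwise operations.
\<close>

record 'i normed_fun_space =
  vecs :: "('i \<Rightarrow> complex) set"
  nrm :: "('i \<Rightarrow> complex) \<Rightarrow> real"

definition banach_space :: "'i normed_fun_space \<Rightarrow> bool" where
  "banach_space V \<longleftrightarrow>
     (\<lambda>_. 0) \<in> vecs V \<and>
     (\<forall>f\<in>vecs V. \<forall>g\<in>vecs V. (\<lambda>i. f i + g i) \<in> vecs V) \<and>
     (\<forall>c. \<forall>f\<in>vecs V. (\<lambda>i. c * f i) \<in> vecs V) \<and>
     (\<forall>f\<in>vecs V. 0 \<le> nrm V f \<and> (nrm V f = 0 \<longleftrightarrow> f = (\<lambda>_. 0))) \<and>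
     (\<forall>c. \<forall>f\<in>vecs V. nrm V (\<lambda>i. c * f i) = cmod c * nrm V f) \<and>
     (\<forall>f\<in>vecs V. \<forall>g\<in>vecs V. nrm V (\<lambda>i. f i + g i) \<le> nrm V f + nrm V g) \<and>
     (\<forall>F :: nat \<Rightarrow> 'i \<Rightarrow> complex.
        (\<forall>n. F n \<in> vecs V) \<and>
        (\<forall>e>0. \<exists>N. \<forall>m\<ge>N. \<forall>n\<ge>N. nrm V (\<lambda>i. F m i - F n i) < e) \<longrightarrow>
        (\<exists>f\<in>vecs V. (\<lambda>n. nrm V (\<lambda>i. F n i - f i)) \<longlonglongrightarrow> 0))"

text \<open>Banach algebras are unital, with a unit of norm one.\<close>

definition banach_algebra ::
  "'i normed_fun_space \<Rightarrow> (('i \<Rightarrow> complex) \<Rightarrow> ('i \<Rightarrow> complex) \<Rightarrow> ('i \<Rightarrow> complex)) \<Rightarrow> bool" where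
  "banach_algebra V mul \<longleftrightarrow>
     banach_space V \<and>
     (\<forall>f\<in>vecs V. \<forall>g\<in>vecs V. mul f g \<in> vecs V \<and> nrm V (mul f g) \<le> nrm V f * nrm V g) \<and>
     (\<forall>f\<in>vecs V. \<forall>g\<in>vecs V. \<forall>h\<in>vecs V.
        mul (mul f g) h = mul f (mul g h) \<and>
        mul (\<lambda>i. f i + g i) h = (\<lambda>i. mul f h i + mul g h i) \<and>
        mul f (\<lambda>i. g i + h i) = (\<lambda>i. mul f g i + mul f h i)) \<and>
     (\<forall>c. \<forall>f\<in>vecs V. \<forall>g\<in>vecs V.
        mul (\<lambda>i. c * f i) g = (\<lambda>i. c * mul f g i) \<and>
        mul f (\<lambda>i. c * g i) = (\<lambda>i. c * mul f g i)) \<and>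
     (\<exists>u\<in>vecs V. nrm V u = 1 \<and> (\<forall>f\<in>vecs V. mul u f = f \<and> mul f u = f))"

definition bounded_linear_map ::
  "'i normed_fun_space \<Rightarrow> 'j normed_fun_space \<Rightarrow> (('i \<Rightarrow> complex) \<Rightarrow> ('j \<Rightarrow> complex)) \<Rightarrow> bool" where
  "bounded_linear_map V W T \<longleftrightarrow>
     (\<forall>f\<in>vecs V. T f \<in> vecs W) \<and>
     (\<forall>f\<in>vecs V. \<forall>g\<in>vecs V. T (\<lambda>i. f i + g i) = (\<lambda>j. T f j + T g j)) \<and>
     (\<forall>c. \<forall>f\<in>vecs V. T (\<lambda>i. c * f i) = (\<lambda>j. c * T f j)) \<and>
     (\<exists>C. \<forall>f\<in>vecs V. nrm W (T f) \<le> C * nrm V f)"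

text \<open>
  Operators and functionals on a space are total functions in HOL; they are made unique by
  requiring the value 0 outside the space.
\<close>

definition bounded_ops :: "'i normed_fun_space \<Rightarrow> (('i \<Rightarrow> complex) \<Rightarrow> ('i \<Rightarrow> complex)) set" where
  "bounded_ops V = {T. bounded_linear_map V V T \<and> (\<forall>f. f \<notin> vecs V \<longrightarrow> T f = (\<lambda>_. 0))}"

definition op_norm :: "'i normed_fun_space \<Rightarrow> (('i \<Rightarrow> complex) \<Rightarrow> ('i \<Rightarrow> complex)) \<Rightarrow> real" where
  "op_norm V T = Sup {nrm V (T f) |f. f \<in> vecs V \<and> nrm V f \<le> 1}"

definition linear_functional_on :: "('i \<Rightarrow> complex) set \<Rightarrow> (('i \<Rightarrow> complex) \<Rightarrow> complex) \<Rightarrow> bool" where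
  "linear_functional_on S \<phi> \<longleftrightarrow>
     (\<forall>f\<in>S. \<forall>g\<in>S. \<phi> (\<lambda>i. f i + g i) = \<phi> f + \<phi> g) \<and>
     (\<forall>c. \<forall>f\<in>S. \<phi> (\<lambda>i. c * f i) = c * \<phi> f) \<and>
     (\<forall>f. f \<notin> S \<longrightarrow> \<phi> f = 0)"

definition dual_space :: "'i normed_fun_space \<Rightarrow> ('i \<Rightarrow> complex) normed_fun_space" where
  "dual_space V =
     \<lparr>vecs = {\<phi>. linear_functional_on (vecs V) \<phi> \<and>
                 (\<exists>C. \<forall>f\<in>vecs V. cmod (\<phi> f) \<le> C * nrm V f)},
      nrm = (\<lambda>\<phi>. Sup {cmod (\<phi> f) |f. f \<in> vecs V \<and> nrm V f \<le> 1})\<rparr>"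

text \<open>Reflexivity: the canonical embedding into the bidual is surjective.\<close>

definition reflexive :: "'i normed_fun_space \<Rightarrow> bool" where
  "reflexive V \<longleftrightarrow>
     (\<forall>\<Phi>\<in>vecs (dual_space (dual_space V)).
        \<exists>f\<in>vecs V. \<forall>\<phi>\<in>vecs (dual_space V). \<Phi> \<phi> = \<phi> f)"

section \<open>Banach sequence spaces\<close>

text \<open>
  The type \<^typ>\<open>nat\<close> stands for \<open>\<nat> = {1, 2, \<dots>}\<close> with the index shifted by one:
  position \<open>n\<close> here is position \<open>n + 1\<close> in one-based notation.
\<close>

definition nonneg_seqs :: "('s \<Rightarrow> real) set" where
  "nonneg_seqs = {f. \<forall>k. 0 \<le> f k}"

text \<open>Only the values of \<open>\<rho>\<close> on \<^const>\<open>nonneg_seqs\<close> are meaningful.\<close>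

definition banach_function_norm :: "(('s \<Rightarrow> real) \<Rightarrow> ennreal) \<Rightarrow> bool" where
  "banach_function_norm \<rho> \<longleftrightarrow>
     (\<forall>f\<in>nonneg_seqs. \<rho> f = 0 \<longleftrightarrow> f = (\<lambda>_. 0)) \<and>
     (\<forall>f\<in>nonneg_seqs. \<forall>\<alpha>\<ge>0. \<rho> (\<lambda>k. \<alpha> * f k) = ennreal \<alpha> * \<rho> f) \<and>
     (\<forall>f\<in>nonneg_seqs. \<forall>g\<in>nonneg_seqs. \<rho> (\<lambda>k. f k + g k) \<le> \<rho> f + \<rho> g) \<and>
     (\<forall>f\<in>nonneg_seqs. \<forall>g\<in>nonneg_seqs. (\<forall>k. g k \<le> f k) \<longrightarrow> \<rho> g \<le> \<rho> f) \<and>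
     (\<forall>f\<in>nonneg_seqs. \<forall>F :: nat \<Rightarrow> 's \<Rightarrow> real. (\<forall>n. F n \<in> nonneg_seqs) \<and>
        (\<forall>k. incseq (\<lambda>n. F n k) \<and> (\<lambda>n. F n k) \<longlonglongrightarrow> f k) \<longrightarrow>
        incseq (\<lambda>n. \<rho> (F n)) \<and> (\<lambda>n. \<rho> (F n)) \<longlonglongrightarrow> \<rho> f) \<and>
     (\<forall>E. finite E \<longrightarrow> \<rho> (indicator E) < \<infinity>) \<and>
     (\<forall>E. finite E \<longrightarrow> (\<exists>C>0. \<forall>f\<in>nonneg_seqs. ennreal (\<Sum>k\<in>E. f k) \<le> ennreal C * \<rho> f))"

definition seq_space :: "(('s \<Rightarrow> real) \<Rightarrow> ennreal) \<Rightarrow> 's normed_fun_space" where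
  "seq_space \<rho> =
     \<lparr>vecs = {f. \<rho> (\<lambda>k. cmod (f k)) < \<infinity>},
      nrm = (\<lambda>f. enn2real (\<rho> (\<lambda>k. cmod (f k))))\<rparr>"

definition weighted_space :: "(('s \<Rightarrow> real) \<Rightarrow> ennreal) \<Rightarrow> ('s \<Rightarrow> real) \<Rightarrow> 's normed_fun_space" where
  "weighted_space \<rho> w =
     \<lparr>vecs = {f. (\<lambda>k. f k * complex_of_real (w k)) \<in> vecs (seq_space \<rho>)},
      nrm = (\<lambda>f. nrm (seq_space \<rho>) (\<lambda>k. f k * complex_of_real (w k)))\<rparr>"

section \<open>Rearrangements and Boyd indices\<close>

definition distribution_fun :: "('s \<Rightarrow> 'b::real_normed_vector) \<Rightarrow> real \<Rightarrow> ennreal" where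
  "distribution_fun f t = emeasure (count_space UNIV) {k. norm (f k) > t}"

definition rearrangement_invariant :: "(('s \<Rightarrow> real) \<Rightarrow> ennreal) \<Rightarrow> bool" where
  "rearrangement_invariant \<rho> \<longleftrightarrow>
     (\<forall>f\<in>nonneg_seqs. \<forall>g\<in>nonneg_seqs.
        (\<forall>t\<ge>0. distribution_fun f t = distribution_fun g t) \<longrightarrow> \<rho> f = \<rho> g)"

text \<open>
  The decreasing rearrangement \<open>f\<^sup>*\<close>. It takes the value \<open>\<infinity>\<close> (infimum of the
  empty set) exactly when \<open>f\<close> is unbounded; the real-valued variant is for bounded \<open>f\<close>.
\<close>

definition rearr :: "('s \<Rightarrow> 'b::real_normed_vector) \<Rightarrow> nat \<Rightarrow> ennreal" where
  "rearr f n = Inf {ennreal t |t. 0 \<le> t \<and> distribution_fun f t \<le> of_nat n}"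

definition rearr_real :: "('s \<Rightarrow> 'b::real_normed_vector) \<Rightarrow> nat \<Rightarrow> real" where
  "rearr_real f n = enn2real (rearr f n)"

text \<open>
  Luxemburg representation. Where \<open>f\<^sup>*\<close> is not finite it is no sequence of numbers, and
  the norm of \<open>f\<^sup>*\<close> is read as \<open>\<infinity>\<close>. The representing norm is unique on
  \<^const>\<open>nonneg_seqs\<close>, so the choice below is immaterial.
\<close>

definition luxemburg_representation ::
  "(('s \<Rightarrow> real) \<Rightarrow> ennreal) \<Rightarrow> ((nat \<Rightarrow> real) \<Rightarrow> ennreal) \<Rightarrow> bool" where
  "luxemburg_representation \<rho> \<sigma> \<longleftrightarrow>
     banach_function_norm \<sigma> \<and> rearrangement_invariant \<sigma> \<and>
     (\<forall>f\<in>nonneg_seqs. \<rho> f = (if \<forall>n. rearr f n < \<infinity> then \<sigma> (rearr_real f) else \<infinity>))"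

definition luxemburg_norm :: "(('s \<Rightarrow> real) \<Rightarrow> ennreal) \<Rightarrow> (nat \<Rightarrow> real) \<Rightarrow> ennreal" where
  "luxemburg_norm \<rho> = (SOME \<sigma>. luxemburg_representation \<rho> \<sigma>)"

text \<open>
  In one-based notation, \<open>(E\<^sub>j f)\<^sub>k = f\<^sub>j\<^sub>k\<close> and
  \<open>(F\<^sub>j f)\<^sub>k\<close> is the value of \<open>f\<close> at \<open>\<lfloor>(k - 1) / j\<rfloor> + 1\<close>.
\<close>

definition compress :: "nat \<Rightarrow> (nat \<Rightarrow> real) \<Rightarrow> nat \<Rightarrow> real" where
  "compress j f k = f (j * (k + 1) - 1)"

definition stretch :: "nat \<Rightarrow> (nat \<Rightarrow> real) \<Rightarrow> nat \<Rightarrow> real" where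
  "stretch j f k = f (k div j)"

definition dilation_unit_ball :: "(('s \<Rightarrow> real) \<Rightarrow> ennreal) \<Rightarrow> (nat \<Rightarrow> complex) set" where
  "dilation_unit_ball \<rho> =
     {f \<in> vecs (seq_space (luxemburg_norm \<rho>)). luxemburg_norm \<rho> (\<lambda>n. cmod (f n)) \<le> 1}"

definition boyd_H :: "(('s \<Rightarrow> real) \<Rightarrow> ennreal) \<Rightarrow> nat \<Rightarrow> ennreal" where
  "boyd_H \<rho> j = (SUP f\<in>dilation_unit_ball \<rho>. luxemburg_norm \<rho> (compress j (rearr_real f)))"

definition boyd_K :: "(('s \<Rightarrow> real) \<Rightarrow> ennreal) \<Rightarrow> nat \<Rightarrow> ennreal" where
  "boyd_K \<rho> j = (SUP f\<in>dilation_unit_ball \<rho>. luxemburg_norm \<rho> (stretch j (rearr_real f)))"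

definition lower_boyd_index :: "(('s \<Rightarrow> real) \<Rightarrow> ennreal) \<Rightarrow> real" where
  "lower_boyd_index \<rho> = lim (\<lambda>j. - ln (enn2real (boyd_H \<rho> j)) / ln (real j))"

definition upper_boyd_index :: "(('s \<Rightarrow> real) \<Rightarrow> ennreal) \<Rightarrow> real" where
  "upper_boyd_index \<rho> = lim (\<lambda>j. ln (enn2real (boyd_K \<rho> j)) / ln (real j))"

section \<open>Muckenhoupt weights\<close>

text \<open>The class is meant for \<open>1 < p < \<infinity>\<close>.\<close>

definition Ap :: "real \<Rightarrow> (int \<Rightarrow> real) set" where
  "Ap p = {w. (\<forall>k. w k > 0) \<and>
     (let q = 1 / (1 - 1 / p) in
      bdd_above {1 / real (card {l..n}) * (\<Sum>k\<in>{l..n}. w k powr p) powr (1 / p)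
                   * (\<Sum>k\<in>{l..n}. w k powr (- q)) powr (1 / q) |l n. l \<le> n})}"

definition Ap_sym :: "real \<Rightarrow> (int \<Rightarrow> real) set" where
  "Ap_sym p = {w \<in> Ap p. \<forall>k. w (- k) = w k}"

section \<open>Periodic distributions\<close>

definition periodic :: "(real \<Rightarrow> complex) \<Rightarrow> bool" where
  "periodic u \<longleftrightarrow> (\<forall>x. u (x + 2 * pi) = u x)"

definition nth_deriv :: "nat \<Rightarrow> (real \<Rightarrow> complex) \<Rightarrow> real \<Rightarrow> complex" where
  "nth_deriv k = (\<lambda>u x. vector_derivative u (at x)) ^^ k"

definition test_functions :: "(real \<Rightarrow> complex) set" where
  "test_functions = {u. periodic u \<and> (\<forall>k x. nth_deriv k u differentiable at x)}"

definition test_seminorm :: "nat \<Rightarrow> (real \<Rightarrow> complex) \<Rightarrow> real" where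
  "test_seminorm k u = (SUP x. cmod (nth_deriv k u x))"

definition test_topology :: "(real \<Rightarrow> complex) topology" where
  "test_topology = topology_generated_by
     {{v \<in> test_functions. test_seminorm k (\<lambda>x. v x - u x) < e} |k u e.
        u \<in> test_functions \<and> e > 0}"

definition periodic_distributions :: "((real \<Rightarrow> complex) \<Rightarrow> complex) set" where
  "periodic_distributions =
     {a. linear_functional_on test_functions a \<and> continuous_map test_topology euclidean a}"

definition fourier_coeff :: "((real \<Rightarrow> complex) \<Rightarrow> complex) \<Rightarrow> int \<Rightarrow> complex" where
  "fourier_coeff a n = a (\<lambda>\<theta>. exp (\<i> * of_int (- n) * complex_of_real \<theta>))"

definition dist_of_fun :: "(real \<Rightarrow> complex) \<Rightarrow> (real \<Rightarrow> complex) \<Rightarrow> complex" where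
  "dist_of_fun f u =
     (if u \<in> test_functions
      then 1 / (2 * complex_of_real pi) * (LINT \<theta>:{-pi<..<pi}|lebesgue. f \<theta> * u \<theta>)
      else 0)"

section \<open>Bounded functions and functions of bounded variation\<close>

definition ess_bound :: "(real \<Rightarrow> complex) \<Rightarrow> ennreal" where
  "ess_bound f = esssup (restrict_space lebesgue {-pi<..<pi}) (\<lambda>\<theta>. ennreal (cmod (f \<theta>)))"

definition Linf :: "(real \<Rightarrow> complex) set" where
  "Linf = {f \<in> borel_measurable lebesgue. periodic f \<and> ess_bound f < \<infinity>}"

definition Linf_norm :: "(real \<Rightarrow> complex) \<Rightarrow> real" where
  "Linf_norm f = enn2real (ess_bound f)"

definition variation_sums :: "(real \<Rightarrow> complex) \<Rightarrow> real set" where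
  "variation_sums f =
     {\<Sum>j=1..n. cmod (f (\<theta> (j + 1)) - f (\<theta> j)) |(n :: nat) (\<theta> :: nat \<Rightarrow> real).
        1 \<le> n \<and> - pi \<le> \<theta> 1 \<and> strict_mono_on {1..n + 1} \<theta> \<and> \<theta> (n + 1) = pi}"

definition variation :: "(real \<Rightarrow> complex) \<Rightarrow> real" where
  "variation f = Sup (variation_sums f)"

definition BV_space :: "real normed_fun_space" where
  "BV_space =
     \<lparr>vecs = {f. periodic f \<and> bdd_above (variation_sums f)},
      nrm = (\<lambda>f. Linf_norm f + variation f)\<rparr>"

section \<open>Multipliers and Laurent operators\<close>

definition finite_seqs :: "(int \<Rightarrow> complex) set" where
  "finite_seqs = {\<phi>. finite {k. \<phi> k \<noteq> 0}}"

definition conv :: "((real \<Rightarrow> complex) \<Rightarrow> complex) \<Rightarrow> (int \<Rightarrow> complex) \<Rightarrow> int \<Rightarrow> complex" where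
  "conv a \<phi> j = (\<Sum>k\<in>{k. \<phi> k \<noteq> 0}. fourier_coeff a (j - k) * \<phi> k)"

definition multiplier_quotients ::
  "int normed_fun_space \<Rightarrow> ((real \<Rightarrow> complex) \<Rightarrow> complex) \<Rightarrow> real set" where
  "multiplier_quotients Y a =
     {nrm Y (conv a \<phi>) / nrm Y \<phi> |\<phi>. \<phi> \<in> finite_seqs \<and> \<phi> \<noteq> (\<lambda>_. 0)}"

definition multiplier_space :: "int normed_fun_space \<Rightarrow> (real \<Rightarrow> complex) normed_fun_space" where
  "multiplier_space Y =
     \<lparr>vecs = {a \<in> periodic_distributions.
                (\<forall>\<phi>\<in>finite_seqs. conv a \<phi> \<in> vecs Y) \<and> bdd_above (multiplier_quotients Y a)},
      nrm = (\<lambda>a. Sup (multiplier_quotients Y a))\<rparr>"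

definition laurent_op ::
  "int normed_fun_space \<Rightarrow> ((real \<Rightarrow> complex) \<Rightarrow> complex) \<Rightarrow> (int \<Rightarrow> complex) \<Rightarrow> int \<Rightarrow> complex" where
  "laurent_op Y a = (THE T. T \<in> bounded_ops Y \<and> (\<forall>\<phi>\<in>finite_seqs. T \<phi> = conv a \<phi>))"

text \<open>
  Pointwise multiplication, for distributions given by essentially bounded functions (which are
  determined up to equality almost everywhere).
\<close>

definition pointwise_mult ::
  "((real \<Rightarrow> complex) \<Rightarrow> complex) \<Rightarrow> ((real \<Rightarrow> complex) \<Rightarrow> complex) \<Rightarrow> (real \<Rightarrow> complex) \<Rightarrow> complex" where
  "pointwise_mult a b =
     (THE c. \<exists>f\<in>Linf. \<exists>g\<in>Linf. a = dist_of_fun f \<and> b = dist_of_fun g \<and>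
        c = dist_of_fun (\<lambda>\<theta>. f \<theta> * g \<theta>))"

end

theory Submission
  imports Defs
begin

text \<open>
 Convolution with \<open>1/n\<close> is the discrete Hilbert transform. Sparse domination by stopping intervals
 bounds it on the weighted \<open>l\<^sup>p\<close> spaces of \<open>A\<^sub>p\<close> weights. By the reverse Hoelder
 inequality, \<open>A\<^sub>p\<close> is an open condition on \<open>p\<close>, so the bound holds for exponents on both sides of
 \<open>[1/\<beta>\<^sub>X, 1/\<alpha>\<^sub>X]\<close> and interpolates to \<open>X(\<int>, w)\<close>. The Fourier coefficients of
 a function of bounded variation are limits of superpositions of modulated copies of \<open>1/n\<close>, weighted by
 its jumps; this is (c).

 The Fejer means of a multiplier average its translates, hence are multipliers of at most the same norm. A trigonometric
 polynomial is bounded by its multiplier norm: test it on characters cut off to long intervals, whose norms grow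
 only polynomially. So the Fejer means are uniformly bounded, and a subsequence converges almost
 everywhere to a bounded function with the given coefficients; this is (a). Multipliers thus
 correspond to the sequences \<open>c\<close> for which convolution with \<open>c\<close> is bounded on finitely supported
 sequences, and (b) follows from Fatou's lemma and the density of these sequences. For density, \<open>\<psi> \<mapsto> \<Sum>\<^sub>k \<psi>(f\<^sub>k e\<^sub>k)\<close>
 lies in the bidual, reflexivity identifies it with \<open>f\<close>, and it annihilates every functional that vanishes
 on finitely supported sequences.
\<close>

text \<open>Openness of the Muckenhoupt condition is needed twice. Sparse domination works with
  averages of \<open>|f|^r\<close>, \<open>r > 1\<close>, which costs a dual exponent larger than
  the conjugate one; and interpolation needs exponents strictly outside the range given by the Boyd
  indices. For \<open>r\<close> near 1 the unweighted bound on \<open>l^r\<close> must be known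
  beforehand: Fourier series give exponent 2, sparse domination with \<open>r = 2\<close> and weight
  1 gives the exponents above 2, and duality those below. The \<open>l^p\<close> estimates are
  proved over finite intervals with constants that do not depend on the interval, so maxima are
  attained and no question of convergence arises. Multipliers are handled through their coefficients
  alone: the predicate \<open>mb C c\<close> bounds convolution with \<open>c\<close> by
  \<open>C\<close>, does not mention distributions, and passes to pointwise limits of coefficients.
  Bounded functions and their products are tied to it by the uniqueness of Fourier coefficients,
  which also makes \<open>pointwise_mult\<close> independent of the representatives.\<close>

abbreviation (input) supp :: "('i => 'b::zero) => 'i set" where
 "supp f \<equiv> {i. f i ~= 0}"

abbreviation (input) ee :: "int => real => complex" where
"ee n x \<equiv> cis (of_int n * x)"

abbreviation (input) ec :: "int => real => complex" where
"ec n x \<equiv> cis (- of_int n * x)"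

section \<open>Weighted maximal functions\<close>

lemma Holder_sum:
 fixes f g :: "'a => real"
 assumes pq: "p > 1" "q > 1" "1/p + 1/q = 1"
  and nn: "!!x. x \<in> A ==> 0 <= f x" "!!x. x \<in> A ==> 0 <= g x"
 shows "(\<Sum>x\<in>A. f x * g x) <= (\<Sum>x\<in>A. f x powr p) powr (1/p) * (\<Sum>x\<in>A. g x powr q) powr (1/q)"
proof (cases "finite A")
 case True
 define F where "F = (\<Sum>x\<in>A. f x powr p) powr (1/p)"
 define G where "G = (\<Sum>x\<in>A. g x powr q) powr (1/q)"
 have sF: "0 <= (\<Sum>x\<in>A. f x powr p)" and sG: "0 <= (\<Sum>x\<in>A. g x powr q)" by (auto intro: sum_nonneg)
 have Fp: "F powr p = (\<Sum>x\<in>A. f x powr p)" and Gq: "G powr q = (\<Sum>x\<in>A. g x powr q)"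
  using pq sF sG by (simp_all add: F_def G_def powr_powr)
 show ?thesis
 proof (cases "F = 0 | G = 0")
  case True
  hence "(\<Sum>x\<in>A. f x powr p) = 0 | (\<Sum>x\<in>A. g x powr q) = 0" using Fp Gq pq by auto
  hence "\<forall>x\<in>A. f x * g x = 0" using \<open>finite A\<close> by (auto simp: sum_nonneg_eq_0_iff)
  hence "(\<Sum>x\<in>A. f x * g x) = 0" by (rule sum.neutral)
  thus ?thesis by simp
 next
  case False
  hence pos: "F > 0" "G > 0" by (auto simp: F_def G_def)
  have "(\<Sum>x\<in>A. (f x / F) * (g x / G)) <= (\<Sum>x\<in>A. (f x / F) powr p / p + (g x / G) powr q / q)"
   using pos nn pq by (intro sum_mono Youngs_inequality) auto
  also have "... = (\<Sum>x\<in>A. f x powr p) / F powr p / p + (\<Sum>x\<in>A. g x powr q) / G powr q / q"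
   using pos nn by (simp add: sum.distrib powr_divide sum_divide_distrib)
  also have "... = 1" using pos pq Fp[symmetric] Gq[symmetric] by simp
  finally have "(\<Sum>x\<in>A. f x * g x) / (F * G) <= 1" by (simp add: sum_divide_distrib)
  thus ?thesis using pos by (simp add: field_simps flip: F_def G_def)
 qed
qed simp

lemma power_mean_mono:
 fixes f :: "'a => real"
 assumes "finite J" "J ~= {}" and nn: "!!x. x \<in> J ==> 0 <= f x" and s: "0 < s" "s <= t"
 shows "((\<Sum>x\<in>J. f x powr s) / card J) powr (1/s) <= ((\<Sum>x\<in>J. f x powr t) / card J) powr (1/t)"
proof (cases "s = t")
 case False
 define P where "P = t / s"
 define Q where "Q = P / (P - 1)"
 have P: "P > 1" using s False by (simp add: P_def)
 have Q: "Q > 1" "1/P + 1/Q = 1" using P by (auto simp: Q_def field_simps)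
 have N: "real (card J) > 0" using assms by (simp add: card_gt_0_iff)
 have "(\<Sum>x\<in>J. f x powr s * 1) <= (\<Sum>x\<in>J. (f x powr s) powr P) powr (1/P) * (\<Sum>x\<in>J. 1 powr Q) powr (1/Q)"
  using P Q by (intro Holder_sum) auto
 also have "(\<Sum>x\<in>J. (f x powr s) powr P) = (\<Sum>x\<in>J. f x powr t)" using s by (simp add: powr_powr P_def)
 also have "(\<Sum>x\<in>J. 1 powr Q) = card J" by simp
 also have "1/Q = 1 - 1/P" using Q by simp
 finally have "(\<Sum>x\<in>J. f x powr s) <= (\<Sum>x\<in>J. f x powr t) powr (1/P) * card J powr (1 - 1/P)" by simp
 also have "card J powr (1 - 1/P) = card J / card J powr (1/P)" using N by (simp add: powr_diff)
 finally have "(\<Sum>x\<in>J. f x powr s) / card J <= ((\<Sum>x\<in>J. f x powr t) / card J) powr (1/P)"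
  using N by (simp add: powr_divide sum_nonneg field_simps)
 hence "((\<Sum>x\<in>J. f x powr s) / card J) powr (1/s) <= (((\<Sum>x\<in>J. f x powr t) / card J) powr (1/P)) powr (1/s)"
  using s by (intro powr_mono2) (auto intro!: divide_nonneg_nonneg sum_nonneg)
 also have "... = ((\<Sum>x\<in>J. f x powr t) / card J) powr (1/t)" using s by (simp add: powr_powr P_def)
 finally show ?thesis .
qed simp

text \<open>The maximal ergodic lemma, via the recursion \<open>T (x + 1) = h (x + 1) + max (T x) 0\<close>.\<close>

lemma maximal_ergodic:
 fixes h :: "int => real"
 assumes "a <= b"
 shows "0 <= (\<Sum>x\<in>{x\<in>{a..b}. \<exists>l\<in>{a..x}. 0 < (\<Sum>k=l..x. h k)}. h x)"
proof -
 define T where "T x = Max ((%l. \<Sum>k=l..x. h k) ` {a..x})" for x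
 have T0: "T a = h a" by (simp add: T_def)
 have TS: "T (x + 1) = h (x + 1) + max (T x) 0" if "a <= x" for x
 proof -
  have s: "(\<Sum>k=l..x+1. h k) = h (x+1) + (\<Sum>k=l..x. h k)" if "l <= x + 1" for l
  proof -
   have "{l..x+1} = insert (x+1) {l..x}" using that by auto
   thus ?thesis by simp
  qed
  have "{a..x+1} = insert (x+1) {a..x}" using that by auto
  hence "(%l. \<Sum>k=l..x+1. h k) ` {a..x+1}
    = insert (h (x+1)) ((%y. h (x+1) + y) ` ((%l. \<Sum>k=l..x. h k) ` {a..x}))" by (auto simp: s image_image)
  moreover have "Max ((%y. h (x+1) + y) ` ((%l. \<Sum>k=l..x. h k) ` {a..x})) = h (x+1) + T x"
   unfolding T_def using that by (intro mono_Max_commute[symmetric]) (auto simp: mono_def)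
  ultimately show ?thesis using that by (simp add: T_def)
 qed
 have Tpos: "(\<exists>l\<in>{a..x}. 0 < (\<Sum>k=l..x. h k)) \<longleftrightarrow> 0 < T x" if "a <= x" for x
  unfolding T_def using that by (subst Max_gr_iff) auto
 \<comment> \<open>Carrying \<open>max (T b) 0\<close> instead of 0 makes the induction close: at a
   point with \<open>T > 0\<close> the recursion turns the old bound plus the new term into exactly
   the new \<open>T\<close>.\<close>
 have "max (T b) 0 <= (\<Sum>x\<in>{x\<in>{a..b}. 0 < T x}. h x)"
  using assms
 proof (induction b rule: int_ge_induct)
  case base
  have "{x\<in>{a..a}. 0 < T x} = (if 0 < h a then {a} else {})" using T0 by auto
  thus ?case using T0 by auto
 next
  case (step i)
  have "{x\<in>{a..i+1}. 0 < T x} = (if 0 < T (i+1) then {i+1} else {}) \<union> {x\<in>{a..i}. 0 < T x}"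
   using step.hyps by (auto simp: order_le_less)
  hence "(\<Sum>x\<in>{x\<in>{a..i+1}. 0 < T x}. h x)
    = (if 0 < T (i+1) then h (i+1) else 0) + (\<Sum>x\<in>{x\<in>{a..i}. 0 < T x}. h x)"
   by (simp only:) (subst sum.union_disjoint, auto intro: finite_subset[of _ "{a..i}"])
  thus ?case using step TS[of i] by auto
 qed
 moreover have "{x\<in>{a..b}. \<exists>l\<in>{a..x}. 0 < (\<Sum>k=l..x. h k)} = {x\<in>{a..b}. 0 < T x}"
  using Tpos by auto
 ultimately show ?thesis by simp
qed

section \<open>Maximal functions with respect to an arbitrary measure\<close>

definition wavg :: "(int => real) => (int => real) => int => int => real" where
 "wavg \<mu> f l n = (\<Sum>k=l..n. f k * \<mu> k) / (\<Sum>k=l..n. \<mu> k)"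

text \<open>The uncentred maximal function relative to the measure \<open>\<mu>\<close>, over
  subintervals of \<open>{a..b}\<close> only. The maximum is over finitely many intervals, hence
  attained; the bounds below have constants independent of \<open>a\<close> and
  \<open>b\<close>.\<close>

definition maxfun :: "int => int => (int => real) => (int => real) => int => real" where
 "maxfun a b \<mu> f x = Max ((%(l, n). wavg \<mu> f l n) ` ({a..x} \<times> {x..b}))"

lemma wavg_le_maxfun:
 "a <= l ==> l <= x ==> x <= n ==> n <= b ==> wavg \<mu> f l n <= maxfun a b \<mu> f x"
 unfolding maxfun_def by (rule Max_ge) auto

lemma maxfun_attained:
 assumes "x \<in> {a..b}"
 obtains l n where "a <= l" "l <= x" "x <= n" "n <= b" "maxfun a b \<mu> f x = wavg \<mu> f l n"
proof -
 have "maxfun a b \<mu> f x \<in> (%(l, n). wavg \<mu> f l n) ` ({a..x} \<times> {x..b})"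
  unfolding maxfun_def using assms by (intro Max_in) auto
 thus ?thesis using that by auto
qed

lemma wavg_nonneg: "(!!k. k \<in> {l..n} ==> 0 <= f k * \<mu> k) ==> (!!k. k \<in> {l..n} ==> 0 <= \<mu> k) ==> 0 <= wavg \<mu> f l n"
 unfolding wavg_def by (intro divide_nonneg_nonneg sum_nonneg) auto

lemma maxfun_nonneg:
 assumes "x \<in> {a..b}" "!!k. k \<in> {a..b} ==> 0 <= f k" "!!k. k \<in> {a..b} ==> 0 <= \<mu> k"
 shows "0 <= maxfun a b \<mu> f x"
proof -
 obtain l n where ln: "a <= l" "l <= x" "x <= n" "n <= b" "maxfun a b \<mu> f x = wavg \<mu> f l n"
  using maxfun_attained[OF assms(1)] by metis
 show ?thesis unfolding ln(5) using assms ln by (intro wavg_nonneg) auto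
qed

text \<open>The maximal ergodic lemma for \<open>(f - c) * \<mu>\<close>. One-sided averages need no
  covering argument, so the constant is 1 for every positive \<open>\<mu>\<close>, without
  doubling.\<close>

lemma one_sided_weak:
 fixes f \<mu> :: "int => real"
 assumes \<mu>: "!!k. k \<in> {a..b} ==> 0 < \<mu> k"
 shows "(\<Sum>x\<in>{x\<in>{a..b}. \<exists>l\<in>{a..x}. c < wavg \<mu> f l x}. c * \<mu> x)
   <= (\<Sum>x\<in>{x\<in>{a..b}. \<exists>l\<in>{a..x}. c < wavg \<mu> f l x}. f x * \<mu> x)"
proof (cases "a <= b")
 case True
 define h where "h x = (f x - c) * \<mu> x" for x
 have eq: "c < wavg \<mu> f l x \<longleftrightarrow> 0 < (\<Sum>k=l..x. h k)" if "a <= l" "l <= x" "x <= b" for l x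
 proof -
  have "0 < (\<Sum>k=l..x. \<mu> k)" using that \<mu> by (intro sum_pos) auto
  moreover have "(\<Sum>k=l..x. h k) = (\<Sum>k=l..x. f k * \<mu> k) - c * (\<Sum>k=l..x. \<mu> k)"
   by (simp add: h_def left_diff_distrib sum_subtractf sum_distrib_left)
  ultimately show ?thesis by (simp add: wavg_def pos_less_divide_eq)
 qed
 have "{x\<in>{a..b}. \<exists>l\<in>{a..x}. c < wavg \<mu> f l x} = {x\<in>{a..b}. \<exists>l\<in>{a..x}. 0 < (\<Sum>k=l..x. h k)}"
  by (intro Collect_cong conj_cong bex_cong refl eq) auto
 hence "0 <= (\<Sum>x\<in>{x\<in>{a..b}. \<exists>l\<in>{a..x}. c < wavg \<mu> f l x}. h x)"
  using maximal_ergodic[OF True, of h] by simp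
 thus ?thesis by (simp add: h_def left_diff_distrib sum_subtractf)
qed simp

lemma wavg_reflect: "wavg \<mu> f l n = wavg (%k. \<mu> (- k)) (%k. f (- k)) (- n) (- l)"
proof -
 have "(\<Sum>k=-n..-l. g (- k)) = (\<Sum>k=l..n. g k)" for g :: "int => real"
  by (rule sum.reindex_bij_witness[of _ uminus uminus]) auto
 from this[of "%k. f k * \<mu> k"] this[of \<mu>] show ?thesis by (simp add: wavg_def)
qed

lemma one_sided_weak':
 fixes f \<mu> :: "int => real"
 assumes \<mu>: "!!k. k \<in> {a..b} ==> 0 < \<mu> k"
 shows "(\<Sum>x\<in>{x\<in>{a..b}. \<exists>n\<in>{x..b}. c < wavg \<mu> f x n}. c * \<mu> x)
   <= (\<Sum>x\<in>{x\<in>{a..b}. \<exists>n\<in>{x..b}. c < wavg \<mu> f x n}. f x * \<mu> x)"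
proof -
 let ?S = "{x\<in>{a..b}. \<exists>n\<in>{x..b}. c < wavg \<mu> f x n}"
 let ?S' = "{x\<in>{-b..-a}. \<exists>l\<in>{-b..x}. c < wavg (%k. \<mu> (- k)) (%k. f (- k)) l x}"
 have S: "x \<in> ?S \<longleftrightarrow> - x \<in> ?S'" for x
 proof -
  have "(\<exists>n\<in>{x..b}. c < wavg \<mu> f x n) \<longleftrightarrow> (\<exists>l\<in>{-b..-x}. c < wavg (%k. \<mu> (- k)) (%k. f (- k)) l (- x))"
  proof
   assume "\<exists>n\<in>{x..b}. c < wavg \<mu> f x n"
   then obtain n where "n \<in> {x..b}" "c < wavg \<mu> f x n" by blast
   thus "\<exists>l\<in>{-b..-x}. c < wavg (%k. \<mu> (- k)) (%k. f (- k)) l (- x)"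
    by (intro bexI[of _ "- n"]) (auto simp: wavg_reflect[of \<mu> f x])
  next
   assume "\<exists>l\<in>{-b..-x}. c < wavg (%k. \<mu> (- k)) (%k. f (- k)) l (- x)"
   then obtain l where "l \<in> {-b..-x}" "c < wavg (%k. \<mu> (- k)) (%k. f (- k)) l (- x)" by blast
   thus "\<exists>n\<in>{x..b}. c < wavg \<mu> f x n"
    by (intro bexI[of _ "- l"]) (auto simp: wavg_reflect[of \<mu> f x])
  qed
  thus ?thesis by auto
 qed
 have "(\<Sum>x\<in>?S'. g (- x)) = (\<Sum>x\<in>?S. g x)" for g :: "int => real"
  by (rule sum.reindex_bij_witness[of _ uminus uminus]) (use S in auto)
 from this[of "%x. c * \<mu> x"] this[of "%x. f x * \<mu> x"] show ?thesis
  using one_sided_weak[of "-b" "-a" "%k. \<mu> (- k)" c "%k. f (- k)"] \<mu> by simp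
qed

text \<open>From weak to strong type: the weak inequality at height \<open>t\<close>, which already
  localizes \<open>f\<close> to the level set of \<open>m\<close>, is multiplied by
  \<open>t powr (p - 2)\<close> and integrated over \<open>t\<close>. This bounds the sum of
  \<open>m powr p\<close> by that of \<open>f * m powr (p - 1)\<close>, and Young's inequality
  absorbs \<open>m\<close>.\<close>

lemma layer_cake_strong:
 fixes f m \<mu> :: "'a => real"
 assumes W: "finite W" and p: "p > 1"
  and \<mu>: "!!x. x \<in> W ==> 0 <= \<mu> x" and m: "!!x. x \<in> W ==> 0 <= m x"
  and f: "!!x. x \<in> W ==> 0 <= f x"
  and weak: "!!c. 0 < c ==> (\<Sum>x\<in>{x\<in>W. c < m x}. c * \<mu> x) <= (\<Sum>x\<in>{x\<in>W. c < m x}. f x * \<mu> x)"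
 shows "(\<Sum>x\<in>W. m x powr p * \<mu> x) <= 2 powr p * (2 / (p - 1)) * (\<Sum>x\<in>W. f x powr p * \<mu> x)"
proof -
 define G where "G x t = (if t \<in> {0..m x} then \<mu> x * (f x * t powr (p-2) - t powr (p-1)) else 0)" for x t
 define B where "B = Max (insert 0 (m ` W))"
 have B: "x \<in> W ==> m x <= B" for x using W by (simp add: B_def)
 have "(G x has_integral \<mu> x * (f x * (m x powr (p-1) / (p-1)) - m x powr p / p)) {0..B}" if "x \<in> W" for x
 proof -
  have "((%t. \<mu> x * (f x * t powr (p-2) - t powr (p-1))) has_integral
    \<mu> x * (f x * (m x powr (p-2+1) / (p-2+1)) - m x powr (p-1+1) / (p-1+1))) {0..m x}" using p m[OF that]
   by (intro has_integral_mult_right has_integral_diff has_integral_powr_from_0) auto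
  thus ?thesis unfolding G_def by (subst has_integral_restrict) (use B[OF that] in auto)
 qed
 hence int: "((%t. \<Sum>x\<in>W. G x t) has_integral
   (\<Sum>x\<in>W. \<mu> x * (f x * (m x powr (p-1) / (p-1)) - m x powr p / p))) {0..B}"
  using W by (intro has_integral_sum) auto
 have nn: "0 <= (\<Sum>x\<in>W. G x t)" if "t > 0" "\<forall>x\<in>W. t ~= m x" for t
 proof -
  have "(\<Sum>x\<in>W. G x t) = (\<Sum>x\<in>{x\<in>W. t < m x}. \<mu> x * (f x * t powr (p-2) - t powr (p-1)))"
   using that W unfolding G_def by (subst sum.inter_filter) (auto intro!: sum.cong)
  also have "... = t powr (p-2) * ((\<Sum>x\<in>{x\<in>W. t < m x}. f x * \<mu> x) - (\<Sum>x\<in>{x\<in>W. t < m x}. t * \<mu> x))"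
   using that(1) powr_add[of t "p-2" 1] by (simp add: sum_distrib_left sum_subtractf[symmetric] algebra_simps)
  also have "... \<ge> 0" using weak[OF that(1)] by simp
  finally show ?thesis by simp
 qed
 have "0 <= (\<Sum>x\<in>W. \<mu> x * (f x * (m x powr (p-1) / (p-1)) - m x powr p / p))"
 \<comment> \<open>The weak inequality has \<open>c < m x\<close>, the cutoff in \<open>G\<close>
   has \<open>t <= m x\<close>. They differ only at the finitely many heights \<open>m x\<close>,
   where the integrand may be changed, as at \<open>t = 0\<close>.\<close>
 proof (rule has_integral_nonneg[where f = "%t. if t = 0 | t \<in> m ` W then 0 else (\<Sum>x\<in>W. G x t)"])
  show "((%t. if t = 0 | t \<in> m ` W then 0 else (\<Sum>x\<in>W. G x t)) has_integral
   (\<Sum>x\<in>W. \<mu> x * (f x * (m x powr (p-1) / (p-1)) - m x powr p / p))) {0..B}"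
   by (rule has_integral_spike_finite[OF _ _ int, of "insert 0 (m ` W)"]) (use W in auto)
  show "0 <= (if t = 0 | t \<in> m ` W then 0 else (\<Sum>x\<in>W. G x t))" if "t \<in> {0..B}" for t
  proof (cases "t = 0 | t \<in> m ` W")
   case False
   thus ?thesis using nn[of t] that by (auto simp: image_iff)
  qed auto
 qed
 hence 1: "(\<Sum>x\<in>W. m x powr p * \<mu> x) * ((p-1)/p) <= (\<Sum>x\<in>W. f x * m x powr (p-1) * \<mu> x)"
 proof -
  have e: "(\<Sum>x\<in>W. \<mu> x * (f x * (m x powr (p-1) / (p-1)) - m x powr p / p))
    = (\<Sum>x\<in>W. f x * m x powr (p-1) * \<mu> x) / (p-1) - (\<Sum>x\<in>W. m x powr p * \<mu> x) / p"
   by (simp add: sum_subtractf[symmetric] sum_divide_distrib algebra_simps)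
  thus ?thesis using p \<open>0 <= (\<Sum>x\<in>W. \<mu> x * _ x)\<close> unfolding e by (simp add: field_simps)
 qed
 define q where "q = p / (p - 1)"
 have q: "q > 1" "1/p + 1/q = 1" using p by (auto simp: q_def field_simps)
 \<comment> \<open>The factor \<open>2 powr (1/q)\<close> in Young's inequality halves the
   coefficient \<open>(p-1)/p\<close> of \<open>m x powr p\<close>, so that this term can be moved
   to the other side.\<close>
 have "f x * m x powr (p-1) <= 2 powr p * f x powr p / p + m x powr p * ((p-1)/p) / 2" if "x \<in> W" for x
 proof -
  have "(2 powr (1/q) * f x) * (m x powr (p-1) / 2 powr (1/q))
    <= (2 powr (1/q) * f x) powr p / p + (m x powr (p-1) / 2 powr (1/q)) powr q / q"
   using p q f[OF that] m[OF that] by (intro Youngs_inequality) auto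
  also have "(2 powr (1/q) * f x) powr p = 2 powr (p-1) * f x powr p"
   using q p f[OF that] by (simp add: powr_mult powr_powr q_def)
  also have "(m x powr (p-1) / 2 powr (1/q)) powr q = m x powr p / 2"
   using q(1) p m[OF that] by (simp add: powr_divide powr_powr q_def)
  finally have "f x * m x powr (p-1) <= 2 powr (p-1) * f x powr p / p + m x powr p * ((p-1)/p) / 2" by (simp add: q_def)
  moreover have "2 powr (p-1) * f x powr p / p <= 2 powr p * f x powr p / p"
   using p by (intro divide_right_mono mult_right_mono) auto
  ultimately show ?thesis by simp
 qed
 hence "(\<Sum>x\<in>W. f x * m x powr (p-1) * \<mu> x)
   <= (\<Sum>x\<in>W. (2 powr p * f x powr p / p + m x powr p * ((p-1)/p) / 2) * \<mu> x)"
  using \<mu> by (intro sum_mono mult_right_mono) auto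
 also have "... = 2 powr p / p * (\<Sum>x\<in>W. f x powr p * \<mu> x) + (\<Sum>x\<in>W. m x powr p * \<mu> x) * ((p-1)/p) / 2"
  unfolding distrib_right sum.distrib by (simp add: sum_distrib_left sum_distrib_right sum_divide_distrib mult_ac)
 finally have "(\<Sum>x\<in>W. m x powr p * \<mu> x) * ((p-1)/p) / 2 <= 2 powr p / p * (\<Sum>x\<in>W. f x powr p * \<mu> x)"
  using 1 by linarith
 hence "2 * p * ((\<Sum>x\<in>W. m x powr p * \<mu> x) * ((p-1)/p) / 2) <= 2 * p * (2 powr p / p * (\<Sum>x\<in>W. f x powr p * \<mu> x))"
  using p by (intro mult_left_mono) auto
 hence "(\<Sum>x\<in>W. m x powr p * \<mu> x) * (p - 1) <= 2 powr p * 2 * (\<Sum>x\<in>W. f x powr p * \<mu> x)"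
  using p by simp
 hence "(\<Sum>x\<in>W. m x powr p * \<mu> x) <= (2 powr p * 2 * (\<Sum>x\<in>W. f x powr p * \<mu> x)) / (p - 1)"
  using p by (subst pos_le_divide_eq) auto
 thus ?thesis by simp
qed

lemma powr_add_le:
 fixes u v p :: real
 assumes "0 <= u" "0 <= v" "0 <= p"
 shows "(u + v) powr p <= 2 powr p * (u powr p + v powr p)"
proof -
 have "(u + v) powr p <= (2 * max u v) powr p" using assms by (intro powr_mono2) auto
 also have "... = 2 powr p * max u v powr p" using assms by (simp add: powr_mult)
 also have "max u v powr p <= u powr p + v powr p" by (auto simp: max_def)
 finally show ?thesis by simp
qed

definition maxl :: "int => (int => real) => (int => real) => int => real" where
 "maxl a \<mu> f x = Max ((%l. wavg \<mu> f l x) ` {a..x})"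

definition maxr :: "int => (int => real) => (int => real) => int => real" where
 "maxr b \<mu> f x = Max ((%n. wavg \<mu> f x n) ` {x..b})"

lemma maxl_gr: "a <= x ==> c < maxl a \<mu> f x \<longleftrightarrow> (\<exists>l\<in>{a..x}. c < wavg \<mu> f l x)"
 unfolding maxl_def by (subst Max_gr_iff) auto

lemma maxr_gr: "x <= b ==> c < maxr b \<mu> f x \<longleftrightarrow> (\<exists>n\<in>{x..b}. c < wavg \<mu> f x n)"
 unfolding maxr_def by (subst Max_gr_iff) auto

context
 fixes a b :: int and \<mu> f :: "int => real"
 assumes \<mu>: "!!k. k \<in> {a..b} ==> 0 < \<mu> k" and f: "!!k. k \<in> {a..b} ==> 0 <= f k"
begin

lemma maxl_nonneg: "x \<in> {a..b} ==> 0 <= maxl a \<mu> f x"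
proof -
 assume x: "x \<in> {a..b}"
 have "0 <= wavg \<mu> f x x" using x \<mu>[OF x] f[OF x] by (simp add: wavg_def)
 also have "... <= maxl a \<mu> f x" unfolding maxl_def using x by (intro Max_ge) auto
 finally show ?thesis .
qed

lemma maxr_nonneg: "x \<in> {a..b} ==> 0 <= maxr b \<mu> f x"
proof -
 assume x: "x \<in> {a..b}"
 have "0 <= wavg \<mu> f x x" using x \<mu>[OF x] f[OF x] by (simp add: wavg_def)
 also have "... <= maxr b \<mu> f x" unfolding maxr_def using x by (intro Max_ge) auto
 finally show ?thesis .
qed

text \<open>An interval containing \<open>x\<close> is split at \<open>x\<close>; each piece is
  averaged over itself, and its measure is at most that of the whole interval. The point
  \<open>x\<close> may be counted twice since everything is nonnegative.\<close>

lemma maxfun_le_one_sided: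
 assumes x: "x \<in> {a..b}"
 shows "maxfun a b \<mu> f x <= maxl a \<mu> f x + maxr b \<mu> f x"
proof -
 obtain l n where ln: "a <= l" "l <= x" "x <= n" "n <= b" "maxfun a b \<mu> f x = wavg \<mu> f l n"
  using maxfun_attained[OF x] by metis
 let ?S = "%g l n. \<Sum>k=l..n. g k"
 have pos: "0 < ?S \<mu> l x" "0 < ?S \<mu> x n" "0 < ?S \<mu> l n" using ln \<mu> by (auto intro!: sum_pos)
 have "?S \<mu> l x <= ?S \<mu> l n" "?S \<mu> x n <= ?S \<mu> l n"
  using ln less_imp_le[OF \<mu>] by (auto intro!: sum_mono2)
 have L: "wavg \<mu> f l x <= maxl a \<mu> f x" unfolding maxl_def using ln by (intro Max_ge) auto
 have R: "wavg \<mu> f x n <= maxr b \<mu> f x" unfolding maxr_def using ln by (intro Max_ge) auto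
 have "?S (%k. f k * \<mu> k) l n <= ?S (%k. f k * \<mu> k) l x + ?S (%k. f k * \<mu> k) x n"
 proof -
  have "{l..n} = {l..x} \<union> {x+1..n}" using ln by auto
  hence "?S (%k. f k * \<mu> k) l n = ?S (%k. f k * \<mu> k) l x + ?S (%k. f k * \<mu> k) (x+1) n"
   by (simp add: sum.union_disjoint)
  moreover have "?S (%k. f k * \<mu> k) (x+1) n <= ?S (%k. f k * \<mu> k) x n"
   using ln f less_imp_le[OF \<mu>] by (intro sum_mono2) (auto intro!: mult_nonneg_nonneg)
  ultimately show ?thesis by simp
 qed
 also have "... <= maxl a \<mu> f x * ?S \<mu> l x + maxr b \<mu> f x * ?S \<mu> x n"
  using L R pos by (intro add_mono) (auto simp: wavg_def pos_divide_le_eq)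
 also have "... <= maxl a \<mu> f x * ?S \<mu> l n + maxr b \<mu> f x * ?S \<mu> l n"
  using maxl_nonneg[OF x] maxr_nonneg[OF x] \<open>?S \<mu> l x <= _\<close> \<open>?S \<mu> x n <= _\<close>
  by (intro add_mono mult_left_mono) auto
 finally show ?thesis unfolding ln(5) wavg_def using pos by (simp add: pos_divide_le_eq distrib_right)
qed

lemma maxl_weak: "(\<Sum>x\<in>{x\<in>{a..b}. c < maxl a \<mu> f x}. c * \<mu> x) <= (\<Sum>x\<in>{x\<in>{a..b}. c < maxl a \<mu> f x}. f x * \<mu> x)"
proof -
 have "{x\<in>{a..b}. c < maxl a \<mu> f x} = {x\<in>{a..b}. \<exists>l\<in>{a..x}. c < wavg \<mu> f l x}"
  by (intro Collect_cong conj_cong maxl_gr refl) auto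
 thus ?thesis using one_sided_weak[of a b \<mu> c f] \<mu> by simp
qed

lemma maxr_weak: "(\<Sum>x\<in>{x\<in>{a..b}. c < maxr b \<mu> f x}. c * \<mu> x) <= (\<Sum>x\<in>{x\<in>{a..b}. c < maxr b \<mu> f x}. f x * \<mu> x)"
proof -
 have "{x\<in>{a..b}. c < maxr b \<mu> f x} = {x\<in>{a..b}. \<exists>l\<in>{x..b}. c < wavg \<mu> f x l}"
  by (intro Collect_cong conj_cong maxr_gr refl) auto
 thus ?thesis using one_sided_weak'[of a b \<mu> c f] \<mu> by simp
qed

lemma maxfun_strong:
 assumes p: "p > 1"
 shows "(\<Sum>x=a..b. maxfun a b \<mu> f x powr p * \<mu> x)
  <= (2 powr p * (2 * (2 powr p * (2 / (p - 1))))) * (\<Sum>x=a..b. f x powr p * \<mu> x)"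
proof -
 let ?F = "2 powr p * (2 / (p - 1)) * (\<Sum>x=a..b. f x powr p * \<mu> x)"
 have "(\<Sum>x=a..b. maxfun a b \<mu> f x powr p * \<mu> x)
   <= (\<Sum>x=a..b. 2 powr p * (maxl a \<mu> f x powr p + maxr b \<mu> f x powr p) * \<mu> x)"
 proof (intro sum_mono mult_right_mono)
  fix x assume x: "x \<in> {a..b}"
  have "maxfun a b \<mu> f x powr p <= (maxl a \<mu> f x + maxr b \<mu> f x) powr p"
   using p x maxfun_le_one_sided[OF x] maxfun_nonneg[OF x, of f \<mu>] f less_imp_le[OF \<mu>] by (intro powr_mono2) auto
  also have "... <= 2 powr p * (maxl a \<mu> f x powr p + maxr b \<mu> f x powr p)"
   using maxl_nonneg[OF x] maxr_nonneg[OF x] p by (intro powr_add_le) auto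
  finally show "maxfun a b \<mu> f x powr p <= ..." .
 qed (use \<mu> less_imp_le in auto)
 also have "... = 2 powr p * ((\<Sum>x=a..b. maxl a \<mu> f x powr p * \<mu> x) + (\<Sum>x=a..b. maxr b \<mu> f x powr p * \<mu> x))"
  by (simp add: sum.distrib[symmetric] sum_distrib_left algebra_simps)
 also have "... <= 2 powr p * (?F + ?F)" using p \<mu> f maxl_nonneg maxr_nonneg maxl_weak maxr_weak
  by (intro mult_left_mono add_mono layer_cake_strong) (auto intro: less_imp_le)
 finally show ?thesis by (simp add: algebra_simps)
qed

end

text \<open>Where \<open>maxfun\<close> exceeds \<open>c\<close>, one of the two one-sided maximal
  functions exceeds \<open>c/2\<close>; two level sets at half the height make the factor 4.\<close>

lemma maxfun_weak_card:
 assumes f: "!!k. k \<in> {a..b} ==> 0 <= f k" and c: "0 < c"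
 shows "c * card {x\<in>{a..b}. c < maxfun a b (%_. 1) f x} <= 4 * (\<Sum>x=a..b. f x)"
proof -
 let ?L = "{x\<in>{a..b}. c/2 < maxl a (%_. 1) f x}" and ?R = "{x\<in>{a..b}. c/2 < maxr b (%_. 1) f x}"
 have "{x\<in>{a..b}. c < maxfun a b (%_. 1) f x} \<subseteq> ?L \<union> ?R"
  using maxfun_le_one_sided[of a b "%_. 1" f] f by force
 hence "card {x\<in>{a..b}. c < maxfun a b (%_. 1) f x} <= card ?L + card ?R"
  by (intro order_trans[OF card_mono card_Un_le] finite_UnI) (auto intro: finite_subset[of _ "{a..b}"])
 hence 1: "c * card {x\<in>{a..b}. c < maxfun a b (%_. 1) f x} <= c * (card ?L + card ?R)"
  using c by (intro mult_left_mono) (auto simp flip: of_nat_add)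
 have "(c/2) * card ?L <= (\<Sum>x\<in>?L. f x)" using maxl_weak[of a b "%_. 1" f "c/2"] f by (simp add: mult.commute)
 also have "... <= (\<Sum>x=a..b. f x)" using f by (intro sum_mono2) auto
 finally have 2: "(c/2) * card ?L <= (\<Sum>x=a..b. f x)" .
 have "(c/2) * card ?R <= (\<Sum>x\<in>?R. f x)" using maxr_weak[of a b "%_. 1" f "c/2"] f by (simp add: mult.commute)
 also have "... <= (\<Sum>x=a..b. f x)" using f by (intro sum_mono2) auto
 finally have "(c/2) * card ?R <= (\<Sum>x=a..b. f x)" .
 thus ?thesis using 1 2 by (simp add: algebra_simps)
qed

section \<open>Muckenhoupt conditions and the weighted maximal inequality\<close>

definition avg :: "(int => real) => int => int => real" where
 "avg f l n = (\<Sum>k=l..n. f k) / real (card {l..n})"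

lemma wavg_one: "wavg (%_. 1) f l n = avg f l n" by (simp add: wavg_def avg_def)

lemma avg_nonneg: "(!!k. k \<in> {l..n} ==> 0 <= f k) ==> 0 <= avg f l n"
 unfolding avg_def by (intro divide_nonneg_nonneg sum_nonneg) auto

lemma avg_pos: "l <= n ==> (!!k. k \<in> {l..n} ==> 0 < f k) ==> 0 < avg f l n"
 unfolding avg_def by (intro divide_pos_pos sum_pos) auto

text \<open>The \<open>A_p\<close> condition is the case of conjugate exponents
  \<open>s = p\<close>, \<open>t = q\<close>. Decoupling them, and using averages instead of sums,
  makes the condition monotone in \<open>s\<close> and \<open>t\<close>, so that the self-improved
  condition has the same form.\<close>

definition muck :: "real => real => real => (int => real) => bool" where
 "muck s t c w \<longleftrightarrow> (\<forall>k. 0 < w k) &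
  (\<forall>l n. l <= n --> avg (%k. w k powr s) l n powr (1/s) * avg (%k. w k powr (-t)) l n powr (1/t) <= c)"

lemma muck_mono:
 assumes "muck s t c w" "0 < s'" "s' <= s" "0 < t'" "t' <= t"
 shows "muck s' t' c w"
 unfolding muck_def
proof (intro conjI allI impI)
 show w: "0 < w k" for k using assms by (auto simp: muck_def)
 fix l n :: int assume ln: "l <= n"
 have 1: "avg (%k. w k powr s') l n powr (1/s') <= avg (%k. w k powr s) l n powr (1/s)"
  unfolding avg_def using ln assms w by (intro power_mean_mono) (auto intro: less_imp_le)
 have "avg (%k. (1 / w k) powr t') l n powr (1/t') <= avg (%k. (1 / w k) powr t) l n powr (1/t)"
  unfolding avg_def using ln assms w by (intro power_mean_mono) (auto intro: less_imp_le)
 hence 2: "avg (%k. w k powr (-t')) l n powr (1/t') <= avg (%k. w k powr (-t)) l n powr (1/t)"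
  using w by (simp add: powr_minus_divide powr_divide less_imp_le)
 have "avg (%k. w k powr s') l n powr (1/s') * avg (%k. w k powr (-t')) l n powr (1/t')
  <= avg (%k. w k powr s) l n powr (1/s) * avg (%k. w k powr (-t)) l n powr (1/t)" using 1 2 by (intro mult_mono) auto
 also have "... <= c" using assms(1) ln by (auto simp: muck_def)
 finally show "avg (%k. w k powr s') l n powr (1/s') * avg (%k. w k powr (-t')) l n powr (1/t') <= c" .
qed

lemma muck_inverse: "muck s t c w ==> muck t s c (%k. 1 / w k)"
 by (auto simp: muck_def powr_minus_divide powr_divide less_imp_le mult.commute)

lemma muck_powr:
 assumes "muck s t c w" "0 < r"
 shows "muck (s/r) (t/r) (c powr r) (%k. w k powr r)"
 unfolding muck_def
proof (intro conjI allI impI)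
 have "0 < w k" for k using assms by (simp add: muck_def)
 thus "0 < w k powr r" for k by (simp add: order_less_imp_not_eq2)
 fix l n :: int assume ln: "l <= n"
 define A where "A = avg (%k. w k powr s) l n"
 define B where "B = avg (%k. w k powr (-t)) l n"
 have "A powr (1/s) * B powr (1/t) <= c" using assms(1) ln by (auto simp: muck_def A_def B_def)
 hence "(A powr (1/s) * B powr (1/t)) powr r <= c powr r" using assms by (intro powr_mono2) auto
 thus "avg (%k. (w k powr r) powr (s/r)) l n powr (1/(s/r))
   * avg (%k. (w k powr r) powr (-(t/r))) l n powr (1/(t/r)) <= c powr r"
  using assms(2) by (simp add: powr_powr powr_mult mult.commute flip: A_def B_def)
qed

text \<open>Lerner's proof of Muckenhoupt's theorem: with \<open>v = w\<^sup>p\<close>, \<open>\<sigma> = w\<^sup>-\<^sup>q\<close> one has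
 \<open>(M f)\<^sup>p\<^sup>-\<^sup>1 \<le> C M\<^sub>v ((M\<^sub>\<sigma> (f/\<sigma>))\<^sup>p\<^sup>-\<^sup>1 / v)\<close>, and \<open>M\<^sub>v\<close>, \<open>M\<^sub>\<sigma>\<close> are
 bounded for any weights.\<close>

lemma muckenhoupt:
 assumes pq: "p > 1" "q > 1" "1/p + 1/q = 1" and w: "muck p q c w"
 obtains C where "C > 0"
  "!!a b f. (!!k. k \<in> {a..b} ==> 0 <= f k) ==>
   (\<Sum>x=a..b. (maxfun a b (%_. 1) f x * w x) powr p) <= C * (\<Sum>x=a..b. (f x * w x) powr p)"
proof -
 define K where "K s = 2 powr s * (2 * (2 powr s * (2 / (s - 1))))" for s :: real
 have Kpos: "K s > 0" if "s > 1" for s using that by (simp add: K_def)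
 have wpos: "0 < w k" for k using w by (auto simp: muck_def)
 define v where "v k = w k powr p" for k
 define \<sigma> where "\<sigma> k = w k powr (- q)" for k
 have vpos: "0 < v k" and spos: "0 < \<sigma> k" for k using wpos[of k] by (simp_all add: v_def \<sigma>_def)
 have c: "c > 0"
 proof -
  have "(w 0 powr p) powr (1/p) * (w 0 powr (-q)) powr (1/q) <= c"
   using w by (auto simp: muck_def avg_def dest!: spec[of _ "0::int"])
  moreover have "(w 0 powr p) powr (1/p) * (w 0 powr (-q)) powr (1/q) > 0" using wpos[of 0] by simp
  ultimately show ?thesis by linarith
 qed
 have q_eq: "q = p / (p - 1)" "p / q = p - 1" "p + q = p * q" using pq by (auto simp: field_simps)
 show ?thesis
 proof (rule that[of "c powr (p * q) * K q * K p"])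
  show "c powr (p * q) * K q * K p > 0" using c Kpos pq by simp
  fix a b :: int and f :: "int => real"
  assume f: "!!k. k \<in> {a..b} ==> 0 <= f k"
  define g where "g k = f k / \<sigma> k" for k
  define G where "G = maxfun a b \<sigma> g"
  define N where "N = maxfun a b v (%k. G k powr (p-1) / v k)"
  have g: "0 <= g k" if "k \<in> {a..b}" for k using f[OF that] spos[of k] by (simp add: g_def)
  have G: "0 <= G k" if "k \<in> {a..b}" for k
   unfolding G_def using that g spos by (intro maxfun_nonneg) (auto intro: less_imp_le)
  have N: "0 <= N k" if "k \<in> {a..b}" for k
   unfolding N_def using that G by (intro maxfun_nonneg) (auto intro!: divide_nonneg_nonneg less_imp_le[OF vpos])
  \<comment> \<open>On the interval where the maximum is attained, the average of \<open>f\<close>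
    is the \<open>\<sigma>\<close>-average of \<open>g\<close> times the mean of
    \<open>\<sigma>\<close>. That \<open>\<sigma>\<close>-average is at most \<open>G\<close> at
    every point of the interval, and averaging \<open>G powr (p-1) / v\<close> against
    \<open>v\<close> brings in \<open>N\<close>. The means of \<open>v\<close> and
    \<open>\<sigma>\<close> that remain are controlled by the Muckenhoupt condition.\<close>
  have key: "(maxfun a b (%_. 1) f x) powr p <= c powr (p*q) * N x powr q" if x: "x \<in> {a..b}" for x
  proof -
   obtain l n where ln: "a <= l" "l <= x" "x <= n" "n <= b" "maxfun a b (%_. 1) f x = avg f l n"
    using maxfun_attained[OF x, of "%_. 1" f] wavg_one by metis
   define m where "m = real (card {l..n})"
   define V where "V = (\<Sum>k=l..n. v k)"
   define S where "S = (\<Sum>k=l..n. \<sigma> k)"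
   define A where "A = wavg \<sigma> g l n"
   have m: "m > 0" using ln by (simp add: m_def)
   have V: "V > 0" unfolding V_def using ln vpos by (intro sum_pos) auto
   have S: "S > 0" unfolding S_def using ln spos by (intro sum_pos) auto
   have A0: "A \<ge> 0" unfolding A_def using ln g
    by (intro wavg_nonneg) (auto intro!: mult_nonneg_nonneg less_imp_le[OF spos])
   have "\<sigma> k ~= 0" for k using spos[of k] by simp
   hence "avg f l n = A * S / m" using S by (simp add: A_def wavg_def S_def avg_def m_def g_def)
   have "A powr (p-1) * m = (\<Sum>k=l..n. A powr (p-1))" by (simp add: m_def)
   also have "... <= (\<Sum>k=l..n. G k powr (p-1))" unfolding A_def G_def using ln pq A0
    by (intro sum_mono powr_mono2 wavg_le_maxfun) (auto simp: A_def)
   also have "... = wavg v (%k. G k powr (p-1) / v k) l n * V"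
    using V vpos by (simp add: wavg_def V_def order_less_imp_not_eq2)
   also have "... <= N x * V" unfolding N_def using ln V by (intro mult_right_mono wavg_le_maxfun) auto
   finally have 1: "A powr (p-1) <= N x * V / m" using m by (simp add: field_simps)
   have 2: "V / m * (S / m) powr (p-1) <= c powr p"
   proof -
    have "(V/m) powr (1/p) * (S/m) powr (1/q) <= c"
     using w ln by (auto simp: muck_def avg_def V_def S_def m_def v_def \<sigma>_def)
    hence "((V/m) powr (1/p) * (S/m) powr (1/q)) powr p <= c powr p" using pq by (intro powr_mono2) auto
    moreover have "((V/m) powr (1/p) * (S/m) powr (1/q)) powr p = V / m * (S / m) powr (p-1)"
     using pq V S m q_eq(2) by (simp add: powr_mult powr_powr)
    ultimately show ?thesis by simp
   qed
   have "(avg f l n) powr (p-1) = A powr (p-1) * (S/m) powr (p-1)"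
    using \<open>avg f l n = A * S / m\<close> A0 S m by (simp add: powr_mult powr_divide)
   also have "... <= (N x * V / m) * (S/m) powr (p-1)" using 1 by (intro mult_right_mono) auto
   also have "... = N x * (V / m * (S / m) powr (p-1))" by simp
   also have "... <= N x * c powr p" using 2 N[OF x] by (intro mult_left_mono) auto
   finally have "(avg f l n powr (p-1)) powr q <= (N x * c powr p) powr q" using pq by (intro powr_mono2) auto
   thus ?thesis using pq N[OF x] q_eq c by (simp add: ln(5) powr_powr powr_mult mult.commute)
  qed
  have "(\<Sum>x=a..b. (maxfun a b (%_. 1) f x * w x) powr p) = (\<Sum>x=a..b. maxfun a b (%_. 1) f x powr p * v x)"
   using wpos maxfun_nonneg[of _ a b f "%_. 1"] f by (intro sum.cong) (auto simp: powr_mult v_def less_imp_le)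
  also have "... <= (\<Sum>x=a..b. c powr (p*q) * N x powr q * v x)"
   using key vpos by (intro sum_mono mult_right_mono) (auto intro: less_imp_le)
  also have "... = c powr (p*q) * (\<Sum>x=a..b. N x powr q * v x)" by (simp add: sum_distrib_left mult.assoc)
  also have "(\<Sum>x=a..b. N x powr q * v x) <= K q * (\<Sum>x=a..b. (G x powr (p-1) / v x) powr q * v x)"
   unfolding N_def K_def using pq vpos G
   by (intro maxfun_strong) (auto intro!: divide_nonneg_nonneg less_imp_le[OF vpos])
  \<comment> \<open>The weights combine because \<open>(p - 1) * q = p\<close> and
    \<open>v powr (1 - q) = \<sigma>\<close>.\<close>
  also have "(\<Sum>x=a..b. (G x powr (p-1) / v x) powr q * v x) = (\<Sum>x=a..b. G x powr p * \<sigma> x)"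
  proof (intro sum.cong refl)
   fix x assume x: "x \<in> {a..b}"
   have e: "p * q = p + q" using q_eq by simp
   hence e': "(p - 1) * q = p" by (simp add: left_diff_distrib)
   have "v x / v x powr q = \<sigma> x"
    using wpos[of x] by (simp add: v_def \<sigma>_def powr_powr powr_diff[symmetric] e)
   hence "G x powr p * (v x / v x powr q) = G x powr p * \<sigma> x" by simp
   thus "(G x powr (p-1) / v x) powr q * v x = G x powr p * \<sigma> x"
    using G[OF x] vpos[of x] by (simp add: powr_divide powr_powr e e')
  qed
  also have "... <= K p * (\<Sum>x=a..b. g x powr p * \<sigma> x)"
   unfolding G_def K_def using pq spos g by (intro maxfun_strong) auto
  also have "(\<Sum>x=a..b. g x powr p * \<sigma> x) = (\<Sum>x=a..b. (f x * w x) powr p)"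
  proof (intro sum.cong refl)
   fix x assume x: "x \<in> {a..b}"
   have e: "p * q = p + q" using q_eq pq by auto
   have "\<sigma> x / \<sigma> x powr p = w x powr p"
    using wpos[of x] by (simp add: \<sigma>_def powr_powr powr_diff[symmetric] e mult.commute)
   hence "f x powr p * (\<sigma> x / \<sigma> x powr p) = f x powr p * w x powr p" by simp
   thus "g x powr p * \<sigma> x = (f x * w x) powr p"
    using f[OF x] spos[of x] wpos[of x] by (simp add: g_def powr_divide powr_mult less_imp_le)
  qed
  finally show "(\<Sum>x=a..b. (maxfun a b (%_. 1) f x * w x) powr p)
    <= c powr (p * q) * K q * K p * (\<Sum>x=a..b. (f x * w x) powr p)"
   using c Kpos pq by (simp add: mult.assoc mult_left_mono)
 qed
qed

section \<open>Stopping intervals and the reverse Hoelder inequality\<close>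

text \<open>The two halves of an interval with at least two points qualify, the ratios 1/3 and 2/3
  being attained at length three. The upper ratio gives geometric decay; the lower one limits the
  growth of averages from parent to child to a factor 3.\<close>

definition child :: "int => int => int => int => bool" where
 "child l n l' n' \<longleftrightarrow> l <= l' & l' <= n' & n' <= n &
  3 * (n' - l' + 1) <= 2 * (n - l + 1) & n - l + 1 <= 3 * (n' - l' + 1)"

text \<open>A Calderon-Zygmund family. In the applications \<open>Bad\<close> bounds averages over
  the selected intervals from below, \<open>Good\<close> of the parents bounds them from above, and
  uncovered points, being \<open>Good\<close> as one-point intervals, obey pointwise bounds.\<close>

definition stopping :: "(int => int => bool) => (int => int => bool) => int => int => (int \<times> int) set => bool" where
 "stopping Good Bad l n P \<longleftrightarrow> finite P &
  (\<forall>(a, b)\<in>P. a <= b & Bad a b & (\<exists>a' b'. Good a' b' & l <= a' & b' <= n & child a' b' a b)) &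
  (\<forall>I\<in>P. \<forall>J\<in>P. I ~= J --> {fst I..snd I} \<inter> {fst J..snd J} = {}) &
  (\<forall>x\<in>{l..n}. (\<forall>(a, b)\<in>P. x \<notin> {a..b}) --> Good x x)"

text \<open>Halve an interval repeatedly and stop at the first bad descendants.\<close>

lemma stopping_exists:
 assumes "Good l n" "l <= n"
  and "!!a b a' b'. Good a b ==> l <= a ==> b <= n ==> child a b a' b' ==> Good a' b' | Bad a' b'"
 shows "\<exists>P. stopping Good Bad l n P"
 using assms
proof (induction "nat (n - l)" arbitrary: l n rule: less_induct)
 case less
 show ?case
 proof (cases "l = n")
  case True
  thus ?thesis using less.prems by (intro exI[of _ "{}"]) (auto simp: stopping_def)
 next
  case False
  define m where "m = (l + n) div 2"
  have m: "l <= m" "m < n" using False less.prems by (auto simp: m_def)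
  have c: "child l n l m" "child l n (m+1) n" using False less.prems unfolding child_def m_def by auto
  have half: "\<exists>P. finite P & (\<forall>(u, v)\<in>P. a <= u & u <= v & v <= b & Bad u v &
     (\<exists>a' b'. Good a' b' & l <= a' & b' <= n & child a' b' u v)) &
   (\<forall>I\<in>P. \<forall>J\<in>P. I ~= J --> {fst I..snd I} \<inter> {fst J..snd J} = {}) &
   (\<forall>x\<in>{a..b}. (\<forall>(u, v)\<in>P. x \<notin> {u..v}) --> Good x x)"
   if ch: "child l n a b" and sm: "nat (b - a) < nat (n - l)" for a b
  proof (cases "Bad a b")
   case True
   have "a <= b" using ch by (auto simp: child_def)
   thus ?thesis using True ch less.prems by (intro exI[of _ "{(a, b)}"]) auto
  next
   case False
   have g: "Good a b" using less.prems(3)[OF less.prems(1) _ _ ch] False by auto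
   have ab: "l <= a" "a <= b" "b <= n" using ch by (auto simp: child_def)
   have "\<exists>P. stopping Good Bad a b P"
   proof (rule less.hyps[OF sm g ab(2)])
    fix c d c' d' assume "Good c d" "a <= c" "d <= b" "child c d c' d'"
    thus "Good c' d' | Bad c' d'" using less.prems(3)[of c d c' d'] ab by auto
   qed
   then obtain P where P: "stopping Good Bad a b P" by blast
   have "a <= u & u <= v & v <= b & Bad u v & (\<exists>a' b'. Good a' b' & l <= a' & b' <= n & child a' b' u v)"
    if uv: "(u, v) \<in> P" for u v
   proof -
    obtain a' b' where *: "Good a' b'" "a <= a'" "b' <= b" "child a' b' u v" "u <= v" "Bad u v"
     using P[unfolded stopping_def] uv by blast
    hence "l <= a'" "b' <= n" "a <= u" "v <= b" using ab by (auto simp: child_def)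
    thus ?thesis using * by blast
   qed
   moreover have "finite P" "\<forall>I\<in>P. \<forall>J\<in>P. I ~= J --> {fst I..snd I} \<inter> {fst J..snd J} = {}"
    "\<forall>x\<in>{a..b}. (\<forall>(u, v)\<in>P. x \<notin> {u..v}) --> Good x x"
    using P by (auto simp: stopping_def)
   ultimately show ?thesis by (intro exI[of _ P]) blast
  qed
  obtain P1 where P1: "finite P1" "\<forall>(u, v)\<in>P1. l <= u & u <= v & v <= m & Bad u v &
     (\<exists>a' b'. Good a' b' & l <= a' & b' <= n & child a' b' u v)"
   "\<forall>I\<in>P1. \<forall>J\<in>P1. I ~= J --> {fst I..snd I} \<inter> {fst J..snd J} = {}"
   "\<forall>x\<in>{l..m}. (\<forall>(u, v)\<in>P1. x \<notin> {u..v}) --> Good x x" using half[OF c(1)] m by auto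
  obtain P2 where P2: "finite P2" "\<forall>(u, v)\<in>P2. m+1 <= u & u <= v & v <= n & Bad u v &
     (\<exists>a' b'. Good a' b' & l <= a' & b' <= n & child a' b' u v)"
   "\<forall>I\<in>P2. \<forall>J\<in>P2. I ~= J --> {fst I..snd I} \<inter> {fst J..snd J} = {}"
   "\<forall>x\<in>{m+1..n}. (\<forall>(u, v)\<in>P2. x \<notin> {u..v}) --> Good x x" using half[OF c(2)] m by auto
  have cross: "{fst I..snd I} \<inter> {fst J..snd J} = {}" if "I \<in> P1" "J \<in> P2" for I J
  proof -
   have "snd I <= m" "m + 1 <= fst J" using P1(2) P2(2) that by (auto simp: split_beta)
   thus ?thesis by auto
  qed
  have "stopping Good Bad l n (P1 \<union> P2)"
   unfolding stopping_def
  proof (intro conjI)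
   show "finite (P1 \<union> P2)" using P1 P2 by auto
   show "\<forall>(a, b)\<in>P1 \<union> P2. a <= b & Bad a b & (\<exists>a' b'. Good a' b' & l <= a' & b' <= n & child a' b' a b)"
    using P1(2) P2(2) by blast
   show "\<forall>I\<in>P1 \<union> P2. \<forall>J\<in>P1 \<union> P2. I ~= J --> {fst I..snd I} \<inter> {fst J..snd J} = {}"
   proof (intro ballI impI)
    fix I J assume "I \<in> P1 \<union> P2" "J \<in> P1 \<union> P2" "I ~= J"
    thus "{fst I..snd I} \<inter> {fst J..snd J} = {}"
     using P1(3)[rule_format, of I J] P2(3)[rule_format, of I J] cross[of I J]
      cross[of J I, unfolded Int_commute[of "{fst J..snd J}"]] by (elim UnE) simp_all
   qed
   show "\<forall>x\<in>{l..n}. (\<forall>(a, b)\<in>P1 \<union> P2. x \<notin> {a..b}) --> Good x x"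
   proof (intro ballI impI)
    fix x assume x: "x \<in> {l..n}" "\<forall>(a, b)\<in>P1 \<union> P2. x \<notin> {a..b}"
    hence "x \<in> {l..m} | x \<in> {m+1..n}" by auto
    thus "Good x x" using P1(4) P2(4) x(2) by blast
   qed
  qed
  thus ?thesis by blast
 qed
qed

lemma stopping_memD:
 assumes "stopping Good Bad l n P" "(a, b) \<in> P"
 shows "l <= a" "a <= b" "b <= n" "Bad a b" "b - a < n - l"
  "\<exists>a' b'. Good a' b' & l <= a' & b' <= n & child a' b' a b"
proof -
 obtain a' b' where *: "Good a' b'" "l <= a'" "b' <= n" "child a' b' a b" "a <= b" "Bad a b"
  using assms by (auto simp: stopping_def)
 thus "l <= a" "a <= b" "b <= n" "Bad a b" "b - a < n - l" by (auto simp: child_def)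
 show "\<exists>a' b'. Good a' b' & l <= a' & b' <= n & child a' b' a b" using * by blast
qed

definition stop_union :: "(int \<times> int) set => int set" where
 "stop_union P = (\<Union>I\<in>P. {fst I..snd I})"

lemma stopping_sum:
 assumes "stopping Good Bad l n P"
 shows "(\<Sum>x\<in>stop_union P. g x) = (\<Sum>I\<in>P. \<Sum>x=fst I..snd I. (g x :: real))"
 unfolding stop_union_def using assms by (intro sum.UNION_disjoint) (auto simp: stopping_def)

lemma stopping_sum_split:
 assumes "stopping Good Bad l n P"
 shows "(\<Sum>x=l..n. g x) = (\<Sum>x\<in>{l..n} - stop_union P. g x) + (\<Sum>I\<in>P. \<Sum>x=fst I..snd I. (g x :: real))"
proof -
 have sub: "stop_union P \<subseteq> {l..n}" using stopping_memD(1,3)[OF assms] by (force simp: stop_union_def)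
 hence "(\<Sum>x=l..n. g x) = (\<Sum>x\<in>{l..n} - stop_union P. g x) + (\<Sum>x\<in>stop_union P. g x)"
  by (intro sum.subset_diff) auto
 thus ?thesis using stopping_sum[OF assms] by simp
qed

lemma stop_union_subset:
 assumes "stopping Good Bad l n P"
 shows "stop_union P \<subseteq> {l..n}" using stopping_memD(1,3)[OF assms] by (force simp: stop_union_def)

section \<open>Self-improvement of Muckenhoupt weights\<close>

lemma avg_mono_interval:
 assumes "l <= a" "a <= b" "b <= n" "n - l + 1 <= k * (b - a + 1)" "!!x. x \<in> {l..n} ==> 0 <= f x"
 shows "avg f a b <= of_int k * avg f l n"
proof -
 have pos: "real (card {a..b}) > 0" "real (card {l..n}) > 0" using assms by auto
 have "(\<Sum>x=a..b. f x) <= (\<Sum>x=l..n. f x)" using assms by (intro sum_mono2) auto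
 hence "avg f a b <= (\<Sum>x=l..n. f x) / card {a..b}" unfolding avg_def by (intro divide_right_mono) auto
 also have "... <= (\<Sum>x=l..n. f x) * (of_int k / card {l..n})"
 proof -
  have "real (card {l..n}) <= of_int k * real (card {a..b})"
  proof -
   have "real_of_int (n - l + 1) <= of_int (k * (b - a + 1))" using assms(4) by (rule of_int_le_iff[THEN iffD2])
   thus ?thesis using assms by simp
  qed
  hence "1 / card {a..b} <= of_int k / card {l..n}" using pos by (simp add: field_simps)
  moreover have "0 <= (\<Sum>x=l..n. f x)" using assms by (intro sum_nonneg) auto
  ultimately show ?thesis using mult_left_mono by fastforce
 qed
 finally show ?thesis by (simp add: avg_def mult.commute)
qed

text \<open>Gehring's argument by induction on the length. Intervals are stopped when their average
  exceeds twice the average \<open>L\<close> of the whole: they cover at most half of it, hence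
  carry at most the fraction \<open>d\<close> of the mass, and their own averages are at most
  \<open>6 * L\<close> by way of the parents. Off them \<open>v <= 2 * L\<close>. As the sums are
  finite, induction takes the place of an a priori integrability assumption.\<close>

lemma reverse_holder:
 fixes v :: "int => real"
 assumes v: "!!k. 0 < v k" and d: "0 <= d" "d < 1"
  and ainf: "!!l n E. l <= n ==> E \<subseteq> {l..n} ==> 2 * card E <= card {l..n} ==> (\<Sum>x\<in>E. v x) <= d * (\<Sum>x=l..n. v x)"
 obtains e K where "e > 0" "K > 0" "!!l n. l <= n ==> avg (%k. v k powr (1+e)) l n <= K * avg v l n powr (1+e)"
proof -
 \<comment> \<open>\<open>e\<close> is so small that the factor \<open>6 powr e\<close> from the
   higher averages does not use up the gain \<open>d < 1\<close>.\<close>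
 have "((%e. 6 powr e * d) \<longlongrightarrow> 6 powr 0 * d) (at_right (0::real))" by (intro tendsto_intros) auto
 hence "\<forall>\<^sub>F e in at_right 0. 6 powr e * d < (1 + d) / 2"
  using d by (intro order_tendstoD(2)[where y = "6 powr 0 * d"]) auto
 hence "\<forall>\<^sub>F e in at_right (0::real). 0 < e & 6 powr e * d < (1 + d) / 2"
  by (intro eventually_conj eventually_at_right_less)
 then obtain e :: real where e: "e > 0" "6 powr e * d < (1 + d) / 2"
  using eventually_happens'[OF trivial_limit_at_right_real] by blast
 \<comment> \<open>\<open>K\<close> solves \<open>2 powr e + K * (1 + d) / 2 = K\<close>, so that
   the estimate reproduces the induction hypothesis.\<close>
 define K where "K = 2 powr e * 2 / (1 - d)"
 have K: "K > 0" using d by (simp add: K_def)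
 have main: "(\<Sum>x=l..n. v x powr (1+e)) <= K * avg v l n powr e * (\<Sum>x=l..n. v x)" if "l <= n" for l n
  using that
 proof (induction "nat (n - l)" arbitrary: l n rule: less_induct)
  case less
  define L where "L = avg v l n"
  have L: "L > 0" unfolding L_def using less.prems v by (intro avg_pos) auto
  define V where "V = (\<Sum>x=l..n. v x)"
  have N: "real (card {l..n}) > 0" using less.prems by simp
  have VL: "V = L * card {l..n}" using N by (simp add: V_def L_def avg_def)
  define Good where "Good a b \<longleftrightarrow> avg v a b <= 2 * L" for a b
  define Bad where "Bad a b \<longleftrightarrow> avg v a b > 2 * L" for a b
  have "\<exists>P. stopping Good Bad l n P"
   by (rule stopping_exists) (use less.prems L in \<open>auto simp: Good_def Bad_def L_def\<close>)
  then obtain P where P: "stopping Good Bad l n P" by blast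
  define U where "U = stop_union P"
  have U: "U \<subseteq> {l..n}" using stop_union_subset[OF P] by (simp add: U_def)
  have "2 * L * card U = (\<Sum>x\<in>U. 2 * L)" by simp
  also have "... = (\<Sum>I\<in>P. \<Sum>x=fst I..snd I. 2 * L)" unfolding U_def by (rule stopping_sum[OF P])
  also have "... <= (\<Sum>I\<in>P. \<Sum>x=fst I..snd I. v x)"
  proof (rule sum_mono)
   fix I assume "I \<in> P"
   hence "avg v (fst I) (snd I) > 2 * L" "fst I <= snd I"
    using stopping_memD[OF P, of "fst I" "snd I"] by (auto simp: Bad_def)
   thus "(\<Sum>x=fst I..snd I. 2 * L) <= (\<Sum>x=fst I..snd I. v x)" by (simp add: avg_def field_simps)
  qed
  also have "... = (\<Sum>x\<in>U. v x)" unfolding U_def by (rule stopping_sum[OF P, symmetric])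
  also have "... <= V" unfolding V_def using U v by (intro sum_mono2) (auto intro: less_imp_le)
  finally have "real (2 * card U) <= real (card {l..n})" using L by (simp add: VL)
  hence cardU: "2 * card U <= card {l..n}" by (simp only: of_nat_le_iff)
  have vU: "(\<Sum>x\<in>U. v x) <= d * V" unfolding V_def by (rule ainf[OF less.prems U cardU])
  have "(\<Sum>x\<in>{l..n} - U. v x powr (1+e)) <= (\<Sum>x\<in>{l..n} - U. (2 * L) powr e * v x)"
  proof (intro sum_mono)
   fix x assume x: "x \<in> {l..n} - U"
   hence "\<forall>(a, b)\<in>P. x \<notin> {a..b}" unfolding U_def stop_union_def by force
   hence "Good x x" using P x by (auto simp: stopping_def)
   hence "v x <= 2 * L" by (simp add: Good_def avg_def)
   hence "v x powr e <= (2 * L) powr e" using v[of x] e by (intro powr_mono2) auto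
   thus "v x powr (1+e) <= (2 * L) powr e * v x" using v[of x] by (simp add: powr_add mult.commute)
  qed
  also have "... <= (2 * L) powr e * V" unfolding V_def sum_distrib_left[symmetric] using v
   by (intro mult_left_mono sum_mono2) (auto intro: less_imp_le)
  finally have 1: "(\<Sum>x\<in>{l..n} - U. v x powr (1+e)) <= (2 * L) powr e * V" .
  have "(\<Sum>I\<in>P. \<Sum>x=fst I..snd I. v x powr (1+e)) <= (\<Sum>I\<in>P. \<Sum>x=fst I..snd I. K * (6 * L) powr e * v x)"
  proof (rule sum_mono)
   fix I assume "I \<in> P"
   then obtain a b where I: "I = (a, b)" "(a, b) \<in> P" by (cases I) auto
   note D = stopping_memD[OF P I(2)]
   obtain a' b' where ab: "Good a' b'" "child a' b' a b" using D(6) by auto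
   have "avg v a b <= of_int 3 * avg v a' b'"
    using ab(2) v by (intro avg_mono_interval) (auto simp: child_def intro: less_imp_le)
   also have "... <= 6 * L" using ab(1) by (simp add: Good_def)
   finally have "avg v a b powr e <= (6 * L) powr e"
    using e v by (intro powr_mono2 avg_nonneg) (auto intro: less_imp_le)
   moreover have "0 <= (\<Sum>x=a..b. v x)" using v by (intro sum_nonneg) (auto intro: less_imp_le)
   ultimately have "K * avg v a b powr e * (\<Sum>x=a..b. v x) <= K * (6 * L) powr e * (\<Sum>x=a..b. v x)"
    using K by (intro mult_right_mono mult_left_mono) auto
   moreover have "(\<Sum>x=a..b. v x powr (1+e)) <= K * avg v a b powr e * (\<Sum>x=a..b. v x)"
    using D by (intro less.hyps) auto
   ultimately show "(\<Sum>x=fst I..snd I. v x powr (1+e)) <= (\<Sum>x=fst I..snd I. K * (6 * L) powr e * v x)"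
    by (simp add: I sum_distrib_left)
  qed
  also have "... = K * (6 * L) powr e * (\<Sum>x\<in>U. v x)"
   unfolding U_def by (simp add: stopping_sum[OF P] sum_distrib_left)
  also have "... <= K * (6 * L) powr e * (d * V)" using vU K by (intro mult_left_mono) auto
  also have "... = K * L powr e * V * (6 powr e * d)" using L by (simp add: powr_mult)
  also have "... <= K * L powr e * V * ((1 + d) / 2)" using e K L VL by (intro mult_left_mono) auto
  finally have 2: "(\<Sum>I\<in>P. \<Sum>x=fst I..snd I. v x powr (1+e)) <= K * L powr e * V * ((1 + d) / 2)" .
  have "(\<Sum>x=l..n. v x powr (1+e)) <= (2 * L) powr e * V + K * L powr e * V * ((1 + d) / 2)"
   using 1 2 stopping_sum_split[OF P, of "%x. v x powr (1+e)"] by (simp add: U_def)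
  also have "(2 * L) powr e * V = K * L powr e * V * ((1 - d) / 2)" using L d by (simp add: K_def powr_mult)
  also have "K * L powr e * V * ((1 - d) / 2) + K * L powr e * V * ((1 + d) / 2) = K * L powr e * V"
   by (simp add: field_simps)
  finally show ?case by (simp add: L_def V_def)
 qed
 show ?thesis
 proof (rule that[OF e(1) K])
  fix l n :: int assume ln: "l <= n"
  have p: "avg v l n > 0" using ln v by (intro avg_pos) auto
  have "avg (%k. v k powr (1+e)) l n <= K * avg v l n powr e * (\<Sum>x=l..n. v x) / card {l..n}"
   unfolding avg_def[of "%k. v k powr (1+e)"] by (rule divide_right_mono[OF main[OF ln]]) auto
  also have "... = K * avg v l n powr e * avg v l n" by (simp add: avg_def)
  also have "... = K * avg v l n powr (1+e)" using p by (simp add: powr_add)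
  finally show "avg (%k. v k powr (1+e)) l n <= K * avg v l n powr (1+e)" .
 qed
qed

text \<open>The Muckenhoupt condition keeps the mass of \<open>w powr p\<close> from concentrating:
  by Hoelder's inequality the complement \<open>F\<close> of \<open>E\<close>, having at least half
  of the points, carries at least the fraction \<open>t\<close> of the mass.\<close>

lemma muck_reverse_holder:
 assumes pq: "p > 1" "q > 1" "1/p + 1/q = 1" and w: "muck p q c w"
 obtains e K where "e > 0" "K > 0"
  "!!l n. l <= n ==> avg (%k. w k powr (p*(1+e))) l n <= K * avg (%k. w k powr p) l n powr (1+e)"
proof -
 have wpos: "0 < w k" for k using w by (auto simp: muck_def)
 define v where "v k = w k powr p" for k
 have vpos: "0 < v k" for k using wpos[of k] by (simp add: v_def)
 \<comment> \<open>Enlarging the constant to at least 1 ensures \<open>0 < t\<close> and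
   \<open>t < 1\<close>.\<close>
 define c' where "c' = max c 1"
 have c': "c' \<ge> 1" "c <= c'" by (auto simp: c'_def)
 define t where "t = (1 / (2 * c')) powr p"
 have t: "0 < t" "t < 1"
 proof -
  show "0 < t" using c' by (simp add: t_def)
  have "t < 1 powr p" unfolding t_def using c' pq by (intro powr_less_mono2) auto
  thus "t < 1" by simp
 qed
 have ainf: "(\<Sum>x\<in>E. v x) <= (1 - t) * (\<Sum>x=l..n. v x)"
  if ln: "l <= n" and E: "E \<subseteq> {l..n}" and card: "2 * card E <= card {l..n}" for l n E
 proof -
  define F where "F = {l..n} - E"
  define m where "m = real (card {l..n})"
  have m: "m > 0" using ln by (simp add: m_def)
  define V where "V = (\<Sum>x=l..n. v x)"
  define S where "S = (\<Sum>x=l..n. w x powr (-q))"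
  have V: "V > 0" unfolding V_def using ln vpos by (intro sum_pos) auto
  have S: "S \<ge> 0" unfolding S_def by (intro sum_nonneg) auto
  have "card F + card E = card {l..n}"
   unfolding F_def using E card_mono[OF _ E] by (subst card_Diff_subset) (auto intro: finite_subset)
  hence "m / 2 <= card F" using card unfolding m_def by linarith
  also have "real (card F) = (\<Sum>x\<in>F. w x * (1 / w x))" using wpos by (simp add: order_less_imp_not_eq2)
  also have "... <= (\<Sum>x\<in>F. w x powr p) powr (1/p) * (\<Sum>x\<in>F. (1 / w x) powr q) powr (1/q)"
   using pq wpos by (intro Holder_sum) (auto intro: less_imp_le)
  also have "... <= (\<Sum>x\<in>F. v x) powr (1/p) * S powr (1/q)"
  proof (intro mult_mono powr_mono2)
   show "(\<Sum>x\<in>F. (1 / w x) powr q) <= S" unfolding S_def F_def using wpos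
    by (intro order_trans[OF _ sum_mono2[of "{l..n}" "{l..n} - E"]] sum_mono)
     (auto simp: powr_minus_divide powr_divide less_imp_le)
  qed (use pq in \<open>auto simp: v_def intro: sum_nonneg\<close>)
  also have "... <= (\<Sum>x\<in>F. v x) powr (1/p) * (c' * m / V powr (1/p))"
  proof (intro mult_left_mono)
   have "(V/m) powr (1/p) * (S/m) powr (1/q) <= c" using w ln by (auto simp: muck_def avg_def V_def S_def m_def v_def)
   hence "V powr (1/p) * S powr (1/q) / (m powr (1/p) * m powr (1/q)) <= c'" using V S m c' by (simp add: powr_divide)
   also have "m powr (1/p) * m powr (1/q) = m" using pq m by (simp add: powr_add[symmetric])
   finally show "S powr (1/q) <= c' * m / V powr (1/p)" using m V by (simp add: field_simps)
  qed auto
  finally have "m * (1 / (2 * c')) <= m * ((\<Sum>x\<in>F. v x) powr (1/p) / V powr (1/p))"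
   using c' by (simp add: field_simps)
  hence "1 / (2 * c') <= ((\<Sum>x\<in>F. v x) / V) powr (1/p)"
   using m V vpos by (subst (asm) mult_le_cancel_left_pos) (auto simp: powr_divide sum_nonneg less_imp_le)
  hence "t <= (((\<Sum>x\<in>F. v x) / V) powr (1/p)) powr p" unfolding t_def using c' pq by (intro powr_mono2) auto
  hence "t <= (\<Sum>x\<in>F. v x) / V" using V vpos pq by (simp add: powr_powr sum_nonneg less_imp_le)
  moreover have "V = (\<Sum>x\<in>F. v x) + (\<Sum>x\<in>E. v x)"
   unfolding V_def F_def using E by (intro sum.subset_diff) auto
  ultimately show ?thesis using V unfolding V_def[symmetric] by (simp add: field_simps)
 qed
 obtain e K where eK: "e > 0" "K > 0" "!!l n. l <= n ==> avg (%k. v k powr (1+e)) l n <= K * avg v l n powr (1+e)"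
  by (rule reverse_holder[of v "1 - t"]) (use vpos t ainf in auto)
 show ?thesis
 proof (rule that[OF eK(1,2)])
  fix l n :: int assume "l <= n"
  from eK(3)[OF this] show "avg (%k. w k powr (p*(1+e))) l n <= K * avg (%k. w k powr p) l n powr (1+e)"
   by (simp add: v_def[abs_def] powr_powr)
 qed
qed

text \<open>The reverse Hoelder inequality is applied to \<open>w powr p\<close> and, since the
  condition is symmetric under inversion of \<open>w\<close>, also to \<open>w powr (-q)\<close>;
  thus both exponents grow at once.\<close>

lemma muck_open:
 assumes pq: "p > 1" "q > 1" "1/p + 1/q = 1" and w: "muck p q c w"
 obtains d c' where "d > 0" "muck (p + d) (q + d) c' w"
proof -
 have wpos: "0 < w k" for k using w by (auto simp: muck_def)
 obtain e K where e: "e > 0" "K > 0"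
  "!!l n. l <= n ==> avg (%k. w k powr (p*(1+e))) l n <= K * avg (%k. w k powr p) l n powr (1+e)"
  using muck_reverse_holder[OF pq w] by metis
 have qp: "1/q + 1/p = 1" using pq by simp
 obtain e' K' where e': "e' > 0" "K' > 0"
  "!!l n. l <= n ==> avg (%k. (1 / w k) powr (q*(1+e'))) l n <= K' * avg (%k. (1 / w k) powr q) l n powr (1+e')"
  using muck_reverse_holder[OF pq(2,1) qp muck_inverse[OF w]] by metis
 define s where "s = p * (1+e)"
 define t where "t = q * (1+e')"
 have st: "s > 0" "t > 0" using pq e e' by (auto simp: s_def t_def)
 have "muck s t (K powr (1/s) * K' powr (1/t) * c) w"
  unfolding muck_def
 proof (intro conjI allI impI wpos)
  fix l n :: int assume ln: "l <= n"
  define A where "A = avg (%k. w k powr p) l n"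
  define B where "B = avg (%k. w k powr (-q)) l n"
  have AB: "A \<ge> 0" "B \<ge> 0" by (auto simp: A_def B_def intro: avg_nonneg)
  have "avg (%k. w k powr s) l n powr (1/s) <= (K * A powr (1+e)) powr (1/s)"
   unfolding A_def s_def using e(3)[OF ln] st by (intro powr_mono2) (auto intro!: avg_nonneg simp: s_def)
  also have "... = K powr (1/s) * A powr (1/p)" using e AB pq by (simp add: powr_mult powr_powr s_def)
  finally have 1: "avg (%k. w k powr s) l n powr (1/s) <= K powr (1/s) * A powr (1/p)" .
  have inv: "avg (%k. w k powr (-r)) l n = avg (%k. (1 / w k) powr r) l n" for r
   using wpos by (simp add: powr_minus_divide powr_divide less_imp_le)
  have "avg (%k. w k powr (-t)) l n powr (1/t) <= (K' * B powr (1+e')) powr (1/t)"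
   unfolding B_def inv t_def using e'(3)[OF ln] st by (intro powr_mono2) (auto intro!: avg_nonneg simp: t_def)
  also have "... = K' powr (1/t) * B powr (1/q)" using e' AB pq by (simp add: powr_mult powr_powr t_def)
  finally have 2: "avg (%k. w k powr (-t)) l n powr (1/t) <= K' powr (1/t) * B powr (1/q)" .
  have "avg (%k. w k powr s) l n powr (1/s) * avg (%k. w k powr (-t)) l n powr (1/t)
    <= (K powr (1/s) * A powr (1/p)) * (K' powr (1/t) * B powr (1/q))" using 1 2 by (intro mult_mono) auto
  also have "... = K powr (1/s) * K' powr (1/t) * (A powr (1/p) * B powr (1/q))" by simp
  also have "... <= K powr (1/s) * K' powr (1/t) * c"
   using w ln by (intro mult_left_mono) (auto simp: muck_def A_def B_def)
  finally show "avg (%k. w k powr s) l n powr (1/s) * avg (%k. w k powr (-t)) l n powr (1/t) <= ..." .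
 qed
 note m = this
 define d where "d = min (p * e) (q * e')"
 have d: "0 < d" "d <= p * e" "d <= q * e'" using pq e e' by (auto simp: d_def)
 have "muck (p + d) (q + d) (K powr (1/s) * K' powr (1/t) * c) w"
  by (rule muck_mono[OF m]) (use pq d in \<open>auto simp: s_def t_def distrib_left\<close>)
 thus ?thesis using that d(1) by blast
qed

section \<open>The discrete Hilbert transform\<close>

text \<open>The diagonal terms vanish because \<open>x / 0 = 0\<close>.\<close>

definition hform :: "int set => int set => (int => real) => (int => real) => real" where
 "hform A B f g = (\<Sum>x\<in>B. \<Sum>y\<in>A. g x * f y / of_int (x - y))"

text \<open>The bound \<open>N\<close> for convolution with \<open>1/n\<close> on weighted
  \<open>l^p\<close>, in dual form: only finite double sums occur, and antisymmetry of the kernel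
  exchanges the two arguments.\<close>

definition hilb :: "real => real => real => (int => real) => bool" where
 "hilb p q N w \<longleftrightarrow> (\<forall>A B f g. finite A --> finite B -->
  \<bar>hform A B f g\<bar> <= N * (\<Sum>y\<in>A. (\<bar>f y\<bar> * w y) powr p) powr (1/p) * (\<Sum>x\<in>B. (\<bar>g x\<bar> / w x) powr q) powr (1/q))"

lemma hform_swap: "hform A B f g = - hform B A g f"
proof -
 have "hform A B f g = (\<Sum>y\<in>A. \<Sum>x\<in>B. g x * f y / of_int (x - y))"
  unfolding hform_def by (rule sum.swap)
 also have "... = (\<Sum>y\<in>A. \<Sum>x\<in>B. - (f y * g x / of_int (y - x)))"
 proof (intro sum.cong refl)
  fix x y
  have "real_of_int (y - x) = - of_int (x - y)" by simp
  thus "g x * f y / of_int (x - y) = - (f y * g x / of_int (y - x))" by (simp only: divide_minus_right minus_minus mult.commute)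
 qed
 finally show ?thesis by (simp add: hform_def sum_negf)
qed

lemma hilb_dual: "hilb p q N (%_. 1) ==> hilb q p N (%_. 1)"
proof (unfold hilb_def, intro allI impI)
 fix A B :: "int set" and f g :: "int => real"
 assume *: "\<forall>A B f g. finite A --> finite B -->
  \<bar>hform A B f g\<bar> <= N * (\<Sum>y\<in>A. (\<bar>f y\<bar> * 1) powr p) powr (1/p) * (\<Sum>x\<in>B. (\<bar>g x\<bar> / 1) powr q) powr (1/q)"
  and fin: "finite A" "finite B"
 have "\<bar>hform A B f g\<bar> = \<bar>hform B A g f\<bar>" by (subst hform_swap) simp
 thus "\<bar>hform A B f g\<bar> <= N * (\<Sum>y\<in>A. (\<bar>f y\<bar> * 1) powr q) powr (1/q) * (\<Sum>x\<in>B. (\<bar>g x\<bar> / 1) powr p) powr (1/p)"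
  using *[rule_format, OF fin(2,1), of g f] by (simp add: mult_ac)
qed

section \<open>The unweighted bound on square-summable sequences\<close>

lemma has_integral_cos_int:
 "((%t. cos (of_int n * t)) has_integral (if n = 0 then 2 * pi else 0)) {0..2*pi}"
proof (cases "n = 0")
 case True
 thus ?thesis using has_integral_const_real[of "1::real" 0 "2*pi"] by simp
next
 case False
 have "((%t. cos (of_int n * t)) has_integral (sin (of_int n * (2*pi)) / n - sin (of_int n * 0) / n)) {0..2*pi}"
  by (rule fundamental_theorem_of_calculus)
   (use False in \<open>auto intro!: derivative_eq_intros simp flip: has_real_derivative_iff_has_vector_derivative\<close>)
 moreover have "sin (of_int n * (2*pi)) = 0" using sin_integer_2pi[of "of_int n"] by (simp add: mult_ac)
 ultimately show ?thesis using False by simp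
qed

lemma has_integral_sawtooth_sin:
 "((%t. (pi - t) * sin (of_int n * t)) has_integral (2 * pi / of_int n)) {0..2*pi}"
proof (cases "n = 0")
 case False
 define G where "G t = - (pi - t) * cos (of_int n * t) / n - sin (of_int n * t) / (of_int n)^2" for t :: real
 have "((%t. (pi - t) * sin (of_int n * t)) has_integral (G (2*pi) - G 0)) {0..2*pi}" unfolding G_def
  by (rule fundamental_theorem_of_calculus)
   (use False in \<open>auto intro!: derivative_eq_intros simp: field_simps power2_eq_square
     simp flip: has_real_derivative_iff_has_vector_derivative\<close>)
 moreover have "sin (of_int n * (2*pi)) = 0" using sin_integer_2pi[of "of_int n"] by (simp add: mult_ac)
 moreover have "cos (of_int n * (2*pi)) = 1" using cos_integer_2pi[of "of_int n"] by (simp add: mult_ac)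
 ultimately show ?thesis using False by (simp add: G_def field_simps)
qed simp

lemma trig_square_integral:
 fixes f :: "int => real"
 assumes "finite A"
 shows "((%t. (\<Sum>y\<in>A. f y * cos (of_int y * t))\<^sup>2 + (\<Sum>y\<in>A. f y * sin (of_int y * t))\<^sup>2)
  has_integral (2 * pi * (\<Sum>y\<in>A. (f y)\<^sup>2))) {0..2*pi}"
proof -
 have "(\<Sum>y\<in>A. f y * cos (of_int y * t))\<^sup>2 + (\<Sum>y\<in>A. f y * sin (of_int y * t))\<^sup>2
   = (\<Sum>y\<in>A. \<Sum>z\<in>A. f y * f z * cos (of_int (y - z) * t))" for t
  by (simp add: power2_eq_square sum_product sum.distrib[symmetric] left_diff_distrib cos_diff algebra_simps)
 moreover have "((%t. \<Sum>y\<in>A. \<Sum>z\<in>A. f y * f z * cos (of_int (y - z) * t)) has_integral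
  (\<Sum>y\<in>A. \<Sum>z\<in>A. f y * f z * (if y - z = 0 then 2 * pi else 0))) {0..2*pi}"
  using assms by (intro has_integral_sum has_integral_mult_right has_integral_cos_int)
 moreover have "(\<Sum>y\<in>A. \<Sum>z\<in>A. f y * f z * (if y - z = 0 then 2 * pi else 0)) = 2 * pi * (\<Sum>y\<in>A. (f y)\<^sup>2)"
  using assms by (simp add: if_distrib[of "(*) _"] power2_eq_square sum_distrib_left mult_ac cong: if_cong)
 ultimately show ?thesis by simp
qed

text \<open>The sequence \<open>1/n\<close> consists of the sine coefficients of the bounded function \<open>\<pi> - t\<close>.\<close>

lemma hilb_two: "hilb 2 2 pi (%_. 1)"
 unfolding hilb_def
proof (intro allI impI)
 fix A B :: "int set" and f g :: "int => real"
 assume fin: "finite A" "finite B"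
 define F where "F = (\<Sum>y\<in>A. (f y)\<^sup>2)"
 define G where "G = (\<Sum>x\<in>B. (g x)\<^sup>2)"
 define Cf where "Cf t = (\<Sum>y\<in>A. f y * cos (of_int y * t))" for t
 define Sf where "Sf t = (\<Sum>y\<in>A. f y * sin (of_int y * t))" for t
 define Cg where "Cg t = (\<Sum>y\<in>B. g y * cos (of_int y * t))" for t
 define Sg where "Sg t = (\<Sum>y\<in>B. g y * sin (of_int y * t))" for t
 have FG: "F \<ge> 0" "G \<ge> 0" by (auto simp: F_def G_def sum_nonneg)
 have "((%t. \<Sum>x\<in>B. \<Sum>y\<in>A. g x * f y * ((pi - t) * sin (of_int (x - y) * t))) has_integral
  (\<Sum>x\<in>B. \<Sum>y\<in>A. g x * f y * (2 * pi / of_int (x - y)))) {0..2*pi}"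
  using fin by (intro has_integral_sum has_integral_mult_right has_integral_sawtooth_sin)
 moreover have "(\<Sum>x\<in>B. \<Sum>y\<in>A. g x * f y * ((pi - t) * sin (of_int (x - y) * t)))
   = (pi - t) * (Sg t * Cf t - Cg t * Sf t)" for t
  by (simp add: Cf_def Sf_def Cg_def Sg_def sum_product left_diff_distrib sin_diff sum_distrib_left
    sum_subtractf[symmetric] algebra_simps)
 moreover have "(\<Sum>x\<in>B. \<Sum>y\<in>A. g x * f y * (2 * pi / of_int (x - y))) = 2 * pi * hform A B f g"
  by (simp add: hform_def sum_distrib_left mult_ac)
 ultimately have int: "((%t. (pi - t) * (Sg t * Cf t - Cg t * Sf t)) has_integral 2 * pi * hform A B f g) {0..2*pi}"
  by simp
 \<comment> \<open>The integrands are compared by \<open>2 * |a * b| <= s * b^2 + a^2 / s\<close>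
   with a free parameter, later \<open>s = sqrt G / sqrt F\<close>; this stands in for the
   Cauchy-Schwarz inequality for integrals.\<close>
 have bd: "\<bar>hform A B f g\<bar> <= pi / 2 * (s * F + G / s)" if s: "s > 0" for s
 proof -
  have intb: "((%t. pi / 2 * (s * ((Cf t)\<^sup>2 + (Sf t)\<^sup>2) + ((Cg t)\<^sup>2 + (Sg t)\<^sup>2) / s)) has_integral
   pi / 2 * (s * (2 * pi * F) + (2 * pi * G) / s)) {0..2*pi}" unfolding Cf_def Sf_def Cg_def Sg_def F_def G_def
   by (intro has_integral_mult_right has_integral_add has_integral_divide trig_square_integral fin)
  have pt: "\<bar>(pi - t) * (Sg t * Cf t - Cg t * Sf t)\<bar> <= pi / 2 * (s * ((Cf t)\<^sup>2 + (Sf t)\<^sup>2) + ((Cg t)\<^sup>2 + (Sg t)\<^sup>2) / s)"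
   if t: "t \<in> {0..2*pi}" for t
  proof -
   have am: "2 * \<bar>a * b\<bar> <= s * b\<^sup>2 + a\<^sup>2 / s" for a b :: real
   proof -
    have "0 <= (sqrt s * \<bar>b\<bar> - \<bar>a\<bar> / sqrt s)\<^sup>2" by simp
    also have "... = s * b\<^sup>2 + a\<^sup>2 / s - 2 * \<bar>a * b\<bar>"
     using s by (simp add: power2_diff power_mult_distrib power_divide abs_mult)
    finally show ?thesis by simp
   qed
   have "\<bar>Sg t * Cf t - Cg t * Sf t\<bar> <= \<bar>Sg t * Cf t\<bar> + \<bar>Cg t * Sf t\<bar>" by (rule abs_triangle_ineq4)
   also have "... <= (s * ((Cf t)\<^sup>2 + (Sf t)\<^sup>2) + ((Cg t)\<^sup>2 + (Sg t)\<^sup>2) / s) / 2"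
    using am[of "Sg t" "Cf t"] am[of "Cg t" "Sf t"] by (simp add: distrib_left add_divide_distrib)
   finally have "\<bar>pi - t\<bar> * \<bar>Sg t * Cf t - Cg t * Sf t\<bar>
     <= pi * ((s * ((Cf t)\<^sup>2 + (Sf t)\<^sup>2) + ((Cg t)\<^sup>2 + (Sg t)\<^sup>2) / s) / 2)"
    using t by (intro mult_mono) auto
   thus ?thesis by (simp add: abs_mult)
  qed
  have "2 * pi * hform A B f g <= pi / 2 * (s * (2 * pi * F) + (2 * pi * G) / s)"
   by (rule has_integral_le[OF int intb]) (rule abs_le_D1[OF pt])
  moreover have "- (2 * pi * hform A B f g) <= pi / 2 * (s * (2 * pi * F) + (2 * pi * G) / s)"
   by (rule has_integral_le[OF has_integral_neg[OF int] intb]) (rule abs_le_D2[OF pt])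
  moreover have "pi / 2 * (s * (2 * pi * F) + (2 * pi * G) / s) = 2 * pi * (pi / 2 * (s * F + G / s))"
   by (simp add: algebra_simps)
  ultimately have "2 * pi * \<bar>hform A B f g\<bar> <= 2 * pi * (pi / 2 * (s * F + G / s))"
   by (cases "hform A B f g < 0") (simp_all only: abs_if if_True if_False mult_minus_right)
  thus ?thesis by (rule mult_left_le_imp_le) simp
 qed
 have "\<bar>hform A B f g\<bar> <= pi * sqrt F * sqrt G"
 proof (cases "F = 0 | G = 0")
  case True
  hence "(\<forall>y\<in>A. f y = 0) | (\<forall>x\<in>B. g x = 0)"
   using fin by (auto simp: F_def G_def sum_nonneg_eq_0_iff)
  hence "hform A B f g = 0" by (auto simp: hform_def)
  thus ?thesis using FG by simp
 next
  case False
  hence pos: "sqrt F > 0" "sqrt G > 0" using FG by auto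
  have e: "v / u * (u * u) + v * v / (v / u) = 2 * (u * v)" if "u > 0" "v > 0" for u v :: real using that by simp
  have "sqrt G / sqrt F * F + G / (sqrt G / sqrt F) = 2 * (sqrt F * sqrt G)" using e[OF pos] FG by simp
  thus ?thesis using bd[of "sqrt G / sqrt F"] pos by (simp only: divide_pos_pos) (simp add: mult_ac)
 qed
 thus "\<bar>hform A B f g\<bar> <= pi * (\<Sum>y\<in>A. (\<bar>f y\<bar> * 1) powr 2) powr (1/2) * (\<Sum>x\<in>B. (\<bar>g x\<bar> / 1) powr 2) powr (1/2)"
  using FG by (simp add: F_def G_def powr_half_sqrt)
qed

lemma hform_add_right: "hform A B f (%x. g x + h x) = hform A B f g + hform A B f h"
 by (simp add: hform_def sum.distrib[symmetric] distrib_right add_divide_distrib)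

lemma hform_diff_right: "hform A B f (%x. g x - h x) = hform A B f g - hform A B f h"
 by (simp add: hform_def sum_subtractf[symmetric] left_diff_distrib diff_divide_distrib)

lemma hform_split_left:
 assumes "finite A" "A' \<subseteq> A"
 shows "hform A B f g = hform A' B f g + hform (A - A') B f g"
proof -
 have "(\<Sum>y\<in>A. g x * f y / of_int (x - y))
   = (\<Sum>y\<in>A'. g x * f y / of_int (x - y)) + (\<Sum>y\<in>A - A'. g x * f y / of_int (x - y))" for x
  using sum.subset_diff[OF assms(2,1)] by (simp add: add.commute)
 thus ?thesis by (simp add: hform_def sum.distrib)
qed

section \<open>Sparse domination of the Hilbert transform\<close>

definition triple :: "int => int => int set" where
 "triple a b = {a - (b - a + 1)..b + (b - a + 1)}"

lemma triple_mono: "l <= a ==> a <= b ==> b <= n ==> triple a b \<subseteq> triple l n" by (auto simp: triple_def)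

lemma finite_triple [simp]: "finite (triple a b)" by (simp add: triple_def)

lemma card_triple: "a <= b ==> real (card (triple a b)) = 3 * real (card {a..b})" by (simp add: triple_def)

definition avg3 :: "(int => real) => int => int => real" where
 "avg3 F a b = avg F (a - (b - a + 1)) (b + (b - a + 1))"

lemma avg3_eq: "avg3 F a b = (\<Sum>y\<in>triple a b. F y) / card (triple a b)"
 by (simp add: avg3_def avg_def triple_def)

text \<open>For \<open>y\<close> outside the triple the maximum is the distance from
  \<open>y\<close> to \<open>{a..b}\<close>. The sum measures the influence of far points on a
  function of mean zero on \<open>{a..b}\<close>: differences of the kernel \<open>1/(x - y)\<close>
  decay quadratically.\<close>

definition tail :: "(int => real) => int set => int => int => real" where
 "tail f W a b = (\<Sum>y\<in>W - triple a b. \<bar>f y\<bar> / (of_int (max (a - y) (y - b)))\<^sup>2)"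

text \<open>Why a tail bound survives any number of halvings: for the child, the old part is
  multiplied by at most 2/3, since the length shrinks and the distances do not, and the shell
  between the two triples adds at most \<open>9 * S\<close>. The constant 27 is the fixed point
  \<open>27 = 2/3 * 27 + 9\<close>.\<close>

lemma tail_child:
 assumes c: "child a b a' b'" and W: "triple a b \<subseteq> W" "finite W"
  and t: "of_int (b - a + 1) * tail f W a b <= 27 * S" and f: "avg3 (%y. \<bar>f y\<bar>) a b <= S" and S: "0 <= S"
 shows "of_int (b' - a' + 1) * tail f W a' b' <= 27 * S"
proof -
 have ab: "a <= a'" "a' <= b'" "b' <= b" "3 * (b' - a' + 1) <= 2 * (b - a + 1)" "b - a + 1 <= 3 * (b' - a' + 1)"
  using c by (auto simp: child_def)
 define m where "m = real_of_int (b - a + 1)"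
 define m' where "m' = real_of_int (b' - a' + 1)"
 have mm: "m' > 0" "m > 0" "3 * m' <= 2 * m" "m <= 3 * m'"
 proof -
  show "m' > 0" "m > 0" using ab by (auto simp: m_def m'_def)
  have "real_of_int (3 * (b' - a' + 1)) <= of_int (2 * (b - a + 1))" using ab(4) by (simp only: of_int_le_iff)
  thus "3 * m' <= 2 * m" by (simp add: m_def m'_def)
  have "real_of_int (b - a + 1) <= of_int (3 * (b' - a' + 1))" using ab(5) by (simp only: of_int_le_iff)
  thus "m <= 3 * m'" by (simp add: m_def m'_def)
 qed
 have sub: "triple a' b' \<subseteq> triple a b" using ab by (intro triple_mono) auto
 let ?d = "%y a b. real_of_int (max (a - y) (y - b))"
 have split: "W - triple a' b' = (W - triple a b) \<union> (triple a b - triple a' b')" using sub W by auto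
 have "tail f W a' b' = (\<Sum>y\<in>W - triple a b. \<bar>f y\<bar> / (?d y a' b')\<^sup>2) + (\<Sum>y\<in>triple a b - triple a' b'. \<bar>f y\<bar> / (?d y a' b')\<^sup>2)"
  unfolding tail_def split using W by (intro sum.union_disjoint) auto
 also have "(\<Sum>y\<in>W - triple a b. \<bar>f y\<bar> / (?d y a' b')\<^sup>2) <= tail f W a b"
  unfolding tail_def
 proof (intro sum_mono divide_left_mono power_mono)
  fix y assume "y \<in> W - triple a b"
  hence "max (a - y) (y - b) > 0" "max (a - y) (y - b) <= max (a' - y) (y - b')" using ab by (auto simp: triple_def)
  thus "?d y a b <= ?d y a' b'" "0 <= ?d y a b" "0 < (?d y a' b')\<^sup>2 * (?d y a b)\<^sup>2"
   by (auto simp del: of_int_max simp: zero_less_mult_iff)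
 qed auto
 also have "(\<Sum>y\<in>triple a b - triple a' b'. \<bar>f y\<bar> / (?d y a' b')\<^sup>2) <= (\<Sum>y\<in>triple a b - triple a' b'. \<bar>f y\<bar> / m'\<^sup>2)"
 proof (intro sum_mono divide_left_mono power_mono)
  fix y assume "y \<in> triple a b - triple a' b'"
  hence *: "b' - a' + 1 <= max (a' - y) (y - b')" using ab by (auto simp: triple_def)
  thus "m' <= ?d y a' b'" unfolding m'_def by (simp only: of_int_le_iff)
  thus "0 < (?d y a' b')\<^sup>2 * m'\<^sup>2" using mm by (auto intro!: mult_pos_pos)
 qed (use mm in auto)
 also have "... <= (\<Sum>y\<in>triple a b. \<bar>f y\<bar> / m'\<^sup>2)" by (intro sum_mono2) auto
 also have "... = 3 * m * avg3 (%y. \<bar>f y\<bar>) a b / m'\<^sup>2"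
 proof -
  have "real (card (triple a b)) = 3 * m" using ab card_triple[of a b] by (simp add: m_def)
  hence "3 * m * avg3 (%y. \<bar>f y\<bar>) a b = (\<Sum>y\<in>triple a b. \<bar>f y\<bar>)" using mm by (simp add: avg3_eq)
  thus ?thesis by (simp add: sum_divide_distrib)
 qed
 also have "... <= 3 * m * S / m'\<^sup>2" using f mm by (intro divide_right_mono mult_left_mono) auto
 finally have "tail f W a' b' <= tail f W a b + 3 * m * S / m'\<^sup>2" by simp
 hence "m' * tail f W a' b' <= m' * (tail f W a b + 3 * m * S / m'\<^sup>2)" using mm by (intro mult_left_mono) auto
 also have "... = (m' / m) * (m * tail f W a b) + 3 * S * (m / m')" using mm by (simp add: power2_eq_square field_simps)
 also have "... <= (2 / 3) * (27 * S) + 3 * S * 3"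
 proof (rule add_mono)
  have "0 <= tail f W a b" unfolding tail_def by (intro sum_nonneg) auto
  thus "(m' / m) * (m * tail f W a b) <= (2 / 3) * (27 * S)"
   using mm t S unfolding m_def[symmetric] by (intro mult_mono[of _ _ _ "27 * S"]) (auto simp: divide_le_eq)
  show "3 * S * (m / m') <= 3 * S * 3" using mm S by (intro mult_left_mono) (auto simp: field_simps)
 qed
 finally show ?thesis by (simp add: m'_def)
qed

text \<open>As \<open>g\<close> has sum zero, \<open>1/(a - y)\<close> may be subtracted from the
  kernel; the difference is at most the length of the interval over the squared distance.\<close>

lemma hform_cancel:
 assumes ab: "a <= b" and W: "triple a b \<subseteq> W" "finite W" and g0: "(\<Sum>x=a..b. g x) = 0"
 shows "\<bar>hform (W - triple a b) {a..b} f g\<bar> <= of_int (b - a + 1) * tail f W a b * (\<Sum>x=a..b. \<bar>g x\<bar>)"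
proof -
 define m where "m = real_of_int (b - a + 1)"
 have "hform (W - triple a b) {a..b} f g = (\<Sum>y\<in>W - triple a b. \<Sum>x=a..b. g x * f y / of_int (x - y))"
  unfolding hform_def by (rule sum.swap)
 also have "... = (\<Sum>y\<in>W - triple a b. \<Sum>x=a..b. g x * f y * (1 / of_int (x - y) - 1 / of_int (a - y)))"
 proof (rule sum.cong[OF refl])
  fix y
  have "(\<Sum>x=a..b. g x * f y * (1 / of_int (x - y) - 1 / of_int (a - y)))
    = (\<Sum>x=a..b. g x * f y / of_int (x - y)) - (\<Sum>x=a..b. g x) * (f y / of_int (a - y))"
   by (simp add: sum_subtractf right_diff_distrib sum_distrib_right sum_divide_distrib)
  thus "(\<Sum>x=a..b. g x * f y / of_int (x - y)) = (\<Sum>x=a..b. g x * f y * (1 / of_int (x - y) - 1 / of_int (a - y)))"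
   using g0 by simp
 qed
 finally have eq: "hform (W - triple a b) {a..b} f g
  = (\<Sum>y\<in>W - triple a b. \<Sum>x=a..b. g x * f y * (1 / of_int (x - y) - 1 / of_int (a - y)))" .
 have pt: "\<bar>g x * f y * (1 / of_int (x - y) - 1 / of_int (a - y))\<bar> <= \<bar>g x\<bar> * \<bar>f y\<bar> * (m / (of_int (max (a - y) (y - b)))\<^sup>2)"
  if y: "y \<in> W - triple a b" and x: "x \<in> {a..b}" for x y
 proof -
  define d where "d = max (a - y) (y - b)"
  have d: "d > 0" "d <= \<bar>x - y\<bar>" "d <= \<bar>a - y\<bar>" "\<bar>a - x\<bar> <= b - a + 1"
   using x y ab by (auto simp: d_def triple_def)
  have r: "real_of_int d > 0" "real_of_int d <= \<bar>real_of_int (x - y)\<bar>" "real_of_int d <= \<bar>real_of_int (a - y)\<bar>"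
   "\<bar>real_of_int (a - x)\<bar> <= m"
   using d unfolding m_def by (simp_all only: of_int_abs[symmetric] of_int_le_iff of_int_0_less_iff)
  have nz: "real_of_int (x - y) ~= 0" "real_of_int (a - y) ~= 0" using r by auto
  have "1 / real_of_int (x - y) - 1 / of_int (a - y) = of_int (a - x) / (of_int (x - y) * of_int (a - y))"
   using nz by (simp add: divide_simps)
  hence "\<bar>1 / real_of_int (x - y) - 1 / of_int (a - y)\<bar> = \<bar>real_of_int (a - x)\<bar> / (\<bar>real_of_int (x - y)\<bar> * \<bar>real_of_int (a - y)\<bar>)"
   by (simp only: abs_divide abs_mult)
  also have "... <= m / (of_int d * of_int d)" using r by (intro frac_le mult_mono) auto
  finally have "\<bar>1 / real_of_int (x - y) - 1 / of_int (a - y)\<bar> <= m / (of_int d)\<^sup>2" by (simp add: power2_eq_square)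
  thus ?thesis unfolding d_def abs_mult by (intro mult_left_mono) auto
 qed
 have "\<bar>hform (W - triple a b) {a..b} f g\<bar> <= (\<Sum>y\<in>W - triple a b. \<Sum>x=a..b. \<bar>g x\<bar> * \<bar>f y\<bar> * (m / (of_int (max (a - y) (y - b)))\<^sup>2))"
  unfolding eq by (rule order_trans[OF sum_abs sum_mono], rule order_trans[OF sum_abs sum_mono], rule pt)
 also have "... = m * tail f W a b * (\<Sum>x=a..b. \<bar>g x\<bar>)"
  unfolding tail_def by (simp add: sum_distrib_left sum_distrib_right sum_divide_distrib mult_ac del: of_int_max)
 finally show ?thesis by (simp add: m_def)
qed

lemma avg_le_power_mean:
 assumes "l <= n" "1 <= r" "!!x. x \<in> {l..n} ==> 0 <= f x"
 shows "avg f l n <= avg (%x. f x powr r) l n powr (1/r)"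
proof -
 have "(\<Sum>x=l..n. f x powr 1) = (\<Sum>x=l..n. f x)" using assms by (intro sum.cong) auto
 hence e: "avg (%x. f x powr 1) l n = avg f l n" by (simp only: avg_def)
 have "0 <= avg f l n" using assms by (intro avg_nonneg) auto
 hence "avg f l n = avg f l n powr (1/1)" by simp
 also have "... = avg (%x. f x powr 1) l n powr (1/1)" by (simp only: e)
 also have "... <= avg (%x. f x powr r) l n powr (1/r)" unfolding avg_def using assms by (intro power_mean_mono) auto
 finally show ?thesis .
qed

context
 fixes r r' N :: real
 assumes r: "r > 1" "r' > 1" "1/r + 1/r' = 1" and N: "0 <= N" and hilb: "hilb r r' N (%_. 1)"
begin

lemma hilb_bound: "finite A ==> finite B ==>
  \<bar>hform A B f g\<bar> <= N * (\<Sum>y\<in>A. \<bar>f y\<bar> powr r) powr (1/r) * (\<Sum>x\<in>B. \<bar>g x\<bar> powr r') powr (1/r')"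
 using hilb by (simp add: hilb_def)

text \<open>The local part, where nothing cancels: the assumed bound on \<open>l^r\<close> is used
  as it stands, and \<open>3 powr (1/r)\<close> and \<open>k powr (1/r)\<close> are estimated
  crudely by \<open>3\<close> and \<open>k\<close>.\<close>

lemma hilb_bound_avg:
 assumes "a <= b" "!!x. x \<in> {a..b} ==> \<bar>g x\<bar> <= c" "avg3 (%y. \<bar>f y\<bar> powr r) a b <= k * s" "1 <= k" "0 <= s" "0 <= c"
 shows "\<bar>hform (triple a b) {a..b} f g\<bar> <= N * (3 * k * card {a..b} * s powr (1/r) * c)"
proof -
 define m where "m = real (card {a..b})"
 have m: "m > 0" using assms by (simp add: m_def)
 have pw: "x powr (1/r) <= x" if "1 <= x" for x :: real using powr_mono[of "1/r" 1 x] that r by simp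
 have "(\<Sum>y\<in>triple a b. \<bar>f y\<bar> powr r) = 3 * m * avg3 (%y. \<bar>f y\<bar> powr r) a b"
  using card_triple[OF assms(1)] m by (simp add: avg3_eq m_def)
 also have "... <= 3 * m * (k * s)" using assms m by (intro mult_left_mono) auto
 finally have "(\<Sum>y\<in>triple a b. \<bar>f y\<bar> powr r) powr (1/r) <= (3 * m * (k * s)) powr (1/r)"
  using r by (intro powr_mono2) (auto intro: sum_nonneg)
 also have "... = 3 powr (1/r) * m powr (1/r) * (k powr (1/r) * s powr (1/r))" using m assms by (simp add: powr_mult)
 also have "... <= 3 * m powr (1/r) * (k * s powr (1/r))"
  using pw[of 3] pw[OF assms(4)] m assms by (intro mult_mono) auto
 finally have 1: "(\<Sum>y\<in>triple a b. \<bar>f y\<bar> powr r) powr (1/r) <= 3 * m powr (1/r) * (k * s powr (1/r))" .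
 have "(\<Sum>x=a..b. \<bar>g x\<bar> powr r') <= (\<Sum>x=a..b. c powr r')"
  using assms r by (intro sum_mono powr_mono2) auto
 hence "(\<Sum>x=a..b. \<bar>g x\<bar> powr r') powr (1/r') <= (m * c powr r') powr (1/r')"
  using r by (intro powr_mono2) (auto intro: sum_nonneg simp: m_def)
 also have "... = m powr (1/r') * c" using m assms r by (simp add: powr_mult powr_powr)
 finally have 2: "(\<Sum>x=a..b. \<bar>g x\<bar> powr r') powr (1/r') <= m powr (1/r') * c" .
 have "\<bar>hform (triple a b) {a..b} f g\<bar>
  <= N * ((\<Sum>y\<in>triple a b. \<bar>f y\<bar> powr r) powr (1/r) * (\<Sum>x=a..b. \<bar>g x\<bar> powr r') powr (1/r'))"
  using hilb_bound[of "triple a b" "{a..b}" f g] by (simp add: mult.assoc)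
 also have "... <= N * ((3 * m powr (1/r) * (k * s powr (1/r))) * (m powr (1/r') * c))"
  using N 1 2 assms m by (intro mult_left_mono mult_mono) auto
 also have "... = N * (3 * k * (m powr (1/r) * m powr (1/r')) * s powr (1/r) * c)" by (simp add: mult_ac)
 also have "m powr (1/r) * m powr (1/r') = m" using r m by (simp add: powr_add[symmetric])
 finally show ?thesis by (simp add: m_def)
qed

lemma abs_avg_le: "\<bar>avg g a b\<bar> <= avg (%x. \<bar>g x\<bar>) a b"
 unfolding avg_def abs_divide by (simp add: divide_right_mono sum_abs)

text \<open>A Calderon-Zygmund step. \<open>g\<close> is split into a bounded function
  \<open>h\<close>, equal to the mean of \<open>g\<close> on each stopping interval and to
  \<open>g\<close> elsewhere, and a rest with sum zero on each of these intervals. The assumed bound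
  handles \<open>h\<close>. The rest on a stopping interval is handled outside the triple by
  cancellation; inside the triple, what is not bounded directly is the same form on a smaller
  interval, with \<open>g\<close> unchanged, and is kept for the recursion. The constants are
  \<open>3 * 96\<close>, \<open>3 * 96 * 96\<close> and \<open>27 * 32 * 6 * 32\<close>.\<close>

lemma domination_step:
 fixes f g :: "int => real" and l n :: int
 defines "m \<equiv> real (card {l..n})"
  and "\<phi> \<equiv> avg3 (%y. \<bar>f y\<bar> powr r) l n powr (1/r)" and "\<gamma> \<equiv> avg (%x. \<bar>g x\<bar>) l n"
 assumes ln: "l <= n"
 shows "\<exists>P Good Bad. stopping Good Bad l n P & 2 * card (stop_union P) <= card {l..n} &
  \<bar>hform (triple l n) {l..n} f g\<bar> <= (288 * N + 27648 * N + 165888) * m * \<phi> * \<gamma>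
   + (\<Sum>I\<in>P. \<bar>hform (triple (fst I) (snd I)) {fst I..snd I} f g\<bar>)"
proof -
 define F where "F y = \<bar>f y\<bar> powr r" for y
 \<comment> \<open>With 32 the weak-type bounds allow at most \<open>12/32\<close> of the length to
   be stopped because of \<open>f\<close>, which is averaged over triples, and \<open>4/32\<close>
   because of \<open>g\<close>: together one half.\<close>
 define A :: real where "A = 32"
 define s where "s = avg3 F l n"
 have \<phi>: "\<phi> = s powr (1/r)" by (simp add: \<phi>_def s_def F_def[abs_def])
 have m: "m > 0" using ln by (simp add: m_def)
 have F0: "F y \<ge> 0" for y by (simp add: F_def)
 have s0: "s \<ge> 0" unfolding s_def avg3_def using F0 by (intro avg_nonneg) auto
 have \<gamma>0: "\<gamma> \<ge> 0" unfolding \<gamma>_def by (intro avg_nonneg) auto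
 have \<phi>0: "\<phi> \<ge> 0" by (simp add: \<phi>)
 define W where "W = triple l n"
 define S where "S = A * \<phi>"
 have S0: "S \<ge> 0" using \<phi>0 by (simp add: S_def A_def)
 define bad where "bad a b \<longleftrightarrow> A * s < avg3 F a b | A * \<gamma> < avg (%x. \<bar>g x\<bar>) a b" for a b
 define tl where "tl a b \<longleftrightarrow> of_int (b - a + 1) * tail f W a b <= 27 * S" for a b
 \<comment> \<open>The tail bound is part of both predicates: good intervals pass it on to their
   children, and it is needed on the stopping intervals themselves. Which intervals are stopped is
   decided by \<open>bad\<close>.\<close>
 define Good where "Good a b \<longleftrightarrow> ~ bad a b & tl a b & l <= a & a <= b & b <= n" for a b
 define Bad where "Bad a b \<longleftrightarrow> bad a b & tl a b" for a b
 have favg: "avg3 (%y. \<bar>f y\<bar>) a b <= S" if "avg3 F a b <= A * s" "a <= b" for a b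
 proof -
  have "avg3 (%y. \<bar>f y\<bar>) a b <= avg3 F a b powr (1/r)"
   unfolding avg3_def F_def using that r by (intro avg_le_power_mean) auto
  also have "... <= (A * s) powr (1/r)" using that r by (intro powr_mono2) (auto simp: avg3_def intro!: avg_nonneg F0)
  also have "... = A powr (1/r) * s powr (1/r)" using s0 by (simp add: powr_mult A_def)
  also have "... <= A * s powr (1/r)" using powr_mono[of "1/r" 1 A] r by (intro mult_right_mono) (auto simp: A_def)
  finally show ?thesis by (simp add: S_def \<phi>)
 qed
 have childtl: "tl a' b'" if "Good a b" "child a b a' b'" for a b a' b'
 proof -
  have G: "~ bad a b" "of_int (b - a + 1) * tail f W a b <= 27 * S" "l <= a" "a <= b" "b <= n"
   using that(1) by (simp_all add: Good_def tl_def)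
  have sub: "triple a b \<subseteq> W" unfolding W_def using G by (intro triple_mono)
  have "avg3 F a b <= A * s" using G(1) by (simp add: bad_def not_less)
  thus ?thesis unfolding tl_def using tail_child[OF that(2) sub _ G(2) favg[OF _ G(4)] S0] by (simp add: W_def)
 qed
 have "\<exists>P. stopping Good Bad l n P"
 proof (rule stopping_exists)
  have "tail f W l n = 0" by (simp add: tail_def W_def)
  moreover have "~ bad l n" using s0 \<gamma>0 unfolding bad_def s_def[symmetric] \<gamma>_def[symmetric] A_def by simp
  ultimately show "Good l n" using ln S0 by (simp add: Good_def tl_def)
  show "Good a' b' | Bad a' b'" if "Good a b" "l <= a" "b <= n" "child a b a' b'" for a b a' b'
   using childtl[OF that(1,4)] that by (auto simp: Good_def Bad_def child_def)
 qed (rule ln)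
 then obtain P where P: "stopping Good Bad l n P" by blast
 define U where "U = stop_union P"
 have U: "U \<subseteq> {l..n}" using stop_union_subset[OF P] by (simp add: U_def)
 have finU: "finite U" using U finite_subset by blast
 define l3 where "l3 = l - (n - l + 1)"
 define n3 where "n3 = n + (n - l + 1)"
 have W_eq: "W = {l3..n3}" by (simp add: W_def triple_def l3_def n3_def)
 \<comment> \<open>If \<open>s = 0\<close>, then \<open>f\<close> vanishes on the triple and no
   interval is stopped because of \<open>f\<close>; the condition \<open>0 < s\<close> makes the set
   empty in this case, where the weak-type bound says nothing. Likewise for \<open>\<gamma>\<close>
   in \<open>UG\<close>.\<close>
 define UF where "UF = {x\<in>{l3..n3}. 0 < s & A * s < maxfun l3 n3 (%_. 1) F x}"
 define UG where "UG = {x\<in>{l..n}. 0 < \<gamma> & A * \<gamma> < maxfun l n (%_. 1) (%x. \<bar>g x\<bar>) x}"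
 have UU: "U \<subseteq> UF \<union> UG"
 proof
  fix x assume "x \<in> U"
  then obtain a b where ab: "(a, b) \<in> P" "x \<in> {a..b}" by (auto simp: U_def stop_union_def)
  note D = stopping_memD[OF P ab(1)]
  from D(4) consider "A * s < avg3 F a b" | "A * \<gamma> < avg (%x. \<bar>g x\<bar>) a b" by (auto simp: Bad_def bad_def)
  thus "x \<in> UF \<union> UG"
  proof cases
   case 1
   have sub: "triple a b \<subseteq> triple l n" using D by (intro triple_mono)
   have "s ~= 0"
   proof
    assume "s = 0"
    hence "(\<Sum>y\<in>triple l n. F y) = 0" using ln by (simp add: s_def avg3_eq triple_def)
    hence "\<forall>y\<in>triple l n. F y = 0" using F0 by (simp add: sum_nonneg_eq_0_iff)
    hence "(\<Sum>y\<in>triple a b. F y) = 0" using sub by (intro sum.neutral) auto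
    thus False using 1 \<open>s = 0\<close> by (simp add: avg3_eq)
   qed
   moreover have "avg3 F a b <= maxfun l3 n3 (%_. 1) F x" unfolding avg3_def wavg_one[symmetric] using D ab(2)
    by (intro wavg_le_maxfun) (auto simp: l3_def n3_def)
   ultimately show ?thesis using 1 s0 D ab(2) by (auto simp: UF_def l3_def n3_def)
  next
   case 2
   have "\<gamma> ~= 0"
   proof
    assume "\<gamma> = 0"
    hence "(\<Sum>y=l..n. \<bar>g y\<bar>) = 0" using ln by (simp add: \<gamma>_def avg_def)
    hence "\<forall>y\<in>{l..n}. \<bar>g y\<bar> = 0" by (simp add: sum_nonneg_eq_0_iff)
    hence "(\<Sum>y=a..b. \<bar>g y\<bar>) = 0" using D by (intro sum.neutral) auto
    thus False using 2 \<open>\<gamma> = 0\<close> by (simp add: avg_def)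
   qed
   moreover have "avg (%x. \<bar>g x\<bar>) a b <= maxfun l n (%_. 1) (%x. \<bar>g x\<bar>) x"
    unfolding wavg_one[symmetric] using D ab(2) by (intro wavg_le_maxfun) auto
   ultimately show ?thesis using 2 \<gamma>0 D ab(2) by (auto simp: UG_def)
  qed
 qed
 have cF: "32 * real (card UF) <= 12 * m"
 proof (cases "s = 0")
  case False
  have "A * s * card {x\<in>{l3..n3}. A * s < maxfun l3 n3 (%_. 1) F x} <= 4 * (\<Sum>x=l3..n3. F x)"
   using False s0 F0 by (intro maxfun_weak_card) (auto simp: A_def)
  also have "(\<Sum>x=l3..n3. F x) = 3 * m * s"
   using card_triple[OF ln] m by (simp add: s_def avg3_eq W_eq[symmetric] W_def m_def)
  finally have "s * (32 * card UF) <= s * (12 * m)" using False s0 by (simp add: UF_def A_def mult_ac)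
  thus ?thesis using False s0 by simp
 qed (use m in \<open>simp add: UF_def\<close>)
 have cG: "32 * real (card UG) <= 4 * m"
 proof (cases "\<gamma> = 0")
  case False
  have "A * \<gamma> * card {x\<in>{l..n}. A * \<gamma> < maxfun l n (%_. 1) (%x. \<bar>g x\<bar>) x} <= 4 * (\<Sum>x=l..n. \<bar>g x\<bar>)"
   using False \<gamma>0 by (intro maxfun_weak_card) (auto simp: A_def)
  also have "(\<Sum>x=l..n. \<bar>g x\<bar>) = m * \<gamma>" using m by (simp add: \<gamma>_def avg_def m_def)
  finally have "\<gamma> * (32 * card UG) <= \<gamma> * (4 * m)" using False \<gamma>0 by (simp add: UG_def A_def mult_ac)
  thus ?thesis using False \<gamma>0 by simp
 qed (use m in \<open>simp add: UG_def\<close>)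
 have "finite UF" "finite UG"
  unfolding UF_def UG_def by (auto intro: finite_subset[of _ "{l3..n3}"] finite_subset[of _ "{l..n}"])
 hence "card U <= card (UF \<union> UG)" using UU by (intro card_mono) auto
 also have "... <= card UF + card UG" by (rule card_Un_le)
 finally have "real (card U) <= real (card UF) + real (card UG)" by (simp only: of_nat_add[symmetric] of_nat_le_iff)
 hence "real (2 * card U) <= m" using cF cG by simp
 hence cU: "2 * card U <= card {l..n}" unfolding m_def by (simp only: of_nat_le_iff)
 let ?c = "%I. avg g (fst I) (snd I)"
 have mem: "fst I <= snd I" "l <= fst I" "snd I <= n" "\<bar>?c I\<bar> <= 3 * A * \<gamma>" "avg (%x. \<bar>g x\<bar>) (fst I) (snd I) <= 3 * A * \<gamma>"
  "avg3 F (fst I) (snd I) <= 96 * s" "tl (fst I) (snd I)" if IP: "I \<in> P" for I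
 proof -
  obtain a b where I: "I = (a, b)" "(a, b) \<in> P" using IP by (cases I) auto
  note D = stopping_memD[OF P I(2)]
  obtain a' b' where ab: "Good a' b'" "child a' b' a b" using D(6) by auto
  show "fst I <= snd I" "l <= fst I" "snd I <= n" using D by (auto simp: I)
  have "avg (%x. \<bar>g x\<bar>) a b <= of_int 3 * avg (%x. \<bar>g x\<bar>) a' b'"
   using ab(2) by (intro avg_mono_interval) (auto simp: child_def)
  also have "... <= of_int 3 * (A * \<gamma>)" using ab(1) by (intro mult_left_mono) (auto simp: Good_def bad_def not_less)
  finally show g3: "avg (%x. \<bar>g x\<bar>) (fst I) (snd I) <= 3 * A * \<gamma>" by (simp add: I)
  show "\<bar>?c I\<bar> <= 3 * A * \<gamma>" using abs_avg_le[of g "fst I" "snd I"] g3 by linarith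
  have "avg3 F a b <= of_int 3 * avg3 F a' b'"
   unfolding avg3_def using ab(2) F0 by (intro avg_mono_interval) (auto simp: child_def)
  also have "... <= of_int 3 * (A * s)" using ab(1) by (intro mult_left_mono) (auto simp: Good_def bad_def not_less)
  finally show "avg3 F (fst I) (snd I) <= 96 * s" by (simp add: I A_def)
  show "tl (fst I) (snd I)" using D(4) by (simp add: Bad_def I)
 qed
 have disj: "x \<notin> {fst J..snd J}" if "I \<in> P" "J \<in> P" "I ~= J" "x \<in> {fst I..snd I}" for I J x
  using P that unfolding stopping_def by blast
 \<comment> \<open>By disjointness the sum over \<open>P\<close> has one nonzero summand at most,
   the mean over the stopping interval that contains \<open>x\<close>.\<close>
 define h where "h x = (if x \<in> U then \<Sum>I\<in>P. (if x \<in> {fst I..snd I} then ?c I else 0) else g x)" for x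
 have hI: "h x = ?c I" if "I \<in> P" "x \<in> {fst I..snd I}" for x I
 proof -
  have "x \<in> U" using that by (auto simp: U_def stop_union_def)
  moreover have "(\<Sum>J\<in>P. (if x \<in> {fst J..snd J} then ?c J else 0)) = (\<Sum>J\<in>P. if J = I then ?c I else 0)"
   using disj[OF that(1) _ _ that(2)] that(2) by (intro sum.cong) auto
  moreover have "finite P" using P by (auto simp: stopping_def)
  ultimately show ?thesis using that(1) by (simp add: h_def)
 qed
 have hb: "\<bar>h x\<bar> <= 3 * A * \<gamma>" if "x \<in> {l..n}" for x
 proof (cases "x \<in> U")
  case True
  then obtain I where "I \<in> P" "x \<in> {fst I..snd I}" by (auto simp: U_def stop_union_def)
  thus ?thesis using hI mem(4) by auto
 next
  case False
  hence "\<forall>(a, b)\<in>P. x \<notin> {a..b}" unfolding U_def stop_union_def by force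
  hence "Good x x" using P that by (auto simp: stopping_def)
  hence "\<bar>g x\<bar> <= A * \<gamma>" by (simp add: Good_def bad_def avg_def not_less)
  thus ?thesis using False \<gamma>0 by (simp add: h_def A_def)
 qed
 have T: "hform W {l..n} f (%x. g x - h x) = (\<Sum>I\<in>P. hform W {fst I..snd I} f (%x. g x - ?c I))"
 proof -
  let ?H = "%k x. \<Sum>y\<in>W. k x * f y / real_of_int (x - y)"
  have "(\<Sum>x=l..n. ?H (%x. g x - h x) x) = (\<Sum>x\<in>{l..n} - stop_union P. ?H (%x. g x - h x) x)
    + (\<Sum>I\<in>P. \<Sum>x=fst I..snd I. ?H (%x. g x - h x) x)" by (rule stopping_sum_split[OF P])
  also have "(\<Sum>x\<in>{l..n} - stop_union P. ?H (%x. g x - h x) x) = 0"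
   by (intro sum.neutral ballI) (auto simp: h_def U_def)
  also have "(\<Sum>I\<in>P. \<Sum>x=fst I..snd I. ?H (%x. g x - h x) x) = (\<Sum>I\<in>P. \<Sum>x=fst I..snd I. ?H (%x. g x - ?c I) x)"
   by (intro sum.cong refl) (simp only: hI)
  finally show ?thesis by (simp add: hform_def)
 qed
 have "hform W {l..n} f g = hform W {l..n} f h + hform W {l..n} f (%x. g x - h x)"
  by (simp add: hform_add_right[symmetric])
 hence "\<bar>hform W {l..n} f g\<bar> <= \<bar>hform W {l..n} f h\<bar> + \<bar>\<Sum>I\<in>P. hform W {fst I..snd I} f (%x. g x - ?c I)\<bar>"
  unfolding T by linarith
 also have "\<bar>hform W {l..n} f h\<bar> <= N * (3 * 1 * real (card {l..n}) * s powr (1/r) * (3 * A * \<gamma>))"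
  unfolding W_def using hb \<gamma>0 s0 ln by (intro hilb_bound_avg) (auto simp: s_def F_def[abs_def] A_def)
 also have "\<bar>\<Sum>I\<in>P. hform W {fst I..snd I} f (%x. g x - ?c I)\<bar>
   <= (\<Sum>I\<in>P. \<bar>hform W {fst I..snd I} f (%x. g x - ?c I)\<bar>)" by (rule sum_abs)
 also have "... <= (\<Sum>I\<in>P. \<bar>hform (triple (fst I) (snd I)) {fst I..snd I} f g\<bar>
   + (27648 * N + 165888) * \<phi> * \<gamma> * card {fst I..snd I})"
 proof (rule sum_mono)
  fix I assume I: "I \<in> P"
  define a where "a = fst I" define b where "b = snd I"
  note D = mem[OF I, folded a_def b_def]
  define c where "c = avg g a b"
  define k where "k = real (card {a..b})"
  have k: "k > 0" "real_of_int (b - a + 1) = k" using D by (auto simp: k_def)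
  have sub: "triple a b \<subseteq> W" unfolding W_def using D by (intro triple_mono)
  have "hform W {a..b} f (%x. g x - c) = hform (triple a b) {a..b} f (%x. g x - c) + hform (W - triple a b) {a..b} f (%x. g x - c)"
   using sub by (intro hform_split_left) (auto simp: W_def)
  also have "hform (triple a b) {a..b} f (%x. g x - c) = hform (triple a b) {a..b} f g - hform (triple a b) {a..b} f (%_. c)"
   by (rule hform_diff_right)
  finally have "\<bar>hform W {a..b} f (%x. g x - c)\<bar> <= \<bar>hform (triple a b) {a..b} f g\<bar>
   + \<bar>hform (triple a b) {a..b} f (%_. c)\<bar> + \<bar>hform (W - triple a b) {a..b} f (%x. g x - c)\<bar>" by linarith
  also have "\<bar>hform (triple a b) {a..b} f (%_. c)\<bar> <= N * (3 * 96 * real (card {a..b}) * s powr (1/r) * (3 * A * \<gamma>))"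
   using D s0 \<gamma>0 by (intro hilb_bound_avg) (auto simp: F_def[abs_def] c_def A_def)
  also have "\<bar>hform (W - triple a b) {a..b} f (%x. g x - c)\<bar>
   <= of_int (b - a + 1) * tail f W a b * (\<Sum>x=a..b. \<bar>g x - c\<bar>)"
  proof (rule hform_cancel[OF D(1) sub])
   show "finite W" by (simp add: W_def)
   have "k * c = (\<Sum>x=a..b. g x)" using k by (simp add: c_def avg_def k_def)
   thus "(\<Sum>x=a..b. g x - c) = 0" by (simp add: sum_subtractf k_def)
  qed
  also have "... <= (27 * S) * (k * (6 * A * \<gamma>))"
  proof (rule mult_mono)
   show "of_int (b - a + 1) * tail f W a b <= 27 * S" using D(7) by (simp add: tl_def)
   have "(\<Sum>x=a..b. \<bar>g x - c\<bar>) <= (\<Sum>x=a..b. \<bar>g x\<bar> + \<bar>c\<bar>)" by (intro sum_mono abs_triangle_ineq4)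
   also have "... = k * (avg (%x. \<bar>g x\<bar>) a b + \<bar>c\<bar>)" using k by (simp add: sum.distrib avg_def k_def distrib_left)
   also have "... <= k * (3 * A * \<gamma> + 3 * A * \<gamma>)" using D(4,5) k by (intro mult_left_mono add_mono) (auto simp: c_def)
   finally show "(\<Sum>x=a..b. \<bar>g x - c\<bar>) <= k * (6 * A * \<gamma>)" by (simp add: algebra_simps)
  qed (use S0 in \<open>auto intro: sum_nonneg\<close>)
  finally show "\<bar>hform W {fst I..snd I} f (%x. g x - ?c I)\<bar> <= \<bar>hform (triple (fst I) (snd I)) {fst I..snd I} f g\<bar>
   + (27648 * N + 165888) * \<phi> * \<gamma> * card {fst I..snd I}"
   unfolding a_def[symmetric] b_def[symmetric] c_def[symmetric] k_def[symmetric] S_def A_def \<phi>[symmetric]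
   by (simp add: algebra_simps)
 qed
 also have "... = (\<Sum>I\<in>P. \<bar>hform (triple (fst I) (snd I)) {fst I..snd I} f g\<bar>) + (27648 * N + 165888) * \<phi> * \<gamma> * card U"
  using stopping_sum[OF P, of "%_. 1"] by (simp add: sum.distrib sum_distrib_left[symmetric] U_def)
 also have "(27648 * N + 165888) * \<phi> * \<gamma> * card U <= (27648 * N + 165888) * \<phi> * \<gamma> * m"
  using \<open>real (2 * card U) <= m\<close> N \<phi>0 \<gamma>0 by (intro mult_left_mono) auto
 finally have "\<bar>hform W {l..n} f g\<bar> <= (288 * N + 27648 * N + 165888) * m * \<phi> * \<gamma>
   + (\<Sum>I\<in>P. \<bar>hform (triple (fst I) (snd I)) {fst I..snd I} f g\<bar>)"
  unfolding \<phi>[symmetric] m_def[symmetric] A_def by (simp add: algebra_simps)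
 thus ?thesis using P cU unfolding U_def W_def by blast
qed

text \<open>At least half of every interval is not covered by its stopping intervals, so the average
 over the interval is charged to the maximal functions there; the rest is induction.\<close>

lemma domination:
 assumes "l <= n" "triple l n \<subseteq> {L..R}"
 shows "\<bar>hform (triple l n) {l..n} f g\<bar> <= 2 * (288 * N + 27648 * N + 165888) *
  (\<Sum>x=l..n. maxfun L R (%_. 1) (%y. \<bar>f y\<bar> powr r) x powr (1/r) * maxfun L R (%_. 1) (%y. \<bar>g y\<bar>) x)"
 using assms
proof (induction "nat (n - l)" arbitrary: l n rule: less_induct)
 case less
 define D where "D = 288 * N + 27648 * N + 165888"
 define M where "M x = maxfun L R (%_. 1) (%y. \<bar>f y\<bar> powr r) x powr (1/r) * maxfun L R (%_. 1) (%y. \<bar>g y\<bar>) x" for x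
 define \<phi> where "\<phi> = avg3 (%y. \<bar>f y\<bar> powr r) l n powr (1/r)"
 define \<gamma> where "\<gamma> = avg (%x. \<bar>g x\<bar>) l n"
 have D: "D \<ge> 0" using N by (simp add: D_def)
 obtain P Good Bad where P: "stopping Good Bad l n P" "2 * card (stop_union P) <= card {l..n}"
  "\<bar>hform (triple l n) {l..n} f g\<bar> <= D * card {l..n} * \<phi> * \<gamma>
   + (\<Sum>I\<in>P. \<bar>hform (triple (fst I) (snd I)) {fst I..snd I} f g\<bar>)"
  using domination_step[OF less.prems(1), of f g] unfolding D_def \<phi>_def \<gamma>_def by blast
 have W: "L <= l - (n - l + 1)" "n + (n - l + 1) <= R" using less.prems by (auto simp: triple_def)
 have \<phi>\<gamma>: "\<phi> \<ge> 0" "\<gamma> \<ge> 0" by (auto simp: \<phi>_def \<gamma>_def intro: avg_nonneg)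
 define V where "V = {l..n} - stop_union P"
 have "card V + card (stop_union P) = card {l..n}"
  unfolding V_def using stop_union_subset[OF P(1)] card_mono[OF _ stop_union_subset[OF P(1)]]
  by (subst card_Diff_subset) (auto intro: finite_subset)
 hence "real (card {l..n}) <= 2 * card V" using P(2) by linarith
 hence "D * card {l..n} * \<phi> * \<gamma> <= D * (2 * card V) * \<phi> * \<gamma>"
  using D \<phi>\<gamma> by (intro mult_right_mono mult_left_mono) auto
 also have "... = 2 * D * (\<Sum>x\<in>V. \<phi> * \<gamma>)" by simp
 also have "... <= 2 * D * (\<Sum>x\<in>V. M x)"
 proof (intro mult_left_mono sum_mono)
  fix x assume "x \<in> V"
  hence x: "x \<in> {l..n}" by (simp add: V_def)
  have "avg3 (%y. \<bar>f y\<bar> powr r) l n <= maxfun L R (%_. 1) (%y. \<bar>f y\<bar> powr r) x"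
   unfolding avg3_def wavg_one[symmetric] using W x by (intro wavg_le_maxfun) auto
  hence "\<phi> <= maxfun L R (%_. 1) (%y. \<bar>f y\<bar> powr r) x powr (1/r)"
   unfolding \<phi>_def using r by (intro powr_mono2) (auto simp: avg3_def intro!: avg_nonneg)
  moreover have "\<gamma> <= maxfun L R (%_. 1) (%y. \<bar>g y\<bar>) x"
   unfolding \<gamma>_def wavg_one[symmetric] using W x by (intro wavg_le_maxfun) auto
  ultimately show "\<phi> * \<gamma> <= M x" unfolding M_def using \<phi>\<gamma> by (intro mult_mono) auto
 qed (use D in auto)
 finally have 1: "D * card {l..n} * \<phi> * \<gamma> <= 2 * D * (\<Sum>x\<in>V. M x)" .
 have "(\<Sum>I\<in>P. \<bar>hform (triple (fst I) (snd I)) {fst I..snd I} f g\<bar>) <= (\<Sum>I\<in>P. 2 * D * (\<Sum>x=fst I..snd I. M x))"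
 proof (rule sum_mono)
  fix I assume "I \<in> P"
  hence I: "l <= fst I" "fst I <= snd I" "snd I <= n" "snd I - fst I < n - l"
   using stopping_memD[OF P(1), of "fst I" "snd I"] by simp_all
  thus "\<bar>hform (triple (fst I) (snd I)) {fst I..snd I} f g\<bar> <= 2 * D * (\<Sum>x=fst I..snd I. M x)"
   unfolding M_def D_def using triple_mono[OF I(1-3)] less.prems(2) by (intro less.hyps) auto
 qed
 also have "... = 2 * D * (\<Sum>I\<in>P. \<Sum>x=fst I..snd I. M x)" by (simp add: sum_distrib_left)
 finally have "\<bar>hform (triple l n) {l..n} f g\<bar> <= 2 * D * ((\<Sum>x\<in>V. M x) + (\<Sum>I\<in>P. \<Sum>x=fst I..snd I. M x))"
  using 1 P(3) by (simp add: distrib_left)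
 thus ?case unfolding V_def stopping_sum_split[OF P(1), symmetric] D_def M_def .
qed

text \<open>Domination reduces the claim to maximal functions. That of \<open>|f|^r\<close>, raised
  to \<open>1/r\<close>, is bounded on weighted \<open>l^p\<close> when the maximal operator is
  bounded on \<open>l^(p/r)\<close> with weight \<open>w powr r\<close>, and the condition with
  exponents \<open>p\<close> and \<open>r * p / (p - r)\<close> is the Muckenhoupt condition there.
  That of \<open>g\<close> is taken on the dual space, with weight \<open>1 / w\<close>.\<close>

lemma hilb_weighted_base:
 assumes p: "r < p" and pq: "q > 1" "1/p + 1/q = 1" and w: "muck p (r * p / (p - r)) c w"
 shows "\<exists>C\<ge>0. hilb p q C w"
proof -
 have p1: "p > 1" "p > r" "r > 0" using r p by auto
 have wpos: "0 < w k" for k using w by (auto simp: muck_def)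
 define P where "P = p / r"
 define Q where "Q = p / (p - r)"
 have PQ: "P > 1" "Q > 1" "1/P + 1/Q = 1" using p1 by (auto simp: P_def Q_def field_simps)
 have m1: "muck P Q (c powr r) (%k. w k powr r)"
 proof -
  have "muck (p/r) ((r * p / (p - r)) / r) (c powr r) (%k. w k powr r)" using w p1 by (intro muck_powr) auto
  thus ?thesis using p1 by (simp add: P_def Q_def)
 qed
 have q_eq: "q = p / (p - 1)" using pq p1 by (auto simp: field_simps)
 \<comment> \<open>Hence the hypothesis contains the ordinary condition with conjugate exponents, on
   which the bound for the maximal function of \<open>g\<close> rests.\<close>
 have "q <= r * p / (p - r)"
 proof -
  have "p * (p - r) <= r * p * (p - 1)" using p1 r mult_right_mono[of 1 r "p * p"] by (simp add: algebra_simps)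
  thus ?thesis unfolding q_eq using p1 by (simp add: divide_simps mult_ac)
 qed
 hence "muck p q c w" using w pq p1 by (intro muck_mono[OF w]) auto
 hence m2: "muck q p c (%k. 1 / w k)" by (rule muck_inverse)
 obtain C1 where C1: "C1 > 0" "!!a b f. (!!k. k \<in> {a..b} ==> 0 <= f k) ==>
   (\<Sum>x=a..b. (maxfun a b (%_. 1) f x * (w x powr r)) powr P) <= C1 * (\<Sum>x=a..b. (f x * (w x powr r)) powr P)"
  by (rule muckenhoupt[OF PQ m1]) blast
 have qp: "1/q + 1/p = 1" using pq by simp
 obtain C2 where C2: "C2 > 0" "!!a b f. (!!k. k \<in> {a..b} ==> 0 <= f k) ==>
   (\<Sum>x=a..b. (maxfun a b (%_. 1) f x * (1 / w x)) powr q) <= C2 * (\<Sum>x=a..b. (f x * (1 / w x)) powr q)"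
  by (rule muckenhoupt[OF pq(1) p1(1) qp m2]) blast
 define D where "D = 2 * (288 * N + 27648 * N + 165888)"
 define C where "C = D * C1 powr (1/p) * C2 powr (1/q)"
 have D0: "D \<ge> 0" using N by (simp add: D_def)
 have "hilb p q C w"
  unfolding hilb_def
 proof (intro allI impI)
  fix A B :: "int set" and f0 g0 :: "int => real"
  assume fin: "finite A" "finite B"
  \<comment> \<open>A common interval for both supports, on which the sequences are extended by
    zero; inserting 0 keeps the minimum and maximum defined.\<close>
  define l where "l = Min (insert 0 (A \<union> B))"
  define n where "n = Max (insert 0 (A \<union> B))"
  have ln: "l <= n" "A \<subseteq> {l..n}" "B \<subseteq> {l..n}"
   using fin by (auto simp: l_def n_def intro: order_trans[OF Min_le Max_ge])
  define L where "L = l - (n - l + 1)"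
  define R where "R = n + (n - l + 1)"
  have T: "triple l n = {L..R}" by (simp add: triple_def L_def R_def)
  define f where "f y = (if y \<in> A then f0 y else 0)" for y
  define g where "g x = (if x \<in> B then g0 x else 0)" for x
  have sub: "A \<subseteq> {L..R}" "B \<subseteq> {L..R}" "{l..n} \<subseteq> {L..R}" using ln by (auto simp: L_def R_def)
  have "hform {L..R} {l..n} f g = (\<Sum>x\<in>B. \<Sum>y=L..R. g x * f y / of_int (x - y))"
   unfolding hform_def using ln by (intro sum.mono_neutral_right) (auto simp: g_def)
  also have "... = hform A B f0 g0" unfolding hform_def using sub
   by (intro sum.cong[OF refl] sum.mono_neutral_cong_right) (auto simp: g_def f_def)
  finally have eq: "hform A B f0 g0 = hform {L..R} {l..n} f g" by simp
  define Mf where "Mf = maxfun L R (%_. 1) (%y. \<bar>f y\<bar> powr r)"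
  define Mg where "Mg = maxfun L R (%_. 1) (%y. \<bar>g y\<bar>)"
  have M0: "Mf x \<ge> 0" "Mg x \<ge> 0" if "x \<in> {L..R}" for x
   unfolding Mf_def Mg_def by (rule maxfun_nonneg[OF that]; simp)+
  have "\<bar>hform A B f0 g0\<bar> <= D * (\<Sum>x=l..n. Mf x powr (1/r) * Mg x)"
   unfolding eq D_def Mf_def Mg_def T[symmetric] using T by (intro domination ln) auto
  also have "... <= D * (\<Sum>x=L..R. Mf x powr (1/r) * Mg x)" using D0 sub M0 by (intro mult_left_mono sum_mono2) auto
  also have "(\<Sum>x=L..R. Mf x powr (1/r) * Mg x) = (\<Sum>x=L..R. (Mf x powr (1/r) * w x) * (Mg x * (1 / w x)))"
   using wpos by (intro sum.cong) (auto simp: order_less_imp_not_eq2)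
  also have "... <= (\<Sum>x=L..R. (Mf x powr (1/r) * w x) powr p) powr (1/p) * (\<Sum>x=L..R. (Mg x * (1 / w x)) powr q) powr (1/q)"
   using p1 pq M0 by (intro Holder_sum) (auto intro!: mult_nonneg_nonneg divide_nonneg_nonneg less_imp_le[OF wpos])
  finally have H: "\<bar>hform A B f0 g0\<bar> <= D * ((\<Sum>x=L..R. (Mf x powr (1/r) * w x) powr p) powr (1/p)
    * (\<Sum>x=L..R. (Mg x * (1 / w x)) powr q) powr (1/q))" using D0 by (simp add: mult_left_mono)
  have "(\<Sum>x=L..R. (Mf x powr (1/r) * w x) powr p) = (\<Sum>x=L..R. (Mf x * (w x powr r)) powr P)"
   using p1 wpos M0 by (intro sum.cong) (auto simp: powr_mult powr_powr P_def less_imp_le)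
  also have "... <= C1 * (\<Sum>x=L..R. (\<bar>f x\<bar> powr r * (w x powr r)) powr P)"
   unfolding Mf_def by (rule C1(2)) auto
  also have "(\<Sum>x=L..R. (\<bar>f x\<bar> powr r * (w x powr r)) powr P) = (\<Sum>y\<in>A. (\<bar>f0 y\<bar> * w y) powr p)"
   using sub p1 wpos by (intro sum.mono_neutral_cong_right) (auto simp: f_def powr_mult powr_powr P_def less_imp_le)
  finally have X1: "(\<Sum>x=L..R. (Mf x powr (1/r) * w x) powr p) <= C1 * (\<Sum>y\<in>A. (\<bar>f0 y\<bar> * w y) powr p)" .
  have "(\<Sum>x=L..R. (Mg x * (1 / w x)) powr q) <= C2 * (\<Sum>x=L..R. (\<bar>g x\<bar> * (1 / w x)) powr q)"
   unfolding Mg_def by (rule C2(2)) auto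
  also have "(\<Sum>x=L..R. (\<bar>g x\<bar> * (1 / w x)) powr q) = (\<Sum>x\<in>B. (\<bar>g0 x\<bar> / w x) powr q)"
   using sub by (intro sum.mono_neutral_cong_right) (auto simp: g_def)
  finally have X2: "(\<Sum>x=L..R. (Mg x * (1 / w x)) powr q) <= C2 * (\<Sum>x\<in>B. (\<bar>g0 x\<bar> / w x) powr q)" .
  note H
  also have "D * ((\<Sum>x=L..R. (Mf x powr (1/r) * w x) powr p) powr (1/p)
    * (\<Sum>x=L..R. (Mg x * (1 / w x)) powr q) powr (1/q))
   <= D * ((C1 * (\<Sum>y\<in>A. (\<bar>f0 y\<bar> * w y) powr p)) powr (1/p)
    * (C2 * (\<Sum>x\<in>B. (\<bar>g0 x\<bar> / w x) powr q)) powr (1/q))"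
   using D0 p1 pq by (intro mult_left_mono mult_mono powr_mono2 X1 X2) (auto intro: sum_nonneg)
  also have "... = C * (\<Sum>y\<in>A. (\<bar>f0 y\<bar> * w y) powr p) powr (1/p) * (\<Sum>x\<in>B. (\<bar>g0 x\<bar> / w x) powr q) powr (1/q)"
   using C1 C2 by (simp add: C_def powr_mult sum_nonneg mult_ac)
  finally show "\<bar>hform A B f0 g0\<bar> <= ..." .
 qed
 moreover have "C \<ge> 0" using D0 by (simp add: C_def)
 ultimately show ?thesis by blast
qed

end

section \<open>Weighted bounds for all exponents near the given one\<close>

lemma muck_one: "muck s t 1 (%_. 1)" by (auto simp: muck_def avg_def)

text \<open>The bound on \<open>l^2\<close> enters the previous lemma as \<open>r = 2\<close> with
  weight 1, which reaches the exponents above 2; duality carries them below 2.\<close>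

lemma hilb_unweighted:
 assumes r: "1 < r" "r < 2"
 obtains C where "C \<ge> 0" "hilb r (r / (r - 1)) C (%_. 1)"
proof -
 define p where "p = r / (r - 1)"
 have p: "2 < p" "1/p + 1/r = 1" using r by (auto simp: p_def field_simps)
 have "\<exists>C\<ge>0. hilb p r C (%_. 1)" by (rule hilb_weighted_base[of 2 2 pi, OF _ _ _ _ hilb_two])
   (use p r in \<open>auto intro: muck_mono[OF muck_one]\<close>)
 thus ?thesis using hilb_dual that unfolding p_def by blast
qed

text \<open>The two-weight exponents \<open>s\<close> near \<open>p\<close> come from the self-improvement of the \<open>A\<^sub>p\<close> condition.\<close>

theorem hilb_weighted:
 assumes pq: "p > 1" "q > 1" "1/p + 1/q = 1" and w: "muck p q c w"
 obtains d where "d > 0" "!!s. \<bar>s - p\<bar> < d ==> s > 1 & (\<exists>C\<ge>0. hilb s (s / (s - 1)) C w)"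
proof -
 obtain e c' where e: "e > 0" "muck (p + e) (q + e) c' w" using muck_open[OF pq w] by metis
 have q: "q = p / (p - 1)" using pq by (auto simp: field_simps)
 have "((%s. s / (s - 1)) \<longlongrightarrow> q) (nhds p)" unfolding q using pq
  by (intro tendsto_intros filterlim_ident) auto
 hence "\<forall>\<^sub>F s in nhds p. s / (s - 1) < q + e" using e by (intro order_tendstoD) auto
 moreover have "\<forall>\<^sub>F s in nhds p. 1 < s" "\<forall>\<^sub>F s in nhds p. s < p + e"
  using pq e by (auto intro!: order_tendstoD[OF filterlim_ident])
 ultimately have "\<forall>\<^sub>F s in nhds p. s / (s - 1) < q + e & 1 < s & s < p + e" by eventually_elim auto
 then obtain d where d: "d > 0" "!!s. \<bar>s - p\<bar> < d ==> s / (s - 1) < q + e & 1 < s & s < p + e"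
  unfolding eventually_nhds_metric dist_real_def by blast
 show ?thesis
 proof (rule that[OF d(1)])
  fix s assume "\<bar>s - p\<bar> < d"
  hence s: "s / (s - 1) < q + e" "1 < s" "s < p + e" using d by auto
  \<comment> \<open>As \<open>r\<close> tends to 1, the dual exponent required by domination tends
    to the conjugate of \<open>s\<close>, which lies below the improved exponent
    \<open>q + e\<close>; this is where the self-improvement is spent.\<close>
  have "((%r. r * s / (s - r)) \<longlongrightarrow> 1 * s / (s - 1)) (at_right 1)"
   using s by (intro tendsto_intros) auto
  hence "\<forall>\<^sub>F r in at_right 1. r * s / (s - r) < q + e" using s by (intro order_tendstoD) auto
  moreover have "\<forall>\<^sub>F r in at_right (1::real). r < s" "\<forall>\<^sub>F r in at_right (1::real). r < 2" "\<forall>\<^sub>F r in at_right (1::real). 1 < r"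
   using s by (auto intro!: order_tendstoD[OF tendsto_ident_at] eventually_at_right_less)
  ultimately have "\<forall>\<^sub>F r in at_right 1. r * s / (s - r) < q + e & r < s & r < 2 & 1 < r" by eventually_elim auto
  then obtain r where r: "r * s / (s - r) < q + e" "r < s" "r < 2" "1 < r"
   using eventually_happens'[OF trivial_limit_at_right_real] by blast
  obtain N where N: "N \<ge> 0" "hilb r (r / (r - 1)) N (%_. 1)" using hilb_unweighted[OF r(4,3)] by metis
  have "muck s (r * s / (s - r)) c' w" by (rule muck_mono[OF e(2)]) (use r s in auto)
  hence "\<exists>C\<ge>0. hilb s (s / (s - 1)) C w"
   by (intro hilb_weighted_base[of r "r / (r - 1)" N, OF _ _ _ N]) (use r s in \<open>auto simp: field_simps\<close>)
  thus "s > 1 & (\<exists>C\<ge>0. hilb s (s / (s - 1)) C w)" using s by simp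
 qed
qed

text \<open>From the dual to the direct form: for the extremal \<open>g\<close> of Hoelder's
  inequality, \<open>hform A B f g\<close> is the sum \<open>X\<close> to be bounded, so
  \<open>X\<close> is at most \<open>N * F powr (1/s) * X powr (1/s')\<close>, and a power of
  \<open>X\<close> cancels.\<close>

lemma hilb_strong:
 assumes s: "s > 1" and h: "hilb s (s / (s - 1)) N w" and N: "N \<ge> 0" and w: "!!k. 0 < w k" and fin: "finite A" "finite B"
 shows "(\<Sum>x\<in>B. (w x * \<bar>\<Sum>y\<in>A. f y / of_int (x - y)\<bar>) powr s) <= N powr s * (\<Sum>y\<in>A. (\<bar>f y\<bar> * w y) powr s)"
proof -
 define s' where "s' = s / (s - 1)"
 have s': "s' > 1" "1/s + 1/s' = 1" "(s - 1) * s' = s" using s by (auto simp: s'_def field_simps)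
 define h where "h x = (\<Sum>y\<in>A. f y / of_int (x - y))" for x
 define H where "H x = w x * \<bar>h x\<bar>" for x
 define g where "g x = sgn (h x) * H x powr (s - 1) * w x" for x
 have H0: "H x \<ge> 0" for x using w[of x] by (simp add: H_def)
 define X where "X = (\<Sum>x\<in>B. H x powr s)"
 define F where "F = (\<Sum>y\<in>A. (\<bar>f y\<bar> * w y) powr s)"
 have "hform A B f g = (\<Sum>x\<in>B. g x * h x)" by (simp add: hform_def h_def sum_distrib_left)
 also have "... = X" unfolding X_def
 proof (rule sum.cong[OF refl])
  fix x
  have "g x * h x = H x powr (s - 1) * H x" by (simp add: g_def H_def abs_sgn mult_ac)
  also have "... = H x powr s" using H0[of x] powr_add[of "H x" "s - 1" 1] by (cases "H x = 0") auto
  finally show "g x * h x = H x powr s" .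
 qed
 finally have eq: "hform A B f g = X" .
 have gs: "(\<Sum>x\<in>B. (\<bar>g x\<bar> / w x) powr s') <= X"
  unfolding X_def
 proof (rule sum_mono)
  fix x
  have "\<bar>g x\<bar> / w x = \<bar>sgn (h x)\<bar> * H x powr (s - 1)" using w[of x] by (simp add: g_def abs_mult)
  also have "... <= H x powr (s - 1)" by (simp add: abs_sgn_eq)
  finally have "(\<bar>g x\<bar> / w x) powr s' <= (H x powr (s - 1)) powr s'"
   using s' w[of x] by (intro powr_mono2) auto
  thus "(\<bar>g x\<bar> / w x) powr s' <= H x powr s" by (simp add: powr_powr s')
 qed
 have X0: "X \<ge> 0" and F0: "F \<ge> 0" by (auto simp: X_def F_def intro: sum_nonneg)
 have "X <= \<bar>hform A B f g\<bar>" by (simp add: eq)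
 also have "... <= N * F powr (1/s) * (\<Sum>x\<in>B. (\<bar>g x\<bar> / w x) powr s') powr (1/s')"
  using h fin unfolding hilb_def F_def s'_def by blast
 also have "... <= N * F powr (1/s) * X powr (1/s')"
  using gs N s' by (intro mult_left_mono powr_mono2) (auto intro: sum_nonneg)
 finally have 1: "X <= N * F powr (1/s) * X powr (1/s')" .
 have "X <= N powr s * F"
 proof (cases "X = 0")
  case False
  hence Xp: "X > 0" using X0 by simp
  have "X = X powr (1/s) * X powr (1/s')" using Xp s' by (simp add: powr_add[symmetric])
  hence "X powr (1/s) * X powr (1/s') <= N * F powr (1/s) * X powr (1/s')" using 1 by simp
  hence "X powr (1/s) <= N * F powr (1/s)" using Xp by simp
  hence "(X powr (1/s)) powr s <= (N * F powr (1/s)) powr s" using s by (intro powr_mono2) auto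
  thus ?thesis using Xp s F0 N by (simp add: powr_powr powr_mult)
 qed (use F0 in simp)
 thus ?thesis by (simp add: X_def F_def H_def h_def)
qed

text \<open>Only the normalization differs: \<open>card\<close> splits as
  \<open>card powr (1/p) * card powr (1/q)\<close>.\<close>

lemma Ap_muck:
 assumes p: "p > 1" and w: "w \<in> Ap p"
 obtains c where "muck p (p / (p - 1)) c w"
proof -
 define q where "q = p / (p - 1)"
 have q: "1 / (1 - 1/p) = q" "1/p + 1/q = 1" using p by (auto simp: q_def field_simps)
 have "bdd_above {1 / real (card {l..n}) * (\<Sum>k=l..n. w k powr p) powr (1 / p)
         * (\<Sum>k=l..n. w k powr (- q)) powr (1 / q) |l n. l <= n}" using w by (simp add: Ap_def q)
 then obtain c where c: "1 / real (card {l..n}) * (\<Sum>k=l..n. w k powr p) powr (1 / p)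
         * (\<Sum>k=l..n. w k powr (- q)) powr (1 / q) <= c" if "l <= n" for l n unfolding bdd_above_def by blast
 have "muck p q c w"
  unfolding muck_def
 proof (intro conjI allI impI)
  show "0 < w k" for k using w by (auto simp: Ap_def)
  fix l n :: int assume ln: "l <= n"
  have pos: "real (card {l..n}) > 0" using ln by simp
  have "real (card {l..n}) powr (1/p) * real (card {l..n}) powr (1/q) = real (card {l..n})"
   using pos q by (simp add: powr_add[symmetric])
  hence "avg (%k. w k powr p) l n powr (1/p) * avg (%k. w k powr (-q)) l n powr (1/q)
   = (\<Sum>k=l..n. w k powr p) powr (1 / p) * (\<Sum>k=l..n. w k powr (- q)) powr (1 / q) / real (card {l..n})"
   using pos unfolding avg_def by (simp add: powr_divide sum_nonneg del: card_atLeastAtMost_int)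
  thus "avg (%k. w k powr p) l n powr (1/p) * avg (%k. w k powr (-q)) l n powr (1/q) <= c"
   using c[OF ln] by (simp del: card_atLeastAtMost_int)
 qed
 thus ?thesis using that by (simp add: q_def)
qed

section \<open>Banach function norms\<close>

lemma nonneg_seqsI [intro]: "(!!k. 0 <= f k) ==> f \<in> nonneg_seqs" by (simp add: nonneg_seqs_def)

lemma nonneg_seqsD: "f \<in> nonneg_seqs ==> 0 <= f k" by (simp add: nonneg_seqs_def)

locale bfn =
 fixes \<rho> :: "('s => real) => ennreal"
 assumes bfn: "banach_function_norm \<rho>"
begin

lemma eq_0_iff: "f \<in> nonneg_seqs ==> \<rho> f = 0 \<longleftrightarrow> f = (%_. 0)"
 using bfn[unfolded banach_function_norm_def, THEN conjunct1] by blast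

lemma scale: "f \<in> nonneg_seqs ==> 0 <= c ==> \<rho> (%k. c * f k) = ennreal c * \<rho> f"
 using bfn[unfolded banach_function_norm_def, THEN conjunct2, THEN conjunct1] by blast

lemma triangle: "f \<in> nonneg_seqs ==> g \<in> nonneg_seqs ==> \<rho> (%k. f k + g k) <= \<rho> f + \<rho> g"
 using bfn[unfolded banach_function_norm_def, THEN conjunct2, THEN conjunct2, THEN conjunct1] by blast

lemma mono: "f \<in> nonneg_seqs ==> (!!k. f k <= g k) ==> \<rho> f <= \<rho> g"
proof -
 assume f: "f \<in> nonneg_seqs" and le: "!!k. f k <= g k"
 have "g \<in> nonneg_seqs" using f le order_trans unfolding nonneg_seqs_def by blast
 thus ?thesis using f le bfn[unfolded banach_function_norm_def, THEN conjunct2, THEN conjunct2, THEN conjunct2, THEN conjunct1] by blast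
qed

lemma monotone_limit:
 assumes "f \<in> nonneg_seqs" "!!n. F n \<in> nonneg_seqs" "!!k. incseq (%n. F n k)" "!!k. (%n. F n k) \<longlonglongrightarrow> f k"
 shows "(%n. \<rho> (F n)) \<longlonglongrightarrow> \<rho> f"
 using bfn[unfolded banach_function_norm_def, THEN conjunct2, THEN conjunct2, THEN conjunct2, THEN conjunct2, THEN conjunct1, THEN bspec, OF assms(1), THEN spec[of _ F]] assms(2-4) by blast

lemma finite_indicator: "finite E ==> \<rho> (indicator E) < \<infinity>"
 using bfn[unfolded banach_function_norm_def, THEN conjunct2, THEN conjunct2, THEN conjunct2, THEN conjunct2, THEN conjunct2, THEN conjunct1] by blast

lemma finite_sum_bound: "finite E ==> \<exists>C>0. \<forall>f\<in>nonneg_seqs. ennreal (\<Sum>k\<in>E. f k) <= ennreal C * \<rho> f"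
 using bfn[unfolded banach_function_norm_def, THEN conjunct2, THEN conjunct2, THEN conjunct2, THEN conjunct2, THEN conjunct2, THEN conjunct2] by blast

lemma zero: "\<rho> (%_. 0) = 0" by (subst eq_0_iff) (auto simp: nonneg_seqs_def)

lemma point_bound: "\<exists>C>0. \<forall>f\<in>nonneg_seqs. ennreal (f k) <= ennreal C * \<rho> f"
 using finite_sum_bound[of "{k}"] by simp

text \<open>The lower envelopes \<open>G n\<close>, infima over \<open>{n..}\<close>, lie below
  \<open>F n\<close> and increase to \<open>f\<close>, so the monotone limit property applies to
  them.\<close>

lemma fatou:
 fixes F :: "nat => 's => real"
 assumes F: "!!n. F n \<in> nonneg_seqs" and lim: "!!k. (%n. F n k) \<longlonglongrightarrow> f k"
  and B: "\<forall>\<^sub>F n in sequentially. \<rho> (F n) <= B"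
 shows "\<rho> f <= B"
proof -
 have F0: "0 <= F n k" for n k by (rule nonneg_seqsD[OF F])
 have f: "f \<in> nonneg_seqs" by (rule nonneg_seqsI, rule LIMSEQ_le_const[OF lim]) (use F0 in blast)
 define G where "G n k = (INF m\<in>{n..}. F m k)" for n k
 have bdd: "bdd_below ((%m. F m k) ` S)" for k S using F0 by (intro bdd_belowI[of _ 0]) auto
 have G0: "0 <= G n k" for n k unfolding G_def using F0 by (intro cINF_greatest) auto
 have GF: "G n k <= F m k" if "n <= m" for n m k unfolding G_def using that by (intro cINF_lower bdd) auto
 have inc: "incseq (%n. G n k)" for k unfolding incseq_def G_def using bdd by (auto intro!: cINF_superset_mono)
 have "(%n. G n k) \<longlonglongrightarrow> f k" for k
 proof (rule LIMSEQ_I)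
  fix r :: real assume r: "0 < r"
  obtain N where N: "!!n. n \<ge> N ==> \<bar>F n k - f k\<bar> < r / 2" using LIMSEQ_D[OF lim, of "r/2" k] r by auto
  show "\<exists>N. \<forall>n\<ge>N. norm (G n k - f k) < r"
  proof (intro exI[of _ N] allI impI)
   fix n assume n: "n \<ge> N"
   have "f k - r / 2 <= F m k" if "m \<in> {n..}" for m
   proof -
    have "N <= m" using that n by simp
    from N[OF this] show ?thesis by linarith
   qed
   hence "f k - r / 2 <= G n k" unfolding G_def by (intro cINF_greatest) auto
   moreover have "G n k <= f k + r / 2" using GF[of n n k] N[OF n] by linarith
   ultimately show "norm (G n k - f k) < r" using r by auto
  qed
 qed
 hence lim2: "(%n. \<rho> (G n)) \<longlonglongrightarrow> \<rho> f" using G0 inc f by (intro monotone_limit) auto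
 have "\<forall>\<^sub>F n in sequentially. \<rho> (G n) <= B"
  using B by eventually_elim (auto intro!: order_trans[OF mono[OF _ GF]] G0)
 thus ?thesis using lim2 tendsto_upperbound by force
qed

lemma sum_bound:
 assumes "!!i. i \<in> I ==> g i \<in> nonneg_seqs"
 shows "\<rho> (%k. \<Sum>i\<in>I. g i k) <= (\<Sum>i\<in>I. \<rho> (g i))"
 using assms
proof (induction I rule: infinite_finite_induct)
 case (insert i I)
 have "\<rho> (%k. g i k + (\<Sum>i\<in>I. g i k)) <= \<rho> (g i) + \<rho> (%k. \<Sum>i\<in>I. g i k)"
  using insert.prems by (intro triangle nonneg_seqsI sum_nonneg) (auto intro: nonneg_seqsD)
 also have "... <= \<rho> (g i) + (\<Sum>i\<in>I. \<rho> (g i))" using insert by (intro add_left_mono) auto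
 finally show ?case using insert by simp
qed (simp_all add: zero)

lemma suminf_bound:
 fixes g :: "nat => 's => real"
 assumes g: "!!i. g i \<in> nonneg_seqs" and s: "!!k. summable (%i. g i k)"
 shows "\<rho> (%k. \<Sum>i. g i k) <= (\<Sum>i. \<rho> (g i))"
proof (rule fatou[where F = "%n k. \<Sum>i<n. g i k"])
 show "(%k. \<Sum>i<n. g i k) \<in> nonneg_seqs" for n by (intro nonneg_seqsI sum_nonneg nonneg_seqsD[OF g])
 show "(%n. \<Sum>i<n. g i k) \<longlonglongrightarrow> (\<Sum>i. g i k)" for k by (rule summable_LIMSEQ[OF s])
 have "\<rho> (%k. \<Sum>i<n. g i k) <= (\<Sum>i. \<rho> (g i))" for n
  using sum_bound[of "{..<n}" g] g by (rule_tac order_trans[OF _ sum_le_suminf]) auto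
 thus "\<forall>\<^sub>F n in sequentially. \<rho> (%k. \<Sum>i<n. g i k) <= (\<Sum>i. \<rho> (g i))" by simp
qed

end

section \<open>The Luxemburg representation\<close>

lemma distribution_le_iff:
 "distribution_fun f t <= of_nat n \<longleftrightarrow> finite {k. t < norm (f k)} & card {k. t < norm (f k)} <= n"
 unfolding distribution_fun_def
 by (cases "finite {k. t < norm (f k)}") (auto simp: emeasure_count_space ennreal_of_nat_eq_real_of_nat top_unique)

lemma distribution_bij:
 assumes "bij \<pi>"
 shows "distribution_fun (%k. f (\<pi> k)) t = distribution_fun f t"
proof -
 have "bij_betw \<pi> {k. t < norm (f (\<pi> k))} {k. t < norm (f k)}"
  using assms surj_image_vimage_eq[of \<pi> "{k. t < norm (f k)}"]
  unfolding bij_betw_def by (auto simp: bij_def vimage_def intro: inj_on_subset)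
 hence "finite {k. t < norm (f (\<pi> k))} \<longleftrightarrow> finite {k. t < norm (f k)}"
  "card {k. t < norm (f (\<pi> k))} = card {k. t < norm (f k)}" by (rule bij_betw_finite, rule bij_betw_same_card)
 thus ?thesis by (auto simp: distribution_fun_def emeasure_count_space)
qed

lemma distribution_mono: "s <= t ==> distribution_fun f t <= distribution_fun f s"
 unfolding distribution_fun_def by (intro emeasure_mono) auto

text \<open>The infimum that defines the rearrangement is attained, by right-continuity of the
  distribution function: below the finitely many values on a finite set where
  \<open>norm (f k) > t\<close> there is room for some \<open>s > t\<close>. This correspondence
  takes the place of the infimum from here on.\<close>

lemma rearr_le_iff:
 assumes t: "0 <= t"
 shows "rearr f n <= ennreal t \<longleftrightarrow> distribution_fun f t <= of_nat n"
proof
 assume "distribution_fun f t <= of_nat n"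
 thus "rearr f n <= ennreal t" unfolding rearr_def using t by (intro Inf_lower) auto
next
 assume le: "rearr f n <= ennreal t"
 have *: "distribution_fun f s <= of_nat n" if "t < s" for s
 proof -
  have "rearr f n < ennreal s" using le that t by (auto intro: le_less_trans simp: ennreal_less_iff)
  then obtain u where "0 <= u" "distribution_fun f u <= of_nat n" "ennreal u < ennreal s"
   unfolding rearr_def Inf_less_iff by auto
  hence "u <= s" by (simp add: ennreal_less_iff)
  thus ?thesis using order_trans[OF distribution_mono \<open>distribution_fun f u <= of_nat n\<close>] by blast
 qed
 have *: "finite {k. s < norm (f k)}" "card {k. s < norm (f k)} <= n" if "t < s" for s
  using *[OF that] by (auto simp: distribution_le_iff)
 have small: "card S <= n" if S: "finite S" "S \<subseteq> {k. t < norm (f k)}" for S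
 proof (cases "S = {}")
  case False
  define m where "m = Min ((%k. norm (f k)) ` S)"
  have "m \<in> (%k. norm (f k)) ` S" unfolding m_def using S False by (intro Min_in) auto
  hence "t < m" using S by auto
  then obtain s where s: "t < s" "s < m" using dense by blast
  have "s < norm (f k)" if "k \<in> S" for k
  proof -
   have "m <= norm (f k)" unfolding m_def using S that by (intro Min_le) auto
   thus ?thesis using s by simp
  qed
  hence "S \<subseteq> {k. s < norm (f k)}" by auto
  thus ?thesis using *[OF s(1)] by (meson card_mono le_trans)
 qed simp
 have "finite {k. t < norm (f k)}"
 proof (rule ccontr)
  assume "infinite {k. t < norm (f k)}"
  then obtain S where "S \<subseteq> {k. t < norm (f k)}" "card S = Suc n" "finite S"
   using infinite_arbitrarily_large by blast
  thus False using small[of S] by simp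
 qed
 thus "distribution_fun f t <= of_nat n" using small[of "{k. t < norm (f k)}"] by (simp add: distribution_le_iff)
qed

lemma card_less_rearr:
 assumes "\<forall>n. rearr f n < \<infinity>" "0 <= t"
 shows "t < rearr_real f n \<longleftrightarrow> of_nat n < distribution_fun f t"
proof -
 have "rearr f n = ennreal (rearr_real f n)" using assms(1) by (simp add: rearr_real_def)
 hence "t < rearr_real f n \<longleftrightarrow> ~ rearr f n <= ennreal t"
  using assms(2) by (simp add: ennreal_le_iff not_le)
 thus ?thesis using rearr_le_iff[OF assms(2), of f n] by (simp add: not_le)
qed

lemma rearr_real_nonneg: "0 <= rearr_real f n" by (simp add: rearr_real_def)

text \<open>The rearrangement exceeds \<open>t\<close> exactly at the indices below
  \<open>distribution_fun f t\<close>; with indices starting at 0 this is an initial segment of that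
  length.\<close>

lemma distribution_rearr:
 assumes "\<forall>n. rearr f n < \<infinity>" "0 <= t"
 shows "distribution_fun (rearr_real f) t = distribution_fun f t"
proof -
 have "{n. t < norm (rearr_real f n)} = {n. of_nat n < distribution_fun f t}"
  using card_less_rearr[OF assms] rearr_real_nonneg[of f] by auto
 moreover have "emeasure (count_space UNIV) {n. of_nat n < distribution_fun f t} = distribution_fun f t"
 proof (cases "finite {k. t < norm (f k)}")
  case True
  hence "distribution_fun f t = of_nat (card {k. t < norm (f k)})"
   by (simp add: distribution_fun_def emeasure_count_space ennreal_of_nat_eq_real_of_nat)
  thus ?thesis by (simp add: lessThan_def[symmetric] emeasure_count_space)
 next
  case False
  hence "distribution_fun f t = \<infinity>" by (simp add: distribution_fun_def emeasure_count_space)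
  moreover have "{n. (of_nat n :: ennreal) < \<infinity>} = UNIV" by (auto simp: of_nat_less_top)
  ultimately show ?thesis by (simp add: emeasure_count_space)
 qed
 ultimately show ?thesis unfolding distribution_fun_def[of "rearr_real f"] by simp
qed

lemma banach_function_norm_bij:
 fixes \<rho> :: "('a => real) => ennreal" and \<pi> :: "'a => 'b"
 assumes \<rho>: "banach_function_norm \<rho>" and \<pi>: "bij \<pi>"
 shows "banach_function_norm (%f. \<rho> (%k. f (\<pi> k)))"
proof -
 interpret bfn \<rho> by unfold_locales (rule \<rho>)
 have nn: "f \<in> nonneg_seqs ==> (%k. f (\<pi> k)) \<in> nonneg_seqs" for f :: "'b => real"
  by (simp add: nonneg_seqs_def)
 have surj: "surj \<pi>" and inj: "inj \<pi>" using \<pi> by (auto simp: bij_def)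
 show ?thesis
  unfolding banach_function_norm_def
 proof (intro conjI ballI allI impI)
  fix f :: "'b => real" assume f: "f \<in> nonneg_seqs"
  have "(%k. f (\<pi> k)) = (%_. 0) \<longleftrightarrow> f = (%_. 0)"
   using surj by (auto simp: fun_eq_iff surj_def) metis
  thus "(\<rho> (%k. f (\<pi> k)) = 0) = (f = (%_. 0))" using eq_0_iff[OF nn[OF f]] by simp
  show "\<rho> (%k. c * f (\<pi> k)) = ennreal c * \<rho> (%k. f (\<pi> k))" if "0 <= c" for c
   using scale[OF nn[OF f] that] .
  show "\<rho> (%k. f (\<pi> k) + g (\<pi> k)) <= \<rho> (%k. f (\<pi> k)) + \<rho> (%k. g (\<pi> k))" if "g \<in> nonneg_seqs" for g
   using triangle[OF nn[OF f] nn[OF that]] .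
  show "\<rho> (%k. g (\<pi> k)) <= \<rho> (%k. f (\<pi> k))" if "g \<in> nonneg_seqs" "\<forall>k. g k <= f k" for g
   using that by (intro mono nn) auto
  fix F :: "nat => 'b => real"
  assume F: "(\<forall>n. F n \<in> nonneg_seqs) & (\<forall>k. incseq (%n. F n k) & (%n. F n k) \<longlonglongrightarrow> f k)"
  show "incseq (%n. \<rho> (%k. F n (\<pi> k)))" using F nn by (intro incseq_SucI mono) (auto simp: incseq_Suc_iff)
  show "(%n. \<rho> (%k. F n (\<pi> k))) \<longlonglongrightarrow> \<rho> (%k. f (\<pi> k))"
   using F nn f by (intro monotone_limit) auto
 next
  fix E :: "'b set" assume E: "finite E"
  have fin: "finite (\<pi> -` E)" using E inj by (rule finite_vimageI)
  have "(%k. indicator E (\<pi> k)) = (indicator (\<pi> -` E) :: 'a => real)" by (auto simp: indicator_def)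
  thus "\<rho> (%k. indicator E (\<pi> k)) < \<infinity>" using finite_indicator[OF fin] by simp
  obtain C where C: "C > 0" "\<forall>f\<in>nonneg_seqs. ennreal (\<Sum>k\<in>\<pi> -` E. f k) <= ennreal C * \<rho> f"
   using finite_sum_bound[OF fin] by blast
  have "(\<Sum>k\<in>\<pi> -` E. f (\<pi> k)) = (\<Sum>k\<in>E. f k)" for f :: "'b => real"
   using inj surj by (intro sum.reindex_cong[symmetric, of \<pi>]) (auto intro: inj_on_subset simp: surj_image_vimage_eq)
  note e = this
  show "\<exists>C>0. \<forall>f\<in>nonneg_seqs. ennreal (\<Sum>k\<in>E. f k) <= ennreal C * \<rho> (%k. f (\<pi> k))"
  proof (intro exI[of _ C] conjI ballI C(1))
   fix f :: "'b => real" assume "f \<in> nonneg_seqs"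
   from C(2)[rule_format, OF nn[OF this]] show "ennreal (\<Sum>k\<in>E. f k) <= ennreal C * \<rho> (%k. f (\<pi> k))"
    unfolding e .
  qed
 qed
qed

lemma rearrangement_invariant_bij:
 fixes \<rho> :: "('a => real) => ennreal" and \<pi> :: "'a => 'b"
 assumes "rearrangement_invariant \<rho>" and \<pi>: "bij \<pi>"
 shows "rearrangement_invariant (%f. \<rho> (%k. f (\<pi> k)))"
 unfolding rearrangement_invariant_def
proof (intro ballI impI)
 fix f g :: "'b => real"
 assume *: "f \<in> nonneg_seqs" "g \<in> nonneg_seqs" "\<forall>t\<ge>0. distribution_fun f t = distribution_fun g t"
 thus "\<rho> (%k. f (\<pi> k)) = \<rho> (%k. g (\<pi> k))"
  using assms(1) distribution_bij[OF \<pi>, of f] distribution_bij[OF \<pi>, of g]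
  unfolding rearrangement_invariant_def by (auto simp: nonneg_seqs_def)
qed

locale ri_bfn = bfn \<rho> for \<rho> :: "('s => real) => ennreal" +
 assumes ri: "rearrangement_invariant \<rho>"
begin

lemma ri_eq:
 "f \<in> nonneg_seqs ==> g \<in> nonneg_seqs ==> (!!t. 0 <= t ==> distribution_fun f t = distribution_fun g t) ==> \<rho> f = \<rho> g"
 using ri[unfolded rearrangement_invariant_def, THEN bspec, THEN bspec, of f g] by blast

lemma point_indicator: "\<rho> (indicator {k}) = \<rho> (indicator {l})"
proof (rule ri_eq)
 fix t :: real assume t: "0 <= t"
 have "{i. t < norm (indicator {j} i :: real)} = (if t < 1 then {j} else {})" for j :: 's
  using t by (auto simp: indicator_def)
 thus "distribution_fun (indicator {k} :: 's => real) t = distribution_fun (indicator {l} :: 's => real) t"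
  by (simp add: distribution_fun_def emeasure_count_space)
qed auto

text \<open>All one-point indicators have the same positive norm, and \<open>f k\<close> times that
  norm is at most the norm of \<open>f\<close>. So unbounded sequences have infinite norm, as the
  Luxemburg representation prescribes.\<close>

lemma finite_imp_bounded:
 assumes f: "f \<in> nonneg_seqs" and fin: "\<rho> f < \<infinity>"
 obtains B where "0 < B" "!!k. f k <= B"
proof -
 fix k0 :: 's
 define c where "c = \<rho> (indicator {k0})"
 have c0: "c ~= 0" unfolding c_def by (subst eq_0_iff) (auto simp: fun_eq_iff indicator_def)
 have ci: "c < \<infinity>" unfolding c_def by (rule finite_indicator) simp
 have c: "c = ennreal (enn2real c)" "enn2real c > 0"
  using c0 ci by (auto simp: enn2real_positive_iff zero_less_iff_neq_zero less_top[symmetric])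
 have r: "\<rho> f = ennreal (enn2real (\<rho> f))" using fin by simp
 have "f k <= enn2real (\<rho> f) / enn2real c + 1" for k
 proof -
  have fk: "0 <= f k" using f by (rule nonneg_seqsD)
  have "ennreal (f k) * c = \<rho> (%i. f k * indicator {k} i)"
   using scale[OF nonneg_seqsI fk, of "indicator {k}"] point_indicator[of k k0] by (simp add: c_def)
  also have "... <= \<rho> f" using fk f by (intro mono) (auto simp: indicator_def nonneg_seqs_def)
  finally have le: "ennreal (f k) * c <= \<rho> f" .
  have "ennreal (f k * enn2real c) = ennreal (f k) * c" unfolding ennreal_mult'[OF fk] c(1)[symmetric] ..
  also have "... <= ennreal (enn2real (\<rho> f))" using le unfolding r[symmetric] .
  finally have "ennreal (f k * enn2real c) <= ennreal (enn2real (\<rho> f))" .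
  hence "f k * enn2real c <= enn2real (\<rho> f)" by (simp add: ennreal_le_iff)
  thus ?thesis using c(2) by (simp add: pos_le_divide_eq add.commute add_increasing)
 qed
 moreover have "0 < enn2real (\<rho> f) / enn2real c + 1" using c by (simp add: add_nonneg_pos)
 ultimately show ?thesis using that by blast
qed

end

lemma rearr_bounded:
 assumes "!!k. norm (f k) <= B"
 shows "rearr f n < \<infinity>"
proof -
 have e: "{k. max B 0 < norm (f k)} = {}" using assms by (auto simp: not_less le_max_iff_disj)
 have "distribution_fun f (max B 0) <= of_nat n" unfolding distribution_fun_def e by simp
 hence "rearr f n <= ennreal (max B 0)" by (subst rearr_le_iff) auto
 thus ?thesis by (rule le_less_trans) simp
qed

lemma rearr_infinite_unbounded:
 assumes "~ rearr f n < \<infinity>"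
 shows "\<exists>k. B < norm (f k)" using rearr_bounded[of f B n] assms by (meson not_less)

text \<open>Both index sets are countably infinite with counting measure, so the representing norm
  is the given one transported along a bijection: a sequence and its rearrangement, read along the
  bijection, have the same distribution function.\<close>

lemma luxemburg_exists:
 assumes "banach_function_norm \<rho>" "rearrangement_invariant \<rho>"
 shows "luxemburg_representation \<rho> (%f. \<rho> (%k :: int. f (int_encode k)))"
 unfolding luxemburg_representation_def
proof (intro conjI ballI)
 interpret ri_bfn \<rho> by unfold_locales (fact assms)+
 have bij: "bij int_encode" by (rule bij_int_encode)
 show "banach_function_norm (%f. \<rho> (%k. f (int_encode k)))" by (rule banach_function_norm_bij[OF assms(1) bij])
 show "rearrangement_invariant (%f. \<rho> (%k. f (int_encode k)))"
  by (rule rearrangement_invariant_bij[OF assms(2) bij])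
 fix f :: "int => real" assume f: "f \<in> nonneg_seqs"
 show "\<rho> f = (if \<forall>n. rearr f n < \<infinity> then \<rho> (%k. rearr_real f (int_encode k)) else \<infinity>)"
 proof (cases "\<forall>n. rearr f n < \<infinity>")
  case True
  have "\<rho> f = \<rho> (%k. rearr_real f (int_encode k))"
  proof (rule ri_eq[OF f])
   show "(%k. rearr_real f (int_encode k)) \<in> nonneg_seqs" using rearr_real_nonneg by auto
   show "distribution_fun f t = distribution_fun (%k. rearr_real f (int_encode k)) t" if "0 <= t" for t
    using distribution_bij[OF bij, of "rearr_real f"] distribution_rearr[OF True that] by simp
  qed
  thus ?thesis using True by simp
 next
  case False
  then obtain n where n: "~ rearr f n < \<infinity>" by blast
  have "~ \<rho> f < \<infinity>"
  proof
   assume "\<rho> f < \<infinity>"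
   then obtain B where "!!k. f k <= B" using finite_imp_bounded[OF f] by blast
   moreover obtain k where "B < norm (f k)" using rearr_infinite_unbounded[OF n] by blast
   ultimately show False using nonneg_seqsD[OF f, of k] by (metis abs_of_nonneg not_le real_norm_def)
  qed
  hence "\<rho> f = \<infinity>" by (simp add: less_top[symmetric])
  thus ?thesis using False by (simp only: if_False)
 qed
qed

text \<open>\<open>luxemburg_norm\<close> is a choice; from here on only this property of it is
  used.\<close>

lemma luxemburg_norm_representation:
 fixes \<rho> :: "(int => real) => ennreal"
 assumes "banach_function_norm \<rho>" "rearrangement_invariant \<rho>"
 shows "luxemburg_representation \<rho> (luxemburg_norm \<rho>)"
 unfolding luxemburg_norm_def by (rule someI[where P = "luxemburg_representation \<rho>", OF luxemburg_exists[OF assms]])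

lemma rearr_real_antimono:
 assumes g: "!!k. 0 <= g k" and anti: "antimono g" and n: "!!k. norm (f k) = g k"
 shows "rearr_real f = g"
proof
 fix n
 have S: "{k. t < norm (f k)} = {k. t < g k}" for t by (simp add: n)
 have B: "\<forall>m. rearr f m < \<infinity>" using rearr_bounded[of f "g 0"] anti by (auto simp: n antimono_def)
 have "rearr f n <= ennreal (g n)"
 proof (subst rearr_le_iff)
  have "{k. g n < g k} \<subseteq> {..<n}" using anti by (auto simp: antimono_def not_le[symmetric])
  thus "distribution_fun f (g n) <= of_nat n"
   unfolding distribution_le_iff S using card_mono[of "{..<n}"] by (auto intro: finite_subset)
 qed (rule g)
 note le = this
 have gt: "~ rearr f n <= ennreal t" if t: "0 <= t" "t < g n" for t
 proof (subst rearr_le_iff[OF t(1)])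
  have "{..n} \<subseteq> {k. t < g k}" using anti t(2) by (force simp: antimono_def intro: less_le_trans)
  thus "~ distribution_fun f t <= of_nat n"
   unfolding distribution_le_iff S using card_mono[of "{k. t < g k}" "{..n}"] by auto
 qed
 have e: "rearr f n = ennreal (rearr_real f n)" using B by (simp add: rearr_real_def)
 have "rearr_real f n <= g n" using le g[of n] unfolding e by (simp add: ennreal_le_iff)
 moreover have "~ rearr_real f n < g n" using gt[OF rearr_real_nonneg] unfolding e by blast
 ultimately show "rearr_real f n = g n" by simp
qed

lemma rearr_mono: "m <= n ==> rearr f n <= rearr f m" unfolding rearr_def
 by (intro Inf_superset_mono Collect_mono impI) (elim exE conjE, rule exI, auto intro: order_trans)

lemma antimono_rearr_real:
 assumes "\<forall>n. rearr f n < \<infinity>"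
 shows "antimono (rearr_real f)"
 unfolding rearr_real_def antimono_def using assms rearr_mono by (auto intro!: enn2real_mono)

section \<open>Boyd indices\<close>

text \<open>Fekete's argument on the multiplicative semigroup of positive integers.\<close>

lemma log_subadditive_limit:
 fixes u c :: "nat => real"
 assumes u: "!!j n. 2 <= j ==> 2 <= n ==> u n <= u j * (ln n / ln j) + c j"
  and b: "!!n. 2 <= n ==> b <= u n / ln n"
 shows "convergent (%n. u n / ln (real n))"
proof -
 define L where "L = (INF j\<in>{2..}. u j / ln (real j))"
 have bdd: "bdd_below ((%j. u j / ln (real j)) ` {2..})" using b by (auto intro!: bdd_belowI)
 have low: "L <= u n / ln n" if "2 <= n" for n unfolding L_def using that by (intro cINF_lower bdd) auto
 have "(%n. u n / ln (real n)) \<longlonglongrightarrow> L"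
 proof (rule order_tendstoI)
  fix a assume "a < L"
  thus "\<forall>\<^sub>F n in sequentially. a < u n / ln (real n)"
   unfolding eventually_sequentially using low by (intro exI[of _ 2]) (auto intro: less_le_trans)
 next
  fix a assume a: "L < a"
  then obtain j where j: "2 <= j" "u j / ln (real j) < a" unfolding L_def using cINF_less_iff[OF _ bdd] by auto
  have "filterlim (%n. ln (real n)) at_top sequentially"
   by (rule filterlim_compose[OF ln_at_top filterlim_real_sequentially])
  \<comment> \<open>The error \<open>c j\<close> does not depend on \<open>n\<close> and vanishes
    after division by \<open>ln n\<close>.\<close>
  hence "(%n. u j / ln j + c j / ln (real n)) \<longlonglongrightarrow> u j / ln j + 0"
   by (intro tendsto_intros real_tendsto_divide_at_top[where f = "%_. c j"]) auto
  hence "\<forall>\<^sub>F n in sequentially. u j / ln j + c j / ln (real n) < a" using j by (intro order_tendstoD) auto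
  moreover have "\<forall>\<^sub>F n in sequentially. 2 <= n" by (rule eventually_ge_at_top)
  ultimately show "\<forall>\<^sub>F n in sequentially. u n / ln (real n) < a"
  proof eventually_elim
   fix n assume n: "u j / ln j + c j / ln (real n) < a" "2 <= n"
   hence "ln (real n) > 0" by simp
   hence "u n / ln n <= (u j * (ln n / ln j) + c j) / ln n" using u[OF j(1) n(2)] by (intro divide_right_mono) auto
   also have "... = u j / ln j + c j / ln n" using \<open>ln (real n) > 0\<close> by (simp add: add_divide_distrib)
   finally show "u n / ln (real n) < a" using n by simp
  qed
 qed
 thus ?thesis by (rule convergentI)
qed

lemma nat_log_bracket:
 fixes j n :: nat
 assumes "2 <= j" "1 <= n"
 obtains k where "j ^ k <= n" "n < j ^ (k + 1)" "real k <= ln n / ln j" "ln n / ln j <= real k + 1"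
proof -
 obtain k where k: "j ^ k <= n" "n < j ^ (k + 1)" using ex_power_ivl1[of j n] assms by auto
 have lj: "ln (real j) > 0" using assms by simp
 have "real (j ^ k) <= real n" using k(1) by (simp only: of_nat_le_iff)
 hence "ln (real j ^ k) <= ln (real n)" using assms by (subst ln_le_cancel_iff) auto
 hence 1: "real k <= ln n / ln j" using lj assms by (simp add: ln_realpow pos_le_divide_eq)
 have "real n <= real (j ^ (k + 1))" using k(2) by (simp only: of_nat_le_iff less_imp_le)
 hence "ln (real n) <= ln (real j ^ (k + 1))" using assms by (subst ln_le_cancel_iff) auto
 hence 2: "ln n / ln j <= real k + 1" using lj assms by (simp add: ln_realpow pos_divide_le_eq add.commute del: power_Suc)
 show ?thesis by (rule that[OF k 1 2])
qed

lemma submultiplicative_power: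
 fixes K :: "nat => real"
 assumes "!!i j. 1 <= i ==> 1 <= j ==> K (i * j) <= K i * K j" "!!j. 1 <= j ==> 0 <= K j" "K 1 <= 1" "1 <= j"
 shows "K (j ^ k) <= K j ^ k"
proof (induction k)
 case (Suc k)
 have "K (j * j ^ k) <= K j * K (j ^ k)" using assms(4) by (intro assms(1)) auto
 also have "... <= K j * K j ^ k" using Suc assms by (intro mult_left_mono) auto
 finally show ?case by simp
qed (use assms in simp)

section \<open>Dilation norms: submultiplicativity, limits and decay\<close>

locale boyd = ri_bfn \<rho> for \<rho> :: "(int => real) => ennreal"
begin

abbreviation "\<sigma> \<equiv> luxemburg_norm \<rho>"

lemma rep: "luxemburg_representation \<rho> \<sigma>" by (rule luxemburg_norm_representation[OF bfn ri])

end

sublocale boyd \<subseteq> S: ri_bfn "luxemburg_norm \<rho>"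
 using rep by unfold_locales (auto simp: luxemburg_representation_def)

context boyd
begin

lemma rho_eq:
 "f \<in> nonneg_seqs ==> \<forall>n. rearr f n < \<infinity> ==> \<rho> f = \<sigma> (rearr_real f)"
 using rep by (simp add: luxemburg_representation_def)

lemma sigma_rearr:
 fixes f :: "nat => 'b :: real_normed_vector"
 assumes "\<sigma> (%n. norm (f n)) < \<infinity>"
 shows "\<forall>n. rearr f n < \<infinity>" "\<sigma> (rearr_real f) = \<sigma> (%n. norm (f n))"
proof -
 have "(%n. norm (f n)) \<in> nonneg_seqs" by auto
 from S.finite_imp_bounded[OF this assms] obtain B where "0 < B" "!!k. norm (f k) <= B" by blast
 thus fin: "\<forall>n. rearr f n < \<infinity>" using rearr_bounded by blast
 show "\<sigma> (rearr_real f) = \<sigma> (%n. norm (f n))"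
 proof (rule S.ri_eq)
  show "distribution_fun (rearr_real f) t = distribution_fun (%n. norm (f n)) t" if "0 <= t" for t
   unfolding distribution_rearr[OF fin that] by (simp add: distribution_fun_def)
 qed (auto simp: rearr_real_nonneg)
qed

lemma ball_rearr:
 assumes "f \<in> dilation_unit_ball \<rho>"
 shows "antimono (rearr_real f)" "\<sigma> (rearr_real f) <= 1"
proof -
 have f: "\<sigma> (%n. norm (f n)) < \<infinity>" "\<sigma> (%n. norm (f n)) <= 1"
  using assms by (auto simp: dilation_unit_ball_def seq_space_def)
 show "antimono (rearr_real f)" using sigma_rearr(1)[OF f(1)] by (rule antimono_rearr_real)
 show "\<sigma> (rearr_real f) <= 1" using sigma_rearr(2)[OF f(1)] f(2) by simp
qed

lemma ball_normalize:
 assumes g: "!!k. 0 <= g k" and anti: "antimono g" and fin: "\<sigma> g < \<infinity>" and nz: "\<sigma> g ~= 0"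
 obtains c f where "0 < c" "\<sigma> g = ennreal c" "f \<in> dilation_unit_ball \<rho>" "rearr_real f = (%n. 1/c * g n)"
proof -
 define c where "c = enn2real (\<sigma> g)"
 have c: "c > 0" "\<sigma> g = ennreal c"
  using fin nz by (auto simp: c_def enn2real_positive_iff zero_less_iff_neq_zero)
 define f where "f n = complex_of_real (1/c * g n)" for n
 have n: "norm (f n) = 1/c * g n" for n using c(1) g[of n] by (simp add: f_def norm_mult norm_divide)
 have "\<sigma> (%n. 1/c * g n) = ennreal (1/c) * \<sigma> g" using c g by (intro S.scale) auto
 also have "... = ennreal (1/c * c)" unfolding c(2) using c(1) by (intro ennreal_mult[symmetric]) auto
 also have "... = 1" using c by simp
 finally have 1: "\<sigma> (%n. 1/c * g n) = 1" .
 have "f \<in> dilation_unit_ball \<rho>"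
  unfolding dilation_unit_ball_def seq_space_def normed_fun_space.simps mem_Collect_eq n 1 by simp
 moreover have "rearr_real f = (%n. 1/c * g n)"
  by (rule rearr_real_antimono[OF _ _ n]) (use c g anti in \<open>auto simp: antimono_def divide_right_mono\<close>)
 ultimately show ?thesis using that c by blast
qed

text \<open>The supremum over the unit ball involves rearrangements only; since a decreasing
  sequence is its own rearrangement, scaling it into the ball turns the supremum into an operator
  bound on decreasing sequences. A general homogeneous positive \<open>T\<close> serves both
  dilations.\<close>

lemma dilation_bound:
 fixes T :: "(nat => real) => nat => real"
 assumes g: "!!k. 0 <= g k" "antimono g" "\<sigma> g < \<infinity>"
  and T: "!!c g. T (%n. c * g n) = (%n. c * T g n)" "!!g k. (!!k. 0 <= g k) ==> 0 <= T g k"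
 shows "\<sigma> (T g) <= (SUP f\<in>dilation_unit_ball \<rho>. \<sigma> (T (rearr_real f))) * \<sigma> g"
proof (cases "\<sigma> g = 0")
 case True
 hence "g = (%_. 0)" using S.eq_0_iff[of g] g by auto
 hence "T g = (%_. 0)" using T(1)[of 0 g] by simp
 thus ?thesis by (simp add: S.zero)
next
 case False
 obtain c f where c: "0 < c" "\<sigma> g = ennreal c" "f \<in> dilation_unit_ball \<rho>" "rearr_real f = (%n. 1/c * g n)"
  using ball_normalize[OF g False] by blast
 have "T g = (%n. c * T (%n. 1/c * g n) n)" using c(1) by (subst T(1)) (simp add: fun_eq_iff)
 moreover have "\<sigma> (%n. c * T (%n. 1/c * g n) n) = ennreal c * \<sigma> (T (%n. 1/c * g n))"
  using c g by (intro S.scale nonneg_seqsI T(2)) auto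
 ultimately have "\<sigma> (T g) = \<sigma> (T (rearr_real f)) * \<sigma> g" by (simp add: c mult.commute)
 also have "... <= (SUP f\<in>dilation_unit_ball \<rho>. \<sigma> (T (rearr_real f))) * \<sigma> g"
  by (intro mult_right_mono SUP_upper c) auto
 finally show ?thesis .
qed

lemma K_bound:
 "(!!k. 0 <= g k) ==> antimono g ==> \<sigma> g < \<infinity> ==> \<sigma> (stretch j g) <= boyd_K \<rho> j * \<sigma> g"
 unfolding boyd_K_def by (rule dilation_bound) (auto simp: stretch_def)

lemma H_bound:
 "(!!k. 0 <= g k) ==> antimono g ==> \<sigma> g < \<infinity> ==> \<sigma> (compress j g) <= boyd_H \<rho> j * \<sigma> g"
 unfolding boyd_H_def by (rule dilation_bound) (auto simp: compress_def)

text \<open>The stretched sequence is a sum of \<open>j\<close> copies of \<open>g\<close>, each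
  spread over one residue class modulo \<open>j\<close> and therefore equimeasurable with
  \<open>g\<close>.\<close>

lemma stretch_norm_le:
 assumes g: "!!k. 0 <= g k" and j: "1 <= j"
 shows "\<sigma> (stretch j g) <= of_nat j * \<sigma> g"
proof -
 define h where "h i k = (if k mod j = i then g (k div j) else 0)" for i k
 have "\<sigma> (h i) = \<sigma> g" if i: "i < j" for i
 proof (rule S.ri_eq)
  fix t :: real assume t: "0 <= t"
  have "bij_betw (%m. j * m + i) {m. t < norm (g m)} {k. t < norm (h i k)}"
  proof (rule bij_betwI)
   show "(%m. j * m + i) \<in> {m. t < norm (g m)} \<rightarrow> {k. t < norm (h i k)}" using i by (auto simp: h_def)
   show "(%k. k div j) \<in> {k. t < norm (h i k)} \<rightarrow> {m. t < norm (g m)}" using t by (auto simp: h_def split: if_splits)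
   show "(j * m + i) div j = m" for m using i j by auto
   show "j * (k div j) + i = k" if "k \<in> {k. t < norm (h i k)}" for k
    using that t mult_div_mod_eq[of j k] by (auto simp: h_def split: if_splits)
  qed
  hence "finite {m. t < norm (g m)} \<longleftrightarrow> finite {k. t < norm (h i k)}"
   "card {m. t < norm (g m)} = card {k. t < norm (h i k)}" by (rule bij_betw_finite, rule bij_betw_same_card)
  thus "distribution_fun (h i) t = distribution_fun g t" by (auto simp: distribution_fun_def emeasure_count_space)
 qed (use g in \<open>auto simp: h_def\<close>)
 hence e: "(\<Sum>i<j. \<sigma> (h i)) = of_nat j * \<sigma> g" by simp
 have "stretch j g = (%k. \<Sum>i<j. h i k)" using j by (auto simp: stretch_def h_def fun_eq_iff)
 moreover have "\<sigma> (%k. \<Sum>i<j. h i k) <= (\<Sum>i<j. \<sigma> (h i))"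
  using g by (intro S.sum_bound) (auto simp: h_def)
 ultimately show ?thesis unfolding e by simp
qed

lemma K_le: "1 <= j ==> boyd_K \<rho> j <= of_nat j"
 unfolding boyd_K_def
proof (rule SUP_least)
 fix f assume "1 <= j" "f \<in> dilation_unit_ball \<rho>"
 hence "\<sigma> (stretch j (rearr_real f)) <= of_nat j * \<sigma> (rearr_real f)"
  by (intro stretch_norm_le rearr_real_nonneg)
 also have "... <= of_nat j * 1" using ball_rearr \<open>f \<in> _\<close> by (intro mult_left_mono) auto
 finally show "\<sigma> (stretch j (rearr_real f)) <= of_nat j" by simp
qed

lemma H_le_1: "1 <= j ==> boyd_H \<rho> j <= 1"
 unfolding boyd_H_def
proof (rule SUP_least)
 fix f assume j: "1 <= j" and f: "f \<in> dilation_unit_ball \<rho>"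
 have "compress j (rearr_real f) k <= rearr_real f k" for k
 proof -
  have "k + 1 <= j * (k + 1)" using mult_le_mono1[OF j, of "k + 1"] by simp
  thus ?thesis using ball_rearr(1)[OF f] unfolding compress_def antimono_def by (meson le_diff_conv2 le_add2 order_trans)
 qed
 hence "\<sigma> (compress j (rearr_real f)) <= \<sigma> (rearr_real f)"
  by (intro S.mono) (auto simp: compress_def rearr_real_nonneg)
 thus "\<sigma> (compress j (rearr_real f)) <= 1" using ball_rearr(2)[OF f] by (rule order_trans)
qed

lemma K_submult: "1 <= i ==> 1 <= j ==> boyd_K \<rho> (i * j) <= boyd_K \<rho> i * boyd_K \<rho> j"
proof -
 assume ij: "1 <= i" "1 <= j"
 show ?thesis unfolding boyd_K_def[of \<rho> "i * j"]
 proof (rule SUP_least)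
  fix f assume f: "f \<in> dilation_unit_ball \<rho>"
  define g where "g = stretch j (rearr_real f)"
  have g: "0 <= g k" "antimono g" for k using ball_rearr(1)[OF f]
   by (auto simp: g_def stretch_def rearr_real_nonneg antimono_def div_le_mono)
  have gK: "\<sigma> g <= boyd_K \<rho> j" unfolding g_def boyd_K_def using f by (intro SUP_upper)
  also have "boyd_K \<rho> j <= of_nat j" by (rule K_le[OF ij(2)])
  also have "(of_nat j :: ennreal) < \<infinity>" by (simp add: of_nat_less_top)
  finally have "\<sigma> g < \<infinity>" .
  have "stretch (i * j) (rearr_real f) = stretch i g" by (simp add: g_def stretch_def fun_eq_iff div_mult2_eq)
  hence "\<sigma> (stretch (i * j) (rearr_real f)) <= boyd_K \<rho> i * \<sigma> g"
   using K_bound[OF g \<open>\<sigma> g < \<infinity>\<close>] by simp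
  also have "... <= boyd_K \<rho> i * boyd_K \<rho> j" using gK by (intro mult_left_mono) auto
  finally show "\<sigma> (stretch (i * j) (rearr_real f)) <= boyd_K \<rho> i * boyd_K \<rho> j" .
 qed
qed

lemma H_submult: "1 <= i ==> 1 <= j ==> boyd_H \<rho> (i * j) <= boyd_H \<rho> i * boyd_H \<rho> j"
proof -
 assume ij: "1 <= i" "1 <= j"
 show ?thesis unfolding boyd_H_def[of \<rho> "i * j"]
 proof (rule SUP_least)
  fix f assume f: "f \<in> dilation_unit_ball \<rho>"
  define g where "g = compress j (rearr_real f)"
  have "j * (k + 1) - 1 <= j * (l + 1) - 1" if "k <= l" for k l using that by (intro diff_le_mono mult_le_mono) auto
  hence g: "0 <= g k" "antimono g" for k using ball_rearr(1)[OF f]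
   by (auto simp: g_def compress_def rearr_real_nonneg antimono_def)
  have gH: "\<sigma> g <= boyd_H \<rho> j" unfolding g_def boyd_H_def using f by (intro SUP_upper)
  also have "boyd_H \<rho> j <= 1" by (rule H_le_1[OF ij(2)])
  also have "(1 :: ennreal) < \<infinity>" by simp
  finally have "\<sigma> g < \<infinity>" .
  \<comment> \<open>Position \<open>k\<close> stands for \<open>k + 1\<close> in one-based counting;
    with the shifts undone, compressions compose.\<close>
  have "i * j * (k + 1) - 1 = j * (i * (k + 1) - 1 + 1) - 1" for k using ij by (simp add: algebra_simps)
  hence "compress (i * j) (rearr_real f) = compress i g" unfolding g_def compress_def fun_eq_iff by metis
  hence "\<sigma> (compress (i * j) (rearr_real f)) <= boyd_H \<rho> i * \<sigma> g"
   using H_bound[OF g \<open>\<sigma> g < \<infinity>\<close>] by simp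
  also have "... <= boyd_H \<rho> i * boyd_H \<rho> j" using gH by (intro mult_left_mono) auto
  finally show "\<sigma> (compress (i * j) (rearr_real f)) <= boyd_H \<rho> i * boyd_H \<rho> j" .
 qed
qed

text \<open>Compression undoes stretching. This keeps both dilation norms away from 0, so that their
  logarithms behave, and later orders the two indices.\<close>

lemma HK_ge_1: "1 <= j ==> 1 <= boyd_H \<rho> j * boyd_K \<rho> j"
proof -
 assume j: "1 <= j"
 define g :: "nat => real" where "g = indicator {0}"
 have g: "0 <= g k" "antimono g" for k by (auto simp: g_def antimono_def indicator_def)
 have fin: "\<sigma> g < \<infinity>" unfolding g_def by (rule S.finite_indicator) simp
 have nz: "\<sigma> g ~= 0" using S.eq_0_iff[of g] g by (auto simp: g_def fun_eq_iff indicator_def)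
 define h where "h = stretch j g"
 have h: "0 <= h k" "antimono h" for k using g by (auto simp: h_def stretch_def antimono_def div_le_mono)
 have hK: "\<sigma> h <= boyd_K \<rho> j * \<sigma> g" unfolding h_def by (rule K_bound[OF g fin])
 also have "... <= of_nat j * \<sigma> g" using K_le[OF j] by (intro mult_right_mono) auto
 also have "... < \<infinity>" using fin by (simp add: ennreal_mult_less_top of_nat_less_top)
 finally have hfin: "\<sigma> h < \<infinity>" .
 have "(j * (k + 1) - 1) div j = k" for k
 proof -
  obtain i where i: "j = Suc i" using j by (cases j) auto
  have "j * (k + 1) - 1 = i + k * j" by (simp add: i)
  hence "(j * (k + 1) - 1) div j = k + i div j" using j by (simp only: div_mult_self1)
  thus ?thesis by (simp add: i)
 qed
 hence "compress j h = g" by (simp add: h_def compress_def stretch_def fun_eq_iff)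
 hence "\<sigma> g <= boyd_H \<rho> j * \<sigma> h" using H_bound[OF h hfin, of j] by simp
 also have "... <= boyd_H \<rho> j * (boyd_K \<rho> j * \<sigma> g)" using hK by (intro mult_left_mono) auto
 finally have "1 * \<sigma> g <= (boyd_H \<rho> j * boyd_K \<rho> j) * \<sigma> g" by (simp add: mult.assoc)
 hence "\<sigma> g * 1 <= \<sigma> g * (boyd_H \<rho> j * boyd_K \<rho> j)" by (simp add: mult.commute)
 thus ?thesis using fin nz by (subst (asm) ennreal_mult_le_mult_iff) auto
qed

lemma K_mono:
 assumes "1 <= i" "i <= j"
 shows "boyd_K \<rho> i <= boyd_K \<rho> j"
 unfolding boyd_K_def
proof (rule SUP_mono)
 fix f assume f: "f \<in> dilation_unit_ball \<rho>"
 have "\<sigma> (stretch i (rearr_real f)) <= \<sigma> (stretch j (rearr_real f))"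
 proof (rule S.mono)
  show "stretch i (rearr_real f) k <= stretch j (rearr_real f) k" for k
   using ball_rearr(1)[OF f] div_le_mono2[of i j k] assms unfolding stretch_def antimono_def by simp
 qed (auto simp: stretch_def rearr_real_nonneg)
 thus "\<exists>g\<in>dilation_unit_ball \<rho>. \<sigma> (stretch i (rearr_real f)) <= \<sigma> (stretch j (rearr_real g))"
  using f by blast
qed

lemma H_antimono:
 assumes "1 <= i" "i <= j"
 shows "boyd_H \<rho> j <= boyd_H \<rho> i"
 unfolding boyd_H_def
proof (rule SUP_mono)
 fix f assume f: "f \<in> dilation_unit_ball \<rho>"
 have "\<sigma> (compress j (rearr_real f)) <= \<sigma> (compress i (rearr_real f))"
 proof (rule S.mono)
  fix k
  have "i * (k + 1) - 1 <= j * (k + 1) - 1" using assms by (intro diff_le_mono mult_le_mono) auto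
  thus "compress j (rearr_real f) k <= compress i (rearr_real f) k"
   using ball_rearr(1)[OF f] unfolding compress_def antimono_def by blast
 qed (auto simp: compress_def rearr_real_nonneg)
 thus "\<exists>g\<in>dilation_unit_ball \<rho>. \<sigma> (compress j (rearr_real f)) <= \<sigma> (compress i (rearr_real g))"
  using f by blast
qed

definition "Kr j = enn2real (boyd_K \<rho> j)"
definition "Hr j = enn2real (boyd_H \<rho> j)"

lemma K_eq: "1 <= j ==> boyd_K \<rho> j = ennreal (Kr j)"
proof -
 assume "1 <= j"
 hence "boyd_K \<rho> j < \<infinity>" by (intro le_less_trans[OF K_le]) (auto simp: of_nat_less_top)
 thus ?thesis by (simp add: Kr_def)
qed

lemma H_eq: "1 <= j ==> boyd_H \<rho> j = ennreal (Hr j)"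
proof -
 assume "1 <= j"
 hence "boyd_H \<rho> j < \<infinity>" by (intro le_less_trans[OF H_le_1]) auto
 thus ?thesis by (simp add: Hr_def)
qed

lemma Kr_nonneg: "0 <= Kr j" and Hr_nonneg: "0 <= Hr j" by (simp_all add: Kr_def Hr_def)

lemma HKr: assumes "1 <= j" shows "1 <= Hr j * Kr j" "Hr j <= 1" "Kr j <= j" "0 < Hr j" "1 <= Kr j"
proof -
 show 1: "1 <= Hr j * Kr j"
 proof -
  have "ennreal 1 <= ennreal (Hr j * Kr j)"
   using HK_ge_1[OF assms] unfolding K_eq[OF assms] H_eq[OF assms] by (simp add: ennreal_mult Hr_nonneg Kr_nonneg)
  thus ?thesis using Hr_nonneg Kr_nonneg by (subst (asm) ennreal_le_iff) auto
 qed
 show 2: "Hr j <= 1" using H_le_1[OF assms] unfolding H_eq[OF assms] by simp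
 show "Kr j <= j" using K_le[OF assms] unfolding K_eq[OF assms] by (simp add: ennreal_of_nat_eq_real_of_nat)
 show "0 < Hr j" using 1 Hr_nonneg[of j] by (cases "Hr j = 0") auto
 have "Hr j * Kr j <= 1 * Kr j" using 2 Kr_nonneg by (intro mult_right_mono)
 thus "1 <= Kr j" using 1 by simp
qed

lemma Kr_submult: "1 <= i ==> 1 <= j ==> Kr (i * j) <= Kr i * Kr j"
 using K_submult[of i j] by (simp add: K_eq ennreal_mult[symmetric] Kr_nonneg)

lemma Hr_submult: "1 <= i ==> 1 <= j ==> Hr (i * j) <= Hr i * Hr j"
 using H_submult[of i j] by (simp add: H_eq ennreal_mult[symmetric] Hr_nonneg)

lemma Kr_mono: "1 <= i ==> i <= j ==> Kr i <= Kr j" using K_mono[of i j] by (simp add: K_eq Kr_nonneg)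

lemma Hr_antimono: "1 <= i ==> i <= j ==> Hr j <= Hr i" using H_antimono[of i j] by (simp add: H_eq Hr_nonneg)

lemma upper_limit: "(%j. ln (Kr j) / ln (real j)) \<longlonglongrightarrow> upper_boyd_index \<rho>"
proof -
 have "convergent (%j. ln (Kr j) / ln (real j))"
 proof (rule log_subadditive_limit[where b = 0])
  fix j n :: nat assume jn: "2 <= j" "2 <= n"
  obtain k where k: "j ^ k <= n" "n < j ^ (k + 1)" "real k <= ln n / ln j" "ln n / ln j <= real k + 1"
   using nat_log_bracket[of j n] jn by auto
  have K1: "1 <= Kr j" "1 <= Kr n" using HKr(5) jn by auto
  have "Kr n <= Kr (j ^ (k + 1))" using k jn by (intro Kr_mono) auto
  also have "... <= Kr j ^ (k + 1)" using jn HKr(3)[of 1] by (intro submultiplicative_power Kr_submult Kr_nonneg) auto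
  finally have "ln (Kr n) <= ln (Kr j ^ (k + 1))" using K1 by (subst ln_le_cancel_iff) auto
  also have "... = (real k + 1) * ln (Kr j)" using K1 by (simp add: ln_realpow add.commute del: power_Suc)
  also have "... <= (ln n / ln j + 1) * ln (Kr j)" using k K1 by (intro mult_right_mono) auto
  finally show "ln (Kr n) <= ln (Kr j) * (ln (real n) / ln (real j)) + ln (Kr j)" by (simp add: algebra_simps)
 next
  fix n :: nat assume "2 <= n"
  thus "0 <= ln (Kr n) / ln (real n)" using HKr(5)[of n] by auto
 qed
 thus ?thesis unfolding upper_boyd_index_def Kr_def convergent_LIMSEQ_iff .
qed

lemma lower_limit: "(%j. - ln (Hr j) / ln (real j)) \<longlonglongrightarrow> lower_boyd_index \<rho>"
proof -
 have "convergent (%j. ln (Hr j) / ln (real j))"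
 \<comment> \<open>The lower bound -1 comes from \<open>1 <= Hr n * Kr n\<close> and
   \<open>Kr n <= n\<close>.\<close>
 proof (rule log_subadditive_limit[where b = "-1"])
  fix j n :: nat assume jn: "2 <= j" "2 <= n"
  obtain k where k: "j ^ k <= n" "n < j ^ (k + 1)" "real k <= ln n / ln j" "ln n / ln j <= real k + 1"
   using nat_log_bracket[of j n] jn by auto
  have H1: "0 < Hr j" "0 < Hr n" "Hr j <= 1" using HKr jn by auto
  have "1 <= j ^ k" using jn by simp
  hence "Hr n <= Hr (j ^ k)" using k by (intro Hr_antimono)
  also have "... <= Hr j ^ k" using jn HKr(2)[of 1] by (intro submultiplicative_power Hr_submult Hr_nonneg) auto
  finally have "ln (Hr n) <= ln (Hr j ^ k)" using H1 by (subst ln_le_cancel_iff) auto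
  also have "... = real k * ln (Hr j)" using H1 by (simp add: ln_realpow)
  \<comment> \<open>\<open>ln (Hr j)\<close> is not positive, so it is the lower bound for
    \<open>k\<close> that counts.\<close>
  also have "... <= (ln n / ln j - 1) * ln (Hr j)" using k H1 by (intro mult_right_mono_neg) auto
  finally show "ln (Hr n) <= ln (Hr j) * (ln (real n) / ln (real j)) + - ln (Hr j)" by (simp add: algebra_simps)
 next
  fix n :: nat assume n: "2 <= n"
  have "1 <= Hr n * Kr n" "Kr n <= n" "0 < Hr n" using HKr[of n] n by auto
  hence "1 <= Hr n * n" by (meson less_imp_le mult_left_mono order_trans)
  hence "0 <= ln (Hr n * n)" by simp
  also have "... = ln (Hr n) + ln n" using \<open>0 < Hr n\<close> n by (intro ln_mult_pos) auto
  finally show "-1 <= ln (Hr n) / ln (real n)" using n by (simp add: pos_le_divide_eq)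
 qed
 hence "convergent (%j. - (ln (Hr j) / ln (real j)))" by (simp add: convergent_minus_iff[symmetric])
 hence "convergent (%j. - ln (Hr j) / ln (real j))" by simp
 thus ?thesis unfolding lower_boyd_index_def Hr_def convergent_LIMSEQ_iff .
qed

lemma lower_le_upper: "lower_boyd_index \<rho> <= upper_boyd_index \<rho>"
proof (rule LIMSEQ_le[OF lower_limit upper_limit], intro exI[of _ 2] allI impI divide_right_mono)
 fix n :: nat assume n: "2 <= n"
 have *: "1 <= Hr n * Kr n" "1 <= Kr n" "0 < Hr n" using HKr[of n] n by auto
 hence "0 <= ln (Hr n * Kr n)" by simp
 also have "... = ln (Hr n) + ln (Kr n)" using * by (intro ln_mult_pos) auto
 finally show "- ln (Hr n) <= ln (Kr n)" by simp
qed auto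

lemma K_decay:
 assumes "upper_boyd_index \<rho> < b"
 obtains C where "0 < C" "!!j. 1 <= j ==> Kr j <= C * real j powr b"
proof -
 have "\<forall>\<^sub>F j in sequentially. ln (Kr j) / ln (real j) < b" by (rule order_tendstoD(2)[OF upper_limit assms])
 then obtain J where J: "!!j. J <= j ==> ln (Kr j) / ln (real j) < b" by (auto simp: eventually_sequentially)
 define M where "M = Max ((%j. Kr j / real j powr b) ` {1..J + 2})"
 have M: "Kr j <= M * real j powr b" if "1 <= j" "j <= J + 2" for j
 proof -
  have "Kr j / real j powr b <= M" unfolding M_def using that by (intro Max_ge) auto
  thus ?thesis using that by (simp add: pos_divide_le_eq)
 qed
 have "Kr j <= max 1 M * real j powr b" if j: "1 <= j" for j
 proof (cases "j <= J + 2")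
  case True
  hence "Kr j <= M * real j powr b" using M j by blast
  also have "... <= max 1 M * real j powr b" by (intro mult_right_mono) auto
  finally show ?thesis .
 next
  case False
  hence "ln (Kr j) <= b * ln (real j)" using J[of j] by (simp add: pos_divide_less_eq less_imp_le)
  hence "Kr j <= exp (b * ln (real j))" using HKr(5)[OF j] by (simp add: ln_ge_iff[symmetric] ln_le_cancel_iff[symmetric] del: ln_le_cancel_iff)
  also have "... = 1 * real j powr b" using j by (simp add: powr_def)
  also have "... <= max 1 M * real j powr b" by (intro mult_right_mono) auto
  finally show ?thesis .
 qed
 thus ?thesis using that[of "max 1 M"] by auto
qed

lemma H_decay:
 assumes "a < lower_boyd_index \<rho>"
 obtains C where "0 < C" "!!j. 1 <= j ==> Hr j <= C * real j powr (- a)"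
proof -
 have "\<forall>\<^sub>F j in sequentially. a < - ln (Hr j) / ln (real j)" by (rule order_tendstoD(1)[OF lower_limit assms])
 then obtain J where J: "!!j. J <= j ==> a < - ln (Hr j) / ln (real j)" by (auto simp: eventually_sequentially)
 define M where "M = Max ((%j. Hr j / real j powr (- a)) ` {1..J + 2})"
 have M: "Hr j <= M * real j powr (- a)" if "1 <= j" "j <= J + 2" for j
 proof -
  have "Hr j / real j powr (- a) <= M" unfolding M_def using that by (intro Max_ge) auto
  thus ?thesis using that by (simp add: pos_divide_le_eq)
 qed
 have "Hr j <= max 1 M * real j powr (- a)" if j: "1 <= j" for j
 proof (cases "j <= J + 2")
  case True
  hence "Hr j <= M * real j powr (- a)" using M j by blast
  also have "... <= max 1 M * real j powr (- a)" by (intro mult_right_mono) auto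
  finally show ?thesis .
 next
  case False
  hence "0 < ln (real j)" by simp
  hence "a * ln (real j) <= - ln (Hr j)"
   using J[of j] False pos_less_divide_eq[of "ln (real j)" a "- ln (Hr j)"] by simp
  hence "ln (Hr j) <= - a * ln (real j)" by simp
  hence "exp (ln (Hr j)) <= exp (- a * ln (real j))" by (simp only: exp_le_cancel_iff)
  hence "Hr j <= exp (- a * ln (real j))" using HKr(4)[OF j] by simp
  also have "... = 1 * real j powr (- a)" using j by (simp add: powr_def)
  also have "... <= max 1 M * real j powr (- a)" by (intro mult_right_mono) auto
  finally show ?thesis .
 qed
 thus ?thesis using that[of "max 1 M"] by auto
qed

end

lemma sum_powr_le:
 fixes a :: "'i => real"
 assumes "!!i. i \<in> I ==> 0 <= a i" "1 <= p"
 shows "(\<Sum>i\<in>I. a i powr p) <= (\<Sum>i\<in>I. a i) powr p"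
 using assms(1)
proof (induction I rule: infinite_finite_induct)
 case (insert i I)
 define S where "S = (\<Sum>i\<in>I. a i)"
 have S: "0 <= S" "0 <= a i" using insert.prems by (auto simp: S_def intro: sum_nonneg)
 have "a i powr p + S powr p <= (a i + S) powr p"
 proof (cases "a i + S = 0")
  case False
  hence T: "0 < a i + S" using S by simp
  have *: "x powr p <= x * (a i + S) powr (p - 1)" if "0 <= x" "x <= a i + S" for x
  proof (cases "x = 0")
   case False
   hence "x powr p = x * x powr (p - 1)" using that powr_add[of x 1 "p - 1"] by simp
   also have "... <= x * (a i + S) powr (p - 1)" using that assms(2) by (intro mult_left_mono powr_mono2) auto
   finally show ?thesis .
  qed simp
  have "a i powr p + S powr p <= a i * (a i + S) powr (p - 1) + S * (a i + S) powr (p - 1)"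
   using S by (intro add_mono *) auto
  also have "... = (a i + S) powr p" using T powr_add[of "a i + S" 1 "p - 1"] by (simp add: distrib_right)
  finally show ?thesis .
 next
  case True
  hence "a i = 0" "S = 0" using S by linarith+
  thus ?thesis by simp
 qed
 thus ?case using insert by (simp add: S_def)
qed (use assms in auto)

section \<open>Interpolation between the Boyd indices\<close>

context boyd
begin

text \<open>Joint weak-type estimate: splitting \<open>f\<close> at the height \<open>f\<^sup>*(n)\<close> and summing over dyadic ranks,
 \<open>(T f)\<^sup>*\<close> is dominated by a discrete Calderon operator applied to \<open>f\<^sup>*\<close>.\<close>

lemma calderon_pointwise:
 fixes f :: "int => real" and T :: "(int => real) => int => real" and p0 p1 C0 C1 :: real
 defines "fs \<equiv> rearr_real f"
 assumes fin: "finite (supp f)" and p: "1 < p0" "1 < p1" and C: "0 < C0" "0 < C1"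
  and add: "!!f g x. finite (supp f) ==> finite (supp g) ==> T (%x. f x + g x) x = T f x + T g x"
  and T0: "!!B f. finite B ==> finite (supp f) ==> (\<Sum>x\<in>B. \<bar>T f x\<bar> powr p0) <= C0 * (\<Sum>x\<in>supp f. \<bar>f x\<bar> powr p0)"
  and T1: "!!B f. finite B ==> finite (supp f) ==> (\<Sum>x\<in>B. \<bar>T f x\<bar> powr p1) <= C1 * (\<Sum>x\<in>supp f. \<bar>f x\<bar> powr p1)"
 shows "summable (%i. 2 powr (- real i / p0) * stretch (2 ^ (i + 1)) fs n)"
  "summable (%i. 2 powr (real i / p1) * compress (2 ^ i) fs n)"
  "distribution_fun (T f) ((4 * C0) powr (1/p0) * (\<Sum>i. 2 powr (- real i / p0) * stretch (2 ^ (i + 1)) fs n)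
   + (8 * C1) powr (1/p1) * (\<Sum>i. 2 powr (real i / p1) * compress (2 ^ i) fs n)) <= of_nat n"
proof -
 define A where "A = supp f"
 have A: "finite A" using fin by (simp add: A_def)
 define b where "b = Max (insert 0 ((%x. \<bar>f x\<bar>) ` A))"
 have "\<bar>f x\<bar> <= b" for x
 proof (cases "x \<in> A")
  case True
  thus ?thesis unfolding b_def using A by (intro Max_ge) auto
 next
  case False
  have "0 <= b" unfolding b_def using A by (intro Max_ge) auto
  thus ?thesis using False by (simp add: A_def)
 qed
 hence rf: "\<forall>n. rearr f n < \<infinity>" using rearr_bounded[of f b] by simp
 have anti: "fs k <= fs l" if "l <= k" for k l
  using antimono_rearr_real[OF rf] that unfolding fs_def antimono_def by blast
 have fs0: "0 <= fs k" for k by (simp add: fs_def rearr_real_nonneg)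
 have card: "finite {x. fs k < \<bar>f x\<bar>}" "card {x. fs k < \<bar>f x\<bar>} <= k" for k
  using card_less_rearr[OF rf fs0, of k k] by (simp_all add: fs_def not_less distribution_le_iff)
 have vanish: "fs k = 0" if "card A <= k" for k
 proof -
  have "{x. 0 < norm (f x)} = A" by (auto simp: A_def)
  hence "distribution_fun f 0 <= of_nat k" using A that by (simp add: distribution_le_iff)
  hence "~ 0 < fs k" using card_less_rearr[OF rf order_refl, of k] by (simp add: fs_def not_less)
  thus ?thesis using fs0[of k] by simp
 qed
 \<comment> \<open>\<open>F i\<close> and \<open>E i\<close> are \<open>fs\<close> at the ranks
   \<open>n div 2 ^ (i + 1)\<close> and \<open>2 ^ i * (n + 1) - 1\<close>, which run dyadically
   from \<open>n\<close> down to 0 and up past the size of the support.\<close>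
 define F where "F i = stretch (2 ^ (i + 1)) fs n" for i
 define E where "E i = compress (2 ^ i) fs n" for i
 have F0: "0 <= F i" and E0: "0 <= E i" for i by (auto simp: F_def E_def stretch_def compress_def fs0)
 have pwi: "2 powr (- real i / p0) = (2 powr (- 1 / p0)) ^ i" for i by (simp add: powr_realpow[symmetric] powr_powr)
 have q1: "2 powr (- 1 / p0) < (1::real)" using p powr_less_mono[of "-1/p0" 0 2] by simp
 have F_le: "F i <= fs 0" for i by (auto simp: F_def stretch_def intro: anti)
 have sF: "summable (%i. 2 powr (- real i / p0) * F i)"
  unfolding pwi
 proof (rule summable_comparison_test')
  show "summable (%i. (2 powr (- 1 / p0)) ^ i * fs 0)" using q1 by (intro summable_mult2 summable_geometric) auto
  show "norm ((2 powr (- 1 / p0)) ^ i * F i) <= (2 powr (- 1 / p0)) ^ i * fs 0" for i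
   using F_le F0 by (simp add: mult_left_mono)
 qed
 have Ez: "E i = 0" if "card A <= i" for i
 proof -
  have "i < 2 ^ i * 1" using less_exp[of i] by simp
  also have "... <= 2 ^ i * (n + 1)" by (intro mult_le_mono2) simp
  finally have "card A <= 2 ^ i * (n + 1) - 1" using that by linarith
  thus ?thesis unfolding E_def compress_def by (rule vanish)
 qed
 have sE: "summable (%i. 2 powr (real i / p1) * E i)"
  by (rule summable_finite[of "{..<card A}"]) (use Ez in \<open>auto simp: not_less\<close>)
 from sF show "summable (%i. 2 powr (- real i / p0) * stretch (2 ^ (i + 1)) fs n)" unfolding F_def .
 from sE show "summable (%i. 2 powr (real i / p1) * compress (2 ^ i) fs n)" unfolding E_def .
 define S0 where "S0 = (\<Sum>i. 2 powr (- real i / p0) * F i)"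
 define S1 where "S1 = (\<Sum>i. 2 powr (real i / p1) * E i)"
 have S0n: "0 <= S0" unfolding S0_def using F0 by (intro suminf_nonneg sF) auto
 have S1n: "0 <= S1" unfolding S1_def using E0 by (intro suminf_nonneg sE) auto
 define f1 where "f1 x = (if fs n < \<bar>f x\<bar> then f x else 0)" for x
 define f2 where "f2 x = (if fs n < \<bar>f x\<bar> then 0 else f x)" for x
 have fin12: "finite (supp f1)" "finite (supp f2)" by (auto intro!: finite_subset[OF _ A] simp: f1_def f2_def A_def)
 \<comment> \<open>At most \<open>k i\<close> points satisfy \<open>fs (k i) < |f x|\<close>, and on
   the \<open>i\<close>-th layer \<open>|f x|\<close> is at most \<open>e i\<close>; each point of
   \<open>D\<close> lies in some layer. Both halves of \<open>f\<close> use this, with different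
   ranks.\<close>
 have dyadic: "(\<Sum>x\<in>D. \<bar>f x\<bar> powr p) <= (\<Sum>i<N. real (k i) * (e i) powr p)"
  if D: "finite D" and cov: "!!x. x \<in> D ==> \<exists>i<N. fs (k i) < \<bar>f x\<bar> & \<bar>f x\<bar> <= e i" and p: "1 < p"
  for D N p and k :: "nat => nat" and e :: "nat => real"
 proof -
  have "(\<Sum>x\<in>D. \<bar>f x\<bar> powr p) <= (\<Sum>x\<in>D. \<Sum>i<N. if fs (k i) < \<bar>f x\<bar> & \<bar>f x\<bar> <= e i then e i powr p else 0)"
  proof (rule sum_mono)
   fix x assume "x \<in> D"
   then obtain i where i: "i < N" "fs (k i) < \<bar>f x\<bar>" "\<bar>f x\<bar> <= e i" using cov by blast
   have "\<bar>f x\<bar> powr p <= e i powr p" using i p by (intro powr_mono2) auto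
   also have "... = (\<Sum>j\<in>{i}. if fs (k j) < \<bar>f x\<bar> & \<bar>f x\<bar> <= e j then e j powr p else 0)" using i by simp
   also have "... <= (\<Sum>i<N. if fs (k i) < \<bar>f x\<bar> & \<bar>f x\<bar> <= e i then e i powr p else 0)"
    using i by (intro sum_mono2) auto
   finally show "\<bar>f x\<bar> powr p <= ..." .
  qed
  also have "... = (\<Sum>i<N. \<Sum>x\<in>D. if fs (k i) < \<bar>f x\<bar> & \<bar>f x\<bar> <= e i then e i powr p else 0)" by (rule sum.swap)
  also have "... <= (\<Sum>i<N. real (k i) * (e i) powr p)"
  proof (rule sum_mono)
   fix i
   have "(\<Sum>x\<in>D. if fs (k i) < \<bar>f x\<bar> & \<bar>f x\<bar> <= e i then e i powr p else 0)
    = (\<Sum>x\<in>{x\<in>D. fs (k i) < \<bar>f x\<bar> & \<bar>f x\<bar> <= e i}. e i powr p)"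
    using D by (rule sum.inter_filter[symmetric])
   also have "... = real (card {x\<in>D. fs (k i) < \<bar>f x\<bar> & \<bar>f x\<bar> <= e i}) * e i powr p" by simp
   also have "... <= real (k i) * e i powr p"
   proof (intro mult_right_mono)
    have "card {x\<in>D. fs (k i) < \<bar>f x\<bar> & \<bar>f x\<bar> <= e i} <= card {x. fs (k i) < \<bar>f x\<bar>}"
     by (intro card_mono card) auto
    thus "real (card {x\<in>D. fs (k i) < \<bar>f x\<bar> & \<bar>f x\<bar> <= e i}) <= real (k i)" using card(2)[of "k i"] by simp
   qed auto
   finally show "(\<Sum>x\<in>D. if fs (k i) < \<bar>f x\<bar> & \<bar>f x\<bar> <= e i then e i powr p else 0) <= real (k i) * e i powr p" .
  qed
  finally show ?thesis .
 qed
 \<comment> \<open>Finds the layer of a point: a place where a comparison along the ranks changes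
   from false to true.\<close>
 have crossing: "\<exists>i<N. ~ P i & P (Suc i)" if "~ P 0" "P N" for P and N :: nat
  using that by (induction N) (auto simp: less_Suc_eq)
 have sum1: "(\<Sum>x\<in>supp f1. \<bar>f1 x\<bar> powr p0) <= n * S0 powr p0"
 proof -
  have "(\<Sum>x\<in>supp f1. \<bar>f1 x\<bar> powr p0) = (\<Sum>x\<in>supp f1. \<bar>f x\<bar> powr p0)"
   by (intro sum.cong) (auto simp: f1_def)
  also have "... <= (\<Sum>i<n. real (n div 2 ^ i) * F i powr p0)"
  proof (rule dyadic[OF fin12(1) _ p(1)])
   fix x assume "x \<in> (supp f1)"
   hence x: "fs n < \<bar>f x\<bar>" by (auto simp: f1_def split: if_splits)
   have z: "n div 2 ^ n = 0" using less_exp[of n] by simp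
   have "{x. fs 0 < \<bar>f x\<bar>} = {}" using card[of 0] by simp
   hence "\<bar>f x\<bar> <= fs (n div 2 ^ n)" using z by (auto simp: not_less)
   hence "\<exists>i<n. ~ \<bar>f x\<bar> <= fs (n div 2 ^ i) & \<bar>f x\<bar> <= fs (n div 2 ^ Suc i)"
    using x by (intro crossing[where P = "%i. \<bar>f x\<bar> <= fs (n div 2 ^ i)"]) auto
   thus "\<exists>i<n. fs (n div 2 ^ i) < \<bar>f x\<bar> & \<bar>f x\<bar> <= F i"
    by (auto simp: F_def stretch_def not_le)
  qed
  also have "... <= (\<Sum>i<n. n * (2 powr (- real i / p0) * F i) powr p0)"
  proof (rule sum_mono)
   fix i
   have "2 ^ i * (n div 2 ^ i) <= n" by simp
   hence "real (2 ^ i * (n div 2 ^ i)) <= real n" by (simp only: of_nat_le_iff)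
   hence "real (n div 2 ^ i) <= n * 2 powr (- real i)" by (simp add: powr_minus powr_realpow field_simps)
   hence "real (n div 2 ^ i) * F i powr p0 <= n * 2 powr (- real i) * F i powr p0" by (intro mult_right_mono) auto
   also have "... = n * (2 powr (- real i / p0) * F i) powr p0" using p F0[of i] by (simp add: powr_mult powr_powr)
   finally show "real (n div 2 ^ i) * F i powr p0 <= n * (2 powr (- real i / p0) * F i) powr p0" .
  qed
  also have "... = n * (\<Sum>i<n. (2 powr (- real i / p0) * F i) powr p0)" by (simp add: sum_distrib_left)
  also have "... <= n * (\<Sum>i<n. 2 powr (- real i / p0) * F i) powr p0"
   using p F0 by (intro mult_left_mono sum_powr_le) auto
  also have "... <= n * S0 powr p0"
   unfolding S0_def using p F0 by (intro mult_left_mono powr_mono2 sum_le_suminf sF sum_nonneg) auto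
  finally show ?thesis .
 qed
 have sum2: "(\<Sum>x\<in>supp f2. \<bar>f2 x\<bar> powr p1) <= 2 * (n + 1) * S1 powr p1"
 proof -
  let ?N = "card A"
  have "(\<Sum>x\<in>supp f2. \<bar>f2 x\<bar> powr p1) = (\<Sum>x\<in>supp f2. \<bar>f x\<bar> powr p1)"
   by (intro sum.cong) (auto simp: f2_def)
  also have "... <= (\<Sum>i<?N. real (2 ^ Suc i * (n + 1) - 1) * E i powr p1)"
  proof (rule dyadic[OF fin12(2) _ p(2)])
   fix x assume "x \<in> (supp f2)"
   hence x: "\<bar>f x\<bar> <= fs n" "f x ~= 0" by (auto simp: f2_def split: if_splits)
   have "fs (2 ^ ?N * (n + 1) - 1) = 0" using Ez[of ?N] by (simp add: E_def compress_def)
   hence "\<exists>i<?N. ~ fs (2 ^ i * (n + 1) - 1) < \<bar>f x\<bar> & fs (2 ^ Suc i * (n + 1) - 1) < \<bar>f x\<bar>"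
    using x by (intro crossing[where P = "%i. fs (2 ^ i * (n + 1) - 1) < \<bar>f x\<bar>"]) auto
   thus "\<exists>i<?N. fs (2 ^ Suc i * (n + 1) - 1) < \<bar>f x\<bar> & \<bar>f x\<bar> <= E i"
    unfolding E_def compress_def not_less by blast
  qed
  also have "... <= (\<Sum>i<?N. 2 * (n + 1) * (2 powr (real i / p1) * E i) powr p1)"
  proof (rule sum_mono)
   fix i
   have "2 ^ Suc i * (n + 1) - 1 <= 2 ^ Suc i * (n + 1)" by simp
   hence "real (2 ^ Suc i * (n + 1) - 1) <= real (2 ^ Suc i * (n + 1))" by (simp only: of_nat_le_iff)
   hence "real (2 ^ Suc i * (n + 1) - 1) * E i powr p1 <= real (2 ^ Suc i * (n + 1)) * E i powr p1"
    by (intro mult_right_mono) auto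
   also have "... = 2 * (n + 1) * (2 powr (real i / p1) * E i) powr p1"
    using p E0[of i] by (simp add: powr_mult powr_powr powr_realpow algebra_simps)
   finally show "real (2 ^ Suc i * (n + 1) - 1) * E i powr p1 <= 2 * (n + 1) * (2 powr (real i / p1) * E i) powr p1" .
  qed
  also have "... = 2 * (n + 1) * (\<Sum>i<?N. (2 powr (real i / p1) * E i) powr p1)" by (simp add: sum_distrib_left)
  also have "... <= 2 * (n + 1) * (\<Sum>i<?N. 2 powr (real i / p1) * E i) powr p1"
   using p E0 by (intro mult_left_mono sum_powr_le) auto
  also have "... <= 2 * (n + 1) * S1 powr p1"
   unfolding S1_def using p E0 by (intro mult_left_mono powr_mono2 sum_le_suminf sE sum_nonneg) auto
  finally show ?thesis .
 qed
 \<comment> \<open>Chebyshev's inequality. The thresholds leave at most \<open>n/4\<close> and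
   \<open>(n + 1)/4\<close> points in the two exceptional sets, fewer than \<open>n + 1\<close>
   together. The \<open>8 * C1\<close> of the statement is \<open>4 * (2 * C1)\<close>, the 2 coming
   from the dyadic sum for \<open>f2\<close>.\<close>
 have cheb: "4 * real (card B) <= m"
  if B: "finite B" "!!x. x \<in> B ==> (4 * K) powr (1/p) * S < \<bar>u x\<bar>" and K: "0 < K" and p: "1 < p" and S: "0 <= S"
   and s: "(\<Sum>x\<in>B. \<bar>u x\<bar> powr p) <= K * (m * S powr p)" and m: "0 <= m" for B K p S m and u :: "int => real"
 proof (cases "S = 0")
  case True
  hence "(\<Sum>x\<in>B. \<bar>u x\<bar> powr p) <= 0" using s by simp
  hence "(\<Sum>x\<in>B. \<bar>u x\<bar> powr p) = 0" by (intro antisym sum_nonneg) auto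
  hence "\<forall>x\<in>B. u x = 0" using B by (simp add: sum_nonneg_eq_0_iff)
  hence "B = {}" using B(2) True by fastforce
  thus ?thesis using m by simp
 next
  case False
  have "card B * (4 * K * S powr p) = (\<Sum>x\<in>B. ((4 * K) powr (1/p) * S) powr p)"
   using K p S by (simp add: powr_mult powr_powr)
  also have "... <= (\<Sum>x\<in>B. \<bar>u x\<bar> powr p)"
   using S p by (intro sum_mono powr_mono2) (auto intro: less_imp_le[OF B(2)])
  also have "... <= K * (m * S powr p)" by (rule s)
  finally have "(K * S powr p) * (4 * real (card B)) <= (K * S powr p) * m" by (simp add: mult_ac)
  moreover have "0 < K * S powr p" using K False S by simp
  ultimately show ?thesis by (rule mult_left_le_imp_le)
 qed
 define t where "t = (4 * C0) powr (1/p0) * S0 + (8 * C1) powr (1/p1) * S1"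
 have small: "card B <= n" if B: "finite B" "B \<subseteq> {x. t < \<bar>T f x\<bar>}" for B
 proof -
  define B1 where "B1 = {x\<in>B. (4 * C0) powr (1/p0) * S0 < \<bar>T f1 x\<bar>}"
  define B2 where "B2 = {x\<in>B. (4 * (2 * C1)) powr (1/p1) * S1 < \<bar>T f2 x\<bar>}"
  have fB: "finite B1" "finite B2" using B by (auto simp: B1_def B2_def)
  have Tf: "T f x = T f1 x + T f2 x" for x
  proof -
   have "f = (%x. f1 x + f2 x)" by (auto simp: f1_def f2_def)
   thus ?thesis using add[OF fin12, of x] by simp
  qed
  have "B \<subseteq> B1 \<union> B2"
  proof
   fix x assume x: "x \<in> B"
   hence "t < \<bar>T f1 x\<bar> + \<bar>T f2 x\<bar>" using B Tf[of x] by force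
   thus "x \<in> B1 \<union> B2" using x by (auto simp: B1_def B2_def t_def)
  qed
  hence cB: "card B <= card B1 + card B2" using card_mono[of "B1 \<union> B2" B] card_Un_le[of B1 B2] fB by auto
  have "4 * real (card B1) <= real n"
  proof (rule cheb[of B1 C0 p0 S0 "T f1"])
   show "(\<Sum>x\<in>B1. \<bar>T f1 x\<bar> powr p0) <= C0 * (real n * S0 powr p0)"
    using T0[OF fB(1) fin12(1)] mult_left_mono[OF sum1, of C0] C by linarith
  qed (use fB p C S0n in \<open>auto simp: B1_def\<close>)
  moreover have "4 * real (card B2) <= real n + 1"
  proof (rule cheb[of B2 "2 * C1" p1 S1 "T f2"])
   show "(\<Sum>x\<in>B2. \<bar>T f2 x\<bar> powr p1) <= 2 * C1 * ((real n + 1) * S1 powr p1)"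
    using T1[OF fB(2) fin12(2)] mult_left_mono[OF sum2, of C1] C by (simp add: algebra_simps)
  qed (use fB p C S1n in \<open>auto simp: B2_def\<close>)
  ultimately show ?thesis using cB by linarith
 qed
 have "finite {x. t < \<bar>T f x\<bar>}"
 proof (rule ccontr)
  assume "infinite {x. t < \<bar>T f x\<bar>}"
  then obtain B where "B \<subseteq> {x. t < \<bar>T f x\<bar>}" "card B = Suc n" "finite B"
   using infinite_arbitrarily_large by blast
  thus False using small[of B] by simp
 qed
 hence "distribution_fun (T f) t <= of_nat n"
  using small[of "{x. t < \<bar>T f x\<bar>}"] by (simp add: distribution_le_iff)
 thus "distribution_fun (T f) ((4 * C0) powr (1/p0) * (\<Sum>i. 2 powr (- real i / p0) * stretch (2 ^ (i + 1)) fs n)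
   + (8 * C1) powr (1/p1) * (\<Sum>i. 2 powr (real i / p1) * compress (2 ^ i) fs n)) <= of_nat n"
  unfolding t_def S0_def S1_def F_def E_def .
qed

text \<open>The pointwise estimate is a bound for the rearrangement of \<open>T f\<close>. In norm,
  the stretchings contribute \<open>2 powr (- real i / p0) * Kr (2 ^ (i + 1))\<close> and the
  compressions \<open>2 powr (real i / p1) * Hr (2 ^ i)\<close>; the strict inequalities between
  indices and exponents make both series geometrically convergent.\<close>

lemma boyd_interpolation:
 fixes T :: "(int => real) => int => real" and p0 p1 C0 C1 :: real
 assumes p: "1 < p0" "1 < p1" and C: "0 < C0" "0 < C1"
  and idx: "upper_boyd_index \<rho> < 1 / p0" "1 / p1 < lower_boyd_index \<rho>"
  and add: "!!f g x. finite (supp f) ==> finite (supp g) ==> T (%x. f x + g x) x = T f x + T g x"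
  and T0: "!!B f. finite B ==> finite (supp f) ==> (\<Sum>x\<in>B. \<bar>T f x\<bar> powr p0) <= C0 * (\<Sum>x\<in>supp f. \<bar>f x\<bar> powr p0)"
  and T1: "!!B f. finite B ==> finite (supp f) ==> (\<Sum>x\<in>B. \<bar>T f x\<bar> powr p1) <= C1 * (\<Sum>x\<in>supp f. \<bar>f x\<bar> powr p1)"
 obtains C where "0 < C" "!!f. finite (supp f) ==> \<rho> (%x. \<bar>T f x\<bar>) <= ennreal C * \<rho> (%x. \<bar>f x\<bar>)"
proof -
 obtain b where b: "upper_boyd_index \<rho> < b" "b < 1 / p0" using dense[OF idx(1)] by blast
 obtain a where a: "1 / p1 < a" "a < lower_boyd_index \<rho>" using dense[OF idx(2)] by blast
 obtain CK where CK: "0 < CK" "!!j. 1 <= j ==> Kr j <= CK * real j powr b" using K_decay[OF b(1)] by blast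
 obtain CH where CH: "0 < CH" "!!j. 1 <= j ==> Hr j <= CH * real j powr (- a)" using H_decay[OF a(2)] by blast
 define xk where "xk = 2 powr (b - 1 / p0)"
 define xh where "xh = 2 powr (1 / p1 - a)"
 have xk: "0 <= xk" "xk < 1" using b powr_less_mono[of "b - 1/p0" 0 2] by (auto simp: xk_def)
 have xh: "0 <= xh" "xh < 1" using a powr_less_mono[of "1/p1 - a" 0 2] by (auto simp: xh_def)
 have tk: "2 powr (- real i / p0) * Kr (2 ^ (i + 1)) <= CK * 2 powr b * xk ^ i" for i
 proof -
  have "2 powr (- real i / p0) * Kr (2 ^ (i + 1)) <= 2 powr (- real i / p0) * (CK * real (2 ^ (i + 1)) powr b)"
   by (intro mult_left_mono CK) auto
  also have "real (2 ^ (i + 1)) = 2 powr (real i + 1)" by (simp add: powr_add powr_realpow)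
  also have "2 powr (- real i / p0) * (CK * (2 powr (real i + 1)) powr b) = CK * 2 powr b * xk ^ i"
   by (simp add: xk_def powr_powr powr_realpow[symmetric] powr_add[symmetric] algebra_simps)
  finally show ?thesis .
 qed
 have th: "2 powr (real i / p1) * Hr (2 ^ i) <= CH * xh ^ i" for i
 proof -
  have "2 powr (real i / p1) * Hr (2 ^ i) <= 2 powr (real i / p1) * (CH * real (2 ^ i) powr (- a))"
   by (intro mult_left_mono CH) auto
  also have "real (2 ^ i) = 2 powr (real i)" by (simp add: powr_realpow)
  also have "2 powr (real i / p1) * (CH * (2 powr (real i)) powr (- a)) = CH * xh ^ i"
   by (simp add: xh_def powr_powr powr_realpow[symmetric] powr_add[symmetric] algebra_simps)
  finally show ?thesis .
 qed
 define L0 where "L0 = (4 * C0) powr (1/p0)"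
 define L1 where "L1 = (8 * C1) powr (1/p1)"
 define Q0 where "Q0 = (\<Sum>i. CK * 2 powr b * xk ^ i)"
 define Q1 where "Q1 = (\<Sum>i. CH * xh ^ i)"
 have sk: "summable (%i. CK * 2 powr b * xk ^ i)" and sh: "summable (%i. CH * xh ^ i)"
  using xk xh by (auto intro!: summable_mult summable_geometric)
 have Q: "0 <= Q0" "0 <= Q1" unfolding Q0_def Q1_def using CK CH xk xh by (auto intro!: suminf_nonneg sk sh)
 define C where "C = L0 * Q0 + L1 * Q1 + 1"
 have Cpos: "0 < C" using Q by (simp add: C_def L0_def L1_def add_nonneg_pos)
 have "\<rho> (%x. \<bar>T f x\<bar>) <= ennreal C * \<rho> (%x. \<bar>f x\<bar>)" if f: "finite (supp f)" for f
 proof -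
  define fs where "fs = rearr_real f"
  define c0 where "c0 i = 2 powr (- real i / p0)" for i
  define c1 where "c1 i = 2 powr (real i / p1)" for i
  define S0 where "S0 n = (\<Sum>i. c0 i * stretch (2 ^ (i + 1)) fs n)" for n
  define S1 where "S1 n = (\<Sum>i. c1 i * compress (2 ^ i) fs n)" for n
  note cp = calderon_pointwise[where T = T and f = f, OF f p C add T0 T1, folded fs_def]
  have s0: "summable (%i. c0 i * stretch (2 ^ (i + 1)) fs n)" for n unfolding c0_def by (rule cp(1))
  have s1: "summable (%i. c1 i * compress (2 ^ i) fs n)" for n unfolding c1_def by (rule cp(2))
  have d: "distribution_fun (T f) (L0 * S0 n + L1 * S1 n) <= of_nat n" for n
   unfolding L0_def L1_def S0_def S1_def c0_def c1_def by (rule cp(3))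
  have fs0: "0 <= fs k" for k by (simp add: fs_def rearr_real_nonneg)
  have S00: "0 <= S0 n" for n unfolding S0_def by (intro suminf_nonneg s0) (auto simp: c0_def stretch_def fs0)
  have S10: "0 <= S1 n" for n unfolding S1_def by (intro suminf_nonneg s1) (auto simp: c1_def compress_def fs0)
  have L: "0 <= L0" "0 <= L1" by (auto simp: L0_def L1_def)
  define u where "u x = \<bar>T f x\<bar>" for x
  have du: "distribution_fun u = distribution_fun (T f)" by (simp add: fun_eq_iff distribution_fun_def u_def)
  have ru: "rearr u n <= ennreal (L0 * S0 n + L1 * S1 n)" for n
   using d[of n] L S00 S10 by (subst rearr_le_iff) (auto simp: du)
  have rfin: "\<forall>n. rearr u n < \<infinity>" by (intro allI le_less_trans[OF ru]) simp
  have "u \<in> nonneg_seqs" by (auto simp: u_def)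
  hence "\<rho> u = \<sigma> (rearr_real u)" using rfin by (rule rho_eq)
  also have "... <= \<sigma> (%n. L0 * S0 n + L1 * S1 n)"
  proof (rule S.mono)
   fix n
   have "enn2real (rearr u n) <= enn2real (ennreal (L0 * S0 n + L1 * S1 n))" using ru by (intro enn2real_mono) auto
   moreover have "0 <= L0 * S0 n + L1 * S1 n" using L S00[of n] S10[of n] by simp
   ultimately show "rearr_real u n <= L0 * S0 n + L1 * S1 n" by (simp only: rearr_real_def enn2real_ennreal)
  qed (auto simp: rearr_real_nonneg)
  also have "... <= \<sigma> (%n. L0 * S0 n) + \<sigma> (%n. L1 * S1 n)" using L S00 S10 by (intro S.triangle) auto
  also have "\<sigma> (%n. L0 * S0 n) = ennreal L0 * \<sigma> S0" using L S00 by (intro S.scale) auto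
  also have "\<sigma> (%n. L1 * S1 n) = ennreal L1 * \<sigma> S1" using L S10 by (intro S.scale) auto
  finally have 1: "\<rho> u <= ennreal L0 * \<sigma> S0 + ennreal L1 * \<sigma> S1" .
  define v where "v x = \<bar>f x\<bar>" for x
  have v: "v \<in> nonneg_seqs" by (auto simp: v_def)
  have "supp v = supp f" by (simp add: v_def)
  define B where "B = Max (insert 0 (v ` (supp f)))"
  have vB: "v x <= B" for x
  proof (cases "f x = 0")
   case True
   have "0 <= B" unfolding B_def using f by (intro Max_ge) auto
   thus ?thesis using True by (simp add: v_def)
  next
   case False
   thus ?thesis unfolding B_def using f by (intro Max_ge) auto
  qed
  hence rv: "\<forall>n. rearr v n < \<infinity>" "\<forall>n. rearr f n < \<infinity>"
   using rearr_bounded[of v B] rearr_bounded[of f B] by (auto simp: v_def)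
  have "rearr_real v = fs"
   unfolding fs_def by (simp add: fun_eq_iff rearr_real_def rearr_def distribution_fun_def v_def)
  hence \<rho>v: "\<rho> v = \<sigma> fs" using rho_eq[OF v rv(1)] by simp
  have anti: "antimono fs" unfolding fs_def by (rule antimono_rearr_real[OF rv(2)])
  have fin: "\<sigma> fs < \<infinity>"
  proof -
   have "\<rho> v <= \<rho> (%x. B * indicator (supp f) x)" using v vB by (intro mono) (auto simp: indicator_def v_def)
   also have "... = ennreal B * \<rho> (indicator (supp f))" using f by (intro scale) (auto simp: B_def)
   also have "... < \<infinity>" using finite_indicator[OF f] by (simp add: ennreal_mult_less_top)
   finally show ?thesis using \<rho>v by simp
  qed
  have "\<sigma> S0 <= (\<Sum>i. \<sigma> (%n. c0 i * stretch (2 ^ (i + 1)) fs n))"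
   unfolding S0_def by (intro S.suminf_bound s0) (auto simp: c0_def stretch_def fs0)
  also have "... <= (\<Sum>i. ennreal (CK * 2 powr b * xk ^ i) * \<sigma> fs)"
  proof (intro suminf_le summableI)
   fix i
   have "\<sigma> (%n. c0 i * stretch (2 ^ (i + 1)) fs n) = ennreal (c0 i) * \<sigma> (stretch (2 ^ (i + 1)) fs)"
    by (intro S.scale) (auto simp: c0_def stretch_def fs0)
   also have "... <= ennreal (c0 i) * (boyd_K \<rho> (2 ^ (i + 1)) * \<sigma> fs)"
    by (intro mult_left_mono K_bound fs0 anti fin) auto
   also have "... = ennreal (c0 i * Kr (2 ^ (i + 1))) * \<sigma> fs"
    by (subst K_eq) (auto simp: ennreal_mult c0_def Kr_nonneg mult.assoc)
   also have "... <= ennreal (CK * 2 powr b * xk ^ i) * \<sigma> fs"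
    using tk[of i] by (intro mult_right_mono ennreal_leI) (auto simp: c0_def)
   finally show "\<sigma> (%n. c0 i * stretch (2 ^ (i + 1)) fs n) <= ennreal (CK * 2 powr b * xk ^ i) * \<sigma> fs" .
  qed
  also have "... = ennreal Q0 * \<sigma> fs"
   unfolding Q0_def using CK xk by (subst ennreal_suminf_multc) (auto simp: suminf_ennreal2 sk)
  finally have 2: "\<sigma> S0 <= ennreal Q0 * \<sigma> fs" .
  have "\<sigma> S1 <= (\<Sum>i. \<sigma> (%n. c1 i * compress (2 ^ i) fs n))"
   unfolding S1_def by (intro S.suminf_bound s1) (auto simp: c1_def compress_def fs0)
  also have "... <= (\<Sum>i. ennreal (CH * xh ^ i) * \<sigma> fs)"
  proof (intro suminf_le summableI)
   fix i
   have "\<sigma> (%n. c1 i * compress (2 ^ i) fs n) = ennreal (c1 i) * \<sigma> (compress (2 ^ i) fs)"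
    by (intro S.scale) (auto simp: c1_def compress_def fs0)
   also have "... <= ennreal (c1 i) * (boyd_H \<rho> (2 ^ i) * \<sigma> fs)"
    by (intro mult_left_mono H_bound fs0 anti fin) auto
   also have "... = ennreal (c1 i * Hr (2 ^ i)) * \<sigma> fs"
    by (subst H_eq) (auto simp: ennreal_mult c1_def Hr_nonneg mult.assoc)
   also have "... <= ennreal (CH * xh ^ i) * \<sigma> fs"
    using th[of i] by (intro mult_right_mono ennreal_leI) (auto simp: c1_def)
   finally show "\<sigma> (%n. c1 i * compress (2 ^ i) fs n) <= ennreal (CH * xh ^ i) * \<sigma> fs" .
  qed
  also have "... = ennreal Q1 * \<sigma> fs"
   unfolding Q1_def using CH xh by (subst ennreal_suminf_multc) (auto simp: suminf_ennreal2 sh)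
  finally have 3: "\<sigma> S1 <= ennreal Q1 * \<sigma> fs" .
  have "\<rho> u <= ennreal L0 * (ennreal Q0 * \<sigma> fs) + ennreal L1 * (ennreal Q1 * \<sigma> fs)"
   using 1 2 3 by (intro order_trans[OF 1] add_mono mult_left_mono) auto
  also have "... = ennreal (L0 * Q0 + L1 * Q1) * \<sigma> fs"
   using L Q by (simp add: ennreal_mult ennreal_plus distrib_right mult.assoc)
  also have "... <= ennreal C * \<sigma> fs" unfolding C_def by (intro mult_right_mono ennreal_leI) auto
  finally show ?thesis unfolding \<rho>v[symmetric] u_def[abs_def] v_def[abs_def] .
 qed
 thus ?thesis using that Cpos by blast
qed

end

text \<open>Conjugating the transform with multiplication by \<open>w\<close> turns its weighted
  \<open>l^s\<close> bounds into unweighted bounds for \<open>T\<close>, so that interpolation takes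
  place in the unweighted space.\<close>

theorem weighted_hilbert_bound:
 fixes \<rho> :: "(int => real) => ennreal" and w :: "int => real"
 assumes "banach_function_norm \<rho>" and "rearrangement_invariant \<rho>"
  and idx: "0 < lower_boyd_index \<rho>" "upper_boyd_index \<rho> < 1"
  and w: "w \<in> Ap (1 / lower_boyd_index \<rho>) \<inter> Ap (1 / upper_boyd_index \<rho>)"
 obtains C where "0 < C" "!!\<phi> :: int => complex. finite (supp \<phi>) ==>
  \<rho> (%j. cmod (\<Sum>k\<in>supp \<phi>. \<phi> k / of_int (j - k)) * w j) <= ennreal C * \<rho> (%k. cmod (\<phi> k) * w k)"
proof -
 interpret boyd \<rho> by unfold_locales (fact assms)+
 define \<alpha> where "\<alpha> = lower_boyd_index \<rho>"
 define \<beta> where "\<beta> = upper_boyd_index \<rho>"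
 have ab: "0 < \<alpha>" "\<alpha> <= \<beta>" "\<beta> < 1" using idx lower_le_upper by (auto simp: \<alpha>_def \<beta>_def)
 have wpos: "0 < w k" for k using w by (auto simp: Ap_def)
 have near: "\<exists>d>0. \<forall>s. \<bar>s - p\<bar> < d --> s > 1 & (\<exists>N\<ge>0. hilb s (s / (s - 1)) N w)" if p: "1 < p" "w \<in> Ap p" for p
 proof -
  obtain c where c: "muck p (p / (p - 1)) c w" using Ap_muck[OF p] by blast
  have "p / (p - 1) > 1" "1 / p + 1 / (p / (p - 1)) = 1" using p by (auto simp: field_simps)
  from hilb_weighted[OF p(1) this c] show ?thesis by metis
 qed
 have ex: "1 < 1 / \<beta>" "1 < 1 / \<alpha>" "w \<in> Ap (1 / \<beta>)" "w \<in> Ap (1 / \<alpha>)"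
  using ab w by (auto simp: \<alpha>_def \<beta>_def)
 obtain d0 where d0: "d0 > 0" "!!s. \<bar>s - 1 / \<beta>\<bar> < d0 ==> s > 1 & (\<exists>N\<ge>0. hilb s (s / (s - 1)) N w)"
  using near[OF ex(1,3)] by blast
 obtain d1 where d1: "d1 > 0" "!!s. \<bar>s - 1 / \<alpha>\<bar> < d1 ==> s > 1 & (\<exists>N\<ge>0. hilb s (s / (s - 1)) N w)"
  using near[OF ex(2,4)] by blast
 define p0 where "p0 = 1 / \<beta> - d0 / 2"
 define p1 where "p1 = 1 / \<alpha> + d1 / 2"
 obtain N0 where N0: "1 < p0" "0 <= N0" "hilb p0 (p0 / (p0 - 1)) N0 w" using d0(2)[of p0] d0(1) by (auto simp: p0_def)
 obtain N1 where N1: "1 < p1" "0 <= N1" "hilb p1 (p1 / (p1 - 1)) N1 w" using d1(2)[of p1] d1(1) by (auto simp: p1_def)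
 have "\<beta> < 1 / p0" using ab d0(1) N0(1) by (simp add: p0_def field_simps)
 have "1 / p1 < \<alpha>" using ab d1(1) N1(1) by (simp add: p1_def field_simps)
 define T where "T f x = w x * (\<Sum>y\<in>supp f. (f y / w y) / real_of_int (x - y))" for f x
 have T_eq: "T f x = w x * (\<Sum>y\<in>A. (f y / w y) / real_of_int (x - y))" if "finite A" "supp f \<subseteq> A" for A f x
  unfolding T_def using that by (intro arg_cong[where f = "(*) (w x)"] sum.mono_neutral_left) auto
 have add: "T (%x. f x + g x) x = T f x + T g x" if "finite (supp f)" "finite (supp g)" for f g x
 proof -
  let ?A = "supp f \<union> supp g"
  have A: "finite ?A" using that by simp
  have "T (%x. f x + g x) x = w x * (\<Sum>y\<in>?A. ((f y + g y) / w y) / real_of_int (x - y))"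
   by (rule T_eq[OF A]) auto
  moreover have "T f x = w x * (\<Sum>y\<in>?A. (f y / w y) / real_of_int (x - y))" by (rule T_eq[OF A]) auto
  moreover have "T g x = w x * (\<Sum>y\<in>?A. (g y / w y) / real_of_int (x - y))" by (rule T_eq[OF A]) auto
  ultimately show ?thesis by (simp add: sum.distrib[symmetric] distrib_left[symmetric] add_divide_distrib)
 qed
 have strong: "(\<Sum>x\<in>B. \<bar>T f x\<bar> powr s) <= (N powr s + 1) * (\<Sum>x\<in>supp f. \<bar>f x\<bar> powr s)"
  if "1 < s" "0 <= N" "hilb s (s / (s - 1)) N w" "finite B" "finite (supp f)" for s N B f
 proof -
  have "(\<Sum>x\<in>B. \<bar>T f x\<bar> powr s) = (\<Sum>x\<in>B. (w x * \<bar>\<Sum>y\<in>supp f. (f y / w y) / of_int (x - y)\<bar>) powr s)"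
   unfolding T_def abs_mult using wpos by (simp add: less_imp_le abs_of_nonneg)
  also have "... <= N powr s * (\<Sum>y\<in>supp f. (\<bar>f y / w y\<bar> * w y) powr s)"
   by (rule hilb_strong[OF that(1,3,2) wpos that(5,4)])
  also have "(\<Sum>y\<in>supp f. (\<bar>f y / w y\<bar> * w y) powr s) = (\<Sum>y\<in>supp f. \<bar>f y\<bar> powr s)"
   using wpos by (intro sum.cong refl) (simp add: abs_divide abs_of_pos order_less_imp_not_eq2)
  also have "N powr s * ... <= (N powr s + 1) * ..." by (intro mult_right_mono sum_nonneg) auto
  finally show ?thesis .
 qed
 have Npos: "0 < N0 powr p0 + 1" "0 < N1 powr p1 + 1" by (auto intro: add_nonneg_pos)
 obtain C where C: "0 < C" "!!f. finite (supp f) ==> \<rho> (%x. \<bar>T f x\<bar>) <= ennreal C * \<rho> (%x. \<bar>f x\<bar>)"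
  using boyd_interpolation[where T = T, OF N0(1) N1(1) Npos _ _ add strong[OF N0] strong[OF N1]]
   \<open>\<beta> < 1 / p0\<close> \<open>1 / p1 < \<alpha>\<close> unfolding \<alpha>_def \<beta>_def by blast
 have "\<rho> (%j. cmod (\<Sum>k\<in>supp \<phi>. \<phi> k / of_int (j - k)) * w j) <= ennreal (2 * C) * \<rho> (%k. cmod (\<phi> k) * w k)"
  if fin: "finite (supp \<phi>)" for \<phi> :: "int => complex"
 proof -
  let ?A = "supp \<phi>"
  \<comment> \<open>\<open>T\<close> acts on real sequences, so real and imaginary parts are treated
    separately, at the cost of a factor 2.\<close>
  define fr where "fr k = Re (\<phi> k) * w k" for k
  define fi where "fi k = Im (\<phi> k) * w k" for k
  have sub: "supp fr \<subseteq> ?A" "supp fi \<subseteq> ?A" by (auto simp: fr_def fi_def)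
  have finr: "finite (supp fr)" "finite (supp fi)" using sub fin finite_subset by blast+
  have wn: "w k ~= 0" for k using wpos[of k] by simp
  have ri: "Re (z / of_int n) = Re z / of_int n" "Im (z / of_int n) = Im z / of_int n" for z n
   using Re_divide_of_real[of z "of_int n"] Im_divide_of_real[of z "of_int n"] by simp_all
  have Tr: "T fr j = w j * Re (\<Sum>k\<in>?A. \<phi> k / of_int (j - k))" for j
   unfolding T_eq[OF fin sub(1)] Re_sum ri fr_def using wn by simp
  have Ti: "T fi j = w j * Im (\<Sum>k\<in>?A. \<phi> k / of_int (j - k))" for j
   unfolding T_eq[OF fin sub(2)] Im_sum ri fi_def using wn by simp
  have "\<rho> (%j. cmod (\<Sum>k\<in>?A. \<phi> k / of_int (j - k)) * w j) <= \<rho> (%j. \<bar>T fr j\<bar> + \<bar>T fi j\<bar>)"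
  proof (rule mono)
   show "(%j. cmod (\<Sum>k\<in>?A. \<phi> k / of_int (j - k)) * w j) \<in> nonneg_seqs"
    by (intro nonneg_seqsI mult_nonneg_nonneg norm_ge_zero less_imp_le[OF wpos])
   show "cmod (\<Sum>k\<in>?A. \<phi> k / of_int (j - k)) * w j <= \<bar>T fr j\<bar> + \<bar>T fi j\<bar>" for j
    unfolding Tr Ti abs_mult using mult_left_mono[OF cmod_le[of "\<Sum>k\<in>?A. \<phi> k / of_int (j - k)"], of "w j"] wpos[of j]
    by (simp add: distrib_left mult.commute abs_of_pos)
  qed
  also have "... <= \<rho> (%j. \<bar>T fr j\<bar>) + \<rho> (%j. \<bar>T fi j\<bar>)" by (intro triangle) auto
  also have "... <= ennreal C * \<rho> (%x. \<bar>fr x\<bar>) + ennreal C * \<rho> (%x. \<bar>fi x\<bar>)"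
   by (intro add_mono C finr)
  also have "... <= ennreal C * \<rho> (%k. cmod (\<phi> k) * w k) + ennreal C * \<rho> (%k. cmod (\<phi> k) * w k)"
  proof (intro add_mono mult_left_mono mono nonneg_seqsI)
   show "\<bar>fr k\<bar> <= cmod (\<phi> k) * w k" for k
    using mult_right_mono[OF abs_Re_le_cmod[of "\<phi> k"], of "w k"] wpos[of k] by (simp add: fr_def abs_mult)
   show "\<bar>fi k\<bar> <= cmod (\<phi> k) * w k" for k
    using mult_right_mono[OF abs_Im_le_cmod[of "\<phi> k"], of "w k"] wpos[of k] by (simp add: fi_def abs_mult)
  qed auto
  also have "... = ennreal (2 * C) * \<rho> (%k. cmod (\<phi> k) * w k)"
   using C(1) by (simp add: ennreal_mult distrib_right[symmetric] mult_2[symmetric] mult.assoc)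
  finally show ?thesis .
 qed
 thus ?thesis using that[of "2 * C"] C(1) by simp
qed

section \<open>Fourier multipliers in terms of their coefficients\<close>

definition cv :: "(int => complex) => (int => complex) => int => complex" where
 "cv c \<phi> j = (\<Sum>k\<in>supp \<phi>. c (j - k) * \<phi> k)"

lemma conv_eq_cv: "conv a \<phi> = cv (fourier_coeff a) \<phi>" by (simp add: fun_eq_iff conv_def cv_def)

lemma finite_seqsD: "\<phi> \<in> finite_seqs ==> finite (supp \<phi>)" by (simp add: finite_seqs_def)

lemma cv_superset: "finite A ==> (supp \<phi>) \<subseteq> A ==> cv c \<phi> j = (\<Sum>k\<in>A. c (j - k) * \<phi> k)"
 unfolding cv_def by (rule sum.mono_neutral_left) auto

lemma cv_supp: "{j. cv d \<phi> j ~= 0} \<subseteq> (%(n, k). n + k) ` ((supp d) \<times> (supp \<phi>))"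
proof
 fix j assume "j \<in> {j. cv d \<phi> j ~= 0}"
 then obtain k where "\<phi> k ~= 0" "d (j - k) ~= 0"
  unfolding cv_def by (auto elim: sum.not_neutral_contains_not_neutral)
 thus "j \<in> (%(n, k). n + k) ` ((supp d) \<times> (supp \<phi>))" by (intro image_eqI[of _ _ "(j - k, k)"]) auto
qed

lemma cv_finite_seqs:
 assumes "finite (supp d)" "\<phi> \<in> finite_seqs"
 shows "cv d \<phi> \<in> finite_seqs"
 using finite_subset[OF cv_supp] assms finite_seqsD[OF assms(2)] by (simp add: finite_seqs_def)

lemma cv_cv:
 assumes d: "finite (supp d)" and \<phi>: "\<phi> \<in> finite_seqs"
 shows "cv c (cv d \<phi>) = cv (cv c d) \<phi>"
proof
 fix j
 define A where "A = supp d"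
 define B where "B = supp \<phi>"
 define S where "S = (%(n, k). n + k) ` (A \<times> B)"
 have fin: "finite A" "finite B" "finite S" using d finite_seqsD[OF \<phi>] by (auto simp: A_def B_def S_def)
 have S: "{j. cv d \<phi> j ~= 0} \<subseteq> S" using cv_supp by (simp add: S_def A_def B_def)
 have "cv c (cv d \<phi>) j = (\<Sum>l\<in>S. c (j - l) * (\<Sum>k\<in>B. d (l - k) * \<phi> k))"
  by (subst cv_superset[OF fin(3) S]) (simp add: cv_def B_def)
 also have "... = (\<Sum>k\<in>B. (\<Sum>l\<in>S. c (j - l) * d (l - k)) * \<phi> k)"
  by (simp add: sum_distrib_left sum_distrib_right mult.assoc) (rule sum.swap)
 also have "... = (\<Sum>k\<in>B. cv c d (j - k) * \<phi> k)"
 proof (intro sum.cong refl, rule arg_cong2[where f = "(*)"])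
  fix k assume k: "k \<in> B"
  have "cv c d (j - k) = (\<Sum>n\<in>A. c (j - k - n) * d n)" by (simp add: cv_def A_def)
  also have "... = (\<Sum>l\<in>(%n. n + k) ` A. c (j - l) * d (l - k))"
   by (subst sum.reindex) (auto simp: inj_on_def algebra_simps)
  also have "... = (\<Sum>l\<in>S. c (j - l) * d (l - k))"
  proof (rule sum.mono_neutral_left[OF fin(3)])
   show "(%n. n + k) ` A \<subseteq> S" using k by (auto simp: S_def)
   show "\<forall>l\<in>S - (%n. n + k) ` A. c (j - l) * d (l - k) = 0"
   proof
    fix l assume l: "l \<in> S - (%n. n + k) ` A"
    have "l - k \<notin> A" using l image_eqI[of l "%n. n + k" "l - k" A] by auto
    thus "c (j - l) * d (l - k) = 0" by (simp add: A_def)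
   qed
  qed
  finally show "(\<Sum>l\<in>S. c (j - l) * d (l - k)) = cv c d (j - k)" by simp
 qed simp
 finally show "cv c (cv d \<phi>) j = cv (cv c d) \<phi> j" by (simp add: cv_def B_def)
qed

section \<open>Multiplier bounds as a predicate on coefficient sequences\<close>

locale wspace = bfn \<rho> for \<rho> :: "(int => real) => ennreal" +
 fixes w :: "int => real"
 assumes wpos: "0 < w k"
begin

text \<open>The extended-valued form of the weighted norm: inequalities carry no membership
  conditions, and Fatou's lemma applies to limits not yet known to lie in the space.\<close>

definition Nw :: "(int => complex) => ennreal" where
 "Nw f = \<rho> (%k. cmod (f k) * w k)"

abbreviation "Y \<equiv> weighted_space \<rho> w"

lemma nn: "(%k. cmod (f k) * w k) \<in> nonneg_seqs"
 by (intro nonneg_seqsI mult_nonneg_nonneg norm_ge_zero less_imp_le[OF wpos])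

lemma norm_w: "cmod (f k * complex_of_real (w k)) = cmod (f k) * w k" using wpos[of k] by (simp add: norm_mult)

lemma vecs_Y: "f \<in> vecs Y \<longleftrightarrow> Nw f < \<infinity>"
 by (simp add: weighted_space_def seq_space_def Nw_def norm_w)

lemma nrm_Y: "nrm Y f = enn2real (Nw f)" by (simp add: weighted_space_def seq_space_def Nw_def norm_w)

lemma Nw_eq_nrm: "Nw f < \<infinity> ==> Nw f = ennreal (nrm Y f)" by (simp add: nrm_Y)

lemma Nw_mono: "(!!k. cmod (f k) <= cmod (g k)) ==> Nw f <= Nw g"
 unfolding Nw_def using wpos less_imp_le by (intro mono nn mult_right_mono) blast+

lemma Nw_cong: "(!!k. cmod (f k) = cmod (g k)) ==> Nw f = Nw g" unfolding Nw_def by simp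

lemma Nw_zero_iff: "Nw f = 0 \<longleftrightarrow> f = (%_. 0)"
proof -
 have "w k ~= 0" for k using wpos[of k] by simp
 thus ?thesis unfolding Nw_def by (subst eq_0_iff[OF nn]) (auto simp: fun_eq_iff)
qed

lemma Nw_scale: "Nw (%k. c * f k) = ennreal (cmod c) * Nw f"
 unfolding Nw_def by (simp add: norm_mult mult.assoc scale[OF nn norm_ge_zero])

lemma Nw_add: "Nw (%k. f k + g k) <= Nw f + Nw g"
proof -
 have "Nw (%k. f k + g k) <= \<rho> (%k. cmod (f k) * w k + cmod (g k) * w k)"
  unfolding Nw_def
 proof (rule mono[OF nn])
  show "cmod (f k + g k) * w k <= cmod (f k) * w k + cmod (g k) * w k" for k
   using mult_right_mono[OF norm_triangle_ineq[of "f k" "g k"], of "w k"] wpos[of k] by (simp add: distrib_right)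
 qed
 also have "... <= Nw f + Nw g" unfolding Nw_def by (rule triangle[OF nn nn])
 finally show ?thesis .
qed

lemma Nw_sum: "Nw (%k. \<Sum>i\<in>I. f i k) <= (\<Sum>i\<in>I. Nw (f i))"
proof (induction I rule: infinite_finite_induct)
 case (insert i I)
 thus ?case using Nw_add[of "f i" "%k. \<Sum>i\<in>I. f i k"] by (simp add: add_left_mono order_trans)
qed (simp_all add: Nw_zero_iff[THEN iffD2])

lemma Nw_finite: assumes "f \<in> finite_seqs" shows "Nw f < \<infinity>"
proof -
 let ?A = "supp f"
 have A: "finite ?A" using assms by (rule finite_seqsD)
 define B where "B = Max (insert 0 ((%k. cmod (f k) * w k) ` ?A))"
 have B: "0 <= B" unfolding B_def using A by (intro Max_ge) auto
 have "Nw f <= \<rho> (%k. B * indicator ?A k)"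
  unfolding Nw_def
 proof (rule mono[OF nn])
  show "cmod (f k) * w k <= B * indicator ?A k" for k
  proof (cases "f k = 0")
   case False
   thus ?thesis unfolding B_def using A by (auto intro!: Max_ge)
  qed simp
 qed
 also have "... = ennreal B * \<rho> (indicator ?A)" using B by (intro scale) auto
 also have "... < \<infinity>" using finite_indicator[OF A] by (simp add: ennreal_mult_less_top)
 finally show ?thesis .
qed

lemma Nw_fatou:
 assumes "!!k. (%n. F n k) \<longlonglongrightarrow> f k" "\<forall>\<^sub>F n in sequentially. Nw (F n) <= B"
 shows "Nw f <= B" unfolding Nw_def using assms
 by (intro fatou[where F = "%n k. cmod (F n k) * w k"] nn tendsto_intros) (auto simp: Nw_def)

lemma Nw_point: "\<exists>C>0. \<forall>f. ennreal (cmod (f k)) <= ennreal C * Nw f"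
proof -
 obtain C where C: "C > 0" "\<forall>f\<in>nonneg_seqs. ennreal (f k) <= ennreal C * \<rho> f" using point_bound by blast
 have "ennreal (cmod (f k)) <= ennreal (C / w k) * Nw f" for f
 proof -
  have "ennreal (cmod (f k)) = ennreal (1 / w k) * ennreal (cmod (f k) * w k)"
   using wpos[of k] by (simp add: ennreal_mult[symmetric])
  also have "... <= ennreal (1 / w k) * (ennreal C * Nw f)"
   unfolding Nw_def using C(2) nn by (intro mult_left_mono) auto
  also have "... = ennreal (C / w k) * Nw f"
   using C(1) wpos[of k] by (simp add: mult.assoc[symmetric] ennreal_mult[symmetric])
  finally show ?thesis .
 qed
 thus ?thesis using C(1) wpos[of k] by (intro exI[of _ "C / w k"]) auto
qed

text \<open>\<open>c\<close> behaves like the coefficient sequence of a multiplier of norm at most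
  \<open>C\<close>, with no reference to a distribution. It is a bound rather than a norm because
  bounds pass to limits.\<close>

definition mb :: "real => (int => complex) => bool" where
 "mb C c \<longleftrightarrow> 0 <= C & (\<forall>\<phi>\<in>finite_seqs. Nw (cv c \<phi>) <= ennreal C * Nw \<phi>)"

lemma mbD: "mb C c ==> \<phi> \<in> finite_seqs ==> Nw (cv c \<phi>) <= ennreal C * Nw \<phi>"
 and mb_nonneg: "mb C c ==> 0 <= C" by (auto simp: mb_def)

lemma mb_mono: "mb C c ==> C <= D ==> mb D c"
 unfolding mb_def by (auto intro: order_trans[OF _ mult_right_mono[OF ennreal_leI]])

text \<open>For a fixed finitely supported sequence each entry of the convolution is a finite sum,
  so coefficientwise convergence suffices, and Fatou's lemma keeps the constant.\<close>

lemma mb_limit: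
 assumes lim: "!!n. (%m. c m n) \<longlonglongrightarrow> c' n" and C: "\<forall>\<^sub>F m in sequentially. mb C (c m)"
 shows "mb C c'"
 unfolding mb_def
proof (intro conjI ballI)
 show "0 <= C" using eventually_happens'[OF sequentially_bot C] mb_nonneg by blast
 fix \<phi> :: "int => complex" assume \<phi>: "\<phi> \<in> finite_seqs"
 show "Nw (cv c' \<phi>) <= ennreal C * Nw \<phi>"
 proof (rule Nw_fatou)
  show "(%m. cv (c m) \<phi> j) \<longlonglongrightarrow> cv c' \<phi> j" for j
   unfolding cv_def by (intro tendsto_intros lim)
  show "\<forall>\<^sub>F m in sequentially. Nw (cv (c m) \<phi>) <= ennreal C * Nw \<phi>"
   using C by eventually_elim (rule mbD[OF _ \<phi>])
 qed
qed

lemma mb_sum: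
 assumes "!!i. i \<in> I ==> mb (C i) (c i)"
 shows "mb (\<Sum>i\<in>I. cmod (q i) * C i) (%n. \<Sum>i\<in>I. q i * c i n)"
 unfolding mb_def
proof (intro conjI ballI)
 show "0 <= (\<Sum>i\<in>I. cmod (q i) * C i)" by (intro sum_nonneg mult_nonneg_nonneg norm_ge_zero mb_nonneg[OF assms])
 fix \<phi> :: "int => complex" assume \<phi>: "\<phi> \<in> finite_seqs"
 have "cv (%n. \<Sum>i\<in>I. q i * c i n) \<phi> = (%j. \<Sum>i\<in>I. q i * cv (c i) \<phi> j)"
  unfolding cv_def fun_eq_iff by (simp add: sum_distrib_left sum_distrib_right mult.assoc) (intro allI, rule sum.swap)
 hence "Nw (cv (%n. \<Sum>i\<in>I. q i * c i n) \<phi>) <= (\<Sum>i\<in>I. Nw (%j. q i * cv (c i) \<phi> j))"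
  using Nw_sum by simp
 also have "... <= (\<Sum>i\<in>I. ennreal (cmod (q i) * C i) * Nw \<phi>)"
 proof (rule sum_mono)
  fix i assume i: "i \<in> I"
  have "Nw (%j. q i * cv (c i) \<phi> j) = ennreal (cmod (q i)) * Nw (cv (c i) \<phi>)" by (rule Nw_scale)
  also have "... <= ennreal (cmod (q i)) * (ennreal (C i) * Nw \<phi>)"
   by (intro mult_left_mono mbD assms i \<phi>) auto
  finally show "Nw (%j. q i * cv (c i) \<phi> j) <= ennreal (cmod (q i) * C i) * Nw \<phi>"
   using mb_nonneg[OF assms[OF i]] by (simp add: ennreal_mult mult.assoc)
 qed
 also have "... = ennreal (\<Sum>i\<in>I. cmod (q i) * C i) * Nw \<phi>"
  by (subst sum_ennreal[symmetric]) (auto simp: sum_distrib_right intro!: mult_nonneg_nonneg mb_nonneg[OF assms])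
 finally show "Nw (cv (%n. \<Sum>i\<in>I. q i * c i n) \<phi>) <= ..." .
qed

lemma mb_add: "mb C c ==> mb D d ==> mb (C + D) (%n. c n + d n)"
 using mb_sum[of "UNIV :: bool set" "%b. if b then C else D" "%b. if b then c else d" "%_. 1"]
 by (simp add: UNIV_bool add.commute)

lemma mb_scale: "mb C c ==> mb (cmod z * C) (%n. z * c n)" using mb_sum[of "{()}" "%_. C" "%_. c" "%_. z"] by simp

text \<open>On the side of the symbol this is a translation. It amounts to conjugation with a
  unimodular diagonal operator, which is isometric because the norm depends on absolute values
  only.\<close>

lemma mb_modulate:
 assumes "mb C c" shows "mb C (%n. cis (t * of_int n) * c n)"
 unfolding mb_def
proof (intro conjI ballI)
 show "0 <= C" using assms by (rule mb_nonneg)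
 fix \<phi> :: "int => complex" assume \<phi>: "\<phi> \<in> finite_seqs"
 define \<psi> where "\<psi> k = cis (- t * of_int k) * \<phi> k" for k
 have supp: "supp \<psi> = supp \<phi>" by (auto simp: \<psi>_def)
 have H: "cis (t * of_int (j - k)) = cis (t * of_int j) * cis (- t * of_int k)" for j k
  by (simp add: cis_mult algebra_simps)
 have "cv (%n. cis (t * of_int n) * c n) \<phi> = (%j. cis (t * of_int j) * cv c \<psi> j)"
 proof
  fix j
  have "cv (%n. cis (t * of_int n) * c n) \<phi> j = (\<Sum>k\<in>supp \<psi>. cis (t * of_int j) * (c (j - k) * \<psi> k))"
   unfolding cv_def supp H by (intro sum.cong refl) (simp add: \<psi>_def mult_ac)
  thus "cv (%n. cis (t * of_int n) * c n) \<phi> j = cis (t * of_int j) * cv c \<psi> j"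
   by (simp add: cv_def sum_distrib_left)
 qed
 hence "Nw (cv (%n. cis (t * of_int n) * c n) \<phi>) = Nw (cv c \<psi>)" by (intro Nw_cong) (simp add: norm_mult)
 also have "... <= ennreal C * Nw \<psi>" using \<phi> by (intro mbD assms) (simp add: finite_seqs_def supp)
 also have "Nw \<psi> = Nw \<phi>" by (intro Nw_cong) (simp add: \<psi>_def norm_mult)
 finally show "Nw (cv (%n. cis (t * of_int n) * c n) \<phi>) <= ennreal C * Nw \<phi>" .
qed

text \<open>Finite support of \<open>d\<close> keeps \<open>cv d \<phi>\<close> finitely supported,
  so that the bound for \<open>c\<close> can be applied to it.\<close>

lemma mb_mult:
 assumes c: "mb C c" and d: "mb D d" "finite (supp d)"
 shows "mb (C * D) (cv c d)"
 unfolding mb_def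
proof (intro conjI ballI)
 show "0 <= C * D" using c d mb_nonneg by simp
 fix \<phi> :: "int => complex" assume \<phi>: "\<phi> \<in> finite_seqs"
 have "Nw (cv (cv c d) \<phi>) = Nw (cv c (cv d \<phi>))" by (simp add: cv_cv[OF d(2) \<phi>])
 also have "... <= ennreal C * Nw (cv d \<phi>)" by (intro mbD[OF c] cv_finite_seqs d \<phi>)
 also have "... <= ennreal C * (ennreal D * Nw \<phi>)" by (intro mult_left_mono mbD[OF d(1) \<phi>]) auto
 finally show "Nw (cv (cv c d) \<phi>) <= ennreal (C * D) * Nw \<phi>"
  using c d mb_nonneg by (simp add: ennreal_mult mult.assoc)
qed

end

section \<open>Fejer means\<close>

text \<open>For \<open>N = 0\<close> division by zero would make every weight 1; hence the condition
  \<open>N ~= 0\<close> in what follows.\<close>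

definition fejer :: "nat => int => real" where
 "fejer N n = max 0 (1 - \<bar>of_int n\<bar> / real N)"

definition fejer_kernel :: "nat => real => real" where
 "fejer_kernel N t = (cmod (\<Sum>s<N. cis (t * real s)))\<^sup>2 / N"

lemma fejer_bounds: "0 <= fejer N n" "fejer N n <= 1" by (auto simp: fejer_def)

lemma fejer_zero: "N ~= 0 ==> int N <= \<bar>n\<bar> ==> fejer N n = 0"
proof -
 assume N: "N ~= 0" and n: "int N <= \<bar>n\<bar>"
 have "real_of_int (int N) <= of_int \<bar>n\<bar>" using n by (simp only: of_int_le_iff)
 thus ?thesis using N by (simp add: fejer_def)
qed

lemma fejer_supp: "N ~= 0 ==> {n. fejer N n ~= 0} \<subseteq> {- int N..int N}"
proof
 fix n assume N: "N ~= 0" and "n \<in> {n. fejer N n ~= 0}"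
 hence "~ int N <= \<bar>n\<bar>" using fejer_zero by blast
 thus "n \<in> {- int N..int N}" by auto
qed

lemma fejer_limit: "(%N. fejer N n) \<longlonglongrightarrow> 1"
proof -
 have "(%N. \<bar>real_of_int n\<bar> / real N) \<longlonglongrightarrow> 0"
  by (rule real_tendsto_divide_at_top[OF tendsto_const filterlim_real_sequentially])
 hence "(%N. max 0 (1 - \<bar>real_of_int n\<bar> / real N)) \<longlonglongrightarrow> max 0 (1 - 0)"
  by (intro tendsto_intros)
 thus ?thesis by (simp add: fejer_def)
qed

lemma fejer_kernel_nonneg: "0 <= fejer_kernel N t" by (simp add: fejer_kernel_def)

lemma fejer_count:
 assumes "N ~= 0"
 shows "(\<Sum>s<N. \<Sum>r<N. if int s - int r = n then 1 else 0) = real N * fejer N n"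
proof -
 have "(\<Sum>s<N. \<Sum>r<N. if int s - int r = n then 1 else 0)
  = (\<Sum>s<N. if 0 <= int s - n & int s - n < int N then 1 else (0::real))"
 proof (rule sum.cong[OF refl])
  fix s
  show "(\<Sum>r<N. if int s - int r = n then 1 else 0) = (if 0 <= int s - n & int s - n < int N then 1 else (0::real))"
  proof (cases "0 <= int s - n & int s - n < int N")
   case True
   have "(\<Sum>r<N. if int s - int r = n then 1 else 0) = (\<Sum>r<N. if r = nat (int s - n) then 1 else (0::real))"
    using True by (intro sum.cong) auto
   also have "... = 1" using True by auto
   finally show ?thesis using True by simp
  next
   case False
   hence "(\<Sum>r<N. if int s - int r = n then 1 else (0::real)) = 0" by (intro sum.neutral) auto
   thus ?thesis using False by simp
  qed
 qed
 also have "... = real (card {s. s < N & 0 <= int s - n & int s - n < int N})"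
  by (simp add: sum.inter_filter[symmetric] lessThan_def)
 also have "{s. s < N & 0 <= int s - n & int s - n < int N} = {nat (max 0 n)..<nat (min (int N) (int N + n))}" by auto
 also have "real (card ...) = real N * fejer N n"
 proof (cases "\<bar>n\<bar> < int N")
  case True
  have "real_of_int \<bar>n\<bar> < real_of_int (int N)" using True by (simp only: of_int_less_iff)
  hence "fejer N n = 1 - \<bar>real_of_int n\<bar> / N" using assms by (simp add: fejer_def field_simps)
  thus ?thesis using True assms by (auto simp: field_simps min_def max_def)
 next
  case False
  hence "fejer N n = 0" using assms by (intro fejer_zero) auto
  thus ?thesis using False by (auto simp: min_def max_def)
 qed
 finally show ?thesis .
qed

definition fmean :: "nat => (int => complex) => real => complex" where
 "fmean N c x = (\<Sum>n=- int N..int N. complex_of_real (fejer N n) * c n * ee n x)"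

lemma fejer_kernel_sum:
 assumes N: "N ~= 0"
 shows "complex_of_real (fejer_kernel N t) = fmean N (%_. 1) t"
proof -
 let ?I = "{- int N..int N}"
 let ?z = "\<Sum>s<N. cis (t * real s)"
 let ?d = "%s r n. if int s - int r = n then 1 else 0"
 have "complex_of_real ((cmod ?z)\<^sup>2) = ?z * cnj ?z" by (rule complex_norm_square)
 also have "... = (\<Sum>s<N. \<Sum>r<N. ee (int s - int r) t)"
  by (simp add: sum_product cis_cnj cis_mult algebra_simps)
 also have "... = (\<Sum>s<N. \<Sum>r<N. \<Sum>n\<in>?I. ?d s r n * ee n t)"
 proof (intro sum.cong refl)
  fix s r assume "s \<in> {..<N}" "r \<in> {..<N}"
  hence "int s - int r \<in> ?I" by auto
  thus "ee (int s - int r) t = (\<Sum>n\<in>?I. ?d s r n * ee n t)"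
   by (simp add: if_distrib[of "%x. x * _"] cong: if_cong)
 qed
 also have "... = (\<Sum>n\<in>?I. \<Sum>s<N. \<Sum>r<N. ?d s r n * ee n t)"
  by (simp only: sum.swap[where A = "{..<N}" and B = ?I])
 also have "... = (\<Sum>n\<in>?I. complex_of_real (\<Sum>s<N. \<Sum>r<N. ?d s r n) * ee n t)"
  by (simp add: sum_distrib_right if_distrib[of complex_of_real] cong: if_cong)
 also have "... = of_nat N * fmean N (%_. 1) t" by (simp add: fejer_count[OF N] fmean_def sum_distrib_left mult_ac)
 finally show ?thesis using N by (simp add: fejer_kernel_def)
qed

lemma root_of_unity_sum:
 assumes L: "0 < L" and m: "\<bar>m\<bar> < int L"
 shows "(\<Sum>l<L. cis (2 * pi * real l / L * of_int m)) = (if m = 0 then of_nat L else 0)"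
proof (cases "m = 0")
 case False
 define z where "z = cis (2 * pi * of_int m / L)"
 have zl: "cis (2 * pi * real l / L * of_int m) = z ^ l" for l by (simp add: z_def Complex.DeMoivre field_simps)
 have zL: "z ^ L = 1" using L cis_multiple_2pi[of "of_int m"] by (simp add: z_def Complex.DeMoivre mult_ac)
 have "z ~= 1"
 proof
  assume "z = 1"
  hence "cos (2 * pi * of_int m / L) = 1" by (simp add: z_def complex_eq_iff)
  then obtain k :: int where "2 * pi * of_int m / L = of_int k * 2 * pi" by (auto simp: cos_one_2pi_int)
  hence "real_of_int m = of_int k * real L" using L by (simp add: field_simps)
  hence "real_of_int m = real_of_int (k * int L)" by simp
  hence "m = k * int L" by (simp only: of_int_eq_iff)
  hence "\<bar>m\<bar> = \<bar>k\<bar> * int L" by (simp add: abs_mult)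
  moreover have "k ~= 0" using \<open>m = k * int L\<close> False by auto
  ultimately have "int L <= \<bar>m\<bar>" using mult_right_mono[of 1 "\<bar>k\<bar>" "int L"] by simp
  thus False using m by simp
 qed
 thus ?thesis unfolding zl using False zL by (simp add: sum_gp_strict)
qed simp

text \<open>The integral over translates is replaced by a mean over \<open>L\<close> equally spaced
  points, which is exact on trigonometric polynomials of degree below \<open>L\<close>. Fejer
  weighting thus becomes a finite combination with nonnegative coefficients, and vector-valued
  integration is avoided.\<close>

lemma fejer_average:
 assumes N: "N ~= 0" and L: "\<bar>n\<bar> + int N < int L"
 shows "(\<Sum>l<L. complex_of_real (fejer_kernel N (2 * pi * real l / L) / L) * cis (- (2 * pi * real l / L) * of_int n))
  = complex_of_real (fejer N n)"
proof -
 have L0: "0 < L" using L by auto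
 have H: "ee m x * cis (- x * of_int n) = cis (x * of_int (m - n))" for m x by (simp add: cis_mult algebra_simps)
 have "complex_of_real (fejer_kernel N x / L) * cis (- x * of_int n)
   = (\<Sum>m=- int N..int N. complex_of_real (fejer N m) * cis (x * of_int (m - n))) / of_nat L" for x
  unfolding of_real_divide fejer_kernel_sum[OF N] fmean_def H[symmetric] by (simp add: sum_distrib_right mult.assoc)
 hence "(\<Sum>l<L. complex_of_real (fejer_kernel N (2 * pi * real l / L) / L) * cis (- (2 * pi * real l / L) * of_int n))
  = (\<Sum>l<L. \<Sum>m=- int N..int N. complex_of_real (fejer N m) * cis (2 * pi * real l / L * of_int (m - n))) / of_nat L"
  by (simp only: sum_divide_distrib)
 also have "... = (\<Sum>m=- int N..int N. complex_of_real (fejer N m) * (\<Sum>l<L. cis (2 * pi * real l / L * of_int (m - n)))) / of_nat L"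
  by (subst sum.swap) (simp add: sum_distrib_left)
 also have "... = (\<Sum>m=- int N..int N. if m = n then complex_of_real (fejer N m) * of_nat L else 0) / of_nat L"
  using L L0 by (intro arg_cong2[where f = "(/)"] sum.cong refl) (subst root_of_unity_sum, auto)
 also have "... = complex_of_real (fejer N n)" using L0 fejer_zero[OF N, of n] by auto
 finally show ?thesis .
qed

context wspace
begin

text \<open>Fejer means average translates of the symbol, and translations preserve the multiplier norm.\<close>

lemma mb_fejer:
 assumes c: "mb C c" and N: "N ~= 0"
 shows "mb C (%n. complex_of_real (fejer N n) * c n)"
proof (rule mb_limit)
 define q where "q L l = complex_of_real (fejer_kernel N (2 * pi * real l / real L) / real L)" for L l :: nat
 \<comment> \<open>\<open>a L n\<close> equals the wanted coefficient as soon as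
   \<open>L > |n| + N\<close>; the limit is taken because no single \<open>L\<close> serves all
   \<open>n\<close>.\<close>
 define a where "a L n = (\<Sum>l<L. q L l * (cis (- (2 * pi * real l / real L) * of_int n) * c n))" for L :: nat and n
 show "(%L. a L n) \<longlonglongrightarrow> complex_of_real (fejer N n) * c n" for n
 proof (rule tendsto_eventually)
  have "\<forall>\<^sub>F L in sequentially. nat (\<bar>n\<bar> + int N) < L" by (rule eventually_gt_at_top)
  thus "\<forall>\<^sub>F L in sequentially. a L n = complex_of_real (fejer N n) * c n"
  proof eventually_elim
   fix L assume "nat (\<bar>n\<bar> + int N) < L"
   hence "\<bar>n\<bar> + int N < int L" by auto
   from fejer_average[OF N this] show "a L n = complex_of_real (fejer N n) * c n"
    unfolding a_def q_def mult.assoc[symmetric] sum_distrib_right[symmetric] by simp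
  qed
 qed
 have "\<forall>\<^sub>F L in sequentially. N < L" by (rule eventually_gt_at_top)
 thus "\<forall>\<^sub>F L in sequentially. mb C (a L)"
 proof eventually_elim
  fix L assume L: "N < L"
  have "mb (\<Sum>l<L. cmod (q L l) * C) (a L)" unfolding a_def by (intro mb_sum mb_modulate c)
  moreover have "(\<Sum>l<L. cmod (q L l) * C) = C"
  proof -
   have "(\<Sum>l<L. cmod (q L l)) = (\<Sum>l<L. fejer_kernel N (2 * pi * real l / L) / L)"
    by (simp add: q_def fejer_kernel_nonneg norm_divide)
   also have "complex_of_real ... = complex_of_real (fejer N 0)" using fejer_average[OF N, of 0 L] L by simp
   finally have "complex_of_real (\<Sum>l<L. cmod (q L l)) = complex_of_real 1"
    by (simp add: fejer_def del: of_real_sum)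
   hence "(\<Sum>l<L. cmod (q L l)) = 1" by (simp only: of_real_eq_iff)
   thus ?thesis by (simp add: sum_distrib_right[symmetric])
  qed
  ultimately show "mb C (a L)" by simp
 qed
qed

end

section \<open>Multiplier norms bound the symbol\<close>

text \<open>If every ratio exceeded \<open>1 + e\<close>, then \<open>R\<close> would grow
  exponentially along the multiples of \<open>d\<close>.\<close>

lemma polynomial_growth_ratio:
 fixes R :: "nat => real"
 assumes pos: "!!m. 0 < R m" and growth: "!!m. R m <= A * (1 + real m)\<^sup>2" and e: "0 < e"
 shows "\<exists>m. R (m + d) <= (1 + e) * R m"
proof (rule ccontr)
 assume "~ (\<exists>m. R (m + d) <= (1 + e) * R m)"
 hence step: "(1 + e) * R m < R (m + d)" for m by (simp add: not_le)
 have geo: "(1 + e) ^ k * R 0 <= R (k * d)" for k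
 proof (induction k)
  case (Suc k)
  have "(1 + e) ^ Suc k * R 0 = (1 + e) * ((1 + e) ^ k * R 0)" by simp
  also have "... <= (1 + e) * R (k * d)" using Suc e by (intro mult_left_mono) auto
  also have "... <= R (k * d + d)" by (rule less_imp_le[OF step])
  finally show ?case by (simp add: add.commute)
 qed simp
 \<comment> \<open>The square root shares the geometric factor between the two powers of
   \<open>1 + k * d\<close>, so that \<open>k * z ^ k\<close> tends to 0 inside the square.\<close>
 define z where "z = 1 / sqrt (1 + e)"
 have z: "0 < z" "z < 1" "z\<^sup>2 = 1 / (1 + e)" using e by (auto simp: z_def power_divide)
 have A: "0 < A" using order_less_le_trans[OF pos growth[of 0]] by simp
 have "(%k. z ^ k + real d * (real k * z ^ k)) \<longlonglongrightarrow> 0 + real d * 0"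
  using z by (intro tendsto_intros LIMSEQ_power_zero powser_times_n_limit_0) auto
 from tendsto_mult[OF tendsto_const tendsto_power[OF this, of 2], of A]
 have lim: "(%k. A * (z ^ k + real d * (real k * z ^ k))\<^sup>2) \<longlonglongrightarrow> A * (0 + real d * 0)\<^sup>2" .
 have "R 0 <= A * (z ^ k + real d * (real k * z ^ k))\<^sup>2" for k
 proof -
  have zk: "(z ^ k)\<^sup>2 * (1 + e) ^ k = 1"
   using z(3) e by (simp add: power_mult[symmetric] mult.commute[of k] power_mult power_divide)
  have "R 0 = (z ^ k)\<^sup>2 * ((1 + e) ^ k * R 0)" using zk by (simp add: mult.assoc[symmetric])
  also have "... <= (z ^ k)\<^sup>2 * (A * (1 + real (k * d))\<^sup>2)"
   using geo[of k] growth[of "k * d"] by (intro mult_left_mono) auto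
  also have "... = A * (z ^ k + real d * (real k * z ^ k))\<^sup>2" by (simp add: power2_eq_square algebra_simps)
  finally show ?thesis .
 qed
 hence "R 0 <= A * (0 + real d * 0)\<^sup>2" by (intro LIMSEQ_le_const[OF lim]) auto
 thus False using pos[of 0] by simp
qed

locale growth_space = wspace +
 fixes A :: real
 assumes growth: "Nw (indicator {- int m..int m}) <= ennreal (A * (1 + real m)\<^sup>2)"
begin

text \<open>With \<open>d\<close> bounding the degree, a character cut off at radius
  \<open>m + d\<close> looks like a full character to the convolution at radius \<open>m\<close>.
  Hence \<open>cmod P * R m <= C * R (m + d)\<close>, and for each tolerance one \<open>m\<close>
  with ratio close to 1 is enough.\<close>

lemma mb_symbol_bound:
 assumes c: "mb C c" and fin: "finite (supp c)"
 shows "cmod (\<Sum>n\<in>supp c. c n * cis (t * of_int n)) <= C"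
proof -
 let ?S = "supp c"
 define P where "P = (\<Sum>n\<in>?S. c n * cis (t * of_int n))"
 define R where "R m = enn2real (Nw (indicator {- int m..int m}))" for m
 have fs: "indicator {- int m..int m} \<in> finite_seqs" for m by (auto simp: finite_seqs_def indicator_def)
 have R: "Nw (indicator {- int m..int m}) = ennreal (R m)" for m using Nw_finite[OF fs[of m]] by (simp add: R_def)
 have Rn: "0 <= R m" for m by (simp add: R_def)
 have Rpos: "0 < R m" for m
 proof -
  have "indicator {- int m..int m} ~= (%_. 0 :: complex)" by (auto simp: fun_eq_iff indicator_def intro!: exI[of _ 0])
  hence "ennreal (R m) ~= 0" using Nw_zero_iff[of "indicator {- int m..int m}"] by (simp add: R)
  thus ?thesis using Rn[of m] by (cases "R m = 0") auto
 qed
 have A0: "0 <= A"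
 proof (rule ccontr)
  assume "~ 0 <= A"
  hence "ennreal (A * (1 + real 0)\<^sup>2) = 0" by (simp add: ennreal_neg)
  thus False using growth[of 0] R[of 0] Rpos[of 0] by simp
 qed
 have gr: "R m <= A * (1 + real m)\<^sup>2" for m using growth[of m] A0 unfolding R by (subst (asm) ennreal_le_iff) auto
 obtain d :: nat where d: "?S \<subseteq> {- int d..int d}"
 proof
  show "?S \<subseteq> {- int (nat (Max (insert 0 (abs ` ?S))))..int (nat (Max (insert 0 (abs ` ?S))))}"
  proof
   fix n assume "n \<in> ?S"
   hence "\<bar>n\<bar> <= Max (insert 0 (abs ` ?S))" using fin by (intro Max_ge) auto
   thus "n \<in> {- int (nat (Max (insert 0 (abs ` ?S))))..int (nat (Max (insert 0 (abs ` ?S))))}" by auto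
  qed
 qed
 have key: "cmod P * R m <= C * R (m + d)" for m
 proof -
  define I where "I = {- int (m + d)..int (m + d)}"
  define \<phi> where "\<phi> k = (if k \<in> I then cis (- t * of_int k) else 0)" for k
  have supp: "supp \<phi> \<subseteq> I" by (auto simp: \<phi>_def)
  have I: "finite I" by (simp add: I_def)
  have \<phi>: "\<phi> \<in> finite_seqs" using finite_subset[OF supp I] by (simp add: finite_seqs_def)
  have val: "cv c \<phi> j = cis (- t * of_int j) * P" if "j \<in> {- int m..int m}" for j
  proof -
   have "cv c \<phi> j = (\<Sum>k\<in>I. c (j - k) * \<phi> k)" by (rule cv_superset[OF I supp])
   also have "... = (\<Sum>k\<in>(%n. j - n) ` ?S. c (j - k) * \<phi> k)"
   proof (rule sum.mono_neutral_right[OF I])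
    show "(%n. j - n) ` ?S \<subseteq> I" using that d by (force simp: I_def)
    show "\<forall>k\<in>I - (%n. j - n) ` ?S. c (j - k) * \<phi> k = 0"
    proof
     fix k assume "k \<in> I - (%n. j - n) ` ?S"
     hence "j - k \<notin> ?S" using image_eqI[of k "%n. j - n" "j - k" ?S] by auto
     thus "c (j - k) * \<phi> k = 0" by simp
    qed
   qed
   also have "... = (\<Sum>n\<in>?S. c n * \<phi> (j - n))" by (subst sum.reindex) (auto simp: inj_on_def)
   also have "... = (\<Sum>n\<in>?S. cis (- t * of_int j) * (c n * cis (t * of_int n)))"
   proof (rule sum.cong[OF refl])
    fix n assume "n \<in> ?S"
    hence "j - n \<in> I" using that d by (force simp: I_def)
    thus "c n * \<phi> (j - n) = cis (- t * of_int j) * (c n * cis (t * of_int n))"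
     by (simp add: \<phi>_def cis_mult algebra_simps)
   qed
   finally show ?thesis by (simp add: P_def sum_distrib_left)
  qed
  have "ennreal (cmod P) * ennreal (R m) = Nw (%j. P * indicator {- int m..int m} j)" by (simp add: Nw_scale R)
  also have "... <= Nw (cv c \<phi>)" by (rule Nw_mono) (simp add: indicator_def val norm_mult)
  also have "... <= ennreal C * Nw \<phi>" by (rule mbD[OF c \<phi>])
  also have "Nw \<phi> = Nw (indicator I)" by (rule Nw_cong) (simp add: \<phi>_def indicator_def)
  also have "... = ennreal (R (m + d))" by (simp only: I_def R)
  finally show ?thesis using mb_nonneg[OF c] Rn by (simp add: ennreal_mult[symmetric])
 qed
 have "cmod P <= C + e" if e: "0 < e" for e
 proof -
  define e' where "e' = e / (C + 1)"
  have C0: "0 <= C" using mb_nonneg[OF c] .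
  have e': "0 < e'" using e C0 by (simp add: e'_def)
  obtain m where m: "R (m + d) <= (1 + e') * R m" using polynomial_growth_ratio[of R A e' d] Rpos gr e' by blast
  have "cmod P * R m <= C * ((1 + e') * R m)" using key[of m] m C0 by (meson mult_left_mono order_trans)
  hence "cmod P * R m <= (C * (1 + e')) * R m" by simp
  hence "cmod P <= C * (1 + e')" using Rpos[of m] by (rule mult_right_le_imp_le)
  also have "C * e' <= (C + 1) * e'" using e' by (intro mult_right_mono) auto
  hence "C * (1 + e') <= C + e" using C0 by (simp add: e'_def distrib_left)
  finally show ?thesis .
 qed
 thus ?thesis unfolding P_def by (rule field_le_epsilon)
qed

end

text \<open>In the condition for \<open>{- int m..int m}\<close> the first sum is bounded below by
  its term at \<open>k\<close>, the second by its term at 0.\<close>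

lemma muck_growth:
 assumes pq: "1 < p" "1 < q" "1/p + 1/q = 1" and w: "muck p q c w" and k: "\<bar>k\<bar> <= int m"
 shows "w k <= c * w 0 * real (2 * m + 1)"
proof -
 have wpos: "0 < w j" for j using w by (auto simp: muck_def)
 let ?J = "{- int m..int m}"
 have N: "real (card ?J) = real (2 * m + 1)" by simp
 have Np: "0 < real (2 * m + 1)" by simp
 define n where "n = real (2 * m + 1)"
 have n: "n > 0" "real (card ?J) = n" by (simp_all add: n_def)
 have "w k powr p <= (\<Sum>j\<in>?J. w j powr p)" using k by (intro member_le_sum) auto
 hence "(w k powr p) powr (1/p) <= (\<Sum>j\<in>?J. w j powr p) powr (1/p)" using pq by (intro powr_mono2) auto
 hence 1: "w k <= (\<Sum>j\<in>?J. w j powr p) powr (1/p)" using pq wpos[of k] by (simp add: powr_powr)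
 have "w 0 powr (-q) <= (\<Sum>j\<in>?J. w j powr (-q))" by (intro member_le_sum) auto
 hence "(w 0 powr (-q)) powr (1/q) <= (\<Sum>j\<in>?J. w j powr (-q)) powr (1/q)" using pq by (intro powr_mono2) auto
 moreover have "(w 0 powr (-q)) powr (1/q) = 1 / w 0"
  using pq wpos[of 0] by (simp only: powr_powr) (simp add: powr_minus_divide)
 ultimately have 2: "1 / w 0 <= (\<Sum>j\<in>?J. w j powr (-q)) powr (1/q)" by simp
 have "avg (%j. w j powr p) (- int m) (int m) powr (1/p) * avg (%j. w j powr (-q)) (- int m) (int m) powr (1/q) <= c"
  using w by (simp add: muck_def)
 hence 3: "(\<Sum>j\<in>?J. w j powr p) powr (1/p) * (\<Sum>j\<in>?J. w j powr (-q)) powr (1/q) / (n powr (1/p) * n powr (1/q)) <= c"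
  unfolding avg_def n(2) using n by (simp add: powr_divide sum_nonneg)
 have "n powr (1/p) * n powr (1/q) = n" using n pq by (simp add: powr_add[symmetric])
 hence 4: "(\<Sum>j\<in>?J. w j powr p) powr (1/p) * (\<Sum>j\<in>?J. w j powr (-q)) powr (1/q) <= c * n"
  using 3 n by (simp add: pos_divide_le_eq)
 have "w k * (1 / w 0) <= (\<Sum>j\<in>?J. w j powr p) powr (1/p) * (\<Sum>j\<in>?J. w j powr (-q)) powr (1/q)"
  using 1 2 wpos[of 0] by (intro mult_mono) auto
 hence "w k * (1 / w 0) <= c * n" using 4 by (rule order_trans)
 thus ?thesis using wpos[of 0] by (simp add: n_def pos_divide_le_eq mult_ac)
qed

text \<open>The norm of the indicator of an interval is at most the sum over its points, each
  contributing \<open>w i * \<tau>\<close>. The number of points and the linear growth of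
  \<open>w\<close> together give the square.\<close>

lemma growth_space_Ap:
 fixes \<rho> :: "(int => real) => ennreal"
 assumes "banach_function_norm \<rho>" "rearrangement_invariant \<rho>" and p: "1 < p" and w: "w \<in> Ap p"
 obtains A where "growth_space \<rho> w A"
proof -
 interpret ri_bfn \<rho> by unfold_locales (fact assms)+
 interpret wspace \<rho> w using w by unfold_locales (auto simp: Ap_def)
 obtain c where c: "muck p (p / (p - 1)) c w" using Ap_muck[OF p w] by blast
 have q: "1 < p / (p - 1)" "1 / p + 1 / (p / (p - 1)) = 1" using p by (auto simp: field_simps)
 define \<tau> where "\<tau> = enn2real (\<rho> (indicator {0}))"
 have \<tau>: "\<rho> (indicator {0}) = ennreal \<tau>" "0 <= \<tau>" using finite_indicator[of "{0}"] by (auto simp: \<tau>_def)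
 have c0: "0 <= c * w 0" using muck_growth[OF p q c, of 0 0] wpos[of 0] by simp
 have "Nw (indicator {- int m..int m}) <= ennreal (4 * (c * w 0 * \<tau>) * (1 + real m)\<^sup>2)" for m
 proof -
  let ?J = "{- int m..int m}"
  have "Nw (indicator ?J) = Nw (%k. \<Sum>i\<in>?J. indicator {i} k)"
   by (rule Nw_cong) (simp add: indicator_def sum.If_cases)
  also have "... <= (\<Sum>i\<in>?J. Nw (indicator {i}))" by (rule Nw_sum)
  also have "... <= (\<Sum>i\<in>?J. ennreal (c * w 0 * real (2 * m + 1) * \<tau>))"
  proof (rule sum_mono)
   fix i assume i: "i \<in> ?J"
   have "Nw (indicator {i}) = \<rho> (%k. w i * indicator {i} k)"
    unfolding Nw_def by (rule arg_cong[where f = \<rho>]) (auto simp: fun_eq_iff indicator_def)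
   also have "... = ennreal (w i) * \<rho> (indicator {i})" using wpos[of i] by (intro scale) auto
   also have "... = ennreal (w i) * ennreal \<tau>" by (simp add: point_indicator[of i 0] \<tau>)
   also have "... <= ennreal (c * w 0 * real (2 * m + 1)) * ennreal \<tau>"
    using i by (intro mult_right_mono ennreal_leI muck_growth[OF p q c]) auto
   also have "... = ennreal (c * w 0 * real (2 * m + 1) * \<tau>)"
    using c0 \<tau> by (intro ennreal_mult[symmetric]) auto
   finally show "Nw (indicator {i}) <= ennreal (c * w 0 * real (2 * m + 1) * \<tau>)" .
  qed
  also have "... = ennreal (real (2 * m + 1) * (c * w 0 * real (2 * m + 1) * \<tau>))"
   using c0 \<tau> by (subst sum_ennreal) auto
  also have "... <= ennreal (4 * (c * w 0 * \<tau>) * (1 + real m)\<^sup>2)"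
  proof (rule ennreal_leI)
   have "(c * w 0 * \<tau>) * (real (2 * m + 1))\<^sup>2 <= (c * w 0 * \<tau>) * (2 * (1 + real m))\<^sup>2"
    using c0 \<tau> by (intro mult_left_mono power_mono) auto
   thus "real (2 * m + 1) * (c * w 0 * real (2 * m + 1) * \<tau>) <= 4 * (c * w 0 * \<tau>) * (1 + real m)\<^sup>2"
    by (simp add: power2_eq_square algebra_simps)
  qed
  finally show ?thesis .
 qed
 hence "growth_space \<rho> w (4 * (c * w 0 * \<tau>))" by unfold_locales
 thus ?thesis by (rule that)
qed

section \<open>Functions of bounded variation\<close>

lemma has_integral_cis_int:
 assumes "n ~= 0" "a <= b"
 shows "((%x. ec n x) has_integral (ec n b - ec n a) * (\<i> / of_int n)) {a..b}"
proof -
 let ?A = "- \<i> * of_int n :: complex"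
 have e: "ec n x = exp (x *\<^sub>R ?A)" for x by (simp add: cis_conv_exp scaleR_conv_of_real mult_ac)
 have "((%x. exp (x *\<^sub>R ?A) * (\<i> / of_int n)) has_vector_derivative (exp (x *\<^sub>R ?A) * ?A) * (\<i> / of_int n)) (at x within {a..b})" for x
  by (intro has_vector_derivative_mult_left exp_scaleR_has_vector_derivative_right)
 moreover have "(exp (x *\<^sub>R ?A) * ?A) * (\<i> / of_int n) = exp (x *\<^sub>R ?A)" for x using assms(1) by simp
 ultimately have "((%x. exp (x *\<^sub>R ?A)) has_integral exp (b *\<^sub>R ?A) * (\<i> / of_int n) - exp (a *\<^sub>R ?A) * (\<i> / of_int n)) {a..b}"
  by (intro fundamental_theorem_of_calculus assms) auto
 thus ?thesis unfolding e by (simp only: left_diff_distrib)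
qed

text \<open>Like \<open>variation_sums\<close>, but with an arbitrary right end point and with the
  one-point partition \<open>n = 0\<close> allowed, so that 0 belongs to the set and partitions can
  be prolonged.\<close>

definition chain_sums :: "(real => complex) => real => real set" where
 "chain_sums f x = {\<Sum>j=1..n. cmod (f (\<theta> (j + 1)) - f (\<theta> j)) |(n :: nat) (\<theta> :: nat => real).
  - pi <= \<theta> 1 & strict_mono_on {1..n + 1} \<theta> & \<theta> (n + 1) = x}"

lemma chain_sumsE:
 assumes "s \<in> chain_sums f x"
 obtains n :: nat and \<theta> :: "nat => real" where "s = (\<Sum>j=1..n. cmod (f (\<theta> (j + 1)) - f (\<theta> j)))" "- pi <= \<theta> 1"
  "strict_mono_on {1..n + 1} \<theta>" "\<theta> (n + 1) = x"
 using assms unfolding chain_sums_def mem_Collect_eq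
proof (elim exE conjE)
 fix n :: nat and \<theta> :: "nat => real"
 assume *: "s = (\<Sum>j=1..n. cmod (f (\<theta> (j + 1)) - f (\<theta> j)))" "- pi <= \<theta> 1"
  "strict_mono_on {1..n + 1} \<theta>" "\<theta> (n + 1) = x"
 show thesis by (rule that[of \<theta> n]) (fact *)+
qed

lemma chain_sums_zero: "- pi <= x ==> 0 \<in> chain_sums f x"
 unfolding chain_sums_def by (intro CollectI exI[of _ 0] exI[of _ "%_. x"]) (auto simp: strict_mono_on_def)

lemma chain_sums_extend:
 assumes "s \<in> chain_sums f x" "x < y"
 shows "s + cmod (f y - f x) \<in> chain_sums f y"
 using assms(1)
proof (rule chain_sumsE)
 fix n :: nat and \<theta> :: "nat => real"
 assume n: "s = (\<Sum>j=1..n. cmod (f (\<theta> (j + 1)) - f (\<theta> j)))" "- pi <= \<theta> 1"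
  "strict_mono_on {1..n + 1} \<theta>" "\<theta> (n + 1) = x"
 define \<theta>' where "\<theta>' = \<theta>(n + 2 := y)"
 have "(\<Sum>j=1..n. cmod (f (\<theta>' (j + 1)) - f (\<theta>' j))) = s"
  unfolding n(1) by (intro sum.cong) (auto simp: \<theta>'_def)
 moreover have "cmod (f (\<theta>' (n + 1 + 1)) - f (\<theta>' (n + 1))) = cmod (f y - f x)"
  using n(4) by (simp add: \<theta>'_def)
 ultimately have e: "(\<Sum>j=1..n + 1. cmod (f (\<theta>' (j + 1)) - f (\<theta>' j))) = s + cmod (f y - f x)" by simp
 have mono: "\<theta> i <= x" if "i \<in> {1..n + 1}" for i
 proof (cases "i = n + 1")
  case False
  hence "\<theta> i < \<theta> (n + 1)" using n(3) that by (auto simp: strict_mono_on_def)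
  thus ?thesis using n(4) by simp
 qed (use n(4) in simp)
 have "strict_mono_on {1..n + 1 + 1} \<theta>'"
 proof (rule strict_mono_onI)
  fix i j assume ij: "i \<in> {1..n + 1 + 1}" "j \<in> {1..n + 1 + 1}" "i < j"
  show "\<theta>' i < \<theta>' j"
  proof (cases "j = n + 2")
   case True
   hence "i \<in> {1..n + 1}" using ij by auto
   thus ?thesis using mono[of i] True assms(2) by (auto simp: \<theta>'_def)
  next
   case False
   thus ?thesis using n(3) ij by (auto simp: \<theta>'_def strict_mono_on_def)
  qed
 qed
 moreover have "- pi <= \<theta>' 1" "\<theta>' (n + 1 + 1) = y" using n by (auto simp: \<theta>'_def)
 ultimately show ?thesis unfolding chain_sums_def using e by (intro CollectI exI[of _ "n + 1"] exI[of _ \<theta>']) auto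
qed

locale bv =
 fixes f :: "real => complex"
 assumes f: "f \<in> vecs BV_space"
begin

lemma periodic: "f (x + 2 * pi) = f x" using f by (simp add: BV_space_def periodic_def)

lemma bdd: "bdd_above (variation_sums f)" using f by (simp add: BV_space_def)

abbreviation "V \<equiv> variation f"

lemma V_nonneg: "0 <= V"
proof -
 define \<theta> where "\<theta> j = (if j = 1 then - pi else pi)" for j :: nat
 have "(\<Sum>j=1..1. cmod (f (\<theta> (j + 1)) - f (\<theta> j))) \<in> variation_sums f" unfolding variation_sums_def
  by (intro CollectI exI[of _ "1::nat"] exI[of _ \<theta>]) (auto simp: \<theta>_def strict_mono_on_def)
 hence "(\<Sum>j=1..1. cmod (f (\<theta> (j + 1)) - f (\<theta> j))) <= V" unfolding variation_def by (rule cSup_upper[OF _ bdd])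
 thus ?thesis by (rule order_trans[rotated]) (intro sum_nonneg, simp)
qed

lemma chain_sums_pi: "s \<in> chain_sums f pi ==> s <= V"
proof (erule chain_sumsE)
 fix n :: nat and \<theta> :: "nat => real"
 assume n: "s = (\<Sum>j=1..n. cmod (f (\<theta> (j + 1)) - f (\<theta> j)))" "- pi <= \<theta> 1"
  "strict_mono_on {1..n + 1} \<theta>" "\<theta> (n + 1) = pi"
 show ?thesis
 proof (cases "n = 0")
  case True
  thus ?thesis using n(1) V_nonneg by simp
 next
  case False
  hence "1 <= n" by simp
  hence "s \<in> variation_sums f" unfolding variation_sums_def using n by blast
  thus ?thesis unfolding variation_def by (rule cSup_upper[OF _ bdd])
 qed
qed

lemma chain_sums_le: "s \<in> chain_sums f x ==> x <= pi ==> s <= V"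
 using chain_sums_pi chain_sums_extend[of s f x pi] norm_ge_zero[of "f pi - f x"]
 by (cases "x = pi") (auto intro: order_trans[of s "s + cmod (f pi - f x)"])

text \<open>The variation over \<open>{- pi..x}\<close>. Of it only the bounds by 0 and
  \<open>V\<close> and the domination of increments in \<open>T_diff\<close> are used.\<close>

definition T :: "real => real" where "T x = Sup (chain_sums f x)"

lemma T_bounds: "- pi <= x ==> x <= pi ==> 0 <= T x" "- pi <= x ==> x <= pi ==> T x <= V"
proof -
 assume x: "- pi <= x" "x <= pi"
 have bd: "bdd_above (chain_sums f x)" by (rule bdd_aboveI[of _ V]) (rule chain_sums_le[OF _ x(2)])
 show "0 <= T x" unfolding T_def by (rule cSup_upper[OF chain_sums_zero[OF x(1)] bd])
 show "T x <= V" unfolding T_def using chain_sums_zero[OF x(1)] chain_sums_le x(2) by (intro cSup_least) auto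
qed

lemma T_diff: "- pi <= x ==> x <= y ==> y <= pi ==> cmod (f y - f x) <= T y - T x"
proof -
 assume x: "- pi <= x" "x <= y" "y <= pi"
 show ?thesis
 proof (cases "x = y")
  case False
  hence xy: "x < y" using x by simp
  have bd: "bdd_above (chain_sums f y)" by (rule bdd_aboveI[of _ V]) (rule chain_sums_le[OF _ x(3)])
  have "T x <= T y - cmod (f y - f x)"
   unfolding T_def[of x]
  proof (rule cSup_least)
   show "chain_sums f x ~= {}" using chain_sums_zero[OF x(1)] by blast
   fix s assume "s \<in> chain_sums f x"
   hence "s + cmod (f y - f x) <= T y" unfolding T_def by (intro cSup_upper[OF _ bd] chain_sums_extend xy)
   thus "s <= T y - cmod (f y - f x)" by simp
  qed
  thus ?thesis by simp
 qed simp
qed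

lemma bounded: "x \<in> {-pi..pi} ==> cmod (f x) <= cmod (f (- pi)) + V"
proof -
 assume x: "x \<in> {-pi..pi}"
 have "cmod (f x - f (- pi)) <= V" using T_diff[of "- pi" x] T_bounds[of x] T_bounds[of "- pi"] x by auto
 thus ?thesis using norm_triangle_ineq2[of "f x" "f (- pi)"] by linarith
qed

text \<open>Jordan decomposition: \<open>T\<close>, \<open>T + Re f\<close> and
  \<open>T + Im f\<close> are nondecreasing on the interval.\<close>

lemma measurable: "f \<in> borel_measurable (restrict_space borel {-pi..pi})"
proof -
 have T: "T \<in> borel_measurable (restrict_space borel {-pi..pi})"
 proof (rule borel_measurable_mono_on_fnc, rule mono_onI)
  fix x y assume "x \<in> {-pi..pi}" "y \<in> {-pi..pi}" "x <= y"
  thus "T x <= T y" using order_trans[OF norm_ge_zero T_diff[of x y]] by auto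
 qed
 have R: "(%x. T x + Re (f x)) \<in> borel_measurable (restrict_space borel {-pi..pi})"
 proof (rule borel_measurable_mono_on_fnc, rule mono_onI)
  fix x y assume "x \<in> {-pi..pi}" "y \<in> {-pi..pi}" "x <= y"
  thus "T x + Re (f x) <= T y + Re (f y)" using T_diff[of x y] abs_Re_le_cmod[of "f y - f x"] by auto
 qed
 have I: "(%x. T x + Im (f x)) \<in> borel_measurable (restrict_space borel {-pi..pi})"
 proof (rule borel_measurable_mono_on_fnc, rule mono_onI)
  fix x y assume "x \<in> {-pi..pi}" "y \<in> {-pi..pi}" "x <= y"
  thus "T x + Im (f x) <= T y + Im (f y)" using T_diff[of x y] abs_Im_le_cmod[of "f y - f x"] by auto
 qed
 have "(%x. (T x + Re (f x)) - T x) \<in> borel_measurable (restrict_space borel {-pi..pi})" using R T by measurable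
 moreover have "(%x. (T x + Im (f x)) - T x) \<in> borel_measurable (restrict_space borel {-pi..pi})"
  using I T by measurable
 ultimately show ?thesis by (subst borel_measurable_complex_iff) simp
qed

lemma measurable_lebesgue: "f \<in> borel_measurable (lebesgue_on {-pi..pi})"
proof -
 have "(%x. indicator {-pi..pi} x *\<^sub>R f x) \<in> borel_measurable borel"
  using measurable by (subst (asm) borel_measurable_restrict_space_iff) auto
 hence "(%x. indicator {-pi..pi} x *\<^sub>R f x) \<in> borel_measurable lebesgue" by (intro measurable_completion) auto
 thus ?thesis by (subst borel_measurable_restrict_space_iff) auto
qed

lemma integrable_cis: "(%x. f x * cis (c * x)) integrable_on {-pi..pi}"
proof (rule measurable_bounded_by_integrable_imp_integrable)
 have "(%x. cis (c * x)) \<in> borel_measurable (lebesgue_on {-pi..pi})"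
  by (intro continuous_imp_measurable_on_sets_lebesgue continuous_intros) auto
 thus "(%x. f x * cis (c * x)) \<in> borel_measurable (lebesgue_on {-pi..pi})"
  by (intro borel_measurable_times measurable_lebesgue)
 show "(%x. cmod (f (- pi)) + V) integrable_on {-pi..pi}" by (rule integrable_const_ivl)
 show "cmod (f x * cis (c * x)) <= cmod (f (- pi)) + V" if "x \<in> {-pi..pi}" for x
  using bounded[OF that] by (simp add: norm_mult)
qed auto

definition coeff :: "int => complex" where
 "coeff n = integral {-pi..pi} (%x. f x * ec n x) / (2 * pi)"

definition grid :: "nat => nat => real" where
 "grid m i = - pi + 2 * pi * real i / real m"

lemma grid: "grid m 0 = - pi" "0 < m ==> grid m m = pi" "grid m i <= grid m (Suc i)" "- pi <= grid m i"
 "i <= m ==> grid m i <= pi" "grid m (Suc i) - grid m i = 2 * pi / m"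
proof -
 show "grid m 0 = - pi" "0 < m ==> grid m m = pi" "- pi <= grid m i" by (auto simp: grid_def)
 show d: "grid m (Suc i) - grid m i = 2 * pi / m" by (simp add: grid_def add_divide_distrib distrib_left)
 thus "grid m i <= grid m (Suc i)" by (metis diff_ge_0_iff_ge divide_nonneg_nonneg of_nat_0_le_iff pi_ge_zero zero_le_mult_iff zero_le_numeral)
 show "i <= m ==> grid m i <= pi"
 proof -
  assume "i <= m"
  hence "real i / real m <= 1" by (cases "m = 0") (simp_all add: divide_le_eq_1)
  hence "2 * pi * (real i / real m) <= 2 * pi * 1" by (intro mult_left_mono) auto
  thus ?thesis by (simp add: grid_def)
 qed
qed

lemma sum_jumps_le: "i <= m ==> (\<Sum>i<i. cmod (f (grid m (Suc i)) - f (grid m i))) <= T (grid m i) - T (grid m 0)"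
proof (induction i)
 case (Suc i)
 have "cmod (f (grid m (Suc i)) - f (grid m i)) <= T (grid m (Suc i)) - T (grid m i)"
  using Suc.prems by (intro T_diff grid)
 thus ?case using Suc by simp
qed simp

lemma sum_T_diff: "0 < m ==> (\<Sum>i<m. T (grid m (Suc i)) - T (grid m i)) <= V"
 using T_bounds(1)[of "- pi"] T_bounds(2)[of pi] sum_lessThan_telescope[of "%i. T (grid m i)" m] by (simp add: grid)

lemma sum_jumps_le_V: "0 < m ==> (\<Sum>i<m. cmod (f (grid m (Suc i)) - f (grid m i))) <= V"
 using sum_jumps_le[of m m] T_bounds(1)[of "- pi"] T_bounds(2)[of pi] by (simp add: grid)

lemma integral_grid:
 assumes "0 < m" "i <= m"
 shows "integral {-pi..grid m i} (%x. f x * cis (c * x)) = (\<Sum>i<i. integral {grid m i..grid m (Suc i)} (%x. f x * cis (c * x)))"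
 using assms(2)
proof (induction i)
 case (Suc i)
 have "integral {-pi..grid m i} (%x. f x * cis (c * x)) + integral {grid m i..grid m (Suc i)} (%x. f x * cis (c * x))
  = integral {-pi..grid m (Suc i)} (%x. f x * cis (c * x))" using Suc.prems grid(5)[of "Suc i" m]
  by (intro Henstock_Kurzweil_Integration.integral_combine grid integrable_on_subinterval[OF integrable_cis]) auto
 thus ?case using Suc by simp
qed (simp add: grid)

text \<open>Summation by parts turns the coefficients of a step function into a superposition of
 modulated copies of \<open>1/n\<close>, weighted by its jumps.\<close>

lemma coeff_step_approx:
 assumes n: "n ~= 0" and m: "0 < m"
 shows "cmod (coeff n - (\<Sum>i<m. (f (grid m (Suc i)) - f (grid m i)) / (2 * pi * \<i>) * (cis (- grid m i * of_int n) * (1 / of_int n)))) <= V / m"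
proof -
 define e where "e i = cis (- of_int n * grid m i)" for i
 define I where "I i = integral {grid m i..grid m (Suc i)} (%x. f x * ec n x)" for i
 \<comment> \<open>The exact integral over a cell of the step function that takes the value of
   \<open>f\<close> at the right end; the error is the width of the cell times the increment of
   \<open>T\<close>.\<close>
 define S where "S i = f (grid m (Suc i)) * ((e (Suc i) - e i) * (\<i> / of_int n))" for i
 have c: "2 * pi * coeff n = (\<Sum>i<m. I i)"
  unfolding coeff_def I_def using integral_grid[OF m order_refl, of "- of_int n"] m by (simp add: grid)
 have IS: "cmod (I i - S i) <= (2 * pi / m) * (T (grid m (Suc i)) - T (grid m i))" if i: "i < m" for i
 proof -
  let ?J = "{grid m i..grid m (Suc i)}"
  let ?d = "T (grid m (Suc i)) - T (grid m i)"
  have sub: "?J \<subseteq> {-pi..pi}" using grid(4)[of m i] grid(5)[of "Suc i" m] i by auto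
  have int1: "(%x. f x * ec n x) integrable_on ?J" by (rule integrable_on_subinterval[OF integrable_cis sub])
  have hi: "((%x. f (grid m (Suc i)) * ec n x) has_integral S i) ?J"
   unfolding S_def e_def by (intro has_integral_mult_right has_integral_cis_int n grid)
  have "((%x. f x * ec n x - f (grid m (Suc i)) * ec n x) has_integral (I i - S i)) ?J"
   unfolding I_def using int1 hi by (intro has_integral_diff) auto
  hence eqI: "I i - S i = integral ?J (%x. f x * ec n x - f (grid m (Suc i)) * ec n x)"
   and int2: "(%x. f x * ec n x - f (grid m (Suc i)) * ec n x) integrable_on ?J" by (auto simp: has_integral_iff)
  have "cmod (I i - S i) <= integral ?J (%_. ?d)" unfolding eqI
  proof (rule integral_norm_bound_integral[OF int2])
   show "(%_. ?d) integrable_on ?J" by (rule integrable_const_ivl)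
   fix x assume x: "x \<in> ?J"
   have "cmod (f x * ec n x - f (grid m (Suc i)) * ec n x) = cmod (f (grid m (Suc i)) - f x)"
    by (simp add: left_diff_distrib[symmetric] norm_mult norm_minus_commute)
   also have "... <= T (grid m (Suc i)) - T x" using x grid(4)[of m i] grid(5)[of "Suc i" m] i by (intro T_diff) auto
   also have "... <= ?d"
    using x grid(4)[of m i] grid(5)[of "Suc i" m] i order_trans[OF norm_ge_zero T_diff[of "grid m i" x]] by auto
   finally show "cmod (f x * ec n x - f (grid m (Suc i)) * ec n x) <= ?d" .
  qed
  also have "... = (2 * pi / m) * ?d" using grid(3)[of m i] grid(6)[of m i] by simp
  finally show ?thesis .
 qed
 have abel: "(\<Sum>i<m. S i) = (\<Sum>i<m. (f (grid m (Suc i)) - f (grid m i)) * e i) / (\<i> * of_int n)"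
 proof -
  have "(\<Sum>i<m. f (grid m (Suc i)) * (e (Suc i) - e i)) + (\<Sum>i<m. (f (grid m (Suc i)) - f (grid m i)) * e i)
   = (\<Sum>i<m. f (grid m (Suc i)) * e (Suc i) - f (grid m i) * e i)"
   by (simp add: sum.distrib[symmetric] algebra_simps)
  also have "... = f (grid m m) * e m - f (grid m 0) * e 0" by (rule sum_lessThan_telescope)
  \<comment> \<open>Periodicity of \<open>f\<close> and of the character removes the boundary
    term.\<close>
  also have "... = 0"
  proof -
   have "f pi = f (- pi)" using periodic[of "- pi"] by simp
   moreover have "ec n pi = ee n pi" by (simp add: complex_eq_iff sin_zero_iff_int2)
   ultimately show ?thesis using m by (simp add: e_def grid)
  qed
  finally have "(\<Sum>i<m. f (grid m (Suc i)) * (e (Suc i) - e i)) = - (\<Sum>i<m. (f (grid m (Suc i)) - f (grid m i)) * e i)"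
   by (simp add: eq_neg_iff_add_eq_0)
  moreover have "(\<Sum>i<m. S i) = (\<Sum>i<m. f (grid m (Suc i)) * (e (Suc i) - e i)) * (\<i> / of_int n)"
   by (simp add: S_def sum_distrib_right sum_divide_distrib mult.assoc)
  moreover have "\<i> / of_int n = - (1 / (\<i> * of_int n))" using n by (simp add: field_simps)
  ultimately show ?thesis by simp
 qed
 have "2 * pi * cmod (coeff n - (\<Sum>i<m. S i) / (2 * pi)) = cmod ((2 * pi) * (coeff n - (\<Sum>i<m. S i) / (2 * pi)))"
  by (simp add: norm_mult)
 also have "(2 * pi) * (coeff n - (\<Sum>i<m. S i) / (2 * pi)) = (\<Sum>i<m. I i - S i)"
  using c by (simp add: right_diff_distrib sum_subtractf)
 also have "cmod ... <= (\<Sum>i<m. (2 * pi / m) * (T (grid m (Suc i)) - T (grid m i)))"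
  using IS by (intro order_trans[OF norm_sum sum_mono]) auto
 also have "... = (2 * pi / m) * (\<Sum>i<m. T (grid m (Suc i)) - T (grid m i))" by (simp only: sum_distrib_left)
 also have "... <= (2 * pi / m) * V" by (intro mult_left_mono sum_T_diff m) auto
 finally have "2 * pi * cmod (coeff n - (\<Sum>i<m. S i) / (2 * pi)) <= 2 * pi * (V / m)" by simp
 hence "cmod (coeff n - (\<Sum>i<m. S i) / (2 * pi)) <= V / m" by (rule mult_left_le_imp_le) simp
 moreover have "(\<Sum>i<m. S i) / (2 * pi) = (\<Sum>i<m. (f (grid m (Suc i)) - f (grid m i)) / (2 * pi * \<i>) * (cis (- grid m i * of_int n) * (1 / of_int n)))"
  unfolding abel by (simp add: sum_divide_distrib e_def mult_ac)
 ultimately show ?thesis by simp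
qed

end

lemma (in wspace) mb_delta: "mb 1 (%n. if n = 0 then 1 else 0)"
proof -
 have "cv (%n. if n = 0 then 1 else 0) \<phi> = \<phi>" if "\<phi> \<in> finite_seqs" for \<phi>
 proof
  fix j
  have "(\<Sum>k\<in>supp \<phi>. (if j - k = 0 then 1 else 0) * \<phi> k) = (\<Sum>k\<in>supp \<phi>. if k = j then \<phi> k else 0)"
   by (intro sum.cong) auto
  thus "cv (%n. if n = 0 then 1 else 0) \<phi> j = \<phi> j"
   unfolding cv_def using finite_seqsD[OF that] by (simp add: sum.delta)
 qed
 thus ?thesis by (simp add: mb_def)
qed

text \<open>Ever finer grids give superpositions with convergent coefficients and with bounds at
  most \<open>C\<close> times the sum of the jumps, as \<open>1 <= 2 * pi\<close>. Since
  \<open>1 / 0 = 0\<close>, the superpositions miss the coefficient at 0, which a multiple of the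
  unit sequence supplies.\<close>

lemma (in wspace) mb_bv:
 assumes C: "mb C (%n. 1 / of_int n)" and f: "f \<in> vecs BV_space"
 shows "mb (cmod (bv.coeff f 0) + C * variation f) (bv.coeff f)"
proof -
 interpret b: bv f by unfold_locales (rule f)
 define q where "q m i = (f (b.grid m (Suc i)) - f (b.grid m i)) / (2 * pi * \<i>)" for m i
 define a where "a m n = b.coeff 0 * (if n = 0 then 1 else 0)
  + (\<Sum>i<m. q m i * (cis (- b.grid m i * of_int n) * (1 / of_int n)))" for m and n :: int
 have C0: "0 <= C" using C by (rule mb_nonneg)
 show ?thesis
 proof (rule mb_limit)
  show "(%m. a m n) \<longlonglongrightarrow> b.coeff n" for n
  proof (cases "n = 0")
   case True
   thus ?thesis by (simp add: a_def)
  next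
   case False
   have "(%m. b.V / real m) \<longlonglongrightarrow> 0"
    by (rule real_tendsto_divide_at_top[OF tendsto_const filterlim_real_sequentially])
   moreover have "\<forall>\<^sub>F m in sequentially. cmod (a m n - b.coeff n) <= b.V / real m"
    using eventually_gt_at_top[of 0]
   proof eventually_elim
    fix m :: nat assume "0 < m"
    from b.coeff_step_approx[OF False this] show "cmod (a m n - b.coeff n) <= b.V / real m"
     using False by (simp add: a_def q_def norm_minus_commute)
   qed
   ultimately have "(%m. a m n - b.coeff n) \<longlonglongrightarrow> 0" by (rule Lim_null_comparison[rotated])
   thus ?thesis by (simp add: LIM_zero_iff)
  qed
  show "\<forall>\<^sub>F m in sequentially. mb (cmod (b.coeff 0) + C * b.V) (a m)"
   using eventually_gt_at_top[of 0]
  proof eventually_elim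
   fix m :: nat assume m: "0 < m"
   have "mb (cmod (b.coeff 0) * 1 + (\<Sum>i<m. cmod (q m i) * C)) (a m)"
    unfolding a_def by (intro mb_add mb_scale mb_delta mb_sum mb_modulate C)
   moreover have "(\<Sum>i<m. cmod (q m i) * C) <= C * b.V"
   proof -
    have "(\<Sum>i<m. cmod (q m i)) <= (\<Sum>i<m. cmod (f (b.grid m (Suc i)) - f (b.grid m i)))"
    proof (rule sum_mono)
     fix i
     have "1 <= 2 * pi" using pi_ge_two by simp
     hence "cmod (f (b.grid m (Suc i)) - f (b.grid m i)) / (2 * pi) <= cmod (f (b.grid m (Suc i)) - f (b.grid m i)) / 1"
      by (intro divide_left_mono) auto
     thus "cmod (q m i) <= cmod (f (b.grid m (Suc i)) - f (b.grid m i))" by (simp add: q_def norm_divide norm_mult)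
    qed
    also have "... <= b.V" by (rule b.sum_jumps_le_V[OF m])
    finally have "C * (\<Sum>i<m. cmod (q m i)) <= C * b.V" using C0 by (rule mult_left_mono)
    thus ?thesis by (simp add: sum_distrib_left mult.commute)
   qed
   ultimately show "mb (cmod (b.coeff 0) + C * b.V) (a m)" by (auto intro: mb_mono)
  qed
 qed
qed

section \<open>Test functions\<close>

lemma nth_deriv_0 [simp]: "nth_deriv 0 u = u" by (simp add: nth_deriv_def)

lemma nth_deriv_Suc: "nth_deriv (Suc k) u x = vector_derivative (nth_deriv k u) (at x)" by (simp add: nth_deriv_def)

lemma nth_deriv_has_derivative:
 "u \<in> test_functions ==> (nth_deriv k u has_vector_derivative nth_deriv (Suc k) u x) (at x)"
 unfolding nth_deriv_Suc by (rule vector_derivative_works[THEN iffD1]) (simp add: test_functions_def)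

lemma nth_derivI:
 assumes "!!k x. (D k has_vector_derivative D (Suc k) x) (at x)" "D 0 = u"
 shows "nth_deriv k u = D k"
proof (induction k)
 case (Suc k)
 show ?case
 proof
  fix x
  show "nth_deriv (Suc k) u x = D (Suc k) x" unfolding nth_deriv_Suc Suc by (rule vector_derivative_at[OF assms(1)])
 qed
qed (use assms in simp)

lemma test_functionI:
 assumes "!!k x. (D k has_vector_derivative D (Suc k) x) (at x)" "D 0 = u" "periodic u"
 shows "u \<in> test_functions" unfolding test_functions_def using nth_derivI[of D u, OF assms(1,2)] assms
 by (auto intro: differentiableI_vector)

lemma test_functions_periodic: "u \<in> test_functions ==> periodic u" by (simp add: test_functions_def)

lemma test_functions_add:
 assumes "u \<in> test_functions" "v \<in> test_functions"
 shows "(%x. u x + v x) \<in> test_functions" "nth_deriv k (%x. u x + v x) = (%x. nth_deriv k u x + nth_deriv k v x)"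
proof -
 let ?D = "%k x. nth_deriv k u x + nth_deriv k v x"
 have D: "(?D k has_vector_derivative ?D (Suc k) x) (at x)" for k x
  using assms by (intro has_vector_derivative_add nth_deriv_has_derivative)
 show "(%x. u x + v x) \<in> test_functions"
  by (rule test_functionI[of ?D, OF D]) (use assms in \<open>auto simp: test_functions_def periodic_def\<close>)
 show "nth_deriv k (%x. u x + v x) = ?D k" by (rule nth_derivI[of ?D, OF D]) simp
qed

lemma test_functions_cmult:
 assumes "u \<in> test_functions"
 shows "(%x. c * u x) \<in> test_functions" "nth_deriv k (%x. c * u x) = (%x. c * nth_deriv k u x)"
proof -
 let ?D = "%k x. c * nth_deriv k u x"
 have D: "(?D k has_vector_derivative ?D (Suc k) x) (at x)" for k x
  using assms by (intro has_vector_derivative_mult_right nth_deriv_has_derivative)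
 show "(%x. c * u x) \<in> test_functions"
  by (rule test_functionI[of ?D, OF D]) (use assms in \<open>auto simp: test_functions_def periodic_def\<close>)
 show "nth_deriv k (%x. c * u x) = ?D k" by (rule nth_derivI[of ?D, OF D]) simp
qed

lemma test_functions_diff:
 assumes "u \<in> test_functions" "v \<in> test_functions"
 shows "(%x. u x - v x) \<in> test_functions" "nth_deriv k (%x. u x - v x) = (%x. nth_deriv k u x - nth_deriv k v x)"
 using test_functions_add[OF assms(1) test_functions_cmult(1)[OF assms(2), of "-1"]]
  test_functions_cmult(2)[OF assms(2), of k "-1"] by auto

lemma test_functions_zero: "(%_. 0) \<in> test_functions"
 by (rule test_functionI[of "%_ _. 0"]) (auto simp: periodic_def)

lemma cis_test_function:
 "(%x. ee n x) \<in> test_functions"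
 "nth_deriv k (%x. ee n x) = (%x. (\<i> * of_int n) ^ k * ee n x)"
proof -
 have e: "ee n x = exp (x *\<^sub>R (\<i> * of_int n))" for x by (simp add: cis_conv_exp scaleR_conv_of_real mult_ac)
 let ?D = "%k x. (\<i> * of_int n) ^ k * ee n x"
 have D: "(?D k has_vector_derivative ?D (Suc k) x) (at x)" for k x
 proof -
  have "((%x. (\<i> * of_int n) ^ k * exp (x *\<^sub>R (\<i> * of_int n))) has_vector_derivative
   (\<i> * of_int n) ^ k * (exp (x *\<^sub>R (\<i> * of_int n)) * (\<i> * of_int n))) (at x)"
   by (intro has_vector_derivative_mult_right exp_scaleR_has_vector_derivative_right)
  thus ?thesis unfolding e by (simp add: mult_ac)
 qed
 have "cis (of_int n * (x + 2 * pi)) = ee n x" for x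
 proof -
  have "cis (of_int n * (x + 2 * pi)) = ee n x * cis (2 * pi * of_int n)" by (simp add: cis_mult algebra_simps)
  thus ?thesis using cis_multiple_2pi[of "of_int n"] by simp
 qed
 hence "periodic (%x. ee n x)" by (simp add: periodic_def)
 thus "(%x. ee n x) \<in> test_functions" by (intro test_functionI[of ?D, OF D]) auto
 show "nth_deriv k (%x. ee n x) = ?D k" by (rule nth_derivI[of ?D, OF D]) simp
qed

lemma test_functions_sum:
 assumes "!!i. i \<in> I ==> u i \<in> test_functions"
 shows "(%x. \<Sum>i\<in>I. u i x) \<in> test_functions" "nth_deriv k (%x. \<Sum>i\<in>I. u i x) = (%x. \<Sum>i\<in>I. nth_deriv k (u i) x)"
proof -
 let ?D = "%k x. \<Sum>i\<in>I. nth_deriv k (u i) x"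
 have D: "(?D k has_vector_derivative ?D (Suc k) x) (at x)" for k x
  using assms by (intro has_vector_derivative_sum nth_deriv_has_derivative)
 show "(%x. \<Sum>i\<in>I. u i x) \<in> test_functions"
  by (rule test_functionI[of ?D, OF D]) (use assms in \<open>auto simp: test_functions_def periodic_def\<close>)
 show "nth_deriv k (%x. \<Sum>i\<in>I. u i x) = ?D k" by (rule nth_derivI[of ?D, OF D]) simp
qed

lemma nth_deriv_periodic:
 assumes u: "u \<in> test_functions"
 shows "nth_deriv k u (x + 2 * pi) = nth_deriv k u x"
proof (induction k arbitrary: x)
 case 0
 thus ?case using u by (simp add: test_functions_def periodic_def)
next
 case (Suc k)
 have "((%y. nth_deriv k u (y + 2 * pi)) has_vector_derivative 1 *\<^sub>R nth_deriv (Suc k) u (x + 2 * pi)) (at x)"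
  using nth_deriv_has_derivative[OF u, of k "x + 2 * pi"]
  by (intro vector_diff_chain_at[where f = "%y. y + 2 * pi", unfolded o_def]) (auto intro!: derivative_eq_intros)
 hence "(nth_deriv k u has_vector_derivative nth_deriv (Suc k) u (x + 2 * pi)) (at x)" using Suc by simp
 from vector_derivative_at[OF this] show ?case by (simp add: nth_deriv_Suc)
qed

lemma periodic_shift:
 fixes g :: "real => 'a"
 assumes "!!x. g (x + 2 * pi) = g x"
 shows "g (x + 2 * pi * of_int k) = g x"
proof -
 have up: "g (x + 2 * pi * real n) = g x" for x n
 proof (induction n)
  case (Suc n)
  have "g (x + 2 * pi * real (Suc n)) = g ((x + 2 * pi * real n) + 2 * pi)" by (simp add: algebra_simps)
  thus ?case using assms Suc by metis
 qed simp
 show ?thesis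
 proof (cases "0 <= k")
  case True
  thus ?thesis using up[of x "nat k"] by simp
 next
  case False
  thus ?thesis using up[of "x + 2 * pi * of_int k" "nat (- k)"] by simp
 qed
qed

lemma shift_to_period: "\<exists>k. x + 2 * pi * of_int k \<in> {-pi..<pi}"
proof
 define k where "k = \<lfloor>(x + pi) / (2 * pi)\<rfloor>"
 have "of_int k <= (x + pi) / (2 * pi)" "(x + pi) / (2 * pi) < of_int k + 1" by (auto simp: k_def)
 hence "of_int k * (2 * pi) <= x + pi" "x + pi < (of_int k + 1) * (2 * pi)"
  by (simp_all add: pos_le_divide_eq pos_divide_less_eq del: distrib_right_numeral)
 thus "x + 2 * pi * of_int (- k) \<in> {-pi..<pi}" by (simp add: algebra_simps)
qed

lemma periodic_reduce:
 fixes g :: "real => 'a"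
 assumes "!!x. g (x + 2 * pi) = g x"
 shows "\<exists>y\<in>{-pi..pi}. g x = g y"
proof -
 obtain k where "x + 2 * pi * of_int k \<in> {-pi..<pi}" using shift_to_period by blast
 thus ?thesis using periodic_shift[of g x k] assms by (intro bexI[of _ "x + 2 * pi * of_int k"]) auto
qed

lemma nth_deriv_continuous: "u \<in> test_functions ==> continuous_on A (nth_deriv k u)"
 using nth_deriv_has_derivative[THEN has_vector_derivative_continuous] by (auto intro!: continuous_at_imp_continuous_on)

lemma nth_deriv_bdd:
 assumes u: "u \<in> test_functions"
 shows "bdd_above (range (%x. cmod (nth_deriv k u x)))"
proof -
 have "compact ((%x. cmod (nth_deriv k u x)) ` {-pi..pi})"
  by (intro compact_continuous_image continuous_intros nth_deriv_continuous u) auto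
 then obtain B where B: "!!y. y \<in> {-pi..pi} ==> cmod (nth_deriv k u y) <= B"
  using compact_imp_bounded bounded_imp_bdd_above unfolding bdd_above_def by (metis imageI)
 have "cmod (nth_deriv k u x) <= B" for x
  using periodic_reduce[of "nth_deriv k u" x] nth_deriv_periodic[OF u] B by metis
 thus ?thesis by (intro bdd_aboveI[of _ B]) auto
qed

lemma test_seminorm_upper: "u \<in> test_functions ==> cmod (nth_deriv k u x) <= test_seminorm k u"
 unfolding test_seminorm_def by (rule cSUP_upper[OF UNIV_I nth_deriv_bdd])

lemma test_seminorm_least: "(!!x. cmod (nth_deriv k u x) <= B) ==> test_seminorm k u <= B"
 unfolding test_seminorm_def by (rule cSUP_least) auto

lemma test_seminorm_triangle:
 assumes "u \<in> test_functions" "v \<in> test_functions" "z \<in> test_functions"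
 shows "test_seminorm k (%x. v x - z x) <= test_seminorm k (%x. v x - u x) + test_seminorm k (%x. u x - z x)"
proof (rule test_seminorm_least)
 fix x
 note d = test_functions_diff[OF assms(2,1)] test_functions_diff[OF assms(1,3)]
 have "cmod (nth_deriv k (%x. v x - z x) x) = cmod (nth_deriv k (%x. v x - u x) x + nth_deriv k (%x. u x - z x) x)"
  by (simp add: test_functions_diff(2)[OF assms(2,3)] d)
 also have "... <= cmod (nth_deriv k (%x. v x - u x) x) + cmod (nth_deriv k (%x. u x - z x) x)" by (rule norm_triangle_ineq)
 also have "... <= test_seminorm k (%x. v x - u x) + test_seminorm k (%x. u x - z x)"
  by (intro add_mono test_seminorm_upper d)
 finally show "cmod (nth_deriv k (%x. v x - z x) x) <= ..." .
qed

lemma test_seminorm_self: "u \<in> test_functions ==> test_seminorm k (%x. u x - u x) = 0"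
 using nth_derivI[of "%_ _. 0" "%_. 0"] by (simp add: test_seminorm_def)

section \<open>The topology of test functions\<close>

lemma topspace_test_topology: "topspace test_topology = test_functions"
proof -
 have "u \<in> \<Union>{{v \<in> test_functions. test_seminorm k (%x. v x - u x) < e} |k u e. u \<in> test_functions & e > 0}"
  if "u \<in> test_functions" for u using that test_seminorm_self[OF that, of 0]
  by (intro UnionI[of "{v \<in> test_functions. test_seminorm 0 (%x. v x - u x) < 1}"]) (auto intro!: exI[of _ "0::nat"] exI[of _ u] exI[of _ "1::real"])
 thus ?thesis unfolding test_topology_def topology_generated_by_topspace by auto
qed

text \<open>The topology is given by a subbasis, so the claim is proved by induction over the
  generation of open sets; the triangle inequality handles seminorm balls whose centre is not
  \<open>u\<close>.\<close>

lemma test_topology_eventually: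
 assumes u: "u \<in> test_functions" "!!N. v N \<in> test_functions"
  and lim: "!!k. (%N. test_seminorm k (%x. v N x - u x)) \<longlonglongrightarrow> 0"
  and W: "openin test_topology W" "u \<in> W"
 shows "\<forall>\<^sub>F N in sequentially. v N \<in> W"
proof -
 have "generate_topology_on {{v \<in> test_functions. test_seminorm k (%x. v x - u x) < e} |k u e. u \<in> test_functions & e > 0} W"
  using W(1) unfolding test_topology_def by (rule openin_topology_generated_by)
 thus ?thesis using W(2)
 proof induction
  case (Int a b)
  thus ?case by (auto elim: eventually_elim2)
 next
  case (UN K)
  then obtain A where "A \<in> K" "u \<in> A" by blast
  hence "\<forall>\<^sub>F N in sequentially. v N \<in> A" using UN by blast
  thus ?case by eventually_elim (use \<open>A \<in> K\<close> in blast)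
 next
  case (Basis s)
  then obtain k z e where s: "s = {v \<in> test_functions. test_seminorm k (%x. v x - z x) < e}" "z \<in> test_functions" "e > 0" by auto
  have "test_seminorm k (%x. u x - z x) < e" using Basis s by simp
  hence "0 < e - test_seminorm k (%x. u x - z x)" by simp
  with lim[of k] have "\<forall>\<^sub>F N in sequentially. test_seminorm k (%x. v N x - u x) < e - test_seminorm k (%x. u x - z x)"
   by (rule order_tendstoD(2))
  thus ?case
  proof eventually_elim
   fix N assume "test_seminorm k (%x. v N x - u x) < e - test_seminorm k (%x. u x - z x)"
   hence "test_seminorm k (%x. v N x - z x) < e" using test_seminorm_triangle[OF u(1) u(2)[of N] s(2), of k] by simp
   thus "v N \<in> s" using u(2) s(1) by simp
  qed
 qed simp
qed

lemma distribution_sequentially_continuous: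
 assumes a: "a \<in> periodic_distributions"
  and u: "u \<in> test_functions" "!!N. v N \<in> test_functions"
  and lim: "!!k. (%N. test_seminorm k (%x. v N x - u x)) \<longlonglongrightarrow> 0"
 shows "(%N. a (v N)) \<longlonglongrightarrow> a u"
proof (rule topological_tendstoI)
 fix S assume S: "open S" "a u \<in> S"
 have "continuous_map test_topology euclidean a" using a by (simp add: periodic_distributions_def)
 hence "openin test_topology {x \<in> topspace test_topology. a x \<in> S}" using S(1) by (simp add: continuous_map_def)
 from test_topology_eventually[OF u lim this] u S(2)
 show "\<forall>\<^sub>F N in sequentially. a (v N) \<in> S"
  by (auto simp: topspace_test_topology elim: eventually_mono)
qed

lemma distribution_linear:
 assumes a: "a \<in> periodic_distributions"
 shows "u \<in> test_functions ==> v \<in> test_functions ==> a (%x. u x + v x) = a u + a v"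
  "u \<in> test_functions ==> a (%x. c * u x) = c * a u" "u \<notin> test_functions ==> a u = 0"
 using a by (auto simp: periodic_distributions_def linear_functional_on_def)

lemma distribution_sum:
 assumes a: "a \<in> periodic_distributions" and u: "!!i. i \<in> I ==> u i \<in> test_functions"
 shows "a (%x. \<Sum>i\<in>I. c i * u i x) = (\<Sum>i\<in>I. c i * a (u i))"
 using u
proof (induction I rule: infinite_finite_induct)
 case (insert i I)
 have "(%x. c i * u i x) \<in> test_functions" "(%x. \<Sum>i\<in>I. c i * u i x) \<in> test_functions"
  using insert.prems by (auto intro!: test_functions_sum(1) test_functions_cmult(1))
 thus ?case using insert by (simp add: distribution_linear[OF a])
qed (use distribution_linear(2)[OF a test_functions_zero, of 0] in auto)

text \<open>Control by the seminorm of order zero is enough for continuity, and it is what bounded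
  functions provide.\<close>

lemma distributionI:
 assumes lin: "!!u v. u \<in> test_functions ==> v \<in> test_functions ==> a (%x. u x + v x) = a u + a v"
  "!!c u. u \<in> test_functions ==> a (%x. c * u x) = c * a u" "!!u. u \<notin> test_functions ==> a u = 0"
  and bound: "!!u. u \<in> test_functions ==> cmod (a u) <= C * test_seminorm 0 u"
 shows "a \<in> periodic_distributions"
 unfolding periodic_distributions_def
proof (intro CollectI conjI)
 show "linear_functional_on test_functions a" using lin by (simp add: linear_functional_on_def)
 show "continuous_map test_topology euclidean a"
  unfolding continuous_map_def topspace_test_topology
 proof (intro conjI allI impI)
  fix U :: "complex set" assume "openin euclidean U"
  hence U: "open U" by simp
  show "openin test_topology {u \<in> test_functions. a u \<in> U}"
  proof (subst openin_subopen, intro ballI)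
   fix u assume "u \<in> {u \<in> test_functions. a u \<in> U}"
   hence u: "u \<in> test_functions" "a u \<in> U" by auto
   obtain e where e: "e > 0" "ball (a u) e \<subseteq> U" using U u(2) open_contains_ball by blast
   define d where "d = e / (\<bar>C\<bar> + 1)"
   have d: "d > 0" using e by (simp add: d_def add_nonneg_pos)
   define B where "B = {v \<in> test_functions. test_seminorm 0 (%x. v x - u x) < d}"
   have "openin test_topology B" unfolding test_topology_def openin_topology_generated_by_iff B_def
    by (rule generate_topology_on.Basis) (use u d in blast)
   moreover have "u \<in> B" using u d test_seminorm_self[OF u(1), of 0] by (simp add: B_def)
   moreover have "B \<subseteq> {u \<in> test_functions. a u \<in> U}"
   proof
    fix v assume "v \<in> B"
    hence v: "v \<in> test_functions" "test_seminorm 0 (%x. v x - u x) < d" by (auto simp: B_def)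
    have s0: "0 <= test_seminorm 0 (%x. v x - u x)"
     using test_seminorm_upper[OF test_functions_diff(1)[OF v(1) u(1)], of 0 0] norm_ge_zero order_trans by blast
    have "a (%x. v x - u x) = a v - a u"
     using lin(1)[OF v(1) test_functions_cmult(1)[OF u(1), of "-1"]] lin(2)[OF u(1), of "-1"] by simp
    hence "cmod (a v - a u) <= C * test_seminorm 0 (%x. v x - u x)"
     using bound[OF test_functions_diff(1)[OF v(1) u(1)]] by simp
    also have "... <= (\<bar>C\<bar> + 1) * test_seminorm 0 (%x. v x - u x)" using s0 by (intro mult_right_mono) auto
    also have "... < (\<bar>C\<bar> + 1) * d" using v(2) by (intro mult_strict_left_mono) auto
    also have "... = e" by (simp add: d_def add_nonneg_eq_0_iff)
    finally have "a v \<in> ball (a u) e" by (simp add: dist_norm norm_minus_commute)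
    thus "v \<in> {u \<in> test_functions. a u \<in> U}" using e v by auto
   qed
   ultimately show "\<exists>T. openin test_topology T & u \<in> T & T \<subseteq> {u \<in> test_functions. a u \<in> U}" by blast
  qed
 qed auto
qed

lemma fourier_coeff_cis: "fourier_coeff a n = a (%x. ee (- n) x)"
 unfolding fourier_coeff_def cis_conv_exp by (simp add: mult_ac)

section \<open>Fourier coefficients of bounded functions\<close>

abbreviation circ :: "real measure" where
 "circ \<equiv> restrict_space lebesgue {-pi<..<pi}"

abbreviation (input) cmeas :: "(real => 'a::topological_space) set" where
 "cmeas \<equiv> borel_measurable circ"

lemma emeasure_circ: "emeasure circ (space circ) = ennreal (2 * pi)" by (simp add: emeasure_restrict_space)

interpretation circ: finite_measure circ by (rule finite_measureI) (simp only: emeasure_circ, simp)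

lemma measurable_circ: "f \<in> borel_measurable borel ==> f \<in> cmeas"
 by (intro measurable_restrict_space1 measurable_completion) simp

lemma circ_continuous:
 fixes g :: "real => 'b :: {banach, second_countable_topology}"
 assumes "continuous_on UNIV g"
 shows "g \<in> cmeas" "integrable circ g"
proof -
 show m: "g \<in> cmeas" by (intro measurable_circ borel_measurable_continuous_onI assms)
 have "compact (g ` {-pi..pi})" using assms by (intro compact_continuous_image continuous_on_subset[OF assms]) auto
 then obtain B where "!!y. y \<in> g ` {-pi..pi} ==> norm y <= B" using compact_imp_bounded bounded_iff by metis
 hence "AE x in circ. norm (g x) <= B" by (intro AE_I2) auto
 thus "integrable circ g" using m by (rule circ.integrable_const_bound)
qed

lemma circ_integral_eq:
 fixes g :: "real => complex"
 assumes "integrable circ g"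
 shows "integral\<^sup>L circ g = integral {-pi..pi} g"
proof -
 have "set_integrable lebesgue {-pi<..<pi} g"
  using assms by (subst (asm) integrable_restrict_space) (auto simp: set_integrable_def)
 hence "set_lebesgue_integral lebesgue {-pi<..<pi} g = integral {-pi<..<pi} g"
  by (rule set_lebesgue_integral_eq_integral(2))
 thus ?thesis by (subst integral_restrict_space) (auto simp: set_lebesgue_integral_def integral_open_interval_real)
qed

lemma circ_integral_cis: "(LINT t|circ. ee n t) = (if n = 0 then 2 * pi else 0)"
proof (cases "n = 0")
 case True
 have "((%t. 1 :: complex) has_integral of_real (2 * pi)) {-pi..pi}"
  using has_integral_const_real[of "1 :: complex" "- pi" pi] by (simp add: scaleR_conv_of_real)
 thus ?thesis using True by (subst circ_integral_eq) (auto simp: integral_unique scaleR_conv_of_real intro!: circ_continuous)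
next
 case False
 have n: "- n ~= 0" using False by simp
 have "((%x. ec (- n) x) has_integral (ec (- n) pi - cis (- of_int (- n) * - pi)) * (\<i> / of_int (- n))) {-pi..pi}"
  by (rule has_integral_cis_int[OF n]) auto
 moreover have "ee n pi = cis (of_int n * - pi)" by (simp add: complex_eq_iff sin_zero_iff_int2)
 ultimately have "((%x. ee n x) has_integral 0) {-pi..pi}" by simp
 thus ?thesis using False
  by (subst circ_integral_eq) (auto simp: integral_unique intro!: circ_continuous continuous_intros)
qed

definition fc :: "(real => complex) => int => complex" where
 "fc f n = (LINT x|circ. f x * ec n x) / (2 * pi)"

lemma cis_measurable: "(%x. cis (c * x)) \<in> cmeas" by (intro circ_continuous(1) continuous_intros)

lemma integrable_times_cis: "integrable circ f ==> integrable circ (%x. f x * cis (c * x))" for f :: "real => complex"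
 by (rule Bochner_Integration.integrable_bound[where f = f])
  (auto intro!: borel_measurable_times cis_measurable simp: norm_mult)

lemma fc_add: "integrable circ f ==> integrable circ g ==> fc (%x. f x + g x) n = fc f n + fc g n"
 using integrable_times_cis[of f "- of_int n"] integrable_times_cis[of g "- of_int n"]
 by (simp add: fc_def distrib_right add_divide_distrib)

lemma fc_diff: "integrable circ f ==> integrable circ g ==> fc (%x. f x - g x) n = fc f n - fc g n"
 using integrable_times_cis[of f "- of_int n"] integrable_times_cis[of g "- of_int n"]
 by (simp add: fc_def left_diff_distrib diff_divide_distrib)

lemma fc_cmult: "fc (%x. c * f x) n = c * fc f n" by (simp add: fc_def mult.assoc)

lemma fc_cis: "fc (%x. ee m x) n = (if n = m then 1 else 0)"
proof -
 have "ee m x * ec n x = ee (m - n) x" for x by (simp add: cis_mult algebra_simps)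
 thus ?thesis using circ_integral_cis[of "m - n"] by (simp add: fc_def)
qed

section \<open>Uniform convergence of Fejer means\<close>

lemma continuous_fmean: "continuous_on A (fmean N c)" unfolding fmean_def by (intro continuous_intros)

lemma continuous_fejer_kernel: "N ~= 0 ==> continuous_on UNIV (%t. fejer_kernel N (x - t))"
 unfolding fejer_kernel_def by (intro continuous_intros) auto

lemma fmean_fc:
 fixes u :: "real => complex"
 assumes N: "N ~= 0" and u: "integrable circ u"
 shows "fmean N (fc u) x = (LINT t|circ. fejer_kernel N (x - t) * u t) / (2 * pi)"
proof -
 have e: "complex_of_real (fejer_kernel N (x - t)) * u t
  = (\<Sum>n=- int N..int N. complex_of_real (fejer N n) * ee n x * (u t * ec n t))" for t
 proof -
  have "cis (of_int n * (x - t)) = ee n x * ec n t" for n by (simp add: cis_mult algebra_simps)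
  thus ?thesis unfolding fejer_kernel_sum[OF N] fmean_def by (simp add: sum_distrib_left sum_distrib_right mult_ac)
 qed
 have "(LINT t|circ. fejer_kernel N (x - t) * u t)
  = (\<Sum>n=- int N..int N. complex_of_real (fejer N n) * ee n x * (LINT t|circ. u t * ec n t))"
 proof -
  have "integrable circ (%t. complex_of_real (fejer N n) * ee n x * (u t * ec n t))" for n
   by (intro integrable_mult_right integrable_times_cis u)
  thus ?thesis unfolding e by (subst Bochner_Integration.integral_sum) auto
 qed
 thus ?thesis by (simp add: fmean_def fc_def sum_divide_distrib mult_ac)
qed

lemma fejer_kernel_cis:
 assumes N: "N ~= 0" and m: "\<bar>m\<bar> <= int N"
 shows "(LINT t|circ. fejer_kernel N (x - t) * ee m t) = 2 * pi * (fejer N m * ee m x)"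
proof -
 have "fmean N (fc (%t. ee m t)) x = fejer N m * ee m x"
  unfolding fmean_def fc_cis using m by (simp add: if_distrib[of "%y. _ * y"] if_distrib[of "%y. y * _"] abs_le_iff cong: if_cong)
 thus ?thesis by (subst (asm) fmean_fc[OF N]) (auto intro!: circ_continuous(2) continuous_intros simp: field_simps)
qed

text \<open>Mass and second moment of the kernel. Distance is measured by the chord, whose square is
  a trigonometric polynomial of degree one, so the moment follows exactly from the weights at 0 and
  1.\<close>

lemma fejer_kernel_integral:
 assumes N: "N ~= 0"
 shows "(LINT t|circ. fejer_kernel N (x - t)) = 2 * pi"
  "(LINT t|circ. fejer_kernel N (x - t) * (cmod (cis t - cis x))\<^sup>2) = 4 * pi / N"
proof -
 have int: "integrable circ (%t. fejer_kernel N (x - t))" by (intro circ_continuous continuous_fejer_kernel N)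
 have "complex_of_real (LINT t|circ. fejer_kernel N (x - t)) = complex_of_real (2 * pi)"
  using fejer_kernel_cis[OF N, of 0 x] by (simp add: fejer_def)
 thus 1: "(LINT t|circ. fejer_kernel N (x - t)) = 2 * pi" by (simp only: of_real_eq_iff)
 have int2: "integrable circ (%t. fejer_kernel N (x - t) * cos (t - x))"
  by (intro circ_continuous continuous_intros continuous_fejer_kernel N)
 have intc: "integrable circ (%t. fejer_kernel N (x - t) * cis t)"
  by (intro circ_continuous continuous_intros continuous_fejer_kernel N)
 have intc': "integrable circ (%t. fejer_kernel N (x - t) * cis t * cis (- x))"
  by (intro circ_continuous continuous_intros continuous_fejer_kernel N)
 have "(LINT t|circ. fejer_kernel N (x - t) * cis t) = 2 * pi * (fejer N 1 * cis x)"
  using fejer_kernel_cis[OF N, of 1 x] N by simp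
 hence "(LINT t|circ. fejer_kernel N (x - t) * cis t * cis (- x)) = 2 * pi * (fejer N 1 * cis x) * cis (- x)" by simp
 also have "... = complex_of_real (2 * pi * fejer N 1)" by (simp add: cis_mult mult.assoc)
 finally have c: "(LINT t|circ. fejer_kernel N (x - t) * cis t * cis (- x)) = complex_of_real (2 * pi * fejer N 1)" .
 have "Re (complex_of_real (fejer_kernel N (x - t)) * cis t * cis (- x)) = fejer_kernel N (x - t) * cos (t - x)" for t
  by (simp add: mult.assoc cis_mult)
 hence "(LINT t|circ. fejer_kernel N (x - t) * cos (t - x)) = Re (LINT t|circ. fejer_kernel N (x - t) * cis t * cis (- x))"
  using integral_Re[OF intc'] by simp
 also have "... = 2 * pi * fejer N 1" unfolding c by simp
 finally have 2: "(LINT t|circ. fejer_kernel N (x - t) * cos (t - x)) = 2 * pi * fejer N 1" .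
 have f1: "fejer N 1 = 1 - 1 / N" using N by (simp add: fejer_def field_simps)
 have ch: "(cmod (cis t - cis x))\<^sup>2 = 2 - 2 * cos (t - x)" for t
  by (simp add: cmod_power2 power2_diff cos_diff) (use sin_cos_squared_add[of t] sin_cos_squared_add[of x] in algebra)
 have "(LINT t|circ. fejer_kernel N (x - t) * (cmod (cis t - cis x))\<^sup>2)
  = (LINT t|circ. 2 * fejer_kernel N (x - t) - 2 * (fejer_kernel N (x - t) * cos (t - x)))"
  unfolding ch by (intro Bochner_Integration.integral_cong refl) (simp add: algebra_simps)
 also have "... = 2 * (2 * pi) - 2 * (2 * pi * fejer N 1)" using int int2 1 2 by simp
 also have "... = 4 * pi / N" using N by (simp add: f1 field_simps)
 finally show "(LINT t|circ. fejer_kernel N (x - t) * (cmod (cis t - cis x))\<^sup>2) = 4 * pi / N" .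
qed

lemma chord_lipschitz_continuous:
 assumes "!!t x. cmod (u t - u x) <= K * cmod (cis t - cis x)"
 shows "continuous_on UNIV u"
proof (rule continuous_at_imp_continuous_on, intro ballI)
 fix x :: real
 have "(%t. K * cmod (cis t - cis x)) \<midarrow>x\<rightarrow> K * cmod (cis x - cis x)" by (intro tendsto_intros)
 hence "(%t. K * cmod (cis t - cis x)) \<midarrow>x\<rightarrow> 0" by simp
 hence "(%t. u t - u x) \<midarrow>x\<rightarrow> 0" by (rule Lim_null_comparison[rotated]) (simp add: assms)
 thus "isCont u x" by (simp add: isCont_def LIM_zero_iff)
qed

text \<open>A function that is Lipschitz in the chord distance is integrated against the kernel by
  means of its mass and second moment. The distance itself enters with power one and is split by
  \<open>c <= d/2 + c^2 / (2 * d)\<close>; the choice \<open>d = 1 / sqrt N\<close> balances the two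
  moments.\<close>

lemma fejer_uniform:
 assumes N: "N ~= 0" and u: "!!t x. cmod (u t - u x) <= K * cmod (cis t - cis x)"
 shows "cmod (fmean N (fc u) x - u x) <= 2 * K / sqrt N"
proof -
 have cont: "continuous_on UNIV u" by (rule chord_lipschitz_continuous[OF u])
 have K: "0 <= K"
 proof -
  have "0 <= K * cmod (cis pi - cis 0)" using u[of pi 0] norm_ge_zero order_trans by blast
  thus ?thesis by (simp add: zero_le_mult_iff)
 qed
 let ?F = "%t. fejer_kernel N (x - t)"
 define d where "d = 1 / sqrt N"
 have d: "d > 0" "d * d = 1 / N" using N by (auto simp: d_def)
 have iu: "integrable circ (%t. ?F t * u t)" and ic: "integrable circ (%t. ?F t * u x)"
  by (intro circ_continuous continuous_intros continuous_fejer_kernel N cont)+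
 have iF: "integrable circ (%t. ?F t * (cmod (cis t - cis x))\<^sup>2)" "integrable circ ?F"
  by (intro circ_continuous continuous_intros continuous_fejer_kernel N)+
 have "2 * pi * (fmean N (fc u) x - u x) = (LINT t|circ. ?F t * u t) - (LINT t|circ. ?F t * u x)"
 proof -
  have "(LINT t|circ. complex_of_real (?F t) * u x) = complex_of_real (LINT t|circ. ?F t) * u x" by simp
  also have "... = 2 * pi * u x" by (simp only: fejer_kernel_integral(1)[OF N])
  finally have c: "(LINT t|circ. complex_of_real (?F t) * u x) = 2 * pi * u x" .
  have "2 * pi * fmean N (fc u) x = (LINT t|circ. ?F t * u t)"
   using fmean_fc[OF N circ_continuous(2)[OF cont], of x] by simp
  thus ?thesis unfolding c by (simp only: right_diff_distrib)
 qed
 also have "... = (LINT t|circ. ?F t * (u t - u x))" using iu ic by (simp add: right_diff_distrib)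
 finally have e: "2 * pi * (fmean N (fc u) x - u x) = (LINT t|circ. ?F t * (u t - u x))" .
 have "cmod (LINT t|circ. ?F t * (u t - u x)) <= (LINT t|circ. (K * d / 2) * ?F t + (K / (2 * d)) * (?F t * (cmod (cis t - cis x))\<^sup>2))"
 proof (rule Bochner_Integration.integral_norm_bound_integral)
  show "integrable circ (%t. ?F t * (u t - u x))"
   by (intro circ_continuous continuous_intros continuous_fejer_kernel N cont)
  show "integrable circ (%t. (K * d / 2) * ?F t + (K / (2 * d)) * (?F t * (cmod (cis t - cis x))\<^sup>2))"
   using iF by (intro Bochner_Integration.integrable_add integrable_mult_right)
  fix t
  have am: "c <= d / 2 + c\<^sup>2 / (2 * d)" for c :: real
  proof -
   have "0 <= (c - d)\<^sup>2" by simp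
   hence "2 * d * c <= d * d + c\<^sup>2" by (simp add: power2_eq_square algebra_simps)
   thus ?thesis using d(1) by (simp add: field_simps power2_eq_square)
  qed
  have "cmod (?F t * (u t - u x)) = ?F t * cmod (u t - u x)" by (simp add: norm_mult fejer_kernel_nonneg)
  also have "... <= ?F t * (K * (d / 2 + (cmod (cis t - cis x))\<^sup>2 / (2 * d)))"
   using u[of t x] mult_left_mono[OF am K] by (intro mult_left_mono fejer_kernel_nonneg) (rule order_trans)
  also have "... = (K * d / 2) * ?F t + (K / (2 * d)) * (?F t * (cmod (cis t - cis x))\<^sup>2)" by (simp add: algebra_simps)
  finally show "cmod (?F t * (u t - u x)) <= ..." .
 qed
 also have "... = (K * d / 2) * (2 * pi) + (K / (2 * d)) * (4 * pi / N)"
  using iF fejer_kernel_integral[OF N, of x] by simp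
 also have "(K / (2 * d)) * (4 * pi / N) = K * (2 * pi) * (1 / N / d)" by (simp add: mult_ac)
 also have "1 / N / d = d" using d by (simp add: d(2)[symmetric])
 also have "(K * d / 2) * (2 * pi) + K * (2 * pi) * d <= 2 * pi * (2 * K * d)" using K d(1) by (simp add: algebra_simps)
 finally have "cmod (2 * pi * (fmean N (fc u) x - u x)) <= 2 * pi * (2 * K * d)" unfolding e .
 hence "2 * pi * cmod (fmean N (fc u) x - u x) <= 2 * pi * (2 * K * d)" by (simp add: norm_mult)
 hence "cmod (fmean N (fc u) x - u x) <= 2 * K * d" by (rule mult_left_le_imp_le) simp
 thus ?thesis by (simp add: d_def)
qed

section \<open>Uniqueness of Fourier coefficients\<close>

text \<open>The positive and the negative part of \<open>g\<close> are densities of finite measures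
  that agree on half-lines, hence coincide.\<close>

lemma AE_zero_halflines:
 fixes g :: "real => real"
 assumes g: "integrable lborel g" and z: "!!s. (LINT x|lborel. indicator {s<..} x * g x) = 0"
 shows "AE x in lborel. g x = 0"
proof -
 have [measurable]: "g \<in> borel_measurable lborel" using g by simp
 define f1 where "f1 x = ennreal (max 0 (g x))" for x
 define f2 where "f2 x = ennreal (max 0 (- g x))" for x
 have i: "integrable lborel (%x. indicator {s<..} x * max 0 (g x))" "integrable lborel (%x. indicator {s<..} x * max 0 (- g x))" for s
  by (rule Bochner_Integration.integrable_bound[OF g]; simp add: indicator_def max_def)+
 have n1: "(\<integral>\<^sup>+x. f1 x * indicator {s<..} x \<partial>lborel) = ennreal (LINT x|lborel. indicator {s<..} x * max 0 (g x))" for s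
  using i(1)[of s] by (subst nn_integral_eq_integral[symmetric]) (auto simp: f1_def indicator_def intro!: nn_integral_cong)
 have n2: "(\<integral>\<^sup>+x. f2 x * indicator {s<..} x \<partial>lborel) = ennreal (LINT x|lborel. indicator {s<..} x * max 0 (- g x))" for s
  using i(2)[of s] by (subst nn_integral_eq_integral[symmetric]) (auto simp: f2_def indicator_def intro!: nn_integral_cong)
 have eq: "(LINT x|lborel. indicator {s<..} x * max 0 (g x)) = (LINT x|lborel. indicator {s<..} x * max 0 (- g x))" for s
 proof -
  have "(LINT x|lborel. indicator {s<..} x * max 0 (g x)) - (LINT x|lborel. indicator {s<..} x * max 0 (- g x))
   = (LINT x|lborel. indicator {s<..} x * max 0 (g x) - indicator {s<..} x * max 0 (- g x))" using i[of s] by simp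
  also have "... = (LINT x|lborel. indicator {s<..} x * g x)"
   by (intro Bochner_Integration.integral_cong) (auto simp: max_def indicator_def)
  finally show ?thesis using z by simp
 qed
 have "density lborel f1 = density lborel f2"
 proof (rule measure_eqI_lessThan)
  show "emeasure (density lborel f1) {s<..} < \<infinity>" for s
  proof -
   have "f1 \<in> borel_measurable lborel" by (simp add: f1_def[abs_def])
   thus ?thesis by (simp add: emeasure_density n1)
  qed
  show "emeasure (density lborel f1) {s<..} = emeasure (density lborel f2) {s<..}" for s
   using n1[of s] n2[of s] eq[of s] by (subst (1 2) emeasure_density) (auto simp: f1_def[abs_def] f2_def[abs_def])
 qed (auto simp: f1_def f2_def)
 moreover have "(\<integral>\<^sup>+x. f1 x \<partial>lborel) ~= \<infinity>"
 proof -
  have "integrable lborel (%x. max 0 (g x))" by (rule Bochner_Integration.integrable_bound[OF g]) (auto simp: max_def)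
  thus ?thesis unfolding f1_def by (subst nn_integral_eq_integral) auto
 qed
 ultimately have "AE x in lborel. f1 x = f2 x"
  by (subst (asm) finite_density_unique) (auto simp: f1_def[abs_def] f2_def[abs_def])
 thus ?thesis by eventually_elim (auto simp: f1_def f2_def max_def split: if_splits)
qed

text \<open>The result for half-lines concerns Borel functions, so \<open>h\<close>, extended by
  zero, is replaced by a Borel function equal to it almost everywhere.\<close>

lemma AE_zero_circ_real:
 fixes h :: "real => real"
 assumes h: "integrable circ h" and z: "!!s. s \<in> {-pi..<pi} ==> (LINT x|circ. indicator {s<..} x * h x) = 0"
 shows "AE x in circ. h x = 0"
proof -
 let ?H = "%x. indicator {-pi<..<pi} x * h x"
 have H: "integrable lebesgue ?H" using h by (subst (asm) integrable_restrict_space) auto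
 hence "?H \<in> borel_measurable (completion lborel)" by simp
 then obtain g where g: "g \<in> borel_measurable lborel" "AE x in lborel. ?H x = g x"
  using completion_ex_borel_measurable_real by blast
 have gl: "AE x in lebesgue. ?H x = g x" using g(2) by (rule AE_completion)
 have gm: "g \<in> borel_measurable lebesgue" using g(1) by (rule measurable_completion)
 have "integrable lebesgue g" using integrable_cong_AE[OF _ gm gl] H by auto
 hence gi: "integrable lborel g" using g(1) by (simp add: integrable_completion)
 have "(LINT x|lborel. indicator {s<..} x * g x) = 0" for s
 proof -
  have "(LINT x|lborel. indicator {s<..} x * g x) = (LINT x|lebesgue. indicator {s<..} x * g x)"
   using g(1) by (intro integral_completion[symmetric]) auto
  also have "... = (LINT x|lebesgue. indicator {s<..} x * ?H x)"
  proof (rule integral_cong_AE)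
   show "(%x. indicator {s<..} x * g x) \<in> borel_measurable lebesgue" using gm by (intro borel_measurable_times borel_measurable_indicator) auto
   show "(%x. indicator {s<..} x * ?H x) \<in> borel_measurable lebesgue"
    by (rule borel_measurable_times[OF borel_measurable_indicator borel_measurable_integrable[OF H]]) simp
   show "AE x in lebesgue. indicator {s<..} x * g x = indicator {s<..} x * ?H x" using gl by eventually_elim simp
  qed
  also have "... = (LINT x|circ. indicator {s<..} x * h x)" by (subst integral_restrict_space) (auto simp: mult_ac)
  also have "... = 0"
  proof -
   consider "pi <= s" | "s \<in> {-pi..<pi}" | "s < - pi" by fastforce
   thus ?thesis
   proof cases
    case 1
    hence "(LINT x|circ. indicator {s<..} x * h x) = (LINT x|circ. 0)"
     by (intro Bochner_Integration.integral_cong) (auto simp: indicator_def)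
    thus ?thesis by simp
   next
    case 3
    hence "(LINT x|circ. indicator {s<..} x * h x) = (LINT x|circ. indicator {-pi<..} x * h x)"
     by (intro Bochner_Integration.integral_cong) (auto simp: indicator_def)
    thus ?thesis using z[of "- pi"] by simp
   qed (rule z)
  qed
  finally show ?thesis .
 qed
 from AE_zero_halflines[OF gi this] have "AE x in lborel. g x = 0" .
 with g(2) have "AE x in lborel. ?H x = 0" by eventually_elim simp
 hence "AE x in lebesgue. ?H x = 0" by (rule AE_completion)
 thus ?thesis by (subst AE_restrict_space_iff) (auto elim: eventually_mono)
qed

lemma measurable_circ_halfline:
 "(%x. indicator {s<..} x :: 'a :: real_normed_algebra_1) \<in> cmeas" by (rule measurable_circ) measurable

lemma AE_zero_circ:
 fixes h :: "real => complex"
 assumes h: "integrable circ h" and z: "!!s. s \<in> {-pi..<pi} ==> (LINT x|circ. indicator {s<..} x * h x) = 0"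
 shows "AE x in circ. h x = 0"
proof -
 have i: "integrable circ (%x. indicator {s<..} x * h x)" for s by (rule Bochner_Integration.integrable_bound[OF h])
   (use h in \<open>auto simp: norm_mult intro!: borel_measurable_times measurable_circ_halfline split: split_indicator\<close>)
 have "AE x in circ. Re (h x) = 0"
 proof (rule AE_zero_circ_real)
  show "integrable circ (%x. Re (h x))" using h by simp
  fix s assume s: "s \<in> {-pi..<pi}"
  have "(LINT x|circ. indicator {s<..} x * Re (h x)) = Re (LINT x|circ. indicator {s<..} x * h x)"
   by (subst integral_Re[OF i, symmetric]) (auto simp: indicator_def intro!: Bochner_Integration.integral_cong)
  thus "(LINT x|circ. indicator {s<..} x * Re (h x)) = 0" using z[OF s] by simp
 qed
 moreover have "AE x in circ. Im (h x) = 0"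
 proof (rule AE_zero_circ_real)
  show "integrable circ (%x. Im (h x))" using h by simp
  fix s assume s: "s \<in> {-pi..<pi}"
  have "(LINT x|circ. indicator {s<..} x * Im (h x)) = Im (LINT x|circ. indicator {s<..} x * h x)"
   by (subst integral_Im[OF i, symmetric]) (auto simp: indicator_def intro!: Bochner_Integration.integral_cong)
  thus "(LINT x|circ. indicator {s<..} x * Im (h x)) = 0" using z[OF s] by simp
 qed
 ultimately show ?thesis by eventually_elim (simp add: complex_eq_iff)
qed

lemma AE_circ_nonneg:
 assumes "AE x in circ. cmod (f x) <= C"
 shows "0 <= C"
proof -
 have "AE x in circ. 0 <= C" using assms by eventually_elim (rule order_trans[OF norm_ge_zero])
 moreover have "ae_filter circ ~= bot" using emeasure_circ by (auto simp: ae_filter_eq_bot_iff)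
 ultimately show ?thesis by (simp add: eventually_const_iff)
qed

lemma integrable_bounded_circ:
 fixes h :: "real => complex"
 assumes "h \<in> cmeas" "AE x in circ. cmod (h x) <= B"
 shows "integrable circ h" using circ.integrable_const_bound[OF assms(2,1)] .

lemma integral_bounded_circ:
 fixes h u :: "real => complex"
 assumes h: "h \<in> cmeas" "AE x in circ. cmod (h x) <= B"
  and u: "u \<in> cmeas" "!!x. cmod (u x) <= K" and K: "0 <= K"
 shows "integrable circ (%x. h x * u x)" "cmod (LINT x|circ. h x * u x) <= 2 * pi * (B * K)"
proof -
 have B: "0 <= B" by (rule AE_circ_nonneg[OF h(2)])
 have bd: "AE x in circ. cmod (h x * u x) <= B * K"
  using h(2) by eventually_elim (auto simp: norm_mult intro!: mult_mono u B K)
 have m: "(%x. h x * u x) \<in> cmeas" using h u by simp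
 show i: "integrable circ (%x. h x * u x)" by (rule integrable_bounded_circ[OF m bd])
 have "cmod (LINT x|circ. h x * u x) <= (LINT x|circ. cmod (h x * u x))" by (rule integral_norm_bound)
 also have "... <= (LINT x|circ. B * K)" using i bd by (intro integral_mono_AE) auto
 also have "... = 2 * pi * (B * K)" using emeasure_circ by (simp add: measure_def)
 finally show "cmod (LINT x|circ. h x * u x) <= 2 * pi * (B * K)" .
qed

lemma trig_sum_integral:
 assumes h: "integrable circ h"
 shows "(LINT x|circ. h x * (\<Sum>i\<in>S. b i * ec (k i) x)) = 2 * pi * (\<Sum>i\<in>S. b i * fc h (k i))"
proof -
 have e: "h x * (\<Sum>i\<in>S. b i * ec (k i) x) = (\<Sum>i\<in>S. b i * (h x * ec (k i) x))" for x
  by (simp add: sum_distrib_left mult_ac)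
 have "integrable circ (%x. b i * (h x * ec (k i) x))" for i by (intro integrable_mult_right integrable_times_cis h)
 hence "(LINT x|circ. h x * (\<Sum>i\<in>S. b i * ec (k i) x))
  = (\<Sum>i\<in>S. b i * (LINT x|circ. h x * ec (k i) x))" unfolding e by (subst Bochner_Integration.integral_sum) auto
 thus ?thesis by (simp add: fc_def sum_distrib_left)
qed

lemma fmean_integral:
 assumes h: "integrable circ h"
 shows "(LINT x|circ. h x * fmean N c x) = 2 * pi * (\<Sum>n=- int N..int N. complex_of_real (fejer N n) * c n * fc h (- n))"
 using trig_sum_integral[OF h, of "%n. complex_of_real (fejer N n) * c n" uminus "{- int N..int N}"]
 by (simp add: fmean_def)

text \<open>Fejer means are trigonometric polynomials, to which \<open>h\<close> is orthogonal, and
  they approximate \<open>u\<close> uniformly.\<close>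

lemma orthogonal_chord_lipschitz:
 assumes h: "h \<in> cmeas" "AE x in circ. cmod (h x) <= B" and z: "!!n. fc h n = 0"
  and u: "!!t x. cmod (u t - u x) <= K * cmod (cis t - cis x)"
 shows "(LINT x|circ. h x * u x) = 0"
proof -
 have K: "0 <= K"
 proof -
  have "0 <= K * cmod (cis pi - cis 0)" using u[of pi 0] norm_ge_zero order_trans by blast
  thus ?thesis by (simp add: zero_le_mult_iff)
 qed
 have cont: "continuous_on UNIV u" by (rule chord_lipschitz_continuous[OF u])
 have hi: "integrable circ h" by (rule integrable_bounded_circ[OF h])
 have bound: "cmod (LINT x|circ. h x * u x) <= 2 * pi * (B * (2 * K / sqrt (real N)))" if N: "N ~= 0" for N
 proof -
  let ?e = "%x. u x - fmean N (fc u) x"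
  have e: "cmod (?e x) <= 2 * K / sqrt (real N)" for x
   using fejer_uniform[OF N u, of x] by (simp add: norm_minus_commute)
  have em: "?e \<in> cmeas" by (intro circ_continuous(1) continuous_intros cont continuous_fmean)
  have iF: "integrable circ (%x. h x * fmean N (fc u) x)"
  proof -
   have "continuous_on UNIV (fmean N (fc u))" by (rule continuous_fmean)
   have "cmod (fmean N (fc u) x) <= (\<Sum>n=- int N..int N. cmod (complex_of_real (fejer N n) * fc u n))" for x
    unfolding fmean_def by (rule order_trans[OF norm_sum]) (simp add: norm_mult)
   thus ?thesis by (intro integral_bounded_circ(1)[OF h] circ_continuous(1) continuous_fmean) (auto intro: sum_nonneg)
  qed
  have ie: "integrable circ (%x. h x * ?e x)" by (rule integral_bounded_circ(1)[OF h em e]) (use K in simp)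
  have "(LINT x|circ. h x * u x) = (LINT x|circ. h x * fmean N (fc u) x + h x * ?e x)" by (simp add: right_diff_distrib)
  also have "... = (LINT x|circ. h x * fmean N (fc u) x) + (LINT x|circ. h x * ?e x)"
   by (rule Bochner_Integration.integral_add[OF iF ie])
  also have "(LINT x|circ. h x * fmean N (fc u) x) = 0" by (simp add: fmean_integral[OF hi] z)
  finally show ?thesis using integral_bounded_circ(2)[OF h em e] K by simp
 qed
 have "(%N. 2 * pi * (B * (2 * K / sqrt (real N)))) \<longlonglongrightarrow> 2 * pi * (B * 0)"
  by (intro tendsto_intros real_tendsto_divide_at_top[where c = "2 * K"] filterlim_compose[OF sqrt_at_top filterlim_real_sequentially])
 hence "cmod (LINT x|circ. h x * u x) <= 2 * pi * (B * 0)"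
  by (rule LIMSEQ_le_const) (use bound in \<open>auto intro!: exI[of _ 1]\<close>)
 thus ?thesis by simp
qed

text \<open>On the circle, \<open>{s<..<pi}\<close> is the arc with centre
  \<open>(s + pi) / 2\<close> and half-width \<open>(pi - s) / 2\<close>, hence a superlevel set of
  a shifted cosine. So its indicator is a limit of functions that are Lipschitz in the chord
  distance.\<close>

lemma interval_by_cosine:
 assumes s: "s \<in> {-pi..<pi}" and x: "x \<in> {-pi<..<pi}"
 shows "cos ((pi - s) / 2) < cos (x - (s + pi) / 2) \<longleftrightarrow> s < x"
proof -
 let ?c = "(s + pi) / 2" and ?d = "(pi - s) / 2"
 have d: "0 <= ?d" "?d <= pi" using s by auto
 show ?thesis
 proof (cases "\<bar>x - ?c\<bar> <= pi")
  case True
  have "cos (x - ?c) = cos \<bar>x - ?c\<bar>" by simp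
  moreover have "cos ?d < cos \<bar>x - ?c\<bar> \<longleftrightarrow> \<bar>x - ?c\<bar> < ?d" using d True by (intro cos_mono_less_eq) auto
  ultimately show ?thesis using s x by (auto simp: abs_if field_simps)
 next
  case False
  have "x - ?c < pi" using s x by (auto simp: field_simps)
  hence l: "x - ?c < - pi" using False by (simp only: abs_le_iff not_le de_Morgan_conj) linarith
  define y where "y = x - ?c + 2 * pi"
  have y: "?d < y" "y <= pi" "0 <= y" using l s x by (auto simp: y_def field_simps)
  have "cos (x - ?c) = cos y" by (simp add: y_def)
  moreover have "cos y < cos ?d" using y d by (subst cos_mono_less_eq) auto
  ultimately show ?thesis using l s x by (auto simp: field_simps)
 qed
qed

lemma fc_zero_imp_AE_zero:
 assumes h: "h \<in> cmeas" "AE x in circ. cmod (h x) <= B" and z: "!!n. fc h n = 0"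
 shows "AE x in circ. h x = 0"
proof (rule AE_zero_circ[OF integrable_bounded_circ[OF h]])
 fix s assume s: "s \<in> {-pi..<pi}"
 define c where "c = (s + pi) / 2"
 define d where "d = (pi - s) / 2"
 \<comment> \<open>A ramp of slope \<open>m\<close> in the shifted cosine, clipped to values between
   0 and 1; on the open interval it tends to the indicator of \<open>{s<..}\<close>.\<close>
 define v where "v m x = max 0 (min 1 (real m * (cos (x - c) - cos d)))" for m x
 have v01: "0 <= v m x" "v m x <= 1" for m x by (auto simp: v_def)
 have lip: "cmod (complex_of_real (v m t) - complex_of_real (v m x)) <= real m * cmod (cis t - cis x)" for m t x
 proof -
  have "\<bar>v m t - v m x\<bar> <= \<bar>real m * (cos (t - c) - cos d) - real m * (cos (x - c) - cos d)\<bar>"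
   unfolding v_def by (auto simp: max_def min_def abs_if)
  also have "... = real m * \<bar>cos (t - c) - cos (x - c)\<bar>" by (simp add: right_diff_distrib[symmetric] abs_mult)
  also have "\<bar>cos (t - c) - cos (x - c)\<bar> <= cmod (cis (t - c) - cis (x - c))"
   using abs_Re_le_cmod[of "cis (t - c) - cis (x - c)"] by simp
  also have "cis (t - c) - cis (x - c) = (cis t - cis x) * cis (- c)" by (simp add: left_diff_distrib cis_mult)
  finally show ?thesis by (simp add: norm_mult mult_left_mono flip: of_real_diff)
 qed
 have "(%m. LINT x|circ. h x * complex_of_real (v m x)) \<longlonglongrightarrow> (LINT x|circ. indicator {s<..} x * h x)"
 proof (rule integral_dominated_convergence)
  show "integrable circ (%x. cmod (h x))" using integrable_bounded_circ[OF h] by simp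
  show "(%x. indicator {s<..} x * h x) \<in> cmeas"
   using h(1) by (intro borel_measurable_times measurable_circ_halfline)
  show "(%x. h x * complex_of_real (v m x)) \<in> cmeas" for m
   by (intro borel_measurable_times[OF h(1)] circ_continuous(1) chord_lipschitz_continuous[OF lip])
  show "AE x in circ. cmod (h x * complex_of_real (v m x)) <= cmod (h x)" for m
   by (intro AE_I2) (simp add: norm_mult v01 mult_left_le)
  show "AE x in circ. (%m. h x * complex_of_real (v m x)) \<longlonglongrightarrow> indicator {s<..} x * h x"
  proof (rule AE_I2)
   fix x assume "x \<in> space circ"
   hence x: "x \<in> {-pi<..<pi}" by simp
   have "(%m. complex_of_real (v m x)) \<longlonglongrightarrow> indicator {s<..} x"
   proof (cases "s < x")
    case True
    hence p: "0 < cos (x - c) - cos d" using interval_by_cosine[OF s x] by (simp add: c_def d_def)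
    obtain M :: nat where M: "1 / (cos (x - c) - cos d) < M" using reals_Archimedean2 by blast
    have "v m x = 1" if "M <= m" for m
    proof -
     have "1 / (cos (x - c) - cos d) <= real m" using M that by linarith
     hence "1 <= real m * (cos (x - c) - cos d)" using p by (simp add: divide_le_eq)
     thus ?thesis by (simp add: v_def)
    qed
    hence "\<forall>\<^sub>F m in sequentially. complex_of_real (v m x) = indicator {s<..} x"
     using True by (auto simp: eventually_sequentially)
    thus ?thesis by (rule tendsto_eventually)
   next
    case False
    hence "cos (x - c) - cos d <= 0" using interval_by_cosine[OF s x] by (simp add: c_def d_def)
    hence "v m x = 0" for m using mult_nonneg_nonpos[of "real m" "cos (x - c) - cos d"] unfolding v_def by linarith
    thus ?thesis using False by simp
   qed
   thus "(%m. h x * complex_of_real (v m x)) \<longlonglongrightarrow> indicator {s<..} x * h x"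
    by (subst mult.commute[of _ "h x"]) (rule tendsto_mult[OF tendsto_const])
  qed
 qed
 moreover have "(LINT x|circ. h x * complex_of_real (v m x)) = 0" for m by (rule orthogonal_chord_lipschitz[OF h z lip])
 ultimately show "(LINT x|circ. indicator {s<..} x * h x) = 0" by (simp add: LIMSEQ_const_iff)
qed

section \<open>Bounded Fejer means come from bounded functions\<close>

lemma fc_trig_sum:
 assumes S: "finite S"
 shows "fc (%x. \<Sum>m\<in>S. a m * ee m x) n = (if n \<in> S then a n else 0)"
proof -
 have i: "integrable circ (%x. ee (- n) x)" by (intro circ_continuous continuous_intros)
 have "2 * pi * fc (%x. \<Sum>m\<in>S. a m * ee m x) n
  = (LINT x|circ. ee (- n) x * (\<Sum>m\<in>S. a m * ec (- m) x))" by (simp add: fc_def mult.commute)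
 also have "... = 2 * pi * (\<Sum>m\<in>S. a m * fc (%x. ee (- n) x) (- m))" by (rule trig_sum_integral[OF i])
 also have "(\<Sum>m\<in>S. a m * fc (%x. ee (- n) x) (- m)) = (\<Sum>m\<in>S. if m = n then a m else 0)"
  unfolding fc_cis by (rule sum.cong) auto
 finally show ?thesis using S by simp
qed

lemma parseval_trig_sum:
 fixes a :: "int => complex"
 assumes S: "finite S"
 shows "(LINT x|circ. (cmod (\<Sum>n\<in>S. a n * ee n x))\<^sup>2) = 2 * pi * (\<Sum>n\<in>S. (cmod (a n))\<^sup>2)"
proof -
 let ?p = "%x. \<Sum>n\<in>S. a n * ee n x"
 have i: "integrable circ ?p" by (intro circ_continuous continuous_intros)
 have "complex_of_real (LINT x|circ. (cmod (?p x))\<^sup>2) = (LINT x|circ. complex_of_real ((cmod (?p x))\<^sup>2))"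
  by (simp only: integral_complex_of_real)
 also have "... = (LINT x|circ. ?p x * (\<Sum>n\<in>S. cnj (a n) * ec n x))"
  by (intro Bochner_Integration.integral_cong refl) (simp only: complex_norm_square, simp add: cis_cnj)
 also have "... = 2 * pi * (\<Sum>n\<in>S. cnj (a n) * a n)"
  unfolding trig_sum_integral[OF i] fc_trig_sum[OF S] by (intro arg_cong2[where f = "(*)"] sum.cong) auto
 also have "... = complex_of_real (2 * pi * (\<Sum>n\<in>S. (cmod (a n))\<^sup>2))"
  by (simp add: complex_norm_square mult.commute del: of_real_power)
 finally show ?thesis by (simp only: of_real_eq_iff)
qed

lemma fmean_extend:
 assumes "M ~= 0" "M <= N"
 shows "fmean M c x = (\<Sum>n=- int N..int N. (complex_of_real (fejer M n) * c n) * ee n x)"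
 unfolding fmean_def by (rule sum.mono_neutral_left) (use assms fejer_zero in auto)

lemma fejer_mono: "M ~= 0 ==> M <= N ==> fejer M n <= fejer N n"
 unfolding fejer_def by (intro max.mono diff_left_mono divide_left_mono) auto

text \<open>As the Fejer weights increase with \<open>N\<close>, \<open>(x - y)\<^sup>2 \<le> x\<^sup>2 - y\<^sup>2\<close> for \<open>0 \<le> y \<le> x\<close>
 turns boundedness of the \<open>L\<^sup>2\<close> norms into the Cauchy property.\<close>

lemma fmean_L2_diff:
 assumes "M ~= 0" "M <= N"
 shows "(LINT x|circ. (cmod (fmean N c x - fmean M c x))\<^sup>2)
  <= (LINT x|circ. (cmod (fmean N c x))\<^sup>2) - (LINT x|circ. (cmod (fmean M c x))\<^sup>2)"
proof -
 have N: "N ~= 0" using assms by simp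
 have d: "fmean N c x - fmean M c x = (\<Sum>n=- int N..int N. (complex_of_real (fejer N n - fejer M n) * c n) * ee n x)" for x
  unfolding fmean_extend[OF assms] fmean_extend[OF N order_refl] by (simp add: left_diff_distrib sum_subtractf)
 have "(fejer N n - fejer M n)\<^sup>2 <= (fejer N n)\<^sup>2 - (fejer M n)\<^sup>2" for n
 proof -
  have "0 <= 2 * (fejer M n * (fejer N n - fejer M n))" using fejer_bounds(1)[of M n] fejer_mono[OF assms, of n] by simp
  thus ?thesis by (simp add: power2_eq_square algebra_simps)
 qed
 from mult_right_mono[OF this zero_le_power2[of "cmod (c _)"]]
 have "(\<Sum>n=- int N..int N. (fejer N n - fejer M n)\<^sup>2 * (cmod (c n))\<^sup>2)
  <= (\<Sum>n=- int N..int N. ((fejer N n)\<^sup>2 - (fejer M n)\<^sup>2) * (cmod (c n))\<^sup>2)" by (rule sum_mono)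
 also have "... = (\<Sum>n=- int N..int N. (fejer N n)\<^sup>2 * (cmod (c n))\<^sup>2) - (\<Sum>n=- int N..int N. (fejer M n)\<^sup>2 * (cmod (c n))\<^sup>2)"
  by (simp add: left_diff_distrib sum_subtractf)
 finally have "2 * pi * (\<Sum>n=- int N..int N. (fejer N n - fejer M n)\<^sup>2 * (cmod (c n))\<^sup>2)
  <= 2 * pi * ((\<Sum>n=- int N..int N. (fejer N n)\<^sup>2 * (cmod (c n))\<^sup>2) - (\<Sum>n=- int N..int N. (fejer M n)\<^sup>2 * (cmod (c n))\<^sup>2))"
  by (rule mult_left_mono) simp
 moreover have "cmod (complex_of_real r * c n) ^ 2 = r\<^sup>2 * (cmod (c n))\<^sup>2" for r n
  by (simp add: norm_mult power_mult_distrib)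
 ultimately show ?thesis unfolding d unfolding fmean_extend[OF assms] fmean_extend[OF N order_refl]
  by (simp only: parseval_trig_sum finite_atLeastAtMost_int right_diff_distrib)
qed

text \<open>The squared mean-square norms increase and are bounded, so the means are Cauchy in that
  norm, and a sparse subsequence converges geometrically.\<close>

lemma bounded_fejer_means_subseq:
 assumes bd: "!!N t. N ~= 0 ==> cmod (fmean N c t) <= C"
 obtains r :: "nat => nat" where "!!k. r k ~= 0" "strict_mono r"
  "!!k. (LINT x|circ. (cmod (fmean (r (Suc k)) c x - fmean (r k) c x))\<^sup>2) <= (1 / 4) ^ k"
proof -
 \<comment> \<open>Shifted by one to avoid the degenerate index \<open>N = 0\<close>.\<close>
 define A where "A N = (LINT x|circ. (cmod (fmean (Suc N) c x))\<^sup>2)" for N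
 have step: "(LINT x|circ. (cmod (fmean (Suc N) c x - fmean (Suc M) c x))\<^sup>2) <= A N - A M" if "M <= N" for M N
  unfolding A_def using that by (intro fmean_L2_diff) auto
 have "incseq A"
 proof (rule monoI)
  fix M N :: nat assume "M <= N"
  hence "0 <= A N - A M" by (rule order_trans[OF integral_nonneg_AE step, rotated]) simp
  thus "A M <= A N" by simp
 qed
 moreover have "A N <= 2 * pi * C\<^sup>2" for N
 proof -
  have "A N <= (LINT x|circ. C\<^sup>2)" unfolding A_def
   by (intro integral_mono circ_continuous continuous_intros continuous_fmean power_mono bd) auto
  thus ?thesis using emeasure_circ by (simp add: measure_def)
 qed
 ultimately have "convergent A" by (metis incseq_convergent convergentI)
 hence "\<forall>k. \<exists>K. \<forall>m\<ge>K. \<forall>n\<ge>K. \<bar>A m - A n\<bar> < (1 / 4) ^ k"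
  using convergent_Cauchy[of A] by (auto simp: Cauchy_def dist_real_def)
 then obtain K where K: "!!k m n. K k <= m ==> K k <= n ==> \<bar>A m - A n\<bar> < (1 / 4) ^ k" by metis
 \<comment> \<open>Adding up all earlier thresholds makes the indices strictly increasing while
   keeping \<open>K k <= s k\<close>.\<close>
 define s where "s k = k + (\<Sum>i\<le>k. K i)" for k
 have s: "K k <= s k" "s k < s (Suc k)" for k using member_le_sum[of k "{..k}" K] by (auto simp: s_def)
 show ?thesis
 proof (rule that[of "%k. Suc (s k)"])
  show "strict_mono (%k. Suc (s k))" using s(2) by (simp add: strict_mono_Suc_iff)
  show "(LINT x|circ. (cmod (fmean (Suc (s (Suc k))) c x - fmean (Suc (s k)) c x))\<^sup>2) <= (1 / 4) ^ k" for k
   using step[of "s k" "s (Suc k)"] s[of k] K[of k "s (Suc k)" "s k"] by linarith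
 qed simp
qed

text \<open>Convergence almost everywhere comes from summability of the mean absolute differences
  along the subsequence; bounded convergence then identifies the coefficients.\<close>

theorem bounded_fejer_means_representation:
 assumes bd: "!!N t. N ~= 0 ==> cmod (fmean N c t) <= C"
 obtains f and r :: "nat => nat" where
  "f \<in> borel_measurable borel" "periodic f" "AE x in circ. cmod (f x) <= C"
  "!!k. r k ~= 0" "strict_mono r" "AE x in circ. (%k. fmean (r k) c x) \<longlonglongrightarrow> f x" "!!n. fc f n = c n"
proof -
 obtain r where r: "!!k. r k ~= 0" "strict_mono r"
  "!!k. (LINT x|circ. (cmod (fmean (r (Suc k)) c x - fmean (r k) c x))\<^sup>2) <= (1 / 4) ^ k"
  using bounded_fejer_means_subseq[OF bd] by blast
 define p where "p k = fmean (r k) c" for k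
 define d where "d k x = p (Suc k) x - p k x" for k x
 \<comment> \<open>\<open>lim\<close> is total, so \<open>f\<close> is Borel measurable and periodic
   everywhere, also at points where the sequence diverges.\<close>
 define f where "f x = lim (%k. p k x)" for x
 have p: "continuous_on UNIV (p k)" for k by (simp add: p_def continuous_fmean)
 have d: "continuous_on UNIV (d k)" for k unfolding d_def by (intro continuous_intros p)
 have pb: "cmod (p k x) <= C" for k x using bd[OF r(1)] by (simp add: p_def)
 have L1: "(\<integral>\<^sup>+x. ennreal (cmod (d k x)) \<partial>circ) <= ennreal (8 * (1 / 2) ^ k)" for k
 proof -
  \<comment> \<open>The inequality between arithmetic and geometric mean in place of Cauchy-Schwarz;
    the weight \<open>2 ^ k\<close> fits the bound \<open>(1 / 4) ^ k\<close> for the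
    squares.\<close>
  have am: "y <= (2 ^ k * y\<^sup>2 + (1 / 2) ^ k) / 2" for y :: real
  proof -
   have "0 <= (2 ^ k * y - 1)\<^sup>2 * (1 / 2) ^ k" by simp
   also have "... = 2 ^ k * y\<^sup>2 + (1 / 2) ^ k - 2 * y"
    by (simp add: power2_eq_square algebra_simps power_one_over)
   finally show ?thesis by simp
  qed
  have i: "integrable circ (%x. cmod (d k x))" "integrable circ (%x. (cmod (d k x))\<^sup>2)"
   by (intro circ_continuous continuous_intros d)+
  have "(LINT x|circ. cmod (d k x)) <= (LINT x|circ. (2 ^ k * (cmod (d k x))\<^sup>2 + (1 / 2) ^ k) / 2)"
   by (intro integral_mono am i integrable_divide Bochner_Integration.integrable_add integrable_mult_right) simp
  also have "... = (2 ^ k * (LINT x|circ. (cmod (d k x))\<^sup>2) + 2 * pi * (1 / 2) ^ k) / 2"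
   using i emeasure_circ by (simp add: measure_def)
  also have "... <= (2 ^ k * (1 / 4) ^ k + 2 * pi * (1 / 2) ^ k) / 2" using r(3)[of k] by (simp add: d_def p_def)
  also have "(2 :: real) ^ k * (1 / 4) ^ k = (1 / 2) ^ k" by (simp add: power_mult_distrib[symmetric])
  also have "((1 / 2) ^ k + 2 * pi * (1 / 2) ^ k) / 2 <= 8 * (1 / 2) ^ k"
   using pi_less_4 mult_right_mono[of "1 + 2 * pi" 16 "(1 / 2) ^ k"] by (simp add: algebra_simps)
  finally show ?thesis using i(1) by (subst nn_integral_eq_integral) (auto intro: ennreal_leI)
 qed
 have "(\<integral>\<^sup>+x. (\<Sum>k. ennreal (cmod (d k x))) \<partial>circ) = (\<Sum>k. \<integral>\<^sup>+x. ennreal (cmod (d k x)) \<partial>circ)"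
 proof (rule nn_integral_suminf)
  show "(%x. ennreal (cmod (d k x))) \<in> cmeas" for k
   using circ_continuous(1)[OF continuous_on_norm[OF d[of k]]] by simp
 qed
 also have "... <= (\<Sum>k. ennreal (8 * (1 / 2) ^ k))" by (intro suminf_le L1) auto
 also have "... = ennreal (\<Sum>k. 8 * (1 / 2) ^ k)" by (intro suminf_ennreal2 summable_mult summable_geometric) auto
 finally have fin: "(\<integral>\<^sup>+x. (\<Sum>k. ennreal (cmod (d k x))) \<partial>circ) ~= \<infinity>"
  by (auto simp: top_unique)
 have "AE x in circ. (\<Sum>k. ennreal (cmod (d k x))) ~= \<infinity>"
 proof (rule nn_integral_PInf_AE[OF _ fin])
  have "(%x. ennreal (cmod (d k x))) \<in> cmeas" for k
   using circ_continuous(1)[OF continuous_on_norm[OF d[of k]]] by simp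
  thus "(%x. \<Sum>k. ennreal (cmod (d k x))) \<in> cmeas" by (rule borel_measurable_suminf_order)
 qed
 hence conv: "AE x in circ. (%k. p k x) \<longlonglongrightarrow> f x"
 proof eventually_elim
  case (elim x)
  hence "summable (%k. cmod (d k x))" by (intro summable_suminf_not_top) auto
  hence "summable (%k. d k x)" by (rule summable_norm_cancel)
  hence "convergent (%n. p 0 x + (\<Sum>k<n. d k x))"
   by (intro convergent_add convergent_const) (simp add: summable_iff_convergent)
  moreover have "p 0 x + (\<Sum>k<n. d k x) = p n x" for n
   using sum_lessThan_telescope[of "%k. p k x" n] by (simp add: d_def)
  ultimately show ?case by (simp add: f_def convergent_LIMSEQ_iff)
 qed
 have fm: "f \<in> borel_measurable borel"
  unfolding f_def by (intro borel_measurable_lim_metric borel_measurable_continuous_onI p)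
 show ?thesis
 proof (rule that[OF fm _ _ r(1,2)])
  have "cis (of_int n * (x + 2 * pi)) = ee n x" for n x
   using test_functions_periodic[OF cis_test_function(1)[of n]] by (simp add: periodic_def)
  thus "periodic f" by (simp add: f_def p_def fmean_def periodic_def)
  show "AE x in circ. cmod (f x) <= C"
   using conv by eventually_elim (rule Lim_bounded[OF tendsto_norm], assumption, simp add: pb)
  show "AE x in circ. (%k. fmean (r k) c x) \<longlonglongrightarrow> f x" using conv by (simp add: p_def)
  fix n
  have "(%k. LINT x|circ. p k x * ec n x) \<longlonglongrightarrow> (LINT x|circ. f x * ec n x)"
  proof (rule integral_dominated_convergence[where w = "%_. C"])
   show "(%x. f x * ec n x) \<in> cmeas" by (intro borel_measurable_times cis_measurable measurable_circ fm)
   show "(%x. p k x * ec n x) \<in> cmeas" for k by (intro circ_continuous continuous_intros p)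
   show "AE x in circ. (%k. p k x * ec n x) \<longlonglongrightarrow> f x * ec n x"
    using conv by eventually_elim (intro tendsto_intros)
   show "AE x in circ. cmod (p k x * ec n x) <= C" for k using pb by (simp add: norm_mult)
  qed simp
  hence lim: "(%k. fc (p k) n) \<longlonglongrightarrow> fc f n" unfolding fc_def by (intro tendsto_divide) auto
  have "\<forall>\<^sub>F k in sequentially. n \<in> {- int (r k)..int (r k)}"
  proof -
   have "n \<in> {- int (r k)..int (r k)}" if "nat \<bar>n\<bar> <= k" for k using seq_suble[OF r(2), of k] that by auto
   thus ?thesis by (auto simp: eventually_sequentially)
  qed
  hence "\<forall>\<^sub>F k in sequentially. fc (p k) n = complex_of_real (fejer (r k) n) * c n"
   by eventually_elim (simp add: p_def fmean_def[abs_def] fc_trig_sum)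
  hence "(%k. complex_of_real (fejer (r k) n) * c n) \<longlonglongrightarrow> fc f n"
   by (rule Lim_transform_eventually[OF lim])
  moreover have "(%k. complex_of_real (fejer (r k) n) * c n) \<longlonglongrightarrow> complex_of_real 1 * c n"
   by (intro tendsto_intros LIMSEQ_subseq_LIMSEQ[OF fejer_limit r(2), unfolded o_def])
  ultimately show "fc f n = c n" using LIMSEQ_unique[of _ "fc f n" "complex_of_real 1 * c n"] by simp
 qed
qed

section \<open>Distributions are determined by their Fourier coefficients\<close>

text \<open>The chord is twice the sine of half the angle, and
  \<open>sin y >= y - y^3/6 >= y/3\<close> for \<open>0 <= y <= 2\<close>; the constant 3 is
  crude.\<close>

lemma abs_le_chord:
 assumes "\<bar>s\<bar> <= pi"
 shows "\<bar>s\<bar> <= 3 * cmod (cis s - 1)"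
proof -
 define y where "y = \<bar>s\<bar> / 2"
 have y: "0 <= y" "y <= 2" using assms pi_less_4 by (auto simp: y_def)
 have "\<bar>sin y - (\<Sum>m<3. sin_coeff m * y ^ m)\<bar> <= inverse (fact 3) * \<bar>y\<bar> ^ 3" by (rule Maclaurin_sin_bound)
 hence "\<bar>sin y - y\<bar> <= y ^ 3 / 6" using y(1) by (simp add: sin_coeff_def eval_nat_numeral)
 moreover have "y ^ 3 <= 4 * y" using mult_right_mono[OF power_mono[OF y(2,1), of 2] y(1)] by (simp add: power3_eq_cube power2_eq_square mult_ac)
 ultimately have "y <= 3 * sin y" by linarith
 moreover have "(cmod (cis s - 1))\<^sup>2 = (2 * sin y)\<^sup>2"
 proof -
  have "(cmod (cis s - 1))\<^sup>2 = 2 - 2 * cos s"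
   using sin_cos_squared_add[of s] by (simp add: cmod_power2 power2_diff)
  also have "cos s = cos (2 * y)" by (simp add: y_def)
  finally show ?thesis by (simp add: cos_double_sin power_mult_distrib)
 qed
 hence "2 * sin y <= cmod (cis s - 1)" by (intro power2_le_imp_le[of "2 * sin y"]) auto
 ultimately show ?thesis by (simp add: y_def)
qed

text \<open>By periodicity \<open>t - x\<close> can be moved into \<open>{-pi..pi}\<close>, where
  arc length and chord are comparable, and the next derivative bounds the increment.\<close>

lemma test_chord_lipschitz:
 assumes u: "u \<in> test_functions"
 shows "cmod (nth_deriv k u t - nth_deriv k u x) <= 3 * test_seminorm (Suc k) u * cmod (cis t - cis x)"
proof -
 let ?g = "nth_deriv k u" and ?B = "test_seminorm (Suc k) u"
 have B: "0 <= ?B" using order_trans[OF norm_ge_zero test_seminorm_upper[OF u]] .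
 obtain y where y: "y \<in> {-pi..pi}" "(?g (x + (t - x)), cis (t - x)) = (?g (x + y), cis y)"
  using periodic_reduce[of "%z. (?g (x + z), cis z)" "t - x"] nth_deriv_periodic[OF u, of k "x + _"]
  by (auto simp: add.assoc[symmetric] cis_mult[symmetric])
 have "cmod (?g (x + y) - ?g x) <= ?B * norm (x + y - x)"
  by (rule differentiable_bound[OF convex_UNIV, where f' = "%z h. h *\<^sub>R nth_deriv (Suc k) u z"])
   (use nth_deriv_has_derivative[OF u] test_seminorm_upper[OF u, of "Suc k"] in
    \<open>auto simp: has_vector_derivative_def onorm_scaleR_left[OF bounded_linear_ident] onorm_id\<close>)
 also have "... <= ?B * (3 * cmod (cis y - 1))" using y(1) by (intro mult_left_mono B) (use abs_le_chord[of y] in auto)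
 also have "cmod (cis y - 1) = cmod (cis t - cis x)"
 proof -
  have "cis t - cis x = cis x * (cis (t - x) - 1)" by (simp add: algebra_simps cis_mult)
  thus ?thesis using y(2) by (simp add: norm_mult)
 qed
 finally show ?thesis using y(2) by simp
qed

lemma fc_nth_deriv:
 assumes u: "u \<in> test_functions"
 shows "fc (nth_deriv (Suc k) u) n = \<i> * of_int n * fc (nth_deriv k u) n"
proof -
 let ?e = "%x. ec n x"
 let ?F = "%x. nth_deriv k u x * ?e x"
 let ?A = "%x. nth_deriv (Suc k) u x * ?e x" and ?B = "%x. \<i> * of_int n * (nth_deriv k u x * ?e x)"
 have e: "(?e has_vector_derivative - \<i> * of_int n * ?e x) (at x)" for x
  using nth_deriv_has_derivative[OF cis_test_function(1), of 0 "- n" x] cis_test_function(2)[of 1 "- n"] by simp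
 have "(?F has_vector_derivative ?A x - ?B x) (at x)" for x
  using has_vector_derivative_mult[OF nth_deriv_has_derivative[OF u] e, of k x] by (simp add: algebra_simps)
 hence "((%x. ?A x - ?B x) has_integral ?F pi - ?F (- pi)) {-pi..pi}"
  by (intro fundamental_theorem_of_calculus) (auto intro: has_vector_derivative_at_within)
 moreover have "?F (- pi + 2 * pi) = ?F (- pi)"
  using nth_deriv_periodic[OF u, of k "- pi"] test_functions_periodic[OF cis_test_function(1)[of "- n"]]
  by (simp only: periodic_def of_int_minus)
 ultimately have "((%x. ?A x - ?B x) has_integral 0) {-pi..pi}" by simp
 hence "(LINT x|circ. ?A x - ?B x) = 0"
  by (subst circ_integral_eq) (auto intro!: integral_unique circ_continuous continuous_intros nth_deriv_continuous u)
 moreover have "integrable circ ?A" "integrable circ ?F"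
  by (intro circ_continuous continuous_intros nth_deriv_continuous u)+
 ultimately have "(LINT x|circ. ?A x) = \<i> * of_int n * (LINT x|circ. ?F x)" by simp
 thus ?thesis by (simp add: fc_def)
qed

lemma fmean_test:
 assumes u: "u \<in> test_functions"
 shows "fmean N c \<in> test_functions" "nth_deriv k (fmean N (fc u)) = fmean N (fc (nth_deriv k u))"
proof -
 have t: "(%x. complex_of_real (fejer N n) * c n * ee n x) \<in> test_functions" for n c
  by (intro test_functions_cmult cis_test_function)
 show "fmean N c \<in> test_functions" unfolding fmean_def by (intro test_functions_sum(1) t)
 have d: "fc (nth_deriv k u) n = (\<i> * of_int n) ^ k * fc u n" for n
  by (induction k) (simp_all add: fc_nth_deriv[OF u])
 have "nth_deriv k (fmean N (fc u)) = (%x. \<Sum>n=- int N..int N. nth_deriv k (%x. complex_of_real (fejer N n) * fc u n * ee n x) x)"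
  unfolding fmean_def by (rule test_functions_sum(2)) (rule t)
 thus "nth_deriv k (fmean N (fc u)) = fmean N (fc (nth_deriv k u))"
  unfolding test_functions_cmult(2)[OF cis_test_function(1)] cis_test_function(2) d fmean_def by (simp add: mult_ac)
qed

text \<open>Fejer means commute with differentiation, and derivatives of test functions are
  Lipschitz in the chord distance, so the means of \<open>u\<close> converge in every seminorm. On a
  mean, \<open>a\<close> is a finite sum of its own coefficients.\<close>

lemma distribution_fejer_limit:
 assumes a: "a \<in> periodic_distributions" and u: "u \<in> test_functions"
 shows "(%N. \<Sum>n=- int N..int N. complex_of_real (fejer N n) * fc u n * fourier_coeff a (- n)) \<longlonglongrightarrow> a u"
proof -
 have "(%N. test_seminorm k (%x. fmean N (fc u) x - u x)) \<longlonglongrightarrow> 0" for k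
 proof (rule Lim_null_comparison)
  let ?B = "3 * test_seminorm (Suc k) u"
  show "\<forall>\<^sub>F N in sequentially. norm (test_seminorm k (%x. fmean N (fc u) x - u x)) <= 2 * ?B / sqrt N"
  proof (rule eventually_sequentiallyI[of 1])
   fix N :: nat assume N: "1 <= N"
   have "test_seminorm k (%x. fmean N (fc u) x - u x) <= 2 * ?B / sqrt N"
   proof (rule test_seminorm_least)
    show "cmod (nth_deriv k (%x. fmean N (fc u) x - u x) x) <= 2 * ?B / sqrt N" for x
     unfolding test_functions_diff(2)[OF fmean_test(1)[OF u] u] fmean_test(2)[OF u]
     by (rule fejer_uniform[OF _ test_chord_lipschitz[OF u]]) (use N in simp)
   qed
   moreover have "0 <= test_seminorm k (%x. fmean N (fc u) x - u x)"
    using test_seminorm_upper[OF test_functions_diff(1)[OF fmean_test(1)[OF u] u]] norm_ge_zero order_trans by blast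
   ultimately show "norm (test_seminorm k (%x. fmean N (fc u) x - u x)) <= 2 * ?B / sqrt N" by simp
  qed
  show "(%N. 2 * ?B / sqrt (real N)) \<longlonglongrightarrow> 0"
   by (intro real_tendsto_divide_at_top[where c = "2 * ?B"] tendsto_const filterlim_compose[OF sqrt_at_top filterlim_real_sequentially])
 qed
 hence "(%N. a (fmean N (fc u))) \<longlonglongrightarrow> a u"
  by (intro distribution_sequentially_continuous[OF a u] fmean_test(1)[OF u])
 moreover have "a (%x. ee n x) = fourier_coeff a (- n)" for n by (simp add: fourier_coeff_def cis_conv_exp mult_ac)
 ultimately show ?thesis unfolding fmean_def by (simp add: distribution_sum[OF a cis_test_function(1)])
qed

lemma distribution_eqI:
 assumes "a \<in> periodic_distributions" "b \<in> periodic_distributions" "!!n. fourier_coeff a n = fourier_coeff b n"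
 shows "a = b"
proof
 fix u
 show "a u = b u" using distribution_fejer_limit[OF assms(1), of u] distribution_fejer_limit[OF assms(2), of u]
   distribution_linear(3)[OF assms(1)] distribution_linear(3)[OF assms(2)]
  by (cases "u \<in> test_functions") (auto simp: assms(3) intro: LIMSEQ_unique)
qed

section \<open>Bounded functions as distributions\<close>

lemma dist_of_fun_circ: "u \<in> test_functions ==> dist_of_fun f u = (LINT x|circ. f x * u x) / (2 * pi)"
 unfolding dist_of_fun_def by (subst integral_restrict_space) (auto simp: set_lebesgue_integral_def)

lemma test_function_circ: "u \<in> test_functions ==> u \<in> cmeas"
 using nth_deriv_continuous[of u UNIV 0] by (intro circ_continuous) simp

lemma dist_of_fun_bound:
 assumes f: "f \<in> cmeas" "AE x in circ. cmod (f x) <= B" and u: "u \<in> test_functions"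
 shows "integrable circ (%x. f x * u x)" "cmod (dist_of_fun f u) <= B * test_seminorm 0 u"
proof -
 have b: "cmod (u x) <= test_seminorm 0 u" for x using test_seminorm_upper[OF u, of 0] by simp
 note * = integral_bounded_circ[OF f test_function_circ[OF u] b order_trans[OF norm_ge_zero b[of 0]]]
 show "integrable circ (%x. f x * u x)" by (rule *(1))
 have "cmod (dist_of_fun f u) = cmod (LINT x|circ. f x * u x) / (2 * pi)"
  unfolding dist_of_fun_circ[OF u] by (simp add: norm_divide norm_mult)
 also have "... <= 2 * pi * (B * test_seminorm 0 u) / (2 * pi)" by (intro divide_right_mono *(2)) simp
 finally show "cmod (dist_of_fun f u) <= B * test_seminorm 0 u" by simp
qed

lemma dist_of_fun_distribution:
 assumes f: "f \<in> cmeas" "AE x in circ. cmod (f x) <= B"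
 shows "dist_of_fun f \<in> periodic_distributions"
proof (rule distributionI)
 fix u v assume u: "u \<in> test_functions" and v: "v \<in> test_functions"
 show "dist_of_fun f (%x. u x + v x) = dist_of_fun f u + dist_of_fun f v"
  using dist_of_fun_bound(1)[OF f u] dist_of_fun_bound(1)[OF f v]
  by (simp add: dist_of_fun_circ u v test_functions_add distrib_left add_divide_distrib)
next
 fix c u assume u: "u \<in> test_functions"
 have "f x * (c * u x) = c * (f x * u x)" for x by simp
 hence "(LINT x|circ. f x * (c * u x)) = c * (LINT x|circ. f x * u x)" by (simp only: integral_mult_right_zero)
 thus "dist_of_fun f (%x. c * u x) = c * dist_of_fun f u" by (simp add: dist_of_fun_circ u test_functions_cmult)
next
 show "cmod (dist_of_fun f u) <= B * test_seminorm 0 u" if "u \<in> test_functions" for u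
  using dist_of_fun_bound(2)[OF f that] .
qed (simp add: dist_of_fun_def)

lemma fourier_coeff_dist_of_fun: "fourier_coeff (dist_of_fun f) n = fc f n"
 using dist_of_fun_circ[OF cis_test_function(1)[of "- n"], of f] by (simp add: fourier_coeff_cis fc_def)

lemma dist_of_fun_eqD:
 assumes "dist_of_fun f = dist_of_fun g"
  and f: "f \<in> cmeas" "AE x in circ. cmod (f x) <= B"
  and g: "g \<in> cmeas" "AE x in circ. cmod (g x) <= C"
 shows "AE x in circ. f x = g x"
proof -
 have "AE x in circ. f x - g x = 0"
 proof (rule fc_zero_imp_AE_zero)
  show "AE x in circ. cmod (f x - g x) <= B + C"
   using f(2) g(2) by eventually_elim (rule order_trans[OF norm_triangle_ineq4 add_mono])
  show "fc (%x. f x - g x) n = 0" for n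
   using fc_diff[OF integrable_bounded_circ[OF f] integrable_bounded_circ[OF g], of n]
   by (simp add: fourier_coeff_dist_of_fun[symmetric] assms(1))
 qed (use f g in simp)
 thus ?thesis by simp
qed

lemma dist_of_fun_cong_AE:
 assumes "AE x in circ. f x = g x" "f \<in> cmeas" "g \<in> cmeas"
 shows "dist_of_fun f = dist_of_fun g"
proof
 fix u
 show "dist_of_fun f u = dist_of_fun g u"
 proof (cases "u \<in> test_functions")
  case True
  have "(LINT x|circ. f x * u x) = (LINT x|circ. g x * u x)"
   using assms test_function_circ[OF True] by (intro integral_cong_AE borel_measurable_times) auto
  thus ?thesis by (simp add: dist_of_fun_circ True)
 qed (simp add: dist_of_fun_def)
qed

lemma AE_le_Linf_norm: "ess_bound f < \<infinity> ==> AE x in circ. cmod (f x) <= Linf_norm f"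
proof -
 assume fin: "ess_bound f < \<infinity>"
 have "AE x in circ. ennreal (cmod (f x)) <= ess_bound f" unfolding ess_bound_def by (rule esssup_AE)
 thus ?thesis
 proof eventually_elim
  case (elim x)
  thus ?case unfolding Linf_norm_def using fin enn2real_mono[OF elim] by simp
 qed
qed

lemma Linf_norm_AE:
 assumes "f \<in> cmeas" "AE x in circ. cmod (f x) <= C"
 shows "AE x in circ. cmod (f x) <= Linf_norm f" "Linf_norm f <= C" "ess_bound f < \<infinity>"
proof -
 have C: "0 <= C" by (rule AE_circ_nonneg[OF assms(2)])
 have le: "ess_bound f <= ennreal C"
  unfolding ess_bound_def by (rule esssup_I) (use assms in \<open>auto elim: eventually_mono intro: ennreal_leI\<close>)
 thus fin: "ess_bound f < \<infinity>" by (auto intro: le_less_trans)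
 show "Linf_norm f <= C" unfolding Linf_norm_def using le C by (intro enn2real_leI)
 show "AE x in circ. cmod (f x) <= Linf_norm f" by (rule AE_le_Linf_norm[OF fin])
qed

lemma LinfI:
 assumes "f \<in> borel_measurable borel" "periodic f" "AE x in circ. cmod (f x) <= C"
 shows "f \<in> Linf" "Linf_norm f <= C" using Linf_norm_AE[OF measurable_circ[OF assms(1)] assms(3)] assms
 by (auto simp: Linf_def intro: measurable_completion)

lemma LinfD:
 assumes "f \<in> Linf"
 shows "f \<in> cmeas" "AE x in circ. cmod (f x) <= Linf_norm f"
 using assms by (auto simp: Linf_def intro: measurable_restrict_space1 AE_le_Linf_norm)

text \<open>The exceptional set is covered by countably many translates of a null set and of the
  point \<open>- pi\<close>, which the open interval leaves out.\<close>

lemma AE_circ_imp_AE_periodic: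
 fixes P :: "real => bool"
 assumes P: "AE x in circ. P x" and per: "!!x. P (x + 2 * pi) = P x"
 shows "AE x in lebesgue. P x"
proof -
 define N where "N = {x \<in> {-pi<..<pi}. ~ P x}"
 have "AE x in lebesgue. x \<in> {-pi<..<pi} --> P x" using P by (subst (asm) AE_restrict_space_iff) auto
 then obtain Z where Z: "{x \<in> space lebesgue. ~ (x \<in> {-pi<..<pi} --> P x)} \<subseteq> Z" "emeasure lebesgue Z = 0" "Z \<in> sets lebesgue"
  by (rule AE_E)
 hence N: "negligible N" by - (rule negligible_subset[of Z]; auto simp: N_def negligible_iff_null_sets null_sets_def)
 define T where "T = (\<Union>k. (+) (2 * pi * of_int k) ` (N \<union> {- pi}))"
 have T: "negligible T" unfolding T_def
  by (intro negligible_countable_Union) (auto intro!: negligible_translation N negligible_Un)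
 have "P x" if "x \<notin> T" for x
 proof (rule ccontr)
  assume nP: "~ P x"
  obtain k where k: "x + 2 * pi * of_int k \<in> {-pi..<pi}" using shift_to_period by blast
  have "~ P (x + 2 * pi * of_int k)" using nP periodic_shift[of P x k, OF per] by simp
  hence "x + 2 * pi * of_int k \<in> N \<union> {- pi}" using k by (auto simp: N_def)
  hence "2 * pi * of_int (- k) + (x + 2 * pi * of_int k) \<in> T" unfolding T_def
   by (intro UN_I[of "- k"] UNIV_I imageI)
  with that show False by simp
 qed
 thus ?thesis using T by (intro AE_I'[of T]) (auto simp: negligible_iff_null_sets)
qed

section \<open>The multiplier space\<close>

lemma Linf_iff: "f \<in> Linf \<longleftrightarrow> f \<in> borel_measurable lebesgue & periodic f & (\<exists>C. AE x in circ. cmod (f x) <= C)"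
 (is "_ \<longleftrightarrow> ?R")
proof
 show ?R if "f \<in> Linf" using that LinfD(2)[OF that] unfolding Linf_def by blast
 show "f \<in> Linf" if r: ?R
 proof -
  obtain C where "AE x in circ. cmod (f x) <= C" using r by blast
  hence "ess_bound f < \<infinity>" using r by (intro Linf_norm_AE(3) measurable_restrict_space1) auto
  thus ?thesis using r by (simp add: Linf_def)
 qed
qed

lemma dist_of_fun_add:
 assumes f: "f \<in> cmeas" "AE x in circ. cmod (f x) <= B"
  and g: "g \<in> cmeas" "AE x in circ. cmod (g x) <= C"
 shows "dist_of_fun (%x. f x + g x) = (%u. dist_of_fun f u + dist_of_fun g u)"
proof
 show "dist_of_fun (%x. f x + g x) u = dist_of_fun f u + dist_of_fun g u" for u
  using dist_of_fun_bound(1)[OF f, of u] dist_of_fun_bound(1)[OF g, of u]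
  by (cases "u \<in> test_functions") (auto simp: dist_of_fun_circ distrib_right add_divide_distrib, simp_all add: dist_of_fun_def)
qed

lemma dist_of_fun_cmult: "dist_of_fun (%x. c * f x) = (%u. c * dist_of_fun f u)"
proof
 show "dist_of_fun (%x. c * f x) u = c * dist_of_fun f u" for u
  by (cases "u \<in> test_functions") (auto simp: dist_of_fun_circ mult.assoc, simp_all add: dist_of_fun_def)
qed

lemma Linf_add:
 assumes "f \<in> Linf" "g \<in> Linf"
 shows "(%x. f x + g x) \<in> Linf" "dist_of_fun (%x. f x + g x) = (%u. dist_of_fun f u + dist_of_fun g u)"
proof -
 have "AE x in circ. cmod (f x + g x) <= Linf_norm f + Linf_norm g"
  using LinfD(2)[OF assms(1)] LinfD(2)[OF assms(2)] by eventually_elim (rule order_trans[OF norm_triangle_ineq add_mono])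
 thus "(%x. f x + g x) \<in> Linf" using assms unfolding Linf_iff by (auto simp: periodic_def)
qed (rule dist_of_fun_add[OF LinfD LinfD], fact+)

lemma Linf_mult:
 assumes "f \<in> Linf" "g \<in> Linf"
 shows "(%x. f x * g x) \<in> Linf"
proof -
 have "AE x in circ. cmod (f x * g x) <= Linf_norm f * Linf_norm g" using LinfD(2)[OF assms(1)] LinfD(2)[OF assms(2)]
  by eventually_elim (auto simp: norm_mult intro!: mult_mono order_trans[OF norm_ge_zero])
 thus ?thesis using assms unfolding Linf_iff by (auto simp: periodic_def)
qed

lemma Linf_const: "(%_. c) \<in> Linf" unfolding Linf_iff by (auto simp: periodic_def)

text \<open>The definite description is meaningful because bounded representatives are unique almost
  everywhere, so all choices give the same product.\<close>

lemma pointwise_mult_eq: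
 assumes f: "f \<in> Linf" and g: "g \<in> Linf"
 shows "pointwise_mult (dist_of_fun f) (dist_of_fun g) = dist_of_fun (%x. f x * g x)"
 unfolding pointwise_mult_def
proof (rule the_equality)
 show "\<exists>f'\<in>Linf. \<exists>g'\<in>Linf. dist_of_fun f = dist_of_fun f' & dist_of_fun g = dist_of_fun g' &
   dist_of_fun (%x. f x * g x) = dist_of_fun (%x. f' x * g' x)" using f g by blast
next
 fix c assume "\<exists>f'\<in>Linf. \<exists>g'\<in>Linf. dist_of_fun f = dist_of_fun f' & dist_of_fun g = dist_of_fun g' &
   c = dist_of_fun (%x. f' x * g' x)"
 then obtain f' g' where h: "f' \<in> Linf" "g' \<in> Linf" "dist_of_fun f = dist_of_fun f'" "dist_of_fun g = dist_of_fun g'"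
  and c: "c = dist_of_fun (%x. f' x * g' x)" by blast
 have "AE x in circ. f x = f' x" "AE x in circ. g x = g' x"
  by (rule dist_of_fun_eqD[OF h(3) LinfD[OF f] LinfD[OF h(1)]], rule dist_of_fun_eqD[OF h(4) LinfD[OF g] LinfD[OF h(2)]])
 hence "AE x in circ. f' x * g' x = f x * g x" by eventually_elim simp
 thus "c = dist_of_fun (%x. f x * g x)" unfolding c by (rule dist_of_fun_cong_AE) (intro LinfD Linf_mult f g h)+
qed

lemma fc_bound:
 assumes "f \<in> cmeas" "AE x in circ. cmod (f x) <= B"
 shows "cmod (fc f n) <= B"
proof -
 have "cmod (LINT x|circ. f x * ec n x) <= 2 * pi * (B * 1)"
  by (rule integral_bounded_circ(2)[OF assms cis_measurable]) auto
 thus ?thesis by (simp add: fc_def norm_divide norm_mult field_simps)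
qed

context wspace
begin

abbreviation "M \<equiv> multiplier_space Y"

lemma nrm_pos: "\<phi> \<in> finite_seqs ==> \<phi> ~= (%_. 0) ==> 0 < nrm Y \<phi>"
 using Nw_finite[of \<phi>] Nw_zero_iff[of \<phi>] unfolding nrm_Y
 by (simp add: enn2real_positive_iff zero_less_iff_neq_zero)

text \<open>The bridge from the predicate to the definition of the multiplier space. The zero
  sequence, left out of the quotients, satisfies the inequality trivially, and finiteness of the
  right-hand side yields membership.\<close>

lemma mb_iff_quotients:
 "mb C (fourier_coeff a) \<longleftrightarrow> 0 <= C & (\<forall>\<phi>\<in>finite_seqs. conv a \<phi> \<in> vecs Y) & (\<forall>q\<in>multiplier_quotients Y a. q <= C)"
proof -
 have "(Nw (conv a \<phi>) <= ennreal C * Nw \<phi>) \<longleftrightarrow> conv a \<phi> \<in> vecs Y & (\<phi> ~= (%_. 0) --> nrm Y (conv a \<phi>) / nrm Y \<phi> <= C)"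
  if C: "0 <= C" and \<phi>: "\<phi> \<in> finite_seqs" for \<phi>
 proof (cases "\<phi> = (%_. 0)")
  case True
  hence "conv a \<phi> = (%_. 0)" by (intro ext) (simp add: conv_def)
  thus ?thesis using True Nw_zero_iff[of "%_. 0"] by (simp add: vecs_Y)
 next
  case False
  have r: "ennreal C * Nw \<phi> = ennreal (C * nrm Y \<phi>)"
   using Nw_eq_nrm[OF Nw_finite[OF \<phi>]] C by (simp add: ennreal_mult nrm_Y)
  show ?thesis
  proof (cases "conv a \<phi> \<in> vecs Y")
   case True
   hence "Nw (conv a \<phi>) = ennreal (nrm Y (conv a \<phi>))" by (simp add: Nw_eq_nrm vecs_Y)
   thus ?thesis using True False nrm_pos[OF \<phi> False] C by (simp add: r ennreal_le_iff pos_divide_le_eq)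
  next
   case False
   hence "Nw (conv a \<phi>) = top" by (simp add: vecs_Y less_top[symmetric])
   thus ?thesis using False by (simp add: r top_unique)
  qed
 qed
 thus ?thesis unfolding mb_def conv_eq_cv[symmetric] multiplier_quotients_def by blast
qed

lemma multiplier_quotients_nonempty: "\<exists>q\<in>multiplier_quotients Y a. 0 <= q"
proof -
 let ?d = "%k. if k = 0 then 1 else 0"
 have "?d \<in> finite_seqs" "?d ~= (%_ :: int. 0 :: complex)" by (auto simp: finite_seqs_def fun_eq_iff)
 hence "nrm Y (conv a ?d) / nrm Y ?d \<in> multiplier_quotients Y a" unfolding multiplier_quotients_def by blast
 thus ?thesis by (rule bexI[rotated]) (simp add: nrm_Y)
qed

lemma multI:
 assumes "a \<in> periodic_distributions" "mb C (fourier_coeff a)"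
 shows "a \<in> vecs M" "nrm M a <= C"
proof -
 have *: "\<forall>\<phi>\<in>finite_seqs. conv a \<phi> \<in> vecs Y" "\<forall>q\<in>multiplier_quotients Y a. q <= C"
  using assms(2) mb_iff_quotients by blast+
 thus "a \<in> vecs M" using assms(1) by (auto simp: multiplier_space_def intro: bdd_aboveI)
 show "nrm M a <= C"
  using *(2) multiplier_quotients_nonempty[of a] by (auto simp: multiplier_space_def intro!: cSup_least)
qed

lemma multD:
 assumes "a \<in> vecs M"
 shows "a \<in> periodic_distributions" "mb (nrm M a) (fourier_coeff a)"
proof -
 show "a \<in> periodic_distributions" using assms by (simp add: multiplier_space_def)
 have b: "\<forall>\<phi>\<in>finite_seqs. conv a \<phi> \<in> vecs Y" "\<forall>q\<in>multiplier_quotients Y a. q <= nrm M a"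
  using assms by (auto simp: multiplier_space_def intro: cSup_upper)
 hence "0 <= nrm M a" using multiplier_quotients_nonempty[of a] order_trans by blast
 thus "mb (nrm M a) (fourier_coeff a)" using b by (simp add: mb_iff_quotients)
qed

end

section \<open>Symbols of multipliers and the Banach algebra structure\<close>

context growth_space
begin

lemma fmean_bound:
 assumes c: "mb C c" and N: "N ~= 0"
 shows "cmod (fmean N c t) <= C"
proof -
 let ?d = "%n. complex_of_real (fejer N n) * c n"
 have s: "supp ?d \<subseteq> {- int N..int N}" using fejer_supp[OF N] by auto
 have "cmod (\<Sum>n\<in>supp ?d. ?d n * cis (t * of_int n)) <= C"
  by (rule mb_symbol_bound[OF mb_fejer[OF c N] finite_subset[OF s]]) simp
 also have "(\<Sum>n\<in>supp ?d. ?d n * cis (t * of_int n)) = fmean N c t"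
  unfolding fmean_def by (rule sum.mono_neutral_cong_left[OF _ s]) (auto simp: mult.commute)
 finally show ?thesis .
qed

lemma mb_symbol:
 assumes c: "mb C c"
 obtains f and r :: "nat => nat" where "f \<in> Linf" "Linf_norm f <= C" "\<forall>k. r k ~= 0"
  "AE x in circ. (%k. fmean (r k) c x) \<longlonglongrightarrow> f x" "fc f = c"
proof (rule bounded_fejer_means_representation[OF fmean_bound[OF c]])
 fix f and r :: "nat => nat"
 assume f: "f \<in> borel_measurable borel" "periodic f" "AE x in circ. cmod (f x) <= C"
  and r: "!!k. r k ~= 0" "AE x in circ. (%k. fmean (r k) c x) \<longlonglongrightarrow> f x" "!!n. fc f n = c n"
 show ?thesis by (rule that[OF LinfI[OF f] _ r(2)]) (use r in auto)
qed

lemma mb_coeff_bound: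
 assumes c: "mb C c"
 shows "cmod (c n) <= C"
proof -
 obtain f and r :: "nat => nat" where f: "f \<in> Linf" "Linf_norm f <= C" "\<forall>k. r k ~= 0"
  "AE x in circ. (%k. fmean (r k) c x) \<longlonglongrightarrow> f x" "fc f = c" by (rule mb_symbol[OF c])
 thus ?thesis using fc_bound[OF LinfD[OF f(1)], of n] by simp
qed

lemma Linf_multiplier:
 assumes "f \<in> Linf" "mb C (fc f)"
 shows "dist_of_fun f \<in> vecs M" "nrm M (dist_of_fun f) <= C"
 using multI[OF dist_of_fun_distribution[OF LinfD[OF assms(1)]]] assms(2)
 by (auto simp: fourier_coeff_dist_of_fun[abs_def])

lemma mult_symbol:
 assumes a: "a \<in> vecs M"
 obtains f where "f \<in> Linf" "Linf_norm f <= nrm M a" "a = dist_of_fun f" "mb (nrm M a) (fc f)"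
proof -
 note a' = multD[OF a]
 obtain f and r :: "nat => nat" where f: "f \<in> Linf" "Linf_norm f <= nrm M a" "\<forall>k. r k ~= 0"
  "AE x in circ. (%k. fmean (r k) (fourier_coeff a) x) \<longlonglongrightarrow> f x" "fc f = fourier_coeff a"
  by (rule mb_symbol[OF a'(2)])
 show ?thesis
 proof (rule that[OF f(1,2)])
  show "a = dist_of_fun f" by (rule distribution_eqI[OF a'(1) dist_of_fun_distribution[OF LinfD[OF f(1)]]])
    (simp add: fourier_coeff_dist_of_fun f)
  show "mb (nrm M a) (fc f)" using a'(2) f(5) by simp
 qed
qed

text \<open>Multiplying \<open>f\<close> by a Fejer mean of \<open>g\<close> convolves
  \<open>fc f\<close> with finitely many coefficients, where bounds multiply. The means are
  uniformly bounded and converge to \<open>g\<close> almost everywhere along a subsequence, so the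
  coefficients of these products converge to those of \<open>f * g\<close>.\<close>

lemma mb_symbol_product:
 assumes f: "f \<in> Linf" "mb C (fc f)" and g: "g \<in> Linf" "mb D (fc g)"
 shows "mb (C * D) (fc (%x. f x * g x))"
proof -
 obtain h and r :: "nat => nat" where h: "h \<in> Linf" "Linf_norm h <= D" "\<forall>k. r k ~= 0"
  "AE x in circ. (%k. fmean (r k) (fc g) x) \<longlonglongrightarrow> h x" "fc h = fc g" by (rule mb_symbol[OF g(2)])
 \<comment> \<open>The limit \<open>h\<close> of the means is tied to \<open>g\<close> by its
   coefficients only; uniqueness identifies the two.\<close>
 have "AE x in circ. h x = g x"
  by (rule dist_of_fun_eqD[OF distribution_eqI[OF dist_of_fun_distribution dist_of_fun_distribution]])
   (rule LinfD h g | simp add: fourier_coeff_dist_of_fun h)+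
 with h(4) have lim: "AE x in circ. (%k. fmean (r k) (fc g) x) \<longlonglongrightarrow> g x" by eventually_elim simp
 let ?d = "%k n. complex_of_real (fejer (r k) n) * fc g n"
 have supp: "{n. ?d k n ~= 0} \<subseteq> {- int (r k)..int (r k)}" for k using fejer_supp[OF h(3)[THEN spec]] by auto
 have i: "integrable circ f" by (rule integrable_bounded_circ[OF LinfD[OF f(1)]])
 have e: "fc (%x. f x * fmean (r k) (fc g) x) n = cv (fc f) (?d k) n" for k n
 proof -
  have p: "f x * fmean N c x * ec n x
   = f x * (\<Sum>m=- int N..int N. (complex_of_real (fejer N m) * c m) * ec (n - m) x)" for N c x
  proof -
   have "ee m x * ec n x = ec (n - m) x" for m by (simp add: cis_mult algebra_simps)
   thus ?thesis unfolding fmean_def sum_distrib_right mult.assoc by simp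
  qed
  have "2 * pi * fc (%x. f x * fmean (r k) (fc g) x) n
   = (LINT x|circ. f x * (\<Sum>m=- int (r k)..int (r k). ?d k m * ec (n - m) x))"
   unfolding p[symmetric] by (subst fc_def) simp
  also have "... = 2 * pi * (\<Sum>m=- int (r k)..int (r k). ?d k m * fc f (n - m))" by (rule trig_sum_integral[OF i])
  also have "(\<Sum>m=- int (r k)..int (r k). ?d k m * fc f (n - m)) = cv (fc f) (?d k) n"
   unfolding cv_superset[OF finite_atLeastAtMost_int supp] by (simp add: mult_ac)
  finally show ?thesis by simp
 qed
 show ?thesis
 proof (rule mb_limit)
  show "\<forall>\<^sub>F k in sequentially. mb (C * D) (cv (fc f) (?d k))"
   by (intro always_eventually allI mb_mult f mb_fejer g h(3)[THEN spec] finite_subset[OF supp]) simp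
  fix n
  have "(%k. LINT x|circ. (f x * fmean (r k) (fc g) x) * ec n x) \<longlonglongrightarrow> (LINT x|circ. (f x * g x) * ec n x)"
  proof (rule integral_dominated_convergence[where w = "%x. cmod (f x) * D"])
   show "integrable circ (%x. cmod (f x) * D)" using i by simp
   show "(%x. (f x * g x) * ec n x) \<in> cmeas" by (intro borel_measurable_times cis_measurable LinfD f g)
   show "(%x. (f x * fmean (r k) (fc g) x) * ec n x) \<in> cmeas" for k
    by (intro borel_measurable_times cis_measurable LinfD(1)[OF f(1)] circ_continuous(1) continuous_fmean)
   show "AE x in circ. (%k. (f x * fmean (r k) (fc g) x) * ec n x) \<longlonglongrightarrow> (f x * g x) * ec n x"
    using lim by eventually_elim (intro tendsto_intros)
   show "AE x in circ. cmod ((f x * fmean (r k) (fc g) x) * ec n x) <= cmod (f x) * D" for k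
    by (intro AE_I2) (simp add: norm_mult mult_left_mono fmean_bound[OF g(2) h(3)[THEN spec]])
  qed
  hence "(%k. fc (%x. f x * fmean (r k) (fc g) x) n) \<longlonglongrightarrow> fc (%x. f x * g x) n"
   unfolding fc_def by (rule tendsto_divide) auto
  thus "(%k. cv (fc f) (?d k) n) \<longlonglongrightarrow> fc (%x. f x * g x) n" by (simp only: e)
 qed
qed

lemma multiplier_add:
 assumes a: "a \<in> vecs M" and b: "b \<in> vecs M"
 shows "(%u. a u + b u) \<in> vecs M" "nrm M (%u. a u + b u) <= nrm M a + nrm M b"
proof -
 obtain f where f: "f \<in> Linf" "Linf_norm f <= nrm M a" "a = dist_of_fun f" "mb (nrm M a) (fc f)" by (rule mult_symbol[OF a])
 obtain g where g: "g \<in> Linf" "Linf_norm g <= nrm M b" "b = dist_of_fun g" "mb (nrm M b) (fc g)" by (rule mult_symbol[OF b])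
 have "fc (%x. f x + g x) = (%n. fc f n + fc g n)" by (intro ext fc_add integrable_bounded_circ[OF LinfD] f g)
 hence m: "mb (nrm M a + nrm M b) (fc (%x. f x + g x))" using mb_add[OF f(4) g(4)] by simp
 have e: "(%u. a u + b u) = dist_of_fun (%x. f x + g x)" using Linf_add(2)[OF f(1) g(1)] f(3) g(3) by simp
 show "(%u. a u + b u) \<in> vecs M" "nrm M (%u. a u + b u) <= nrm M a + nrm M b"
  unfolding e by (rule Linf_multiplier[OF Linf_add(1)[OF f(1) g(1)] m])+
qed

lemma multiplier_cmult:
 assumes a: "a \<in> vecs M"
 shows "(%u. c * a u) \<in> vecs M" "nrm M (%u. c * a u) <= cmod c * nrm M a"
proof -
 obtain f where f: "f \<in> Linf" "Linf_norm f <= nrm M a" "a = dist_of_fun f" "mb (nrm M a) (fc f)" by (rule mult_symbol[OF a])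
 have "fc (%x. c * f x) = (%n. c * fc f n)" by (intro ext fc_cmult)
 hence m: "mb (cmod c * nrm M a) (fc (%x. c * f x))" using mb_scale[OF f(4)] by simp
 have e: "(%u. c * a u) = dist_of_fun (%x. c * f x)" using dist_of_fun_cmult[of c f] f(3) by simp
 show "(%u. c * a u) \<in> vecs M" "nrm M (%u. c * a u) <= cmod c * nrm M a"
  unfolding e by (rule Linf_multiplier[OF Linf_mult[OF Linf_const f(1)] m])+
qed

lemma multiplier_diff:
 assumes "a \<in> vecs M" "b \<in> vecs M"
 shows "(%u. a u - b u) \<in> vecs M"
 using multiplier_add(1)[OF assms(1) multiplier_cmult(1)[OF assms(2), of "-1"]] by simp

lemma multiplier_nonneg: "a \<in> vecs M ==> 0 <= nrm M a" using multD(2) mb_nonneg by blast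

lemma multiplier_eqI:
 assumes "a \<in> vecs M" "b \<in> vecs M" "fourier_coeff a = fourier_coeff b"
 shows "a = b" using distribution_eqI[OF multD(1)[OF assms(1)] multD(1)[OF assms(2)]] assms(3) by simp

lemma mb_multiplier:
 assumes c: "mb C c"
 obtains a where "a \<in> vecs M" "nrm M a <= C" "fourier_coeff a = c"
proof -
 obtain f and r :: "nat => nat" where f: "f \<in> Linf" "Linf_norm f <= C" "\<forall>k. r k ~= 0"
  "AE x in circ. (%k. fmean (r k) c x) \<longlonglongrightarrow> f x" "fc f = c" by (rule mb_symbol[OF c])
 have "mb C (fc f)" using c f(5) by simp
 from Linf_multiplier[OF f(1) this] show ?thesis by (rule that) (simp add: fourier_coeff_dist_of_fun[abs_def] f(5))
qed

lemma zero_multiplier: "(%_. 0) \<in> vecs M" "nrm M (%_. 0) = 0"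
proof -
 have "fc (%_. 0) = (%_. 0)" by (simp add: fc_def fun_eq_iff)
 moreover have "mb 0 (%_. 0)" by (simp add: mb_def cv_def[abs_def] Nw_zero_iff)
 ultimately have "mb 0 (fc (%_. 0))" by simp
 note * = Linf_multiplier[OF Linf_const this]
 have e: "dist_of_fun (%_. 0) = (%_. 0)" using dist_of_fun_cmult[of 0 "%_. 0"] by simp
 show z: "(%_. 0) \<in> vecs M" using *(1) by (simp add: e)
 show "nrm M (%_. 0) = 0" using *(2) multiplier_nonneg[OF z] by (simp add: e)
qed

lemma multiplier_nrm_eq_0:
 assumes a: "a \<in> vecs M" and z: "nrm M a = 0"
 shows "a = (%_. 0)"
proof (rule multiplier_eqI[OF a zero_multiplier(1)])
 have "fourier_coeff a n = 0" for n using mb_coeff_bound[OF multD(2)[OF a], of n] z by simp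
 thus "fourier_coeff a = fourier_coeff (%_. 0)" by (simp add: fun_eq_iff fourier_coeff_def)
qed

lemma multiplier_nrm_cmult:
 assumes a: "a \<in> vecs M"
 shows "nrm M (%u. c * a u) = cmod c * nrm M a"
proof (cases "c = 0")
 case False
 have "nrm M (%u. inverse c * (c * a u)) <= cmod (inverse c) * nrm M (%u. c * a u)"
  by (rule multiplier_cmult(2)[OF multiplier_cmult(1)[OF a]])
 hence "cmod c * nrm M a <= nrm M (%u. c * a u)"
  using False by (simp add: mult.assoc[symmetric] norm_inverse norm_divide field_simps)
 thus ?thesis using multiplier_cmult(2)[OF a, of c] by simp
qed (simp add: zero_multiplier)

text \<open>Coefficients are bounded by the norm, so they converge; the limit sequence again
  satisfies \<open>mb\<close> and therefore belongs to a distribution. Letting \<open>m\<close> tend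
  to infinity in the bound for \<open>F n - F m\<close> gives convergence in norm.\<close>

lemma multiplier_complete:
 assumes F: "!!n. F n \<in> vecs M" and cauchy: "!!e. 0 < e ==> \<exists>N. \<forall>m\<ge>N. \<forall>n\<ge>N. nrm M (%u. F m u - F n u) < e"
 shows "\<exists>a\<in>vecs M. (%n. nrm M (%u. F n u - a u)) \<longlonglongrightarrow> 0"
proof -
 have d: "(%u. F m u - F n u) \<in> vecs M" for m n by (intro multiplier_diff F)
 have mbd: "mb (nrm M (%u. F m u - F n u)) (%j. fourier_coeff (F m) j - fourier_coeff (F n) j)" for m n
  using multD(2)[OF d[of m n]] by (simp add: fourier_coeff_def[abs_def])
 have "Cauchy (%m. fourier_coeff (F m) j)" for j
 proof (rule CauchyI)
  fix e :: real assume "0 < e"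
  then obtain N where "\<forall>m\<ge>N. \<forall>n\<ge>N. nrm M (%u. F m u - F n u) < e" using cauchy by blast
  thus "\<exists>N. \<forall>m\<ge>N. \<forall>n\<ge>N. cmod (fourier_coeff (F m) j - fourier_coeff (F n) j) < e"
   by (intro exI[of _ N] allI impI le_less_trans[OF mb_coeff_bound[OF mbd]]) simp
 qed
 then obtain c where c: "!!j. (%m. fourier_coeff (F m) j) \<longlonglongrightarrow> c j"
  unfolding Cauchy_convergent_iff convergent_def by metis
 have close: "\<exists>N. \<forall>n\<ge>N. mb e (%j. fourier_coeff (F n) j - c j)" if e: "0 < e" for e
 proof -
  obtain N where N: "\<forall>m\<ge>N. \<forall>n\<ge>N. nrm M (%u. F m u - F n u) < e" using cauchy[OF e] by blast
  have "mb e (%j. fourier_coeff (F n) j - c j)" if n: "N <= n" for n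
  proof (rule mb_limit)
   show "(%m. fourier_coeff (F n) j - fourier_coeff (F m) j) \<longlonglongrightarrow> fourier_coeff (F n) j - c j" for j
    by (intro tendsto_intros c)
   show "\<forall>\<^sub>F m in sequentially. mb e (%j. fourier_coeff (F n) j - fourier_coeff (F m) j)"
    using N n by (intro eventually_sequentiallyI[of N] mb_mono[OF mbd]) (simp add: less_imp_le)
  qed
  thus ?thesis by blast
 qed
 obtain N where "mb 1 (%j. fourier_coeff (F N) j - c j)" using close[of 1] by auto
 from mb_add[OF multD(2)[OF F[of N]] mb_scale[OF this, of "-1"]] obtain C where "mb C c" by auto
 then obtain a where a: "a \<in> vecs M" "nrm M a <= C" "fourier_coeff a = c" by (rule mb_multiplier)
 have "\<exists>N. \<forall>n\<ge>N. norm (nrm M (%u. F n u - a u) - 0) < e" if e: "0 < e" for e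
 proof -
  have "0 < e / 2" using e by simp
  then obtain N where N: "\<forall>n\<ge>N. mb (e / 2) (%j. fourier_coeff (F n) j - c j)" using close by blast
  have "norm (nrm M (%u. F n u - a u) - 0) < e" if "N <= n" for n
  proof -
   have v: "(%u. F n u - a u) \<in> vecs M" by (intro multiplier_diff F a)
   have "fourier_coeff (%u. F n u - a u) = (%j. fourier_coeff (F n) j - c j)"
    by (simp add: a(3)[symmetric] fourier_coeff_def[abs_def])
   hence "nrm M (%u. F n u - a u) <= e / 2" using N that by (intro multI(2)[OF multD(1)[OF v]]) auto
   thus ?thesis using e multiplier_nonneg[OF v] by simp
  qed
  thus ?thesis by blast
 qed
 hence "(%n. nrm M (%u. F n u - a u)) \<longlonglongrightarrow> 0" by (rule LIMSEQ_I)
 thus ?thesis using a(1) by blast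
qed

lemma multiplier_banach_space: "banach_space M"
 unfolding banach_space_def
proof (intro conjI ballI allI impI)
 fix a assume "a \<in> vecs M"
 thus "nrm M a = 0 \<longleftrightarrow> a = (%_. 0)" using multiplier_nrm_eq_0 zero_multiplier(2) by blast
next
 fix F :: "nat => (real => complex) => complex"
 assume "(\<forall>n. F n \<in> vecs M) & (\<forall>e>0. \<exists>N. \<forall>m\<ge>N. \<forall>n\<ge>N. nrm M (%i. F m i - F n i) < e)"
 thus "\<exists>f\<in>vecs M. (%n. nrm M (%i. F n i - f i)) \<longlonglongrightarrow> 0" by (intro multiplier_complete) auto
qed (intro zero_multiplier multiplier_add multiplier_cmult multiplier_nrm_cmult multiplier_nonneg; assumption)+

lemma multiplier_unit: "dist_of_fun (%_. 1) \<in> vecs M" "nrm M (dist_of_fun (%_. 1)) = 1"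
proof -
 have e: "fc (%_. 1) = (%n. if n = 0 then 1 else 0)" using fc_cis[of 0] by (simp add: fun_eq_iff)
 hence "mb 1 (fc (%_. 1))" using mb_delta by simp
 note * = Linf_multiplier[OF Linf_const this]
 show "dist_of_fun (%_. 1) \<in> vecs M" by (rule *(1))
 have "fourier_coeff (dist_of_fun (%_. 1)) 0 = 1" unfolding fourier_coeff_dist_of_fun e by simp
 hence "1 <= nrm M (dist_of_fun (%_. 1))" using mb_coeff_bound[OF multD(2)[OF *(1)], of 0] by simp
 thus "nrm M (dist_of_fun (%_. 1)) = 1" using *(2) by simp
qed

theorem multiplier_banach_algebra: "banach_algebra M pointwise_mult"
 unfolding banach_algebra_def
proof (intro conjI ballI allI)
 show "banach_space M" by (rule multiplier_banach_space)
next
 fix a b assume a: "a \<in> vecs M" and b: "b \<in> vecs M"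
 obtain f where f: "f \<in> Linf" "Linf_norm f <= nrm M a" "a = dist_of_fun f" "mb (nrm M a) (fc f)" by (rule mult_symbol[OF a])
 obtain g where g: "g \<in> Linf" "Linf_norm g <= nrm M b" "b = dist_of_fun g" "mb (nrm M b) (fc g)" by (rule mult_symbol[OF b])
 have e: "pointwise_mult a b = dist_of_fun (%x. f x * g x)" unfolding f(3) g(3) by (rule pointwise_mult_eq[OF f(1) g(1)])
 note m = mb_symbol_product[OF f(1,4) g(1,4)]
 show "pointwise_mult a b \<in> vecs M" "nrm M (pointwise_mult a b) <= nrm M a * nrm M b"
  unfolding e by (rule Linf_multiplier[OF Linf_mult[OF f(1) g(1)] m])+
 fix c
 have "(%i. c * a i) = dist_of_fun (%x. c * f x)" "(%i. c * b i) = dist_of_fun (%x. c * g x)"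
  unfolding dist_of_fun_cmult f(3) g(3) by simp_all
 thus "pointwise_mult (%i. c * a i) b = (%i. c * pointwise_mult a b i)"
  "pointwise_mult a (%i. c * b i) = (%i. c * pointwise_mult a b i)" unfolding e dist_of_fun_cmult[symmetric]
  using pointwise_mult_eq[OF Linf_mult[OF Linf_const f(1)] g(1)] pointwise_mult_eq[OF f(1) Linf_mult[OF Linf_const g(1)]]
  by (simp_all add: f(3) g(3) mult_ac)
next
 fix a b d assume a: "a \<in> vecs M" and b: "b \<in> vecs M" and d: "d \<in> vecs M"
 obtain f where f: "f \<in> Linf" "Linf_norm f <= nrm M a" "a = dist_of_fun f" "mb (nrm M a) (fc f)" by (rule mult_symbol[OF a])
 obtain g where g: "g \<in> Linf" "Linf_norm g <= nrm M b" "b = dist_of_fun g" "mb (nrm M b) (fc g)" by (rule mult_symbol[OF b])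
 obtain h where h: "h \<in> Linf" "Linf_norm h <= nrm M d" "d = dist_of_fun h" "mb (nrm M d) (fc h)" by (rule mult_symbol[OF d])
 show "pointwise_mult (pointwise_mult a b) d = pointwise_mult a (pointwise_mult b d)"
  unfolding f(3) g(3) h(3) by (simp add: pointwise_mult_eq f(1) g(1) h(1) Linf_mult mult.assoc)
 show "pointwise_mult (%i. a i + b i) d = (%i. pointwise_mult a d i + pointwise_mult b d i)" unfolding f(3) g(3) h(3)
  by (simp add: pointwise_mult_eq f(1) g(1) h(1) Linf_mult Linf_add(1) Linf_add(2)[symmetric] distrib_right)
 show "pointwise_mult a (%i. b i + d i) = (%i. pointwise_mult a b i + pointwise_mult a d i)" unfolding f(3) g(3) h(3)
  by (simp add: pointwise_mult_eq f(1) g(1) h(1) Linf_mult Linf_add(1) Linf_add(2)[symmetric] distrib_left)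
next
 show "\<exists>u\<in>vecs M. nrm M u = 1 & (\<forall>f\<in>vecs M. pointwise_mult u f = f & pointwise_mult f u = f)"
 proof (intro bexI[of _ "dist_of_fun (%_. 1)"] conjI ballI multiplier_unit)
  fix a assume a: "a \<in> vecs M"
  obtain f where f: "f \<in> Linf" "Linf_norm f <= nrm M a" "a = dist_of_fun f" "mb (nrm M a) (fc f)" by (rule mult_symbol[OF a])
  show "pointwise_mult (dist_of_fun (%_. 1)) a = a" "pointwise_mult a (dist_of_fun (%_. 1)) = a"
   unfolding f(3) by (simp_all add: pointwise_mult_eq Linf_const f(1))
 qed
qed

end

section \<open>A Hahn-Banach theorem\<close>

text \<open>Minimal sublinear functionals are linear, and a functional \<open>p\<close> stays sublinear when it is
 lowered in the direction \<open>y\<close> to the infimum of \<open>p (x + t y) - t p y\<close> over \<open>t \<ge> 0\<close>.\<close>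

locale complex_subspace =
 fixes X :: "('i => complex) set"
 assumes zero: "(%_. 0) \<in> X"
  and add: "x \<in> X ==> y \<in> X ==> (%i. x i + y i) \<in> X"
  and scale: "x \<in> X ==> (%i. c * x i) \<in> X"
begin

definition sublinear :: "(('i => complex) => real) => bool" where
 "sublinear p \<longleftrightarrow> (\<forall>x\<in>X. \<forall>y\<in>X. p (%i. x i + y i) <= p x + p y) &
  (\<forall>x\<in>X. \<forall>t\<ge>0. p (%i. complex_of_real t * x i) <= t * p x)"

abbreviation shift :: "('i => complex) => real => ('i => complex) => 'i => complex" where
 "shift x t y \<equiv> %i. x i + complex_of_real t * y i"

lemma neg: "x \<in> X ==> (%i. - x i) \<in> X" using scale[of x "-1"] by simp

lemma shift: "x \<in> X ==> y \<in> X ==> shift x t y \<in> X" by (intro add scale)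

lemma sublinearD:
 assumes "sublinear p"
 shows "x \<in> X ==> y \<in> X ==> p (%i. x i + y i) <= p x + p y"
  "x \<in> X ==> 0 <= t ==> p (%i. complex_of_real t * x i) <= t * p x" using assms by (auto simp: sublinear_def)

lemma sublinear_zero: "sublinear p ==> p (%_. 0) = 0"
 using sublinearD(2)[OF _ zero, of p 0] sublinearD(1)[OF _ zero zero, of p] by simp

lemma sublinear_neg: "sublinear p ==> x \<in> X ==> - p (%i. - x i) <= p x"
 using sublinearD(1)[OF _ _ neg, of p x x] sublinear_zero[of p] by simp

lemma sublinear_scale:
 assumes p: "sublinear p" and x: "x \<in> X" and t: "0 < t"
 shows "p (%i. complex_of_real t * x i) = t * p x"
proof -
 have "p (%i. complex_of_real (1 / t) * (complex_of_real t * x i)) <= 1 / t * p (%i. complex_of_real t * x i)"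
  using t by (intro sublinearD(2)[OF p] scale x) simp
 moreover have "(%i. complex_of_real (1 / t) * (complex_of_real t * x i)) = x" using t by auto
 ultimately have "t * p x <= p (%i. complex_of_real t * x i)" using t by (simp add: field_simps)
 thus ?thesis using sublinearD(2)[OF p x, of t] t by simp
qed

definition lower :: "(('i => complex) => real) => ('i => complex) => ('i => complex) => real" where
 "lower p y x = (if x \<in> X then INF t\<in>{0..}. p (shift x t y) - t * p y else 0)"

context
 fixes p y assumes p: "sublinear p" and y: "y \<in> X"
begin

lemma lower_bdd:
 assumes x: "x \<in> X"
 shows "bdd_below ((%t. p (shift x t y) - t * p y) ` {0..})"
proof (rule bdd_belowI2)
 fix t :: real assume t: "t \<in> {0..}"
 have "p (%i. shift x t y i + - x i) <= p (shift x t y) + p (%i. - x i)" by (intro sublinearD(1)[OF p] shift neg x y)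
 moreover have "(%i. shift x t y i + - x i) = (%i. complex_of_real t * y i)" by auto
 moreover have "p (%i. complex_of_real t * y i) = t * p y"
  using sublinear_scale[OF p y, of t] sublinear_zero[OF p] t by (cases "t = 0") auto
 ultimately show "- p (%i. - x i) <= p (shift x t y) - t * p y" by simp
qed

lemma lower_le: "x \<in> X ==> 0 <= t ==> lower p y x <= p (shift x t y) - t * p y"
 unfolding lower_def using cINF_lower[OF lower_bdd, of x t] by simp

lemma lower_greatest: "x \<in> X ==> (!!t. 0 <= t ==> B <= p (shift x t y) - t * p y) ==> B <= lower p y x"
 unfolding lower_def by (simp, rule cINF_greatest) auto

lemma lower_sublinear: "sublinear (lower p y)"
 unfolding sublinear_def
proof (intro conjI ballI allI impI)
 fix x z assume x: "x \<in> X" and z: "z \<in> X"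
 have le: "lower p y (%i. x i + z i) <= (p (shift x t y) - t * p y) + (p (shift z s y) - s * p y)" if "0 <= t" "0 <= s" for t s
 proof -
  have "lower p y (%i. x i + z i) <= p (shift (%i. x i + z i) (t + s) y) - (t + s) * p y"
   using that by (intro lower_le add x z) simp
  also have "shift (%i. x i + z i) (t + s) y = (%i. shift x t y i + shift z s y i)" by (auto simp: algebra_simps)
  also have "p ... <= p (shift x t y) + p (shift z s y)" by (intro sublinearD(1)[OF p] shift x y z)
  finally show ?thesis by (simp add: algebra_simps)
 qed
 have "lower p y (%i. x i + z i) - (p (shift x t y) - t * p y) <= lower p y z" if t: "0 <= t" for t
 proof (rule lower_greatest[OF z])
  show "lower p y (%i. x i + z i) - (p (shift x t y) - t * p y) <= p (shift z s y) - s * p y" if "0 <= s" for s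
   using le[OF t that] by linarith
 qed
 hence "lower p y (%i. x i + z i) - lower p y z <= lower p y x"
  by (intro lower_greatest[OF x]) (simp add: algebra_simps)
 thus "lower p y (%i. x i + z i) <= lower p y x + lower p y z" by simp
next
 fix x and r :: real assume x: "x \<in> X" and r: "0 <= r"
 show "lower p y (%i. complex_of_real r * x i) <= r * lower p y x"
 proof (cases "r = 0")
  case True
  thus ?thesis using lower_le[OF zero, of 0] sublinear_zero[OF p] by simp
 next
  case False
  hence r: "0 < r" using r by simp
  have "lower p y (%i. complex_of_real r * x i) / r <= lower p y x"
  proof (rule lower_greatest[OF x])
   fix t :: real assume t: "0 <= t"
   have "lower p y (%i. complex_of_real r * x i) <= p (shift (%i. complex_of_real r * x i) (r * t) y) - (r * t) * p y"
    using r t by (intro lower_le scale x) simp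
   also have "shift (%i. complex_of_real r * x i) (r * t) y = (%i. complex_of_real r * shift x t y i)"
    by (auto simp: algebra_simps)
   also have "p ... = r * p (shift x t y)" by (intro sublinear_scale p shift x y r)
   finally show "lower p y (%i. complex_of_real r * x i) / r <= p (shift x t y) - t * p y"
    using r by (simp add: pos_divide_le_eq left_diff_distrib right_diff_distrib mult_ac)
  qed
  thus ?thesis using r by (simp add: pos_divide_le_eq mult.commute)
 qed
qed

lemma lower_below: "x \<in> X ==> lower p y x <= p x" using lower_le[of x 0] by simp

end

text \<open>Fixing the value 0 outside \<open>X\<close> keeps functionals from being lowered there,
  so that minimality is a statement about \<open>X\<close>.\<close>

definition minorants :: "(('i => complex) => real) => (('i => complex) => real) set" where
 "minorants p = {q. sublinear q & (\<forall>x\<in>X. q x <= p x) & (\<forall>x. x \<notin> X --> q x = 0)}"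

text \<open>The pointwise infimum is finite because every minorant lies above
  \<open>- p (- x)\<close> on \<open>X\<close>. For its subadditivity, the smaller of two members of
  the chain serves both summands.\<close>

lemma minorants_chain:
 assumes p: "sublinear p" and C: "C \<subseteq> minorants p" "C ~= {}"
  and chain: "!!q r. q \<in> C ==> r \<in> C ==> (\<forall>x. q x <= r x) | (\<forall>x. r x <= q x)"
 shows "\<exists>u\<in>minorants p. \<forall>q\<in>C. \<forall>x. u x <= q x"
proof -
 define u where "u x = (INF q\<in>C. q x)" for x
 have q: "sublinear q" "x \<in> X ==> q x <= p x" "x \<notin> X ==> q x = 0" if "q \<in> C" for q x
  using C(1) that by (auto simp: minorants_def)
 have bdd: "bdd_below ((%q. q x) ` C)" for x
 proof (cases "x \<in> X")
  case True
  have "- p (%i. - x i) <= q x" if "q \<in> C" for q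
   using sublinear_neg[OF q(1)[OF that] True] q(2)[OF that neg[OF True]] by simp
  thus ?thesis by (rule bdd_belowI2)
 next
  case False
  thus ?thesis by (intro bdd_belowI2[of _ 0]) (simp add: q)
 qed
 have lower: "u x <= q x" if "q \<in> C" for q x unfolding u_def by (rule cINF_lower[OF bdd that])
 have greatest: "B <= u x" if "!!q. q \<in> C ==> B <= q x" for B x
  unfolding u_def by (rule cINF_greatest[OF C(2)]) (rule that)
 obtain q0 where q0: "q0 \<in> C" using C(2) by blast
 have "sublinear u"
  unfolding sublinear_def
 proof (intro conjI ballI allI impI)
  fix x z assume x: "x \<in> X" and z: "z \<in> X"
  have le: "u (%i. x i + z i) <= q x + r z" if qr: "q \<in> C" "r \<in> C" for q r
  proof -
   obtain s where s: "s \<in> C" "s x <= q x" "s z <= r z" using chain[OF qr] qr by blast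
   have "u (%i. x i + z i) <= s (%i. x i + z i)" by (rule lower[OF s(1)])
   also have "... <= s x + s z" by (rule sublinearD(1)[OF q(1)[OF s(1)] x z])
   finally show ?thesis using s by simp
  qed
  have "u (%i. x i + z i) - q x <= u z" if q: "q \<in> C" for q
  proof (rule greatest)
   show "u (%i. x i + z i) - q x <= r z" if "r \<in> C" for r using le[OF q that] by linarith
  qed
  hence "u (%i. x i + z i) - u z <= u x" by (intro greatest) (simp add: algebra_simps)
  thus "u (%i. x i + z i) <= u x + u z" by simp
 next
  fix x and t :: real assume x: "x \<in> X" and t: "0 <= t"
  have le: "u (%i. complex_of_real t * x i) <= t * q x" if "q \<in> C" for q
   using lower[OF that] sublinearD(2)[OF q(1)[OF that] x t] order_trans by blast
  show "u (%i. complex_of_real t * x i) <= t * u x"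
  proof (cases "t = 0")
   case True
   thus ?thesis using le[OF q0] by simp
  next
   case False
   hence "u (%i. complex_of_real t * x i) / t <= u x"
    using t le by (intro greatest) (simp add: pos_divide_le_eq mult.commute)
   thus ?thesis using t False by (simp add: pos_divide_le_eq mult.commute)
  qed
 qed
 moreover have "u x <= p x" if "x \<in> X" for x using lower[OF q0, of x] q(2)[OF q0 that] by simp
 moreover have "u x = 0" if "x \<notin> X" for x
  using lower[OF q0, of x] greatest[of 0 x] q(3)[OF _ that] q0 by fastforce
 ultimately have "u \<in> minorants p" by (simp add: minorants_def)
 thus ?thesis using lower by blast
qed

theorem hahn_banach:
 assumes p: "sublinear p" and f: "f \<in> X"
 shows "\<exists>u. (\<forall>x\<in>X. \<forall>y\<in>X. u (%i. x i + y i) = u x + u y) & (\<forall>x\<in>X. \<forall>t. u (%i. complex_of_real t * x i) = t * u x)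
  & (\<forall>x\<in>X. u x <= p x) & p f <= u f"
proof -
 \<comment> \<open>Lowering \<open>p\<close> in the direction \<open>f\<close> beforehand gives
   \<open>p' (- f) <= - p f\<close>, which forces \<open>p f <= u f\<close> in the end.\<close>
 define p' where "p' = lower p f"
 have p': "sublinear p'" unfolding p'_def by (rule lower_sublinear[OF p f])
 \<comment> \<open>Zorn's lemma yields maximal elements, hence the reversed order.\<close>
 let ?P = "%q r :: ('i => complex) => real. \<forall>x. r x <= q x"
 have "\<exists>m\<in>minorants p'. \<forall>a\<in>minorants p'. ?P m a --> a = m"
 proof (rule predicate_Zorn)
  show "partial_order_on (minorants p') (relation_of ?P (minorants p'))"
   by (auto simp: partial_order_on_def preorder_on_def refl_on_def trans_def antisym_def relation_of_def
    intro: order_trans intro!: ext antisym)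
  fix C assume C: "C \<in> Chains (relation_of ?P (minorants p'))"
  have C1: "C \<subseteq> minorants p'" "!!q r. q \<in> C ==> r \<in> C ==> ?P r q | ?P q r"
   using C by (auto simp: Chains_def relation_of_def)
  show "\<exists>u\<in>minorants p'. \<forall>a\<in>C. ?P a u"
  proof (cases "C = {}")
   case True
   have "p' \<in> minorants p'" using p' by (auto simp: minorants_def p'_def lower_def)
   thus ?thesis using True by blast
  next
   case False
   show ?thesis using minorants_chain[OF p' C1(1) False C1(2)] .
  qed
 qed
 then obtain u where u: "u \<in> minorants p'" "!!q. q \<in> minorants p' ==> (!!x. q x <= u x) ==> q = u" by blast
 have us: "sublinear u" and up: "!!x. x \<in> X ==> u x <= p' x" and u0: "!!x. x \<notin> X ==> u x = 0"
  using u(1) by (auto simp: minorants_def)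
 \<comment> \<open>By minimality, lowering changes nothing; with \<open>t = 1\<close> this says
   \<open>u x <= u (x + y) - u y\<close>, the reverse of subadditivity.\<close>
 have low: "lower u y = u" if y: "y \<in> X" for y
 proof (rule u(2))
  show "lower u y x <= u x" for x using lower_below[OF us y] by (cases "x \<in> X") (auto simp: lower_def u0)
  hence "lower u y x <= p' x" if "x \<in> X" for x using up[OF that] order_trans by blast
  thus "lower u y \<in> minorants p'" using lower_sublinear[OF us y] by (auto simp: minorants_def lower_def)
 qed
 have additive: "u (%i. x i + y i) = u x + u y" if "x \<in> X" "y \<in> X" for x y
  using sublinearD(1)[OF us that] lower_le[OF us that(2,1), of 1] low[OF that(2)] by simp
 have homog: "u (%i. complex_of_real t * x i) = t * u x" if x: "x \<in> X" for x t
 proof -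
  have nn: "u (%i. complex_of_real s * x i) = s * u x" if "0 <= s" for s
   using that sublinear_scale[OF us x, of s] sublinear_zero[OF us] by (cases "s = 0") auto
  show ?thesis
  proof (cases "0 <= t")
   case False
   have "u (%i. complex_of_real t * x i + complex_of_real (- t) * x i) = u (%i. complex_of_real t * x i) + u (%i. complex_of_real (- t) * x i)"
    by (intro additive scale x)
   thus ?thesis using nn[of "- t"] False sublinear_zero[OF us] by simp
  qed (rule nn)
 qed
 have "u x <= p x" if "x \<in> X" for x using up[OF that] lower_below[OF p f that] by (simp add: p'_def)
 moreover have "p f <= u f"
 proof -
  have "u (%i. - f i) <= - p f"
   using up[OF neg[OF f]] lower_le[OF p f neg[OF f], of 1] sublinear_zero[OF p] by (simp add: p'_def)
  thus ?thesis using homog[OF f, of "-1"] by simp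
 qed
 ultimately show ?thesis using additive homog by (intro exI[of _ u]) simp
qed

end

section \<open>Density of finitely supported sequences in reflexive spaces\<close>

context wspace
begin

lemma vecs_Y_closed:
 "f \<in> vecs Y ==> g \<in> vecs Y ==> (%k. f k + g k) \<in> vecs Y"
 "f \<in> vecs Y ==> (%k. z * f k) \<in> vecs Y"
 "f \<in> vecs Y ==> g \<in> vecs Y ==> (%k. f k - g k) \<in> vecs Y"
 "\<phi> \<in> finite_seqs ==> \<phi> \<in> vecs Y"
proof -
 show a: "f \<in> vecs Y ==> g \<in> vecs Y ==> (%k. f k + g k) \<in> vecs Y" for f g
  unfolding vecs_Y by (rule le_less_trans[OF Nw_add]) simp
 show m: "f \<in> vecs Y ==> (%k. z * f k) \<in> vecs Y" for f z
  unfolding vecs_Y by (simp add: Nw_scale ennreal_mult_less_top)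
 show "f \<in> vecs Y ==> g \<in> vecs Y ==> (%k. f k - g k) \<in> vecs Y"
  using a[of f "%k. -1 * g k"] m[of g "-1"] by simp
 show "\<phi> \<in> finite_seqs ==> \<phi> \<in> vecs Y" unfolding vecs_Y by (rule Nw_finite)
qed

lemma nrm_point: "\<exists>K. \<forall>f\<in>vecs Y. cmod (f k) <= K * nrm Y f"
proof -
 obtain K where K: "K > 0" "\<forall>f. ennreal (cmod (f k)) <= ennreal K * Nw f" using Nw_point by blast
 have "cmod (f k) <= K * nrm Y f" if "f \<in> vecs Y" for f
 proof -
  have "ennreal (cmod (f k)) <= ennreal K * ennreal (nrm Y f)"
   using K(2)[THEN spec, of f] Nw_eq_nrm[of f] that by (simp only: vecs_Y)
  also have "... = ennreal (K * nrm Y f)" using K(1) by (simp add: ennreal_mult nrm_Y)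
  finally show ?thesis using K(1) by (simp add: ennreal_le_iff nrm_Y)
 qed
 thus ?thesis by blast
qed

lemma nrm_Y_mono: "g \<in> vecs Y ==> (!!k. cmod (f k) <= cmod (g k)) ==> nrm Y f <= nrm Y g"
 using Nw_mono[of f g] unfolding vecs_Y nrm_Y by (auto intro: enn2real_mono)

lemma nrm_Y_add: "f \<in> vecs Y ==> g \<in> vecs Y ==> nrm Y (%k. f k + g k) <= nrm Y f + nrm Y g"
 using enn2real_mono[OF Nw_add, of f g] unfolding vecs_Y nrm_Y by (simp add: enn2real_plus)

lemma nrm_Y_scale: "nrm Y (%k. c * f k) = cmod c * nrm Y f" by (simp add: nrm_Y Nw_scale enn2real_mult)

lemma zero_Y: "(%_. 0) \<in> vecs Y" "nrm Y (%_. 0) = 0" using Nw_zero_iff[of "%_. 0"] by (auto simp: vecs_Y nrm_Y)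

interpretation Y: complex_subspace "vecs Y" by unfold_locales (use vecs_Y_closed zero_Y in auto)

lemma dual_linear:
 assumes "\<psi> \<in> vecs (dual_space Y)" "f \<in> vecs Y"
 shows "g \<in> vecs Y ==> \<psi> (%i. f i + g i) = \<psi> f + \<psi> g" "\<psi> (%i. c * f i) = c * \<psi> f"
 using assms by (auto simp: dual_space_def linear_functional_on_def)

lemma dual_bound:
 assumes \<psi>: "\<psi> \<in> vecs (dual_space Y)"
 shows "0 <= nrm (dual_space Y) \<psi>" "f \<in> vecs Y ==> cmod (\<psi> f) <= nrm (dual_space Y) \<psi> * nrm Y f"
proof -
 let ?S = "{cmod (\<psi> f) |f. f \<in> vecs Y & nrm Y f <= 1}"
 obtain C where C: "\<forall>f\<in>vecs Y. cmod (\<psi> f) <= C * nrm Y f" using \<psi> by (auto simp: dual_space_def)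
 have "bdd_above ?S"
 proof (rule bdd_aboveI)
  fix x assume "x \<in> ?S"
  then obtain h where h: "x = cmod (\<psi> h)" "h \<in> vecs Y" "nrm Y h <= 1" by blast
  have "x <= C * nrm Y h" using C h by blast
  also have "... <= \<bar>C\<bar> * 1" using h(3) by (intro mult_mono) (auto simp: nrm_Y)
  finally show "x <= \<bar>C\<bar> * 1" .
 qed
 hence up: "cmod (\<psi> g) <= nrm (dual_space Y) \<psi>" if "g \<in> vecs Y" "nrm Y g <= 1" for g
  using that by (auto simp: dual_space_def intro!: cSup_upper)
 show "0 <= nrm (dual_space Y) \<psi>" using order_trans[OF norm_ge_zero up[of "%_. 0"]] by (simp add: zero_Y)
 assume f: "f \<in> vecs Y"
 show "cmod (\<psi> f) <= nrm (dual_space Y) \<psi> * nrm Y f"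
 proof (cases "f = (%_. 0)")
  case True
  thus ?thesis using dual_linear(2)[OF \<psi> f, of 0] by (simp add: zero_Y)
 next
  case False
  have pos: "0 < nrm Y f" using f False Nw_zero_iff[of f]
   by (simp add: vecs_Y nrm_Y enn2real_positive_iff zero_less_iff_neq_zero)
  let ?s = "complex_of_real (1 / nrm Y f)"
  have "(%k. ?s * f k) \<in> vecs Y" "nrm Y (%k. ?s * f k) <= 1"
   using f pos by (auto simp: nrm_Y_scale norm_divide intro: vecs_Y_closed simp del: of_real_divide)
  from up[OF this] have "cmod (?s * \<psi> f) <= nrm (dual_space Y) \<psi>" by (simp only: dual_linear(2)[OF \<psi> f])
  thus ?thesis using pos by (simp add: norm_mult norm_divide field_simps)
 qed
qed

abbreviation entry :: "(int => complex) => int => int => complex" where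
 "entry f k \<equiv> %j. if j = k then f j else 0"

lemma entry_finite: "entry f k \<in> finite_seqs" by (auto simp: finite_seqs_def intro: finite_subset[of _ "{k}"])

lemma dual_finite_sum:
 assumes \<psi>: "\<psi> \<in> vecs (dual_space Y)" and A: "finite A"
 shows "(%j. if j \<in> A then c j * f j else 0) \<in> finite_seqs"
  "\<psi> (%j. if j \<in> A then c j * f j else 0) = (\<Sum>k\<in>A. c k * \<psi> (entry f k))"
proof -
 have fin: "(%j. if j \<in> A then c j * f j else 0) \<in> finite_seqs" if "finite A" for A
  using that by (auto simp: finite_seqs_def intro: finite_subset[of _ A])
 show "(%j. if j \<in> A then c j * f j else 0) \<in> finite_seqs" by (rule fin[OF A])
 show "\<psi> (%j. if j \<in> A then c j * f j else 0) = (\<Sum>k\<in>A. c k * \<psi> (entry f k))"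
  using A
 proof induction
  case empty
  thus ?case using dual_linear(2)[OF \<psi> zero_Y(1), of 0] by simp
 next
  case (insert a A)
  let ?x = "%j. c a * entry f a j" and ?y = "%j. if j \<in> A then c j * f j else 0"
  have xy: "entry f a \<in> vecs Y" "?x \<in> vecs Y" "?y \<in> vecs Y"
   using insert.hyps(1) by (intro vecs_Y_closed entry_finite fin)+
  have "(%j. if j \<in> insert a A then c j * f j else 0) = (%j. ?x j + ?y j)" using insert.hyps(2) by auto
  thus ?case using dual_linear(1)[OF \<psi> xy(2,3)] dual_linear(2)[OF \<psi> xy(1), of "c a"] insert by simp
 qed
qed

text \<open>Multiplying the entries of \<open>f\<close> by unimodular numbers does not change its norm, so a functional
 converges absolutely along \<open>f\<close>.\<close>

lemma dual_entries_bounded: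
 assumes \<psi>: "\<psi> \<in> vecs (dual_space Y)" and f: "f \<in> vecs Y" and A: "finite A"
 shows "(\<Sum>k\<in>A. cmod (\<psi> (entry f k))) <= nrm (dual_space Y) \<psi> * nrm Y f"
proof -
 define c where "c k = cnj (sgn (\<psi> (entry f k)))" for k
 let ?g = "%j. if j \<in> A then c j * f j else 0"
 have "complex_of_real (\<Sum>k\<in>A. cmod (\<psi> (entry f k))) = (\<Sum>k\<in>A. c k * \<psi> (entry f k))"
  unfolding of_real_sum
 proof (rule sum.cong)
  fix k
  have "c k * \<psi> (entry f k) = \<psi> (entry f k) * cnj (\<psi> (entry f k)) / cmod (\<psi> (entry f k))"
   by (simp add: c_def sgn_div_norm scaleR_conv_of_real divide_inverse mult_ac)
  also have "... = complex_of_real (cmod (\<psi> (entry f k)))"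
   by (cases "\<psi> (entry f k) = 0") (simp_all add: complex_norm_square[symmetric] power2_eq_square)
  finally show "complex_of_real (cmod (\<psi> (entry f k))) = c k * \<psi> (entry f k)" ..
 qed simp
 also have "... = \<psi> ?g" by (rule dual_finite_sum(2)[OF \<psi> A, symmetric])
 finally have e: "complex_of_real (\<Sum>k\<in>A. cmod (\<psi> (entry f k))) = \<psi> ?g" .
 have "0 <= (\<Sum>k\<in>A. cmod (\<psi> (entry f k)))" by (intro sum_nonneg) simp
 hence "(\<Sum>k\<in>A. cmod (\<psi> (entry f k))) = cmod (\<psi> ?g)" unfolding e[symmetric] by (simp del: of_real_sum)
 also have "... <= nrm (dual_space Y) \<psi> * nrm Y ?g"
  by (intro dual_bound \<psi> vecs_Y_closed dual_finite_sum(1)[OF \<psi> A])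
 also have "... <= nrm (dual_space Y) \<psi> * nrm Y f"
  by (intro mult_left_mono dual_bound \<psi> nrm_Y_mono[OF f]) (auto simp: c_def norm_mult norm_sgn)
 finally show ?thesis .
qed

definition entry_sum :: "(int => complex) => ((int => complex) => complex) => complex" where
 "entry_sum f \<psi> = (if \<psi> \<in> vecs (dual_space Y) then \<Sum>\<^sub>\<infinity>k. \<psi> (entry f k) else 0)"

lemma entry_summable:
 assumes "\<psi> \<in> vecs (dual_space Y)" "f \<in> vecs Y"
 shows "(%k. cmod (\<psi> (entry f k))) summable_on UNIV"
 by (rule nonneg_bdd_above_summable_on) (use dual_entries_bounded[OF assms] in \<open>auto intro!: bdd_aboveI2\<close>)

lemma dual_closed:
 assumes \<psi>: "\<psi> \<in> vecs (dual_space Y)" and \<xi>: "\<xi> \<in> vecs (dual_space Y)"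
 shows "(%f. \<psi> f + \<xi> f) \<in> vecs (dual_space Y)" "(%f. c * \<psi> f) \<in> vecs (dual_space Y)"
proof -
 have "cmod (\<psi> f + \<xi> f) <= (nrm (dual_space Y) \<psi> + nrm (dual_space Y) \<xi>) * nrm Y f" if "f \<in> vecs Y" for f
  using order_trans[OF norm_triangle_ineq add_mono[OF dual_bound(2)[OF \<psi> that] dual_bound(2)[OF \<xi> that]]]
  by (simp add: distrib_right)
 moreover have "cmod (c * \<psi> f) <= (cmod c * nrm (dual_space Y) \<psi>) * nrm Y f" if "f \<in> vecs Y" for f
  using mult_left_mono[OF dual_bound(2)[OF \<psi> that], of "cmod c"] by (simp add: norm_mult mult.assoc)
 ultimately show "(%f. \<psi> f + \<xi> f) \<in> vecs (dual_space Y)" "(%f. c * \<psi> f) \<in> vecs (dual_space Y)"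
  using \<psi> \<xi> unfolding dual_space_def linear_functional_on_def by (auto simp: distrib_left mult.left_commute)
qed

lemma entry_sum_bidual:
 assumes f: "f \<in> vecs Y"
 shows "entry_sum f \<in> vecs (dual_space (dual_space Y))"
proof -
 have s: "(%k. \<psi> (entry f k)) summable_on UNIV" if "\<psi> \<in> vecs (dual_space Y)" for \<psi>
  by (rule abs_summable_summable[OF entry_summable[OF that f]])
 have add: "entry_sum f (%i. \<psi> i + \<xi> i) = entry_sum f \<psi> + entry_sum f \<xi>"
  if "\<psi> \<in> vecs (dual_space Y)" "\<xi> \<in> vecs (dual_space Y)" for \<psi> \<xi>
  using dual_closed(1)[OF that] that by (simp add: entry_sum_def infsum_add[OF s s])
 have scale: "entry_sum f (%i. c * \<psi> i) = c * entry_sum f \<psi>" if "\<psi> \<in> vecs (dual_space Y)" for \<psi> c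
  using dual_closed(2)[OF that that] that by (simp add: entry_sum_def infsum_cmult_right[OF s])
 have bound: "cmod (entry_sum f \<psi>) <= nrm Y f * nrm (dual_space Y) \<psi>" if \<psi>: "\<psi> \<in> vecs (dual_space Y)" for \<psi>
 proof -
  have "cmod (entry_sum f \<psi>) <= (\<Sum>\<^sub>\<infinity>k. cmod (\<psi> (entry f k)))"
   using \<psi> norm_infsum_bound[OF entry_summable[OF \<psi> f]] by (simp add: entry_sum_def)
  also have "... <= nrm (dual_space Y) \<psi> * nrm Y f"
   by (rule infsum_le_finite_sums[OF entry_summable[OF \<psi> f]]) (rule dual_entries_bounded[OF \<psi> f])
  finally show ?thesis by (simp add: mult.commute)
 qed
 have "linear_functional_on (vecs (dual_space Y)) (entry_sum f)"
  unfolding linear_functional_on_def using add scale by (auto simp: entry_sum_def)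
 thus ?thesis unfolding dual_space_def[of "dual_space Y"] using bound by auto
qed

lemma eval_dual: "(%f. if f \<in> vecs Y then f k else 0) \<in> vecs (dual_space Y)"
proof -
 obtain K where "\<forall>f\<in>vecs Y. cmod (f k) <= K * nrm Y f" using nrm_point by blast
 thus ?thesis unfolding dual_space_def linear_functional_on_def using vecs_Y_closed(1,2) by auto
qed

text \<open>The distance \<open>p\<close> to the finitely supported sequences is sublinear. Were it
  at least \<open>e\<close> at \<open>f\<close>, a functional dominated by it would vanish on all
  these sequences but not at \<open>f\<close>.\<close>

theorem reflexive_dense:
 assumes refl: "reflexive Y" and f: "f \<in> vecs Y" and e: "0 < e"
 shows "\<exists>\<phi>\<in>finite_seqs. Nw (%k. f k - \<phi> k) < ennreal e"
proof (rule ccontr)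
 assume n: "~ (\<exists>\<phi>\<in>finite_seqs. Nw (%k. f k - \<phi> k) < ennreal e)"
 define p where "p x = (INF \<phi>\<in>finite_seqs. nrm Y (%k. x k - \<phi> k))" for x
 have f0: "(%_. 0) \<in> finite_seqs" by (simp add: finite_seqs_def)
 have fadd: "(%k. \<phi> k + \<xi> k) \<in> finite_seqs" if "\<phi> \<in> finite_seqs" "\<xi> \<in> finite_seqs" for \<phi> \<xi>
  using that finite_subset[of "{k. \<phi> k + \<xi> k ~= 0}" "supp \<phi> \<union> supp \<xi>"]
  unfolding finite_seqs_def by fastforce
 have fscale: "(%k. c * \<phi> k) \<in> finite_seqs" if "\<phi> \<in> finite_seqs" for \<phi> c
  using that by (auto simp: finite_seqs_def intro: finite_subset)
 have p_le: "p x <= nrm Y (%k. x k - \<phi> k)" if "\<phi> \<in> finite_seqs" for x \<phi>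
  unfolding p_def by (rule cINF_lower[OF bdd_belowI2[of _ 0] that]) (simp add: nrm_Y)
 have p_ge: "B <= p x" if "!!\<phi>. \<phi> \<in> finite_seqs ==> B <= nrm Y (%k. x k - \<phi> k)" for x B
  unfolding p_def using f0 by (intro cINF_greatest that) auto
 have pf: "e <= p f"
 proof (rule p_ge)
  fix \<phi> assume \<phi>: "\<phi> \<in> finite_seqs"
  have "(%k. f k - \<phi> k) \<in> vecs Y" by (intro vecs_Y_closed f \<phi>)
  moreover have "~ Nw (%k. f k - \<phi> k) < ennreal e" using n \<phi> by blast
  ultimately show "e <= nrm Y (%k. f k - \<phi> k)"
   by (cases "Nw (%k. f k - \<phi> k)") (auto simp: nrm_Y ennreal_less_iff vecs_Y)
 qed
 have p0: "p x = 0" if "x \<in> finite_seqs" for x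
  using p_le[OF that, of x] p_ge[of 0 x] by (simp add: zero_Y) (simp add: nrm_Y)
 have "Y.sublinear p"
  unfolding Y.sublinear_def
 proof (intro conjI ballI allI impI)
  fix x z assume x: "x \<in> vecs Y" and z: "z \<in> vecs Y"
  have le: "p (%i. x i + z i) <= nrm Y (%k. x k - \<phi> k) + nrm Y (%k. z k - \<xi> k)"
   if \<phi>: "\<phi> \<in> finite_seqs" and \<xi>: "\<xi> \<in> finite_seqs" for \<phi> \<xi>
  proof -
   have "p (%i. x i + z i) <= nrm Y (%k. (x k - \<phi> k) + (z k - \<xi> k))"
    using p_le[OF fadd[OF \<phi> \<xi>], of "%i. x i + z i"] by (simp add: algebra_simps)
   also have "... <= nrm Y (%k. x k - \<phi> k) + nrm Y (%k. z k - \<xi> k)"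
    by (intro nrm_Y_add vecs_Y_closed x z \<phi> \<xi>)
   finally show ?thesis .
  qed
  have "p (%i. x i + z i) - nrm Y (%k. x k - \<phi> k) <= p z" if \<phi>: "\<phi> \<in> finite_seqs" for \<phi>
  proof (rule p_ge)
   show "p (%i. x i + z i) - nrm Y (%k. x k - \<phi> k) <= nrm Y (%k. z k - \<xi> k)" if "\<xi> \<in> finite_seqs" for \<xi>
    using le[OF \<phi> that] by linarith
  qed
  hence "p (%i. x i + z i) - p z <= p x" by (intro p_ge) (simp add: algebra_simps)
  thus "p (%i. x i + z i) <= p x + p z" by simp
 next
  fix x and t :: real assume x: "x \<in> vecs Y" and t: "0 <= t"
  have le: "p (%i. complex_of_real t * x i) <= t * nrm Y (%k. x k - \<phi> k)" if "\<phi> \<in> finite_seqs" for \<phi>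
   using p_le[OF fscale[OF that, of "complex_of_real t"], of "%i. complex_of_real t * x i"] t
    nrm_Y_scale[of "complex_of_real t" "%k. x k - \<phi> k"] by (simp add: right_diff_distrib)
  show "p (%i. complex_of_real t * x i) <= t * p x"
  proof (cases "t = 0")
   case False
   hence "p (%i. complex_of_real t * x i) / t <= p x"
    using t le by (intro p_ge) (simp add: pos_divide_le_eq mult.commute)
   thus ?thesis using t False by (simp add: pos_divide_le_eq mult.commute)
  qed (simp add: p0[OF f0])
 qed
 from Y.hahn_banach[OF this f] obtain u where u':
  "\<forall>x\<in>vecs Y. \<forall>y\<in>vecs Y. u (%i. x i + y i) = u x + u y" "\<forall>x\<in>vecs Y. \<forall>t. u (%i. complex_of_real t * x i) = t * u x"
  "\<forall>x\<in>vecs Y. u x <= p x" "p f <= u f" by (elim exE conjE)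
 note u = u'(1)[THEN bspec, THEN bspec] u'(2)[THEN bspec, THEN spec] u'(3)[THEN bspec] u'(4)
 \<comment> \<open>The complex-linear functional with real part \<open>u\<close>; estimating real
   and imaginary part separately gives the factor 2 in its bound.\<close>
 define \<xi> where "\<xi> x = (if x \<in> vecs Y then Complex (u x) (- u (%k. \<i> * x k)) else 0)" for x
 have abs: "\<bar>u x\<bar> <= p x" if x: "x \<in> vecs Y" for x
 proof -
  have v: "(%i. -1 * x i) \<in> vecs Y" by (rule vecs_Y_closed(2)[OF x])
  have "p (%i. -1 * x i) <= p x"
  proof (rule p_ge)
   fix \<phi> assume "\<phi> \<in> finite_seqs"
   from p_le[OF fscale[OF this, of "-1"], of "%i. -1 * x i"] show "p (%i. -1 * x i) <= nrm Y (%k. x k - \<phi> k)"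
    using nrm_Y_scale[of "-1" "%k. x k - \<phi> k"] by (simp add: right_diff_distrib)
  qed
  thus ?thesis using u(3)[OF x] u(3)[OF v] u(2)[OF x, of "-1"] by simp
 qed
 have pn: "p x <= nrm Y x" for x using p_le[OF f0, of x] by simp
 have \<xi>: "\<xi> \<in> vecs (dual_space Y)"
 proof -
  have add: "\<xi> (%i. x i + y i) = \<xi> x + \<xi> y" if "x \<in> vecs Y" "y \<in> vecs Y" for x y
   using u(1)[OF that] u(1)[OF vecs_Y_closed(2)[OF that(1), of "\<i>"] vecs_Y_closed(2)[OF that(2), of "\<i>"]]
    vecs_Y_closed(1)[OF that] that by (simp add: \<xi>_def distrib_left complex_eq_iff)
  have scale: "\<xi> (%i. c * x i) = c * \<xi> x" if x: "x \<in> vecs Y" for x c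
  proof -
   have ux: "u (%i. d * x i) = Re d * u x + Im d * u (%i. \<i> * x i)" for d
   proof -
    have ix: "(%i. \<i> * x i) \<in> vecs Y" by (rule vecs_Y_closed(2)[OF x])
    have "(%i. d * x i) = (%i. complex_of_real (Re d) * x i + complex_of_real (Im d) * (\<i> * x i))"
     by (subst complex_eq[of d]) (simp add: algebra_simps)
    thus ?thesis
     using u(1)[OF vecs_Y_closed(2)[OF x] vecs_Y_closed(2)[OF ix], of "complex_of_real (Re d)" "complex_of_real (Im d)"]
      u(2)[OF x] u(2)[OF ix] by simp
   qed
   show ?thesis using ux[of c] ux[of "\<i> * c"] x vecs_Y_closed(2)[OF x, of c]
    by (simp add: \<xi>_def complex_eq_iff mult.assoc)
  qed
  have "cmod (\<xi> x) <= 2 * nrm Y x" if x: "x \<in> vecs Y" for x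
  proof -
   have "cmod (\<xi> x) <= \<bar>u x\<bar> + \<bar>u (%k. \<i> * x k)\<bar>"
    using x cmod_le[of "\<xi> x"] by (simp add: \<xi>_def)
   also have "... <= nrm Y x + nrm Y (%k. \<i> * x k)" by (intro add_mono order_trans[OF abs pn] x vecs_Y_closed)
   finally show ?thesis by (simp add: nrm_Y_scale)
  qed
  thus ?thesis unfolding dual_space_def linear_functional_on_def using add scale by (auto simp: \<xi>_def)
 qed
 have \<xi>0: "\<xi> \<phi> = 0" if \<phi>: "\<phi> \<in> finite_seqs" for \<phi>
  using abs[OF vecs_Y_closed(4)[OF \<phi>]] abs[OF vecs_Y_closed(4)[OF fscale[OF \<phi>, of "\<i>"]]] p0[OF \<phi>] p0[OF fscale[OF \<phi>, of "\<i>"]]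
  by (simp add: \<xi>_def complex_eq_iff)
 obtain g where g: "g \<in> vecs Y" "\<forall>\<psi>\<in>vecs (dual_space Y). entry_sum f \<psi> = \<psi> g"
  using refl entry_sum_bidual[OF f] unfolding reflexive_def by blast
 \<comment> \<open>The point evaluations belong to the dual, and on them \<open>entry_sum f\<close>
   returns the entries of \<open>f\<close>.\<close>
 have "g k = f k" for k :: int
 proof -
  have "entry_sum f (%f. if f \<in> vecs Y then f k else 0) = (\<Sum>\<^sub>\<infinity>j. entry f j k)"
   using eval_dual[of k] vecs_Y_closed(4)[OF entry_finite] by (simp add: entry_sum_def)
  also have "... = (\<Sum>\<^sub>\<infinity>j\<in>{k}. f k)" by (intro infsum_cong_neutral) auto
  finally show ?thesis using g(2)[THEN bspec, OF eval_dual, of k] g(1) by simp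
 qed
 hence "g = f" by blast
 hence "\<xi> f = entry_sum f \<xi>" using g(2) \<xi> by simp
 also have "... = 0" by (simp add: entry_sum_def \<xi>0 entry_finite)
 finally show False using u(4) pf e f by (simp add: \<xi>_def complex_eq_iff)
qed

end

section \<open>Laurent operators\<close>

definition trunc :: "nat => (int => complex) => int => complex" where
 "trunc m f k = (if \<bar>k\<bar> <= int m then f k else 0)"

lemma cv_diff:
 assumes "\<phi> \<in> finite_seqs" "\<psi> \<in> finite_seqs"
 shows "cv c (%k. \<phi> k - \<psi> k) j = cv c \<phi> j - cv c \<psi> j"
proof -
 define A where "A = supp \<phi> \<union> supp \<psi>"
 have "finite A" "supp \<phi> \<subseteq> A" "supp \<psi> \<subseteq> A" "{k. \<phi> k - \<psi> k ~= 0} \<subseteq> A"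
  using assms by (auto simp: A_def finite_seqs_def)
 thus ?thesis by (simp add: cv_superset[of A] right_diff_distrib sum_subtractf)
qed

lemma trunc_finite: "trunc m f \<in> finite_seqs"
proof -
 have "{k. trunc m f k ~= 0} \<subseteq> {- int m..int m}" by (auto simp: trunc_def split: if_splits)
 thus ?thesis by (auto simp: finite_seqs_def intro: finite_subset)
qed

lemma cv_trunc: "cv c (trunc m f) j = (\<Sum>k=- int m..int m. c (j - k) * f k)"
proof -
 have "{k. trunc m f k ~= 0} \<subseteq> {- int m..int m}" by (auto simp: trunc_def split: if_splits)
 thus ?thesis by (subst cv_superset) (auto simp: trunc_def intro!: sum.cong)
qed

lemma trunc_eventually: "\<phi> \<in> finite_seqs ==> \<exists>m0. \<forall>m\<ge>m0. trunc m \<phi> = \<phi>"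
proof -
 assume "\<phi> \<in> finite_seqs"
 hence "finite ((%k. nat \<bar>k\<bar>) ` (supp \<phi>))" by (simp add: finite_seqs_def)
 then obtain m0 where m0: "!!k. \<phi> k ~= 0 ==> nat \<bar>k\<bar> <= m0" unfolding finite_nat_set_iff_bounded_le by auto
 have "trunc m \<phi> = \<phi>" if "m0 <= m" for m
 proof
  show "trunc m \<phi> k = \<phi> k" for k using m0[of k] that by (cases "\<phi> k = 0") (auto simp: trunc_def)
 qed
 thus ?thesis by blast
qed

locale dense_space = growth_space +
 assumes dense: "f \<in> vecs Y ==> 0 < e ==> \<exists>\<phi>\<in>finite_seqs. Nw (%k. f k - \<phi> k) < ennreal e"
begin

text \<open>Truncating \<open>f\<close> beyond the support of an approximant \<open>\<phi>\<close>
  is at least as good as \<open>\<phi>\<close>: inside the error is zero, outside both errors equal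
  \<open>f\<close>.\<close>

lemma trunc_tendsto:
 assumes f: "f \<in> vecs Y"
 shows "(%m. nrm Y (%k. f k - trunc m f k)) \<longlonglongrightarrow> 0"
proof (rule LIMSEQ_I)
 fix e :: real assume e: "0 < e"
 then obtain \<phi> where \<phi>: "\<phi> \<in> finite_seqs" "Nw (%k. f k - \<phi> k) < ennreal e" using dense[OF f] by blast
 obtain m0 where m0: "\<forall>m\<ge>m0. trunc m \<phi> = \<phi>" using trunc_eventually[OF \<phi>(1)] by blast
 have "norm (nrm Y (%k. f k - trunc m f k) - 0) < e" if m: "m0 <= m" for m
 proof -
  have "cmod (f k - trunc m f k) <= cmod (f k - \<phi> k)" for k
   using m0[THEN spec, THEN mp, OF m, THEN fun_cong, of k] by (auto simp: trunc_def split: if_splits)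
  from Nw_mono[of "%k. f k - trunc m f k" "%k. f k - \<phi> k", OF this]
  have "Nw (%k. f k - trunc m f k) < ennreal e" using \<phi>(2) by (rule le_less_trans)
  thus ?thesis using e by (cases "Nw (%k. f k - trunc m f k)") (auto simp: nrm_Y ennreal_less_iff)
 qed
 thus "\<exists>m0. \<forall>m\<ge>m0. norm (nrm Y (%k. f k - trunc m f k) - 0) < e" by blast
qed

lemma bounded_op_limit:
 assumes T: "bounded_linear_map Y Y T" and f: "f \<in> vecs Y"
 shows "(%m. T (trunc m f) j) \<longlonglongrightarrow> T f j"
proof -
 obtain C where C: "\<forall>f\<in>vecs Y. nrm Y (T f) <= C * nrm Y f" using T by (auto simp: bounded_linear_map_def)
 obtain K where K: "\<forall>f\<in>vecs Y. cmod (f j) <= K * nrm Y f" using nrm_point by blast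
 have t: "trunc m f \<in> vecs Y" for m by (intro vecs_Y_closed trunc_finite)
 have "(%m. T (trunc m f) j - T f j) \<longlonglongrightarrow> 0"
 proof (rule Lim_null_comparison)
  show "\<forall>\<^sub>F m in sequentially. cmod (T (trunc m f) j - T f j) <= \<bar>K\<bar> * (\<bar>C\<bar> * nrm Y (%k. f k - trunc m f k))"
  proof (rule always_eventually, rule allI)
   fix m
   let ?d = "%k. f k - trunc m f k"
   have d: "?d \<in> vecs Y" by (intro vecs_Y_closed f t)
   have "T (%k. trunc m f k + ?d k) = (%j. T (trunc m f) j + T ?d j)" using T t d by (simp only: bounded_linear_map_def)
   hence "T f j = T (trunc m f) j + T ?d j" by (simp add: fun_eq_iff)
   hence "cmod (T (trunc m f) j - T f j) = cmod (T ?d j)" by simp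
   also have "... <= K * nrm Y (T ?d)" using K T d by (simp add: bounded_linear_map_def)
   also have "... <= \<bar>K\<bar> * nrm Y (T ?d)" by (intro mult_right_mono) (auto simp: nrm_Y)
   also have "... <= \<bar>K\<bar> * (\<bar>C\<bar> * nrm Y ?d)"
    by (intro mult_left_mono order_trans[OF C[THEN bspec, OF d] mult_right_mono]) (auto simp: nrm_Y)
   finally show "cmod (T (trunc m f) j - T f j) <= \<bar>K\<bar> * (\<bar>C\<bar> * nrm Y ?d)" .
  qed
  have "(%m. \<bar>K\<bar> * (\<bar>C\<bar> * nrm Y (%k. f k - trunc m f k))) \<longlonglongrightarrow> \<bar>K\<bar> * (\<bar>C\<bar> * 0)"
   by (intro tendsto_intros trunc_tendsto f)
  thus "(%m. \<bar>K\<bar> * (\<bar>C\<bar> * nrm Y (%k. f k - trunc m f k))) \<longlonglongrightarrow> 0" by simp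
 qed
 thus ?thesis by (rule LIM_zero_cancel)
qed

text \<open>The operator is given explicitly by limits of entries; the zero value outside the space
  is what \<open>bounded_ops\<close> asks for.\<close>

definition ext :: "(int => complex) => (int => complex) => int => complex" where
 "ext c f = (if f \<in> vecs Y then (%j. lim (%m. cv c (trunc m f) j)) else (%_. 0))"

text \<open>Truncations are Cauchy in norm, convolution is bounded on their differences, and each
  entry is bounded by the norm.\<close>

lemma ext_tendsto:
 assumes c: "mb C c" and f: "f \<in> vecs Y"
 shows "(%m. cv c (trunc m f) j) \<longlonglongrightarrow> ext c f j"
proof -
 obtain K where K: "\<forall>f\<in>vecs Y. cmod (f j) <= K * nrm Y f" using nrm_point by blast
 have "Cauchy (%m. cv c (trunc m f) j)"
 proof (rule CauchyI)
  fix e :: real assume e: "0 < e"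
  define D where "D = \<bar>K\<bar> * C + 1"
  have D: "0 < D" using mb_nonneg[OF c] by (simp add: D_def add_nonneg_pos)
  obtain m0 where m0: "\<forall>m\<ge>m0. norm (nrm Y (%k. f k - trunc m f k) - 0) < e / D"
   using LIMSEQ_D[OF trunc_tendsto[OF f], of "e / D"] e D by auto
  have "cmod (cv c (trunc m f) j - cv c (trunc n f) j) < e" if mn: "m0 <= m" "m0 <= n" for m n
  proof -
   let ?d = "%k. trunc m f k - trunc n f k"
   have d: "?d \<in> finite_seqs" unfolding finite_seqs_def
    by (rule CollectI, rule finite_subset[OF _ finite_UnI[OF finite_seqsD[OF trunc_finite[of m f]] finite_seqsD[OF trunc_finite[of n f]]]]) auto
   have t0: "(%k. f k - trunc m0 f k) \<in> vecs Y" by (intro vecs_Y_closed f trunc_finite)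
   have "Nw ?d <= Nw (%k. f k - trunc m0 f k)" using mn by (intro Nw_mono) (auto simp: trunc_def)
   hence le: "nrm Y ?d <= nrm Y (%k. f k - trunc m0 f k)"
    unfolding nrm_Y by (rule enn2real_mono) (use t0 in \<open>simp only: vecs_Y infinity_ennreal_def\<close>)
   have b: "Nw (cv c ?d) <= ennreal (C * nrm Y ?d)"
   proof -
    have "ennreal C * Nw ?d = ennreal (C * nrm Y ?d)"
     unfolding Nw_eq_nrm[OF Nw_finite[OF d]] by (rule ennreal_mult[symmetric]) (auto simp: nrm_Y mb_nonneg[OF c])
    thus ?thesis using mbD[OF c d] by (simp only:)
   qed
   hence v: "cv c ?d \<in> vecs Y" unfolding vecs_Y by (rule le_less_trans) simp
   have n: "nrm Y (cv c ?d) <= C * nrm Y ?d"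
    unfolding nrm_Y[of "cv c ?d"] using b mb_nonneg[OF c] by (intro enn2real_leI) (auto simp: nrm_Y)
   have "cmod (cv c (trunc m f) j - cv c (trunc n f) j) = cmod (cv c ?d j)" by (simp add: cv_diff trunc_finite)
   also have "... <= K * nrm Y (cv c ?d)" using K v by blast
   also have "... <= \<bar>K\<bar> * nrm Y (cv c ?d)" by (intro mult_right_mono) (auto simp: nrm_Y)
   also have "... <= \<bar>K\<bar> * (C * nrm Y (%k. f k - trunc m0 f k))"
    using n mult_left_mono[OF le mb_nonneg[OF c]] by (intro mult_left_mono) auto
   also have "... <= D * nrm Y (%k. f k - trunc m0 f k)" by (simp add: D_def distrib_right nrm_Y)
   also have "... < D * (e / D)" using m0[THEN spec[of _ m0]] D by (intro mult_strict_left_mono) auto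
   finally show ?thesis using D by simp
  qed
  thus "\<exists>M. \<forall>m\<ge>M. \<forall>n\<ge>M. cmod (cv c (trunc m f) j - cv c (trunc n f) j) < e" by blast
 qed
 thus ?thesis using f by (simp add: ext_def Cauchy_convergent_iff convergent_LIMSEQ_iff)
qed

lemma ext_bound:
 assumes c: "mb C c" and f: "f \<in> vecs Y"
 shows "ext c f \<in> vecs Y" "nrm Y (ext c f) <= C * nrm Y f"
proof -
 have "Nw (ext c f) <= ennreal C * Nw f"
 proof (rule Nw_fatou[OF ext_tendsto[OF c f]])
  have "Nw (cv c (trunc m f)) <= ennreal C * Nw f" for m
   by (rule order_trans[OF mbD[OF c trunc_finite] mult_left_mono[OF Nw_mono]]) (auto simp: trunc_def)
  thus "\<forall>\<^sub>F m in sequentially. Nw (cv c (trunc m f)) <= ennreal C * Nw f" by simp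
 qed
 also have "... = ennreal (C * nrm Y f)"
  unfolding Nw_eq_nrm[OF f[unfolded vecs_Y]] by (rule ennreal_mult[symmetric]) (auto simp: nrm_Y mb_nonneg[OF c])
 finally have b: "Nw (ext c f) <= ennreal (C * nrm Y f)" .
 thus "ext c f \<in> vecs Y" unfolding vecs_Y by (rule le_less_trans) simp
 show "nrm Y (ext c f) <= C * nrm Y f"
  unfolding nrm_Y[of "ext c f"] using b mb_nonneg[OF c] by (intro enn2real_leI) (auto simp: nrm_Y)
qed

lemma ext_finite:
 assumes "\<phi> \<in> finite_seqs"
 shows "ext c \<phi> = cv c \<phi>"
proof
 fix j
 obtain m0 where "\<forall>m\<ge>m0. trunc m \<phi> = \<phi>" using trunc_eventually[OF assms] by blast
 hence "\<forall>\<^sub>F m in sequentially. cv c (trunc m \<phi>) j = cv c \<phi> j"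
  by (intro eventually_sequentiallyI[of m0]) simp
 hence "(%m. cv c (trunc m \<phi>) j) \<longlonglongrightarrow> cv c \<phi> j" by (rule tendsto_eventually)
 thus "ext c \<phi> j = cv c \<phi> j" using vecs_Y_closed(4)[OF assms] by (simp add: ext_def limI)
qed

lemma ext_bounded_op:
 assumes c: "mb C c"
 shows "ext c \<in> bounded_ops Y"
 unfolding bounded_ops_def bounded_linear_map_def
proof (intro CollectI conjI ballI allI impI)
 fix f g assume f: "f \<in> vecs Y" and g: "g \<in> vecs Y"
 show "ext c (%i. f i + g i) = (%j. ext c f j + ext c g j)"
 proof
  fix j
  have "cv c (trunc m (%i. f i + g i)) j = cv c (trunc m f) j + cv c (trunc m g) j" for m
   by (simp add: cv_trunc distrib_left sum.distrib)
  hence "(%m. cv c (trunc m (%i. f i + g i)) j) \<longlonglongrightarrow> ext c f j + ext c g j"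
   using tendsto_add[OF ext_tendsto[OF c f] ext_tendsto[OF c g]] by simp
  thus "ext c (%i. f i + g i) j = ext c f j + ext c g j"
   by (rule LIMSEQ_unique[OF ext_tendsto[OF c vecs_Y_closed(1)[OF f g]]])
 qed
next
 fix z f assume f: "f \<in> vecs Y"
 show "ext c (%i. z * f i) = (%j. z * ext c f j)"
 proof
  fix j
  have "cv c (trunc m (%i. z * f i)) j = z * cv c (trunc m f) j" for m by (simp add: cv_trunc sum_distrib_left mult_ac)
  hence "(%m. cv c (trunc m (%i. z * f i)) j) \<longlonglongrightarrow> z * ext c f j"
   using tendsto_mult[OF tendsto_const ext_tendsto[OF c f], of z] by simp
  thus "ext c (%i. z * f i) j = z * ext c f j" by (rule LIMSEQ_unique[OF ext_tendsto[OF c vecs_Y_closed(2)[OF f]]])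
 qed
qed (use ext_bound[OF c] in \<open>auto simp: ext_def\<close>)

text \<open>A bounded operator is determined by its values on truncations, so the description in
  \<open>laurent_op\<close> has exactly one solution.\<close>

lemma laurent_op_eq_ext:
 assumes a: "a \<in> vecs M"
 shows "laurent_op Y a = ext (fourier_coeff a)"
 unfolding laurent_op_def
proof (rule the_equality)
 show "ext (fourier_coeff a) \<in> bounded_ops Y & (\<forall>\<phi>\<in>finite_seqs. ext (fourier_coeff a) \<phi> = conv a \<phi>)"
  using ext_bounded_op[OF multD(2)[OF a]] by (simp add: ext_finite conv_eq_cv)
next
 fix T assume T: "T \<in> bounded_ops Y & (\<forall>\<phi>\<in>finite_seqs. T \<phi> = conv a \<phi>)"
 show "T = ext (fourier_coeff a)"
 proof (intro ext)
  fix f j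
  show "T f j = ext (fourier_coeff a) f j"
  proof (cases "f \<in> vecs Y")
   case True
   have "(%m. T (trunc m f) j) \<longlonglongrightarrow> T f j" using T True by (intro bounded_op_limit) (auto simp: bounded_ops_def)
   hence "(%m. cv (fourier_coeff a) (trunc m f) j) \<longlonglongrightarrow> T f j" using T trunc_finite by (simp add: conv_eq_cv)
   thus ?thesis by (rule LIMSEQ_unique[OF _ ext_tendsto[OF multD(2)[OF a] True]])
  next
   case False
   thus ?thesis using T by (auto simp: bounded_ops_def ext_def)
  qed
 qed
qed

theorem laurent_op:
 assumes a: "a \<in> vecs M"
 shows "laurent_op Y a \<in> bounded_ops Y" "\<phi> \<in> finite_seqs ==> laurent_op Y a \<phi> = conv a \<phi>"
  "nrm M a = op_norm Y (laurent_op Y a)"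
proof -
 let ?T = "ext (fourier_coeff a)"
 note T = laurent_op_eq_ext[OF a]
 note bd = ext_bounded_op[OF multD(2)[OF a]]
 show "laurent_op Y a \<in> bounded_ops Y" unfolding T by (rule bd)
 show "\<phi> \<in> finite_seqs ==> laurent_op Y a \<phi> = conv a \<phi>" by (simp add: T ext_finite conv_eq_cv)
 let ?S = "{nrm Y (?T f) |f. f \<in> vecs Y & nrm Y f <= 1}"
 have z: "(%_. 0) \<in> vecs Y" "nrm Y (%_. 0) = 0" using Nw_zero_iff[of "%_. 0"] by (auto simp: vecs_Y nrm_Y)
 have ne: "nrm Y (?T (%_. 0)) \<in> ?S" using z by auto
 have ub: "s <= nrm M a" if s: "s \<in> ?S" for s
 proof -
  obtain f where f: "f \<in> vecs Y" "nrm Y f <= 1" "s = nrm Y (?T f)" using s by blast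
  thus ?thesis using ext_bound(2)[OF multD(2)[OF a] f(1)] mult_left_mono[OF f(2) multiplier_nonneg[OF a]] by simp
 qed
 have bdd: "bdd_above ?S" using ub by (rule bdd_aboveI)
 have "Sup ?S <= nrm M a" using ne ub by (intro cSup_least) auto
 moreover have "nrm M a <= Sup ?S"
 proof (rule multI(2)[OF multD(1)[OF a]], unfold mb_iff_quotients, intro conjI ballI)
  show "0 <= Sup ?S" by (rule order_trans[OF _ cSup_upper[OF ne bdd]]) (simp add: nrm_Y)
  show "conv a \<phi> \<in> vecs Y" if "\<phi> \<in> finite_seqs" for \<phi> using a that by (simp add: multiplier_space_def)
  fix q assume "q \<in> multiplier_quotients Y a"
  then obtain \<phi> where \<phi>: "q = nrm Y (conv a \<phi>) / nrm Y \<phi>" "\<phi> \<in> finite_seqs" "\<phi> ~= (%_. 0)"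
   by (auto simp: multiplier_quotients_def)
  let ?s = "complex_of_real (1 / nrm Y \<phi>)"
  have p: "0 < nrm Y \<phi>" by (rule nrm_pos[OF \<phi>(2,3)])
  have sc: "nrm Y (%k. ?s * f k) = nrm Y f / nrm Y \<phi>" for f
   unfolding nrm_Y[of "%k. ?s * f k"] Nw_scale nrm_Y[of f] using p by (simp add: enn2real_mult norm_divide)
  have v: "(%k. ?s * \<phi> k) \<in> vecs Y" by (intro vecs_Y_closed \<phi>)
  have "bounded_linear_map Y Y ?T" using bd unfolding bounded_ops_def by blast
  hence "\<forall>c. \<forall>f\<in>vecs Y. ?T (%i. c * f i) = (%j. c * ?T f j)" unfolding bounded_linear_map_def by (elim conjE)
  from this[THEN spec, THEN bspec, OF vecs_Y_closed(4)[OF \<phi>(2)], of ?s]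
  have "nrm Y (?T (%k. ?s * \<phi> k)) = q" by (simp only: sc ext_finite[OF \<phi>(2)] conv_eq_cv \<phi>(1))
  moreover have "nrm Y (?T (%k. ?s * \<phi> k)) \<in> ?S"
   by (rule CollectI, rule exI[of _ "%k. ?s * \<phi> k"]) (use v p in \<open>simp only: sc, simp\<close>)
  ultimately show "q <= Sup ?S" using cSup_upper[OF _ bdd] by simp
 qed
 ultimately show "nrm M a = op_norm Y (laurent_op Y a)" by (simp add: op_norm_def T)
qed

end

section \<open>Multipliers of bounded variation\<close>

context bv
begin

lemma circ_measurable: "f \<in> cmeas" by (rule measurable_restrict_mono[OF measurable_lebesgue]) auto

lemma circ_bounded: "AE x in circ. cmod (f x) <= cmod (f (- pi)) + V" by (intro AE_I2 bounded) auto

lemma coeff_eq_fc: "coeff = fc f"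
proof
 fix n
 have "integrable circ (%x. f x * ec n x)"
  by (intro integrable_times_cis integrable_bounded_circ[OF circ_measurable circ_bounded])
 thus "coeff n = fc f n" by (simp add: coeff_def fc_def circ_integral_eq)
qed

end

text \<open>The coefficient at 0 is bounded by the supremum norm with constant 1, the rest by the
  variation with constant \<open>C\<close>.\<close>

lemma (in growth_space) bv_multiplier:
 assumes C: "mb C (%n. 1 / of_int n)" and f: "f \<in> vecs BV_space"
 shows "dist_of_fun f \<in> vecs M" "nrm M (dist_of_fun f) <= max 1 C * (Linf_norm f + variation f)"
proof -
 interpret b: bv f by unfold_locales (rule f)
 note L = Linf_norm_AE[OF b.circ_measurable b.circ_bounded]
 have "cmod (fc f 0) + C * variation f <= max 1 C * (Linf_norm f + variation f)"
  using fc_bound[OF b.circ_measurable L(1), of 0] mult_right_mono[of 1 "max 1 C" "Linf_norm f"]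
   mult_right_mono[of C "max 1 C" "variation f"] b.V_nonneg by (simp add: distrib_left Linf_norm_def)
 hence "mb (max 1 C * (Linf_norm f + variation f)) (fourier_coeff (dist_of_fun f))"
  using mb_mono[OF mb_bv[OF C f]] by (simp add: fourier_coeff_dist_of_fun[abs_def] b.coeff_eq_fc)
 from multI[OF dist_of_fun_distribution[OF b.circ_measurable b.circ_bounded] this]
 show "dist_of_fun f \<in> vecs M" "nrm M (dist_of_fun f) <= max 1 C * (Linf_norm f + variation f)" .
qed

lemma bv_dist_of_fun_eqD:
 assumes f: "f \<in> vecs BV_space" and g: "g \<in> vecs BV_space" and eq: "dist_of_fun f = dist_of_fun g"
 shows "AE x in lebesgue. f x = g x"
proof (rule AE_circ_imp_AE_periodic)
 interpret f: bv f by unfold_locales (rule f)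
 interpret g: bv g by unfold_locales (rule g)
 show "AE x in circ. f x = g x"
  by (rule dist_of_fun_eqD[OF eq f.circ_measurable f.circ_bounded g.circ_measurable g.circ_bounded])
 show "(f (x + 2 * pi) = g (x + 2 * pi)) = (f x = g x)" for x by (simp add: f.periodic g.periodic)
qed

lemma bv_dist_of_fun_add:
 assumes f: "f \<in> vecs BV_space" and g: "g \<in> vecs BV_space"
 shows "dist_of_fun (%x. f x + g x) = (%u. dist_of_fun f u + dist_of_fun g u)"
proof -
 interpret f: bv f by unfold_locales (rule f)
 interpret g: bv g by unfold_locales (rule g)
 show ?thesis by (rule dist_of_fun_add[OF f.circ_measurable f.circ_bounded g.circ_measurable g.circ_bounded])
qed

text \<open>Reflexivity is assumed of the unweighted space. Multiplication by \<open>w\<close> is an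
  isometry onto that space and preserves finite support, so density is carried back by
  division.\<close>

lemma weighted_dense:
 fixes \<rho> :: "(int => real) => ennreal"
 assumes "wspace \<rho> w" and refl: "reflexive (seq_space \<rho>)"
  and f: "f \<in> vecs (weighted_space \<rho> w)" and e: "0 < e"
 shows "\<exists>\<phi>\<in>finite_seqs. wspace.Nw \<rho> w (%k. f k - \<phi> k) < ennreal e"
proof -
 interpret wspace \<rho> w by fact
 interpret u: wspace \<rho> "%_. 1" by unfold_locales simp
 have Y1: "weighted_space \<rho> (%_. 1) = seq_space \<rho>" by (simp add: weighted_space_def seq_space_def)
 have "(%k. f k * complex_of_real (w k)) \<in> vecs (weighted_space \<rho> (%_. 1))" using f by (simp add: Y1 weighted_space_def)
 from u.reflexive_dense[OF _ this e] obtain \<phi> where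
  \<phi>: "\<phi> \<in> finite_seqs" "u.Nw (%k. f k * complex_of_real (w k) - \<phi> k) < ennreal e" using refl by (auto simp: Y1)
 define \<psi> where "\<psi> k = \<phi> k / complex_of_real (w k)" for k
 have w0: "w k ~= 0" for k using wpos[of k] by simp
 have "cmod (f k - \<psi> k) * w k = cmod (f k * complex_of_real (w k) - \<phi> k) * 1" for k
  using norm_w[of "%k. f k - \<psi> k" k] w0[of k] by (simp add: \<psi>_def left_diff_distrib)
 hence "Nw (%k. f k - \<psi> k) < ennreal e" using \<phi>(2) by (simp add: Nw_def u.Nw_def)
 moreover have "\<psi> \<in> finite_seqs" using \<phi>(1) by (auto simp: \<psi>_def finite_seqs_def intro: finite_subset)
 ultimately show ?thesis by blast
qed

text \<open>A distribution sees a function only up to null sets, so the embedding of functions of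
  bounded variation takes the form of a bounded linear map that is injective up to equality almost
  everywhere.\<close>

theorem theorem1p2:
  fixes \<rho> :: "(int \<Rightarrow> real) \<Rightarrow> ennreal" and w :: "int \<Rightarrow> real"
  assumes "banach_function_norm \<rho>" and "rearrangement_invariant \<rho>"
    and "reflexive (seq_space \<rho>)"
    and "0 < lower_boyd_index \<rho>" and "upper_boyd_index \<rho> < 1"
    and "w \<in> Ap_sym (1 / lower_boyd_index \<rho>) \<inter> Ap_sym (1 / upper_boyd_index \<rho>)"
  shows "let Y = weighted_space \<rho> w; M = multiplier_space Y in
     (\<forall>a\<in>vecs M. \<exists>f\<in>Linf. a = dist_of_fun f \<and> Linf_norm f \<le> nrm M a) \<and>
     banach_algebra M pointwise_mult \<and>
     (\<forall>a\<in>vecs M. laurent_op Y a \<in> bounded_ops Y \<and>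
        (\<forall>\<phi>\<in>finite_seqs. laurent_op Y a \<phi> = conv a \<phi>) \<and>
        nrm M a = op_norm Y (laurent_op Y a)) \<and>
     (\<exists>C>0. \<forall>f\<in>vecs BV_space. dist_of_fun f \<in> vecs M \<and>
        nrm M (dist_of_fun f) \<le> C * (Linf_norm f + variation f)) \<and>
     bounded_linear_map BV_space M dist_of_fun \<and>
     (\<forall>f\<in>vecs BV_space. \<forall>g\<in>vecs BV_space.
        dist_of_fun f = dist_of_fun g \<longrightarrow> (AE \<theta> in lebesgue. f \<theta> = g \<theta>))"
proof -
 interpret boyd \<rho> by unfold_locales (fact assms)+
 have w: "w \<in> Ap (1 / lower_boyd_index \<rho>) \<inter> Ap (1 / upper_boyd_index \<rho>)" using assms(6) by (auto simp: Ap_sym_def)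
 have p: "1 < 1 / lower_boyd_index \<rho>" using assms(4,5) lower_le_upper by simp
 obtain A where "growth_space \<rho> w A" using growth_space_Ap[OF assms(1,2) p, of w] w by blast
 then interpret g: growth_space \<rho> w A .
 interpret d: dense_space \<rho> w A by unfold_locales (rule weighted_dense[OF g.wspace_axioms assms(3)])
 obtain C where C: "0 < C" "\<forall>\<phi>. finite (supp \<phi>) -->
   \<rho> (%j. cmod (\<Sum>k\<in>supp \<phi>. \<phi> k / of_int (j - k)) * w j) <= ennreal C * \<rho> (%k. cmod (\<phi> k) * w k)"
  using weighted_hilbert_bound[OF assms(1,2,4,5) w] by blast
 have "cv (%n. 1 / of_int n) \<phi> j = (\<Sum>k\<in>supp \<phi>. \<phi> k / of_int (j - k))" for \<phi> j
  by (simp add: cv_def)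
 hence mb: "g.mb C (%n. 1 / of_int n)" unfolding g.mb_def g.Nw_def using C by (simp add: finite_seqs_def)
 note bv = g.bv_multiplier[OF mb]
 have "bounded_linear_map BV_space g.M dist_of_fun" unfolding bounded_linear_map_def
  using bv bv_dist_of_fun_add dist_of_fun_cmult by (auto simp: BV_space_def)
 moreover have "\<exists>f\<in>Linf. a = dist_of_fun f & Linf_norm f <= nrm g.M a" if "a \<in> vecs g.M" for a
  using g.mult_symbol[OF that] by metis
 moreover have "\<exists>C>0. \<forall>f\<in>vecs BV_space. dist_of_fun f \<in> vecs g.M & nrm g.M (dist_of_fun f) <= C * (Linf_norm f + variation f)"
  using bv by (intro exI[of _ "max 1 C"]) auto
 ultimately show ?thesis
  unfolding Let_def by (intro conjI ballI impI) (assumption | rule g.multiplier_banach_algebra d.laurent_op bv_dist_of_fun_eqD | blast)+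
qed

end
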